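(* Let $\mathcal M$ be a presheaf of groupoids on $\mathcal C$. The functors $(B,\Gamma)$ restrict to give an equivalence of categories between the category $Sh(\mathcal C/\mathcal M)$ of sheaves of sets on $\mathcal C/\mathcal M$ and the category $(P(\mathcal C,\mathrm{Grpd})_L/\mathcal M)_{df}$ of local fibrations $\mathcal N\to\mathcal M$ with levelwise discrete fibers.
   Context: $\mathcal C$ is a small site closed under finite products and pullbacks, with topology given by covering families $\{U_i\to X\}$. $P(\mathcal C,\mathrm{Grpd})$ is the category of presheaves of (small) groupoids on $\mathcal C$; objects of $\mathcal C$ are identified with the presheaves of sets (discrete groupoids) they represent. The site $\mathcal C/\mathcal M$: objects are pairs $(X,f)$ with $X\in\mathcal C$ and $f\colon X\to\mathcal M$ (equivalently $f\in \mathrm{ob}\,\mathcal M(X)$); morphisms $(X,f)\to(X',g)$ are pairs $(h,\alpha)$ with $h\colon X\to X'$ in $\mathcal C$ and $\alpha\colon f\to g\circ h$ a homotopy (i.e. an isomorphism $f\to h^*g$ in $\mathcal M(X)$). Covers are the families of morphisms whose images in $\mathcal C$ are covers. Model structures. A map of groupoids $p\colon G\to H$ is a weak equivalence if it is an equivalence of categories, and a fibration if for every isomorphism $\alpha\colon b\to p(a)$ in $H$ there is $\beta\colon c\to a$ in $G$ with $p(\beta)=\alpha$. In the levelwise model structure on $P(\mathcal C,\mathrm{Grpd})$, fibrations and weak equivalences are defined objectwise. For a cover $\{U_i\to X\}$ with nerve $U_\bullet$, $|U_\bullet|$ is the presheaf of groupoids with $|U_\bullet|(Y)$ having object set $\coprod_i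 \mathrm{Hom}(Y,U_i)$ and exactly one morphism between two objects when their composites to $X$ agree, and none otherwise. $P(\mathcal C,\mathrm{Grpd})_L$ is the local model structure: the left Bousfield localization of the levelwise model structure at all maps $|U_\bullet|\to X$, for covers $\{U_i\to X\}$ in $\mathcal C$. Fibrations in $P(\mathcal C,\mathrm{Grpd})_L$ are called local fibrations. A levelwise fibration $F\to F'$ has discrete fibers if for each $X\in\mathcal C$ and each $a\in F'(X)$ the fiber of $F(X)\to F'(X)$ over $a$ is a discrete groupoid (only identity morphisms). $(P(\mathcal C,\mathrm{Grpd})/\mathcal M)_{df}$ is the full subcategory of $P(\mathcal C,\mathrm{Grpd})/\mathcal M$ of levelwise fibrations with discrete fibers, and $(P(\mathcal C,\mathrm{Grpd})_L/\mathcal M)_{df}$ is its full subcategory of those that are local fibrations. The functor $B\colon P(\mathcal C/\mathcal M,\mathrm{Set})\to (P(\mathcal C,\mathrm{Grpd})/\mathcal M)_{df}$: $BG(X)$ is the groupoid with objects pairs $(a,s)$, $a\in\mathcal M(X)$, $s\in G(X,a)$, and morphisms $(a,s)\to(b,s')$ the morphisms $\alpha\colon a\to b$ in $\mathcal M(X)$ with $s=\alpha^*s'$; the map $BG\to\mathcal M$ is the projection. The functor $\Gamma\colon (P(\mathcal C,\mathrm{Grpd})/\mathcal M)_{df}\to P(\mathcal C/\mathcal M,\mathrm{Set})$ is $\Gamma(\pi\colon F\to\mathcal M)(X,a)=\pi_X^{-1}(a)$, the fiber of $F(X)\to\mathcal M(X)$ over $a$, with functoriality given by unique path lifting. *)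

theory Defs
  imports "HOL-Library.FuncSet"
begin

section \<open>Categories, functors, groupoids\<close>

text \<open>Composition is written in the usual order: \<open>Comp C g f\<close> is \<open>g\<close> after \<open>f\<close>. As in HOL-Algebra, the
  values of the operations outside the carriers are irrelevant.\<close>

record ('o, 'a) cat =
  Obj :: "'o set"
  Arr :: "'a set"
  Dom :: "'a \<Rightarrow> 'o"
  Cod :: "'a \<Rightarrow> 'o"
  Idt :: "'o \<Rightarrow> 'a"
  Comp :: "'a \<Rightarrow> 'a \<Rightarrow> 'a"

definition Hom :: "('o, 'a) cat \<Rightarrow> 'o \<Rightarrow> 'o \<Rightarrow> 'a set" where
  "Hom C x y = {f \<in> Arr C. Dom C f = x \<and> Cod C f = y}"

locale category =
  fixes C :: "('o, 'a) cat"
  assumes Dom_Obj: "f \<in> Arr C \<Longrightarrow> Dom C f \<in> Obj C"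
    and Cod_Obj: "f \<in> Arr C \<Longrightarrow> Cod C f \<in> Obj C"
    and Idt_Hom: "x \<in> Obj C \<Longrightarrow> Idt C x \<in> Hom C x x"
    and Comp_Hom: "\<lbrakk>f \<in> Hom C x y; g \<in> Hom C y z\<rbrakk> \<Longrightarrow> Comp C g f \<in> Hom C x z"
    and Comp_Idt: "f \<in> Hom C x y \<Longrightarrow> Comp C f (Idt C x) = f"
    and Idt_Comp: "f \<in> Hom C x y \<Longrightarrow> Comp C (Idt C y) f = f"
    and Comp_assoc: "\<lbrakk>f \<in> Hom C w x; g \<in> Hom C x y; h \<in> Hom C y z\<rbrakk>
      \<Longrightarrow> Comp C (Comp C h g) f = Comp C h (Comp C g f)"

definition iso_arr :: "('o, 'a) cat \<Rightarrow> 'a \<Rightarrow> bool" where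
  "iso_arr C f \<longleftrightarrow> f \<in> Arr C \<and>
    (\<exists>g \<in> Hom C (Cod C f) (Dom C f).
      Comp C g f = Idt C (Dom C f) \<and> Comp C f g = Idt C (Cod C f))"

definition groupoid :: "('o, 'a) cat \<Rightarrow> bool" where
  "groupoid G \<longleftrightarrow> category G \<and> (\<forall>f \<in> Arr G. iso_arr G f)"

definition full_subcat :: "('o, 'a) cat \<Rightarrow> ('o \<Rightarrow> bool) \<Rightarrow> ('o, 'a) cat" where
  "full_subcat C P = C\<lparr>Obj := {x \<in> Obj C. P x}, Arr := {f \<in> Arr C. P (Dom C f) \<and> P (Cod C f)}\<rparr>"

record ('o1, 'a1, 'o2, 'a2) ftor =
  obm :: "'o1 \<Rightarrow> 'o2"
  arm :: "'a1 \<Rightarrow> 'a2"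

definition is_functor :: "('o1, 'a1) cat \<Rightarrow> ('o2, 'a2) cat \<Rightarrow> ('o1, 'a1, 'o2, 'a2) ftor \<Rightarrow> bool" where
  "is_functor C D F \<longleftrightarrow> category C \<and> category D \<and>
    (\<forall>x \<in> Obj C. obm F x \<in> Obj D) \<and>
    (\<forall>f \<in> Arr C. arm F f \<in> Hom D (obm F (Dom C f)) (obm F (Cod C f))) \<and>
    (\<forall>x \<in> Obj C. arm F (Idt C x) = Idt D (obm F x)) \<and>
    (\<forall>x y z. \<forall>f \<in> Hom C x y. \<forall>g \<in> Hom C y z. arm F (Comp C g f) = Comp D (arm F g) (arm F f))"

definition ftor_id :: "('o, 'a) cat \<Rightarrow> ('o, 'a, 'o, 'a) ftor" where
  "ftor_id C = \<lparr>obm = (\<lambda>x \<in> Obj C. x), arm = (\<lambda>f \<in> Arr C. f)\<rparr>"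

definition ftor_comp :: "('o1, 'a1) cat \<Rightarrow> ('o2, 'a2, 'o3, 'a3) ftor \<Rightarrow> ('o1, 'a1, 'o2, 'a2) ftor
    \<Rightarrow> ('o1, 'a1, 'o3, 'a3) ftor" where
  "ftor_comp C G F =
    \<lparr>obm = (\<lambda>x \<in> Obj C. obm G (obm F x)), arm = (\<lambda>f \<in> Arr C. arm G (arm F f))\<rparr>"

definition naturally_isomorphic :: "('o1, 'a1) cat \<Rightarrow> ('o2, 'a2) cat
    \<Rightarrow> ('o1, 'a1, 'o2, 'a2) ftor \<Rightarrow> ('o1, 'a1, 'o2, 'a2) ftor \<Rightarrow> bool" where
  "naturally_isomorphic C D F G \<longleftrightarrow>
    (\<exists>\<eta>. (\<forall>x \<in> Obj C. \<eta> x \<in> Hom D (obm F x) (obm G x) \<and> iso_arr D (\<eta> x)) \<and>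
         (\<forall>f \<in> Arr C. Comp D (\<eta> (Cod C f)) (arm F f) = Comp D (arm G f) (\<eta> (Dom C f))))"

definition equivalence_pair :: "('o1, 'a1) cat \<Rightarrow> ('o2, 'a2) cat
    \<Rightarrow> ('o1, 'a1, 'o2, 'a2) ftor \<Rightarrow> ('o2, 'a2, 'o1, 'a1) ftor \<Rightarrow> bool" where
  "equivalence_pair C D F G \<longleftrightarrow> is_functor C D F \<and> is_functor D C G \<and>
    naturally_isomorphic C C (ftor_id C) (ftor_comp C G F) \<and>
    naturally_isomorphic D D (ftor_comp D F G) (ftor_id D)"

definition is_equivalence :: "('o1, 'a1) cat \<Rightarrow> ('o2, 'a2) cat \<Rightarrow> ('o1, 'a1, 'o2, 'a2) ftor \<Rightarrow> bool" where
  "is_equivalence C D F \<longleftrightarrow> (\<exists>G. equivalence_pair C D F G)"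

definition grpd_fibration :: "('o1, 'a1) cat \<Rightarrow> ('o2, 'a2) cat \<Rightarrow> ('o1, 'a1, 'o2, 'a2) ftor \<Rightarrow> bool" where
  "grpd_fibration G H p \<longleftrightarrow>
    (\<forall>a \<in> Obj G. \<forall>\<alpha> \<in> Arr H. Cod H \<alpha> = obm p a \<longrightarrow> (\<exists>\<beta> \<in> Arr G. Cod G \<beta> = a \<and> arm p \<beta> = \<alpha>))"

section \<open>Sites and sheaves of sets\<close>

definition has_finite_products :: "('o, 'a) cat \<Rightarrow> bool" where
  "has_finite_products C \<longleftrightarrow>
    (\<exists>t \<in> Obj C. \<forall>x \<in> Obj C. \<exists>!f. f \<in> Hom C x t) \<and>
    (\<forall>x \<in> Obj C. \<forall>y \<in> Obj C. \<exists>z \<in> Obj C. \<exists>p \<in> Hom C z x. \<exists>q \<in> Hom C z y.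
      \<forall>w \<in> Obj C. \<forall>f \<in> Hom C w x. \<forall>g \<in> Hom C w y.
        \<exists>!k. k \<in> Hom C w z \<and> Comp C p k = f \<and> Comp C q k = g)"

definition is_pullback :: "('o, 'a) cat \<Rightarrow> 'a \<Rightarrow> 'a \<Rightarrow> 'a \<Rightarrow> 'a \<Rightarrow> bool" where
  "is_pullback C f g p q \<longleftrightarrow>
    f \<in> Arr C \<and> g \<in> Arr C \<and> Cod C f = Cod C g \<and>
    p \<in> Arr C \<and> q \<in> Arr C \<and> Dom C p = Dom C q \<and> Cod C p = Dom C f \<and> Cod C q = Dom C g \<and>
    Comp C f p = Comp C g q \<and>
    (\<forall>w \<in> Obj C. \<forall>a \<in> Hom C w (Dom C f). \<forall>b \<in> Hom C w (Dom C g). Comp C f a = Comp C g b \<longrightarrow>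
      (\<exists>!k. k \<in> Hom C w (Dom C p) \<and> Comp C p k = a \<and> Comp C q k = b))"

definition has_pullbacks :: "('o, 'a) cat \<Rightarrow> bool" where
  "has_pullbacks C \<longleftrightarrow>
    (\<forall>f \<in> Arr C. \<forall>g \<in> Arr C. Cod C f = Cod C g \<longrightarrow> (\<exists>p q. is_pullback C f g p q))"

text \<open>A Grothendieck pretopology; \<open>Cov X S\<close> says that the set \<open>S\<close> of arrows into \<open>X\<close> is a covering
  family of \<open>X\<close>. The object \<open>X\<close> is recorded because \<open>S\<close> may be empty.\<close>

locale site = category C
  for C :: "('o, 'a) cat" and Cov :: "'o \<Rightarrow> 'a set \<Rightarrow> bool" +
  assumes cov_arrows: "Cov X S \<Longrightarrow> X \<in> Obj C \<and> (\<forall>u \<in> S. u \<in> Arr C \<and> Cod C u = X)"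
    and cov_iso: "iso_arr C f \<Longrightarrow> Cov (Cod C f) {f}"
    and cov_pullback: "\<lbrakk>Cov X S; h \<in> Hom C Y X; \<And>u. u \<in> S \<Longrightarrow> is_pullback C h u (p u) (q u)\<rbrakk>
      \<Longrightarrow> Cov Y (p ` S)"
    and cov_trans: "\<lbrakk>Cov X S; \<And>u. u \<in> S \<Longrightarrow> Cov (Dom C u) (T u)\<rbrakk>
      \<Longrightarrow> Cov X {Comp C u v | u v. u \<in> S \<and> v \<in> T u}"

text \<open>The sets of a presheaf are subsets of a fixed type \<open>'u\<close>, which plays the role of the universe
  of small sets; the hypotheses on its size are stated in the locale \<open>set_universe\<close> below.\<close>

record ('o, 'a, 'u) set_psh =
  at :: "'o \<Rightarrow> 'u set"
  rs :: "'a \<Rightarrow> 'u \<Rightarrow> 'u"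

definition presheaf :: "('o, 'a) cat \<Rightarrow> ('o, 'a, 'u) set_psh \<Rightarrow> bool" where
  "presheaf D G \<longleftrightarrow> category D \<and>
    (\<forall>h \<in> Arr D. rs G h \<in> at G (Cod D h) \<rightarrow> at G (Dom D h)) \<and>
    (\<forall>x \<in> Obj D. \<forall>s \<in> at G x. rs G (Idt D x) s = s) \<and>
    (\<forall>x y z. \<forall>f \<in> Hom D x y. \<forall>g \<in> Hom D y z. \<forall>s \<in> at G z.
      rs G (Comp D g f) s = rs G f (rs G g s))"

definition sheaf :: "('o, 'a) cat \<Rightarrow> ('o \<Rightarrow> 'a set \<Rightarrow> bool) \<Rightarrow> ('o, 'a, 'u) set_psh \<Rightarrow> bool" where
  "sheaf D Cov G \<longleftrightarrow> presheaf D G \<and>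
    (\<forall>X S. Cov X S \<longrightarrow>
      (\<forall>s. (\<forall>u \<in> S. s u \<in> at G (Dom D u)) \<and>
           (\<forall>u \<in> S. \<forall>v \<in> S. \<forall>Y. \<forall>g \<in> Hom D Y (Dom D u). \<forall>h \<in> Hom D Y (Dom D v).
              Comp D u g = Comp D v h \<longrightarrow> rs G g (s u) = rs G h (s v))
        \<longrightarrow> (\<exists>!t. t \<in> at G X \<and> (\<forall>u \<in> S. rs G u t = s u))))"

text \<open>Morphisms of presheaves carry their source and target; their components are extensional, so
  that equality of arrows is equality of natural transformations.\<close>

type_synonym ('o, 'a, 'u) set_psh_arr =
  "('o, 'a, 'u) set_psh \<times> ('o \<Rightarrow> 'u \<Rightarrow> 'u) \<times> ('o, 'a, 'u) set_psh"

definition PSh :: "('o, 'a) cat \<Rightarrow> (('o, 'a, 'u) set_psh, ('o, 'a, 'u) set_psh_arr) cat" where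
  "PSh D =
    \<lparr>Obj = {G. presheaf D G},
     Arr = {(G, \<theta>, G'). presheaf D G \<and> presheaf D G' \<and>
        \<theta> \<in> (\<Pi>\<^sub>E x \<in> Obj D. at G x \<rightarrow>\<^sub>E at G' x) \<and>
        (\<forall>h \<in> Arr D. \<forall>s \<in> at G (Cod D h). \<theta> (Dom D h) (rs G h s) = rs G' h (\<theta> (Cod D h) s))},
     Dom = (\<lambda>(G, \<theta>, G'). G),
     Cod = (\<lambda>(G, \<theta>, G'). G'),
     Idt = (\<lambda>G. (G, (\<lambda>x \<in> Obj D. \<lambda>s \<in> at G x. s), G)),
     Comp = (\<lambda>(G', \<theta>', G'') (G, \<theta>, H). (G, (\<lambda>x \<in> Obj D. \<lambda>s \<in> at G x. \<theta>' x (\<theta> x s)), G''))\<rparr>"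

definition Sh :: "('o, 'a) cat \<Rightarrow> ('o \<Rightarrow> 'a set \<Rightarrow> bool)
    \<Rightarrow> (('o, 'a, 'u) set_psh, ('o, 'a, 'u) set_psh_arr) cat" where
  "Sh D Cov = full_subcat (PSh D) (sheaf D Cov)"

section \<open>Presheaves of groupoids\<close>

record ('o, 'a, 'p, 'q) gpsh =
  sect :: "'o \<Rightarrow> ('p, 'q) cat"
  rst :: "'a \<Rightarrow> ('p, 'q, 'p, 'q) ftor"

definition grpd_presheaf :: "('o, 'a) cat \<Rightarrow> ('o, 'a, 'p, 'q) gpsh \<Rightarrow> bool" where
  "grpd_presheaf C F \<longleftrightarrow> category C \<and>
    (\<forall>X \<in> Obj C. groupoid (sect F X)) \<and>
    (\<forall>h \<in> Arr C. is_functor (sect F (Cod C h)) (sect F (Dom C h)) (rst F h)) \<and>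
    (\<forall>X \<in> Obj C.
      (\<forall>a \<in> Obj (sect F X). obm (rst F (Idt C X)) a = a) \<and>
      (\<forall>\<alpha> \<in> Arr (sect F X). arm (rst F (Idt C X)) \<alpha> = \<alpha>)) \<and>
    (\<forall>X Y Z. \<forall>f \<in> Hom C X Y. \<forall>g \<in> Hom C Y Z.
      (\<forall>a \<in> Obj (sect F Z). obm (rst F (Comp C g f)) a = obm (rst F f) (obm (rst F g) a)) \<and>
      (\<forall>\<alpha> \<in> Arr (sect F Z). arm (rst F (Comp C g f)) \<alpha> = arm (rst F f) (arm (rst F g) \<alpha>)))"

type_synonym ('o, 'p1, 'q1, 'p2, 'q2) gmap = "'o \<Rightarrow> ('p1, 'q1, 'p2, 'q2) ftor"

definition grpd_map :: "('o, 'a) cat \<Rightarrow> ('o, 'a, 'p1, 'q1) gpsh \<Rightarrow> ('o, 'a, 'p2, 'q2) gpsh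
    \<Rightarrow> ('o, 'p1, 'q1, 'p2, 'q2) gmap \<Rightarrow> bool" where
  "grpd_map C A B \<phi> \<longleftrightarrow> grpd_presheaf C A \<and> grpd_presheaf C B \<and>
    \<phi> \<in> extensional (Obj C) \<and>
    (\<forall>X \<in> Obj C. is_functor (sect A X) (sect B X) (\<phi> X) \<and>
      obm (\<phi> X) \<in> extensional (Obj (sect A X)) \<and> arm (\<phi> X) \<in> extensional (Arr (sect A X))) \<and>
    (\<forall>h \<in> Arr C.
      (\<forall>a \<in> Obj (sect A (Cod C h)).
        obm (\<phi> (Dom C h)) (obm (rst A h) a) = obm (rst B h) (obm (\<phi> (Cod C h)) a)) \<and>
      (\<forall>\<alpha> \<in> Arr (sect A (Cod C h)).
        arm (\<phi> (Dom C h)) (arm (rst A h) \<alpha>) = arm (rst B h) (arm (\<phi> (Cod C h)) \<alpha>)))"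

definition gmap_id :: "('o, 'a) cat \<Rightarrow> ('o, 'a, 'p, 'q) gpsh \<Rightarrow> ('o, 'p, 'q, 'p, 'q) gmap" where
  "gmap_id C A = (\<lambda>X \<in> Obj C. ftor_id (sect A X))"

text \<open>\<open>gmap_comp C A \<psi> \<phi>\<close> is \<open>\<psi>\<close> after \<open>\<phi>\<close>; \<open>A\<close> is the source of \<open>\<phi>\<close>.\<close>

definition gmap_comp :: "('o, 'a) cat \<Rightarrow> ('o, 'a, 'p1, 'q1) gpsh
    \<Rightarrow> ('o, 'p2, 'q2, 'p3, 'q3) gmap \<Rightarrow> ('o, 'p1, 'q1, 'p2, 'q2) gmap
    \<Rightarrow> ('o, 'p1, 'q1, 'p3, 'q3) gmap" where
  "gmap_comp C A \<psi> \<phi> = (\<lambda>X \<in> Obj C. ftor_comp (sect A X) (\<psi> X) (\<phi> X))"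

text \<open>The groupoid \<open>Map(A, W)\<close> of maps and homotopies, i.e. the groupoid enrichment of the category
  of presheaves of groupoids.\<close>

type_synonym ('o, 'p1, 'q1, 'p2, 'q2) homotopy =
  "('o, 'p1, 'q1, 'p2, 'q2) gmap \<times> ('o \<Rightarrow> 'p1 \<Rightarrow> 'q2) \<times> ('o, 'p1, 'q1, 'p2, 'q2) gmap"

definition Map_grpd :: "('o, 'a) cat \<Rightarrow> ('o, 'a, 'p1, 'q1) gpsh \<Rightarrow> ('o, 'a, 'p2, 'q2) gpsh
    \<Rightarrow> (('o, 'p1, 'q1, 'p2, 'q2) gmap, ('o, 'p1, 'q1, 'p2, 'q2) homotopy) cat" where
  "Map_grpd C A W =
    \<lparr>Obj = {\<phi>. grpd_map C A W \<phi>},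
     Arr = {(\<phi>, \<theta>, \<psi>). grpd_map C A W \<phi> \<and> grpd_map C A W \<psi> \<and>
        \<theta> \<in> (\<Pi>\<^sub>E X \<in> Obj C. \<Pi>\<^sub>E a \<in> Obj (sect A X). Hom (sect W X) (obm (\<phi> X) a) (obm (\<psi> X) a)) \<and>
        (\<forall>X \<in> Obj C. \<forall>\<alpha> \<in> Arr (sect A X).
          Comp (sect W X) (\<theta> X (Cod (sect A X) \<alpha>)) (arm (\<phi> X) \<alpha>) =
          Comp (sect W X) (arm (\<psi> X) \<alpha>) (\<theta> X (Dom (sect A X) \<alpha>))) \<and>
        (\<forall>h \<in> Arr C. \<forall>a \<in> Obj (sect A (Cod C h)).
          \<theta> (Dom C h) (obm (rst A h) a) = arm (rst W h) (\<theta> (Cod C h) a))},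
     Dom = (\<lambda>(\<phi>, \<theta>, \<psi>). \<phi>),
     Cod = (\<lambda>(\<phi>, \<theta>, \<psi>). \<psi>),
     Idt = (\<lambda>\<phi>. (\<phi>, (\<lambda>X \<in> Obj C. \<lambda>a \<in> Obj (sect A X). Idt (sect W X) (obm (\<phi> X) a)), \<phi>)),
     Comp = (\<lambda>(\<psi>, \<theta>', \<chi>) (\<phi>, \<theta>, \<psi>').
        (\<phi>, (\<lambda>X \<in> Obj C. \<lambda>a \<in> Obj (sect A X). Comp (sect W X) (\<theta>' X a) (\<theta> X a)), \<chi>))\<rparr>"

text \<open>Restriction \<open>Map(B, W) \<rightarrow> Map(A, W)\<close> along \<open>f : A \<rightarrow> B\<close>; it does not depend on \<open>W\<close>.\<close>

definition Map_precomp :: "('o, 'a) cat \<Rightarrow> ('o, 'a, 'p0, 'q0) gpsh \<Rightarrow> ('o, 'p0, 'q0, 'p1, 'q1) gmap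
    \<Rightarrow> (('o, 'p1, 'q1, 'p2, 'q2) gmap, ('o, 'p1, 'q1, 'p2, 'q2) homotopy,
        ('o, 'p0, 'q0, 'p2, 'q2) gmap, ('o, 'p0, 'q0, 'p2, 'q2) homotopy) ftor" where
  "Map_precomp C A f =
    \<lparr>obm = (\<lambda>\<phi>. gmap_comp C A \<phi> f),
     arm = (\<lambda>(\<phi>, \<theta>, \<psi>). (gmap_comp C A \<phi> f,
        (\<lambda>X \<in> Obj C. \<lambda>a \<in> Obj (sect A X). \<theta> X (obm (f X) a)), gmap_comp C A \<psi> f))\<rparr>"

section \<open>The levelwise model structure\<close>

definition levelwise_fibration :: "('o, 'a) cat \<Rightarrow> ('o, 'a, 'p1, 'q1) gpsh \<Rightarrow> ('o, 'a, 'p2, 'q2) gpsh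
    \<Rightarrow> ('o, 'p1, 'q1, 'p2, 'q2) gmap \<Rightarrow> bool" where
  "levelwise_fibration C E B p \<longleftrightarrow> grpd_map C E B p \<and>
    (\<forall>X \<in> Obj C. grpd_fibration (sect E X) (sect B X) (p X))"

definition levelwise_equivalence :: "('o, 'a) cat \<Rightarrow> ('o, 'a, 'p1, 'q1) gpsh \<Rightarrow> ('o, 'a, 'p2, 'q2) gpsh
    \<Rightarrow> ('o, 'p1, 'q1, 'p2, 'q2) gmap \<Rightarrow> bool" where
  "levelwise_equivalence C E B p \<longleftrightarrow> grpd_map C E B p \<and>
    (\<forall>X \<in> Obj C. is_equivalence (sect E X) (sect B X) (p X))"

definition lifts_against :: "('o, 'a) cat
    \<Rightarrow> ('o, 'a, 'p1, 'q1) gpsh \<Rightarrow> ('o, 'a, 'p2, 'q2) gpsh \<Rightarrow> ('o, 'p1, 'q1, 'p2, 'q2) gmap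
    \<Rightarrow> ('o, 'a, 'p3, 'q3) gpsh \<Rightarrow> ('o, 'a, 'p4, 'q4) gpsh \<Rightarrow> ('o, 'p3, 'q3, 'p4, 'q4) gmap \<Rightarrow> bool" where
  "lifts_against C A B j E H p \<longleftrightarrow>
    (\<forall>u v. grpd_map C A E u \<and> grpd_map C B H v \<and> gmap_comp C A p u = gmap_comp C A v j \<longrightarrow>
      (\<exists>l. grpd_map C B E l \<and> gmap_comp C A l j = u \<and> gmap_comp C B p l = v))"

text \<open>From here on, presheaves of groupoids with objects and arrows in the universe \<open>'u\<close>.\<close>

type_synonym ('o, 'a, 'u) ugpsh = "('o, 'a, 'u, 'u) gpsh"
type_synonym ('o, 'u) ugmap = "('o, 'u, 'u, 'u, 'u) gmap"

definition cofibration :: "('o, 'a) cat \<Rightarrow> ('o, 'a, 'u) ugpsh \<Rightarrow> ('o, 'a, 'u) ugpsh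
    \<Rightarrow> ('o, 'u) ugmap \<Rightarrow> bool" where
  "cofibration C A B j \<longleftrightarrow> grpd_map C A B j \<and>
    (\<forall>(E :: ('o, 'a, 'u) ugpsh) (H :: ('o, 'a, 'u) ugpsh) p.
      levelwise_fibration C E H p \<and> levelwise_equivalence C E H p \<longrightarrow> lifts_against C A B j E H p)"

definition empty_gpsh :: "('o, 'a, 'u) ugpsh" where
  "empty_gpsh =
    \<lparr>sect = (\<lambda>_. \<lparr>Obj = {}, Arr = {}, Dom = undefined, Cod = undefined, Idt = undefined, Comp = undefined\<rparr>),
     rst = (\<lambda>_. \<lparr>obm = undefined, arm = undefined\<rparr>)\<rparr>"

definition cofibrant :: "('o, 'a) cat \<Rightarrow> ('o, 'a, 'u) ugpsh \<Rightarrow> bool" where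
  "cofibrant C A \<longleftrightarrow> (\<exists>i. cofibration C empty_gpsh A i)"

section \<open>The local model structure\<close>

text \<open>The presheaf represented by \<open>X\<close>, as a presheaf of discrete groupoids.\<close>

definition rep :: "('o, 'a) cat \<Rightarrow> 'o \<Rightarrow> ('o, 'a, 'a, 'a) gpsh" where
  "rep C X =
    \<lparr>sect = (\<lambda>Y. \<lparr>Obj = Hom C Y X, Arr = Hom C Y X, Dom = (\<lambda>f. f), Cod = (\<lambda>f. f),
        Idt = (\<lambda>f. f), Comp = (\<lambda>g f. f)\<rparr>),
     rst = (\<lambda>h. \<lparr>obm = (\<lambda>f. Comp C f h), arm = (\<lambda>f. Comp C f h)\<rparr>)\<rparr>"

text \<open>\<open>|U|\<close> for the family \<open>S\<close> of arrows into \<open>X\<close>. An object of \<open>|U|(Y)\<close> is a pair \<open>(u, k)\<close> with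
  \<open>u : U \<rightarrow> X\<close> in \<open>S\<close> and \<open>k : Y \<rightarrow> U\<close>; a morphism is the pair of its source and target.\<close>

definition nerve_grpd :: "('o, 'a) cat \<Rightarrow> 'a set
    \<Rightarrow> ('o, 'a, 'a \<times> 'a, ('a \<times> 'a) \<times> ('a \<times> 'a)) gpsh" where
  "nerve_grpd C S =
    \<lparr>sect = (\<lambda>Y. \<lparr>Obj = {(u, k). u \<in> S \<and> k \<in> Hom C Y (Dom C u)},
        Arr = {((u, k), (u', k')). u \<in> S \<and> k \<in> Hom C Y (Dom C u) \<and>
          u' \<in> S \<and> k' \<in> Hom C Y (Dom C u') \<and> Comp C u k = Comp C u' k'},
        Dom = fst, Cod = snd, Idt = (\<lambda>x. (x, x)), Comp = (\<lambda>g f. (fst f, snd g))\<rparr>),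
     rst = (\<lambda>h. \<lparr>obm = (\<lambda>(u, k). (u, Comp C k h)),
        arm = (\<lambda>((u, k), (u', k')). ((u, Comp C k h), (u', Comp C k' h)))\<rparr>)\<rparr>"

definition nerve_map :: "('o, 'a) cat \<Rightarrow> 'a set
    \<Rightarrow> ('o, 'a \<times> 'a, ('a \<times> 'a) \<times> ('a \<times> 'a), 'a, 'a) gmap" where
  "nerve_map C S = (\<lambda>Y \<in> Obj C.
    \<lparr>obm = (\<lambda>(u, k) \<in> Obj (sect (nerve_grpd C S) Y). Comp C u k),
     arm = (\<lambda>((u, k), (u', k')) \<in> Arr (sect (nerve_grpd C S) Y). Comp C u k)\<rparr>)"

text \<open>The local objects of the left Bousfield localization at the maps \<open>|U| \<rightarrow> X\<close>. Every presheaf of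
  groupoids is levelwise fibrant, and \<open>|U|\<close> and \<open>X\<close> are cofibrant, so the homotopy function
  complexes in the definition of a local object are the nerves of the groupoids \<open>Map\<close>.\<close>

definition local_object :: "('o, 'a) cat \<Rightarrow> ('o \<Rightarrow> 'a set \<Rightarrow> bool) \<Rightarrow> ('o, 'a, 'u) ugpsh \<Rightarrow> bool" where
  "local_object C Cov W \<longleftrightarrow> grpd_presheaf C W \<and>
    (\<forall>X S. Cov X S \<longrightarrow>
      is_equivalence (Map_grpd C (rep C X) W) (Map_grpd C (nerve_grpd C S) W)
        (Map_precomp C (nerve_grpd C S) (nerve_map C S)))"

text \<open>A map is a weak equivalence of the localization if it induces equivalences of homotopy function
  complexes into all local objects; these are computed on a cofibrant approximation \<open>f'\<close> of \<open>f\<close>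
  (the choice of which does not matter).\<close>

definition local_equivalence :: "('o, 'a) cat \<Rightarrow> ('o \<Rightarrow> 'a set \<Rightarrow> bool)
    \<Rightarrow> ('o, 'a, 'u) ugpsh \<Rightarrow> ('o, 'a, 'u) ugpsh \<Rightarrow> ('o, 'u) ugmap \<Rightarrow> bool" where
  "local_equivalence C Cov A B f \<longleftrightarrow> grpd_map C A B f \<and>
    (\<exists>(A' :: ('o, 'a, 'u) ugpsh) (B' :: ('o, 'a, 'u) ugpsh) f' a b.
      cofibrant C A' \<and> cofibrant C B' \<and> grpd_map C A' B' f' \<and>
      levelwise_equivalence C A' A a \<and> levelwise_equivalence C B' B b \<and>
      gmap_comp C A' f a = gmap_comp C A' b f' \<and>
      (\<forall>W :: ('o, 'a, 'u) ugpsh. local_object C Cov W \<longrightarrow>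
        is_equivalence (Map_grpd C B' W) (Map_grpd C A' W) (Map_precomp C A' f')))"

definition local_fibration :: "('o, 'a) cat \<Rightarrow> ('o \<Rightarrow> 'a set \<Rightarrow> bool)
    \<Rightarrow> ('o, 'a, 'u) ugpsh \<Rightarrow> ('o, 'a, 'u) ugpsh \<Rightarrow> ('o, 'u) ugmap \<Rightarrow> bool" where
  "local_fibration C Cov E H p \<longleftrightarrow> grpd_map C E H p \<and>
    (\<forall>(A :: ('o, 'a, 'u) ugpsh) (B :: ('o, 'a, 'u) ugpsh) j.
      cofibration C A B j \<and> local_equivalence C Cov A B j \<longrightarrow> lifts_against C A B j E H p)"

section \<open>The site \<open>C/M\<close>\<close>

text \<open>An arrow \<open>(X, f) \<rightarrow> (X', g)\<close> is recorded as \<open>((X, f), (h, \<alpha>), (X', g))\<close>.\<close>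

type_synonym ('o, 'a, 'u) slice_arr = "('o \<times> 'u) \<times> ('a \<times> 'u) \<times> ('o \<times> 'u)"

definition slice :: "('o, 'a) cat \<Rightarrow> ('o, 'a, 'u) ugpsh
    \<Rightarrow> ('o \<times> 'u, ('o, 'a, 'u) slice_arr) cat" where
  "slice C M =
    \<lparr>Obj = {(X, f). X \<in> Obj C \<and> f \<in> Obj (sect M X)},
     Arr = {((X, f), (h, \<alpha>), (X', g)).
        X \<in> Obj C \<and> f \<in> Obj (sect M X) \<and> X' \<in> Obj C \<and> g \<in> Obj (sect M X') \<and>
        h \<in> Hom C X X' \<and> \<alpha> \<in> Hom (sect M X) f (obm (rst M h) g)},
     Dom = (\<lambda>(x, m, y). x),
     Cod = (\<lambda>(x, m, y). y),
     Idt = (\<lambda>(X, f). ((X, f), (Idt C X, Idt (sect M X) f), (X, f))),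
     Comp = (\<lambda>(y', (k, \<beta>), z) (x, (h, \<alpha>), y).
        (x, (Comp C k h, Comp (sect M (fst x)) (arm (rst M h) \<beta>) \<alpha>), z))\<rparr>"

definition slice_cov :: "('o, 'a) cat \<Rightarrow> ('o \<Rightarrow> 'a set \<Rightarrow> bool) \<Rightarrow> ('o, 'a, 'u) ugpsh
    \<Rightarrow> 'o \<times> 'u \<Rightarrow> ('o, 'a, 'u) slice_arr set \<Rightarrow> bool" where
  "slice_cov C Cov M x R \<longleftrightarrow> x \<in> Obj (slice C M) \<and>
    (\<forall>r \<in> R. r \<in> Arr (slice C M) \<and> Cod (slice C M) r = x) \<and>
    Cov (fst x) ((\<lambda>(y, (h, \<alpha>), z). h) ` R)"

section \<open>Local fibrations over \<open>M\<close> with discrete fibers\<close>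

definition discrete_fibers :: "('o, 'a) cat \<Rightarrow> ('o, 'a, 'u) ugpsh \<Rightarrow> ('o, 'a, 'u) ugpsh
    \<Rightarrow> ('o, 'u) ugmap \<Rightarrow> bool" where
  "discrete_fibers C F H p \<longleftrightarrow>
    (\<forall>X \<in> Obj C. \<forall>a \<in> Obj (sect H X). \<forall>\<beta> \<in> Arr (sect F X).
      arm (p X) \<beta> = Idt (sect H X) a \<longrightarrow> \<beta> = Idt (sect F X) (Dom (sect F X) \<beta>))"

type_synonym ('o, 'a, 'u) over_obj = "('o, 'a, 'u) ugpsh \<times> ('o, 'u) ugmap"
type_synonym ('o, 'a, 'u) over_arr =
  "('o, 'a, 'u) over_obj \<times> ('o, 'u) ugmap \<times> ('o, 'a, 'u) over_obj"

definition Over :: "('o, 'a) cat \<Rightarrow> ('o, 'a, 'u) ugpsh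
    \<Rightarrow> (('o, 'a, 'u) over_obj, ('o, 'a, 'u) over_arr) cat" where
  "Over C M =
    \<lparr>Obj = {(F, \<pi>). grpd_map C F M \<pi>},
     Arr = {((F, \<pi>), \<phi>, (F', \<pi>')). grpd_map C F M \<pi> \<and> grpd_map C F' M \<pi>' \<and>
        grpd_map C F F' \<phi> \<and> gmap_comp C F \<pi>' \<phi> = \<pi>},
     Dom = (\<lambda>(x, \<phi>, y). x),
     Cod = (\<lambda>(x, \<phi>, y). y),
     Idt = (\<lambda>x. (x, gmap_id C (fst x), x)),
     Comp = (\<lambda>(y', \<psi>, z) (x, \<phi>, y). (x, gmap_comp C (fst x) \<psi> \<phi>, z))\<rparr>"

definition Over_df :: "('o, 'a) cat \<Rightarrow> ('o, 'a, 'u) ugpsh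
    \<Rightarrow> (('o, 'a, 'u) over_obj, ('o, 'a, 'u) over_arr) cat" where
  "Over_df C M = full_subcat (Over C M)
    (\<lambda>(F, \<pi>). levelwise_fibration C F M \<pi> \<and> discrete_fibers C F M \<pi>)"

definition Over_L_df :: "('o, 'a) cat \<Rightarrow> ('o \<Rightarrow> 'a set \<Rightarrow> bool) \<Rightarrow> ('o, 'a, 'u) ugpsh
    \<Rightarrow> (('o, 'a, 'u) over_obj, ('o, 'a, 'u) over_arr) cat" where
  "Over_L_df C Cov M = full_subcat (Over_df C M) (\<lambda>(F, \<pi>). local_fibration C Cov F M \<pi>)"

section \<open>The functors \<open>B\<close> and \<open>\<Gamma>\<close>\<close>

text \<open>The type \<open>'u\<close> as a universe of sets for a category \<open>C\<close>: it is infinite, \<open>C\<close> is small relative to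
  it (families of elements indexed by the arrows of \<open>C\<close> can be coded by elements), and \<open>enc\<close> is a
  coding of ordered pairs (only used to define \<open>B\<close>). For every \<open>C\<close> there are such types of arbitrarily large cardinality,
  e.g. \<open>'u = 'a \<times> 'b \<times> nat \<Rightarrow> bool\<close> with \<open>'a\<close> the type of arrows of \<open>C\<close> and \<open>'b\<close> arbitrary.\<close>

locale set_universe =
  fixes C :: "('o, 'a) cat" and enc :: "'u \<times> 'u \<Rightarrow> 'u"
  assumes infinite_universe: "infinite (UNIV :: 'u set)"
    and small_category: "\<exists>e :: ('a \<Rightarrow> 'u) \<Rightarrow> 'u. inj_on e (Arr C \<rightarrow>\<^sub>E UNIV)"
    and enc_inj: "inj enc"

text \<open>\<open>\<alpha>\<^sup>*s\<close> for \<open>\<alpha>\<close> in \<open>M(X)\<close>.\<close>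

definition iso_act :: "('o, 'a) cat \<Rightarrow> ('o, 'a, 'u) ugpsh
    \<Rightarrow> ('o \<times> 'u, ('o, 'a, 'u) slice_arr, 'u) set_psh \<Rightarrow> 'o \<Rightarrow> 'u \<Rightarrow> 'u \<Rightarrow> 'u" where
  "iso_act C M G X \<alpha> s =
    rs G ((X, Dom (sect M X) \<alpha>), (Idt C X, \<alpha>), (X, Cod (sect M X) \<alpha>)) s"

text \<open>A morphism \<open>\<alpha> : (a, s) \<rightarrow> (b, s')\<close> of \<open>BG(X)\<close> is coded as the pair \<open>(\<alpha>, s')\<close>, which determines
  its source \<open>(a, \<alpha>\<^sup>*s')\<close> and target.\<close>

definition B_gpsh :: "('u \<times> 'u \<Rightarrow> 'u) \<Rightarrow> ('o, 'a) cat \<Rightarrow> ('o, 'a, 'u) ugpsh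
    \<Rightarrow> ('o \<times> 'u, ('o, 'a, 'u) slice_arr, 'u) set_psh \<Rightarrow> ('o, 'a, 'u) ugpsh" where
  "B_gpsh enc C M G = (let dec = inv enc in
    \<lparr>sect = (\<lambda>X.
       \<lparr>Obj = {enc (a, s) | a s. a \<in> Obj (sect M X) \<and> s \<in> at G (X, a)},
        Arr = {enc (\<alpha>, s) | \<alpha> s. \<alpha> \<in> Arr (sect M X) \<and> s \<in> at G (X, Cod (sect M X) \<alpha>)},
        Dom = (\<lambda>w. case dec w of (\<alpha>, s) \<Rightarrow> enc (Dom (sect M X) \<alpha>, iso_act C M G X \<alpha> s)),
        Cod = (\<lambda>w. case dec w of (\<alpha>, s) \<Rightarrow> enc (Cod (sect M X) \<alpha>, s)),
        Idt = (\<lambda>w. case dec w of (a, s) \<Rightarrow> enc (Idt (sect M X) a, s)),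
        Comp = (\<lambda>w' w. case dec w' of (\<beta>, t) \<Rightarrow> case dec w of (\<alpha>, s) \<Rightarrow>
          enc (Comp (sect M X) \<beta> \<alpha>, t))\<rparr>),
     rst = (\<lambda>h. let
         restr = (\<lambda>b s. rs G ((Dom C h, obm (rst M h) b),
           (h, Idt (sect M (Dom C h)) (obm (rst M h) b)), (Cod C h, b)) s) in
       \<lparr>obm = (\<lambda>w. case dec w of (a, s) \<Rightarrow> enc (obm (rst M h) a, restr a s)),
        arm = (\<lambda>w. case dec w of (\<alpha>, s) \<Rightarrow>
          enc (arm (rst M h) \<alpha>, restr (Cod (sect M (Cod C h)) \<alpha>) s))\<rparr>)\<rparr>)"

definition B_proj :: "('u \<times> 'u \<Rightarrow> 'u) \<Rightarrow> ('o, 'a) cat \<Rightarrow> ('o, 'a, 'u) ugpsh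
    \<Rightarrow> ('o \<times> 'u, ('o, 'a, 'u) slice_arr, 'u) set_psh \<Rightarrow> ('o, 'u) ugmap" where
  "B_proj enc C M G = (\<lambda>X \<in> Obj C.
    \<lparr>obm = (\<lambda>w \<in> Obj (sect (B_gpsh enc C M G) X). fst (inv enc w)),
     arm = (\<lambda>w \<in> Arr (sect (B_gpsh enc C M G) X). fst (inv enc w))\<rparr>)"

definition B_map :: "('u \<times> 'u \<Rightarrow> 'u) \<Rightarrow> ('o, 'a) cat \<Rightarrow> ('o, 'a, 'u) ugpsh
    \<Rightarrow> ('o \<times> 'u, ('o, 'a, 'u) slice_arr, 'u) set_psh \<Rightarrow> ('o \<times> 'u \<Rightarrow> 'u \<Rightarrow> 'u) \<Rightarrow> ('o, 'u) ugmap" where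
  "B_map enc C M G \<theta> = (\<lambda>X \<in> Obj C.
    \<lparr>obm = (\<lambda>w \<in> Obj (sect (B_gpsh enc C M G) X).
        case inv enc w of (a, s) \<Rightarrow> enc (a, \<theta> (X, a) s)),
     arm = (\<lambda>w \<in> Arr (sect (B_gpsh enc C M G) X).
        case inv enc w of (\<alpha>, s) \<Rightarrow> enc (\<alpha>, \<theta> (X, Cod (sect M X) \<alpha>) s))\<rparr>)"

definition B_functor :: "('u \<times> 'u \<Rightarrow> 'u) \<Rightarrow> ('o, 'a) cat \<Rightarrow> ('o, 'a, 'u) ugpsh
    \<Rightarrow> (('o \<times> 'u, ('o, 'a, 'u) slice_arr, 'u) set_psh,
        ('o \<times> 'u, ('o, 'a, 'u) slice_arr, 'u) set_psh_arr,
        ('o, 'a, 'u) over_obj, ('o, 'a, 'u) over_arr) ftor" where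
  "B_functor enc C M =
    \<lparr>obm = (\<lambda>G. (B_gpsh enc C M G, B_proj enc C M G)),
     arm = (\<lambda>(G, \<theta>, G'). ((B_gpsh enc C M G, B_proj enc C M G), B_map enc C M G \<theta>,
        (B_gpsh enc C M G', B_proj enc C M G')))\<rparr>"

text \<open>\<open>\<Gamma>(\<pi>)\<close> restricts \<open>s\<close> over \<open>g\<close> along \<open>(h, \<alpha>)\<close> to the source of the unique lift of \<open>\<alpha>\<close> with target
  \<open>h\<^sup>*s\<close>.\<close>

definition Gamma_psh :: "('o, 'a) cat \<Rightarrow> ('o, 'a, 'u) over_obj
    \<Rightarrow> ('o \<times> 'u, ('o, 'a, 'u) slice_arr, 'u) set_psh" where
  "Gamma_psh C = (\<lambda>(F, \<pi>).
    \<lparr>at = (\<lambda>(X, a). {c \<in> Obj (sect F X). obm (\<pi> X) c = a}),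
     rs = (\<lambda>((X, f), (h, \<alpha>), (X', g)) s.
        Dom (sect F X) (THE \<beta>. \<beta> \<in> Arr (sect F X) \<and>
          Cod (sect F X) \<beta> = obm (rst F h) s \<and> arm (\<pi> X) \<beta> = \<alpha>))\<rparr>)"

definition Gamma_functor :: "('o, 'a) cat \<Rightarrow> ('o, 'a, 'u) ugpsh
    \<Rightarrow> (('o, 'a, 'u) over_obj, ('o, 'a, 'u) over_arr,
        ('o \<times> 'u, ('o, 'a, 'u) slice_arr, 'u) set_psh,
        ('o \<times> 'u, ('o, 'a, 'u) slice_arr, 'u) set_psh_arr) ftor" where
  "Gamma_functor C M =
    \<lparr>obm = Gamma_psh C,
     arm = (\<lambda>(x, \<phi>, y). (Gamma_psh C x,
        (\<lambda>(X, a) \<in> Obj (slice C M). \<lambda>s \<in> at (Gamma_psh C x) (X, a). obm (\<phi> X) s),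
        Gamma_psh C y))\<rparr>"

end

theory Submission
 imports Defs "HOL-Library.Equipollence"
begin

text \<open>If \<open>\<pi> : F \<rightarrow> M\<close> is a local fibration with discrete fibers, lifting it against two local equivalences
 built from a cover (see \<open>EQ\<close> below) gives existence and uniqueness of gluing for the sections of
 \<open>\<pi>\<close>, so \<open>\<Gamma>(\<pi>)\<close> is a sheaf.

 Conversely let \<open>G\<close> be a sheaf on \<open>C/M\<close>. A lift of a map \<open>g : B \<rightarrow> M\<close> along \<open>BG \<rightarrow> M\<close> is a section of
 \<open>g\<^sup>*G\<close>, and these have to extend along local equivalences \<open>A \<rightarrow> B\<close>. The sheaves on \<open>C/X\<close> that
 are locally of the form \<open>m\<^sup>*G\<close> with \<open>m \<in> M(X)\<close>, with the isomorphisms that locally come from \<open>M\<close>, form a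
 stack; so do those equipped with a global section. Both are essentially small, hence local objects. A
 section of \<open>G\<close> over \<open>A\<close> is a map from \<open>A\<close> to the pointed stack over the map \<open>m \<mapsto> m\<^sup>*G\<close> to the
 unpointed one, and since both are local it extends to \<open>B\<close>.\<close>

section \<open>Categories and groupoids\<close>

text \<open>The obstacle is that local equivalences are known only through maps into local objects
  with values in \<open>'u\<close>, while neither \<open>M\<close> nor \<open>BG\<close> need be
  local: lifting along \<open>BG\<close> over \<open>M\<close> has to be rephrased as mapping into
  auxiliary local objects. The stack of all sheaves would classify \<open>m\<^sup>*G\<close>, but
  sheaves with values in subsets of \<open>'u\<close>, and their isomorphisms, need not fit into the
  universe. Being locally induced by \<open>G\<close> bounds the objects: the elements of
  \<open>M\<close> that label the charts and the transitions between them determine an object up to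
  isomorphism. Requiring isomorphisms to come locally from \<open>M\<close> bounds the arrows in the
  same way. The elements of \<open>M\<close> behind an isomorphism are only asked to exist, so
  coherence between them is never imposed. Local objects extend maps only up to homotopy, but a lift
  must be strict; here transporting the point along the homotopy yields an element of
  \<open>G\<close> over exactly the prescribed object of \<open>M\<close>, and elements of a set
  carry no further coherence.\<close>

lemma Hom_iff: "f \<in> Hom C x y \<longleftrightarrow> f \<in> Arr C \<and> Dom C f = x \<and> Cod C f = y"
 by (simp add: Hom_def)

lemma cat_simps [simp]:
 assumes "category C"
 shows "f \<in> Arr C ==> Dom C f \<in> Obj C" "f \<in> Arr C ==> Cod C f \<in> Obj C"
  "x \<in> Obj C ==> Idt C x \<in> Arr C" "x \<in> Obj C ==> Dom C (Idt C x) = x"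
  "x \<in> Obj C ==> Cod C (Idt C x) = x"
  "[|f \<in> Arr C; g \<in> Arr C; Cod C f = Dom C g|] ==> Comp C g f \<in> Arr C"
  "[|f \<in> Arr C; g \<in> Arr C; Cod C f = Dom C g|] ==> Dom C (Comp C g f) = Dom C f"
  "[|f \<in> Arr C; g \<in> Arr C; Cod C f = Dom C g|] ==> Cod C (Comp C g f) = Cod C g"
  "[|f \<in> Arr C; x = Dom C f|] ==> Comp C f (Idt C x) = f"
  "[|f \<in> Arr C; x = Cod C f|] ==> Comp C (Idt C x) f = f"
proof -
 interpret category C by fact
 show "f \<in> Arr C ==> Dom C f \<in> Obj C" "f \<in> Arr C ==> Cod C f \<in> Obj C"
  by (simp_all add: Dom_Obj Cod_Obj)
 show "x \<in> Obj C ==> Idt C x \<in> Arr C" "x \<in> Obj C ==> Dom C (Idt C x) = x"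
  "x \<in> Obj C ==> Cod C (Idt C x) = x"
  using Idt_Hom[of x] by (simp_all add: Hom_iff)
 show "[|f \<in> Arr C; g \<in> Arr C; Cod C f = Dom C g|] ==> Comp C g f \<in> Arr C"
  "[|f \<in> Arr C; g \<in> Arr C; Cod C f = Dom C g|] ==> Dom C (Comp C g f) = Dom C f"
  "[|f \<in> Arr C; g \<in> Arr C; Cod C f = Dom C g|] ==> Cod C (Comp C g f) = Cod C g"
  using Comp_Hom[of f "Dom C f" "Cod C f" g "Cod C g"] by (simp_all add: Hom_iff)
 show "[|f \<in> Arr C; x = Dom C f|] ==> Comp C f (Idt C x) = f"
  "[|f \<in> Arr C; x = Cod C f|] ==> Comp C (Idt C x) f = f"
  using Comp_Idt[of f "Dom C f" "Cod C f"] Idt_Comp[of f "Dom C f" "Cod C f"]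
  by (simp_all add: Hom_iff)
qed

lemma comp_assoc:
 assumes "category C" "f \<in> Arr C" "g \<in> Arr C" "h \<in> Arr C" "Cod C f = Dom C g" "Cod C g = Dom C h"
 shows "Comp C (Comp C h g) f = Comp C h (Comp C g f)"
 using category.Comp_assoc[OF assms(1), of f "Dom C f" "Cod C f" g "Cod C g" h "Cod C h"] assms
 by (simp add: Hom_iff)

lemma categoryI:
 assumes "!!f. f \<in> Arr C ==> Dom C f \<in> Obj C \<and> Cod C f \<in> Obj C"
  "!!x. x \<in> Obj C ==> Idt C x \<in> Arr C \<and> Dom C (Idt C x) = x \<and> Cod C (Idt C x) = x"
  "!!f g. [|f \<in> Arr C; g \<in> Arr C; Cod C f = Dom C g|] ==>
   Comp C g f \<in> Arr C \<and> Dom C (Comp C g f) = Dom C f \<and> Cod C (Comp C g f) = Cod C g"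
  "!!f. f \<in> Arr C ==> Comp C f (Idt C (Dom C f)) = f \<and> Comp C (Idt C (Cod C f)) f = f"
  "!!f g h. [|f \<in> Arr C; g \<in> Arr C; h \<in> Arr C; Cod C f = Dom C g; Cod C g = Dom C h|]
   ==> Comp C (Comp C h g) f = Comp C h (Comp C g f)"
 shows "category C"
 by unfold_locales (use assms in \<open>auto simp: Hom_iff\<close>)

text \<open>A chosen inverse, meaningful only for isomorphisms, hence for all arrows of a
  groupoid.\<close>

definition ginv :: "('o, 'a) cat => 'a => 'a" where
 "ginv G f = (SOME g. g \<in> Hom G (Cod G f) (Dom G f) \<and>
  Comp G g f = Idt G (Dom G f) \<and> Comp G f g = Idt G (Cod G f))"

lemma groupoid_category [simp]: "groupoid G ==> category G"
 by (simp add: groupoid_def)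

lemma iso_arr_ginv:
 assumes "iso_arr G f"
 shows "ginv G f \<in> Arr G" "Dom G (ginv G f) = Cod G f" "Cod G (ginv G f) = Dom G f"
  "Comp G (ginv G f) f = Idt G (Dom G f)" "Comp G f (ginv G f) = Idt G (Cod G f)"
proof -
 have "\<exists>g. g \<in> Hom G (Cod G f) (Dom G f) \<and>
  Comp G g f = Idt G (Dom G f) \<and> Comp G f g = Idt G (Cod G f)"
  using assms by (auto simp: iso_arr_def)
 from someI_ex[OF this, folded ginv_def]
 show "ginv G f \<in> Arr G" "Dom G (ginv G f) = Cod G f" "Cod G (ginv G f) = Dom G f"
  "Comp G (ginv G f) f = Idt G (Dom G f)" "Comp G f (ginv G f) = Idt G (Cod G f)"
  by (simp_all add: Hom_iff)
qed

lemma ginv_simps [simp]: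
 assumes "groupoid G" "f \<in> Arr G"
 shows "ginv G f \<in> Arr G" "Dom G (ginv G f) = Cod G f" "Cod G (ginv G f) = Dom G f"
  "Comp G (ginv G f) f = Idt G (Dom G f)" "Comp G f (ginv G f) = Idt G (Cod G f)"
 using iso_arr_ginv[of G f] assms by (auto simp: groupoid_def)

lemma ginv_cancel [simp]:
 assumes "groupoid G" "f \<in> Arr G" "g \<in> Arr G"
 shows "Cod G g = Dom G f ==> Comp G (ginv G f) (Comp G f g) = g"
  "Cod G g = Cod G f ==> Comp G f (Comp G (ginv G f) g) = g"
  "Dom G g = Cod G f ==> Comp G (Comp G g f) (ginv G f) = g"
  "Dom G g = Dom G f ==> Comp G (Comp G g (ginv G f)) f = g"
 using assms by (simp_all add: comp_assoc) (simp_all add: comp_assoc[symmetric])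

lemma ginv_unique:
 assumes "groupoid G" "f \<in> Arr G" "g \<in> Arr G" "Cod G f = Dom G g" "Comp G g f = Idt G (Dom G f)"
 shows "g = ginv G f"
proof -
 have "Comp G (Comp G g f) (ginv G f) = g"
  using assms by (intro ginv_cancel) auto
 then show ?thesis using assms by simp
qed

lemma ginv_Idt [simp]: "groupoid G ==> x \<in> Obj G ==> ginv G (Idt G x) = Idt G x"
 by (rule ginv_unique[symmetric]) auto

lemma ginv_ginv [simp]: "groupoid G ==> f \<in> Arr G ==> ginv G (ginv G f) = f"
 by (rule ginv_unique[symmetric]) auto

lemma ginv_Comp:
 "[|groupoid G; f \<in> Arr G; g \<in> Arr G; Cod G f = Dom G g|]
  ==> ginv G (Comp G g f) = Comp G (ginv G f) (ginv G g)"
 by (rule ginv_unique[symmetric]) (auto simp: comp_assoc)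

lemma groupoidI:
 assumes "category G" "!!f. f \<in> Arr G ==> \<exists>g \<in> Arr G. Dom G g = Cod G f \<and> Cod G g = Dom G f \<and>
  Comp G g f = Idt G (Dom G f) \<and> Comp G f g = Idt G (Cod G f)"
 shows "groupoid G"
 using assms unfolding groupoid_def iso_arr_def by (fastforce simp: Hom_iff)

lemma groupoid_iso_arr [simp]: "groupoid G ==> f \<in> Arr G ==> iso_arr G f"
 by (simp add: groupoid_def)

section \<open>Functors and equivalences in elementary terms\<close>

lemma ftorD:
 assumes "is_functor C D F"
 shows "category C" "category D" "x \<in> Obj C ==> obm F x \<in> Obj D"
  "f \<in> Arr C ==> arm F f \<in> Arr D"
  "f \<in> Arr C ==> Dom D (arm F f) = obm F (Dom C f)"
  "f \<in> Arr C ==> Cod D (arm F f) = obm F (Cod C f)"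
  "x \<in> Obj C ==> arm F (Idt C x) = Idt D (obm F x)"
  "[|f \<in> Arr C; g \<in> Arr C; Cod C f = Dom C g|]
   ==> arm F (Comp C g f) = Comp D (arm F g) (arm F f)"
 using assms unfolding is_functor_def Hom_def by auto

lemma ftorI:
 assumes "category C" "category D" "!!x. x \<in> Obj C ==> obm F x \<in> Obj D"
  "!!f. f \<in> Arr C ==> arm F f \<in> Arr D \<and> Dom D (arm F f) = obm F (Dom C f)
   \<and> Cod D (arm F f) = obm F (Cod C f)"
  "!!x. x \<in> Obj C ==> arm F (Idt C x) = Idt D (obm F x)"
  "!!f g. [|f \<in> Arr C; g \<in> Arr C; Cod C f = Dom C g|]
   ==> arm F (Comp C g f) = Comp D (arm F g) (arm F f)"
 shows "is_functor C D F"
 using assms unfolding is_functor_def Hom_def by auto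

lemma ftor_ginv:
 assumes "is_functor G H F" "groupoid G" "groupoid H" "f \<in> Arr G"
 shows "arm F (ginv G f) = ginv H (arm F f)"
 by (rule ginv_unique) (use assms ftorD[OF assms(1)] in \<open>auto simp flip: ftorD(8)[OF assms(1)]\<close>)

text \<open>Cancelling the unit and the counit shows that \<open>F\<close> and \<open>G\<close> are
  faithful. For fullness, an arrow \<open>g\<close> is pulled back to the conjugate of
  \<open>arm G g\<close> by the unit; its image under \<open>F\<close> and \<open>g\<close> have the
  same image under \<open>G\<close>, so they agree.\<close>

lemma equivalence_full_faithful:
 assumes "is_equivalence C D F"
 shows "is_functor C D F"
  and "[|f \<in> Arr C; g \<in> Arr C; Dom C f = Dom C g; Cod C f = Cod C g; arm F f = arm F g|] ==> f = g"
  and "[|x \<in> Obj C; y \<in> Obj C; k \<in> Arr D; Dom D k = obm F x; Cod D k = obm F y|]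
   ==> \<exists>f \<in> Arr C. Dom C f = x \<and> Cod C f = y \<and> arm F f = k"
  and "d \<in> Obj D ==> \<exists>c \<in> Obj C. \<exists>i \<in> Arr D. Dom D i = obm F c \<and> Cod D i = d \<and> iso_arr D i"
proof -
 obtain G where E: "equivalence_pair C D F G" using assms by (auto simp: is_equivalence_def)
 have F: "is_functor C D F" and G: "is_functor D C G"
  using E by (auto simp: equivalence_pair_def)
 note Fs = ftorD[OF F] and Gs = ftorD[OF G]
 have N1: "naturally_isomorphic C C (ftor_id C) (ftor_comp C G F)"
  and N2: "naturally_isomorphic D D (ftor_comp D F G) (ftor_id D)"
  using E by (auto simp: equivalence_pair_def)
 obtain \<eta> where \<eta>0: "!!x. x \<in> Obj C ==> \<eta> x \<in> Arr C \<and> Dom C (\<eta> x) = x \<and> Cod C (\<eta> x) = obm G (obm F x) \<and> iso_arr C (\<eta> x)"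
  and \<eta>1: "!!f. f \<in> Arr C ==> Comp C (\<eta> (Cod C f)) f = Comp C (arm G (arm F f)) (\<eta> (Dom C f))"
  using N1 by (auto simp: naturally_isomorphic_def ftor_id_def ftor_comp_def Hom_iff)
 obtain \<epsilon> where \<epsilon>0: "!!x. x \<in> Obj D ==> \<epsilon> x \<in> Arr D \<and> Dom D (\<epsilon> x) = obm F (obm G x) \<and> Cod D (\<epsilon> x) = x \<and> iso_arr D (\<epsilon> x)"
  and \<epsilon>1: "!!f. f \<in> Arr D ==> Comp D (\<epsilon> (Cod D f)) (arm F (arm G f)) = Comp D f (\<epsilon> (Dom D f))"
  using N2 by (auto simp: naturally_isomorphic_def ftor_id_def ftor_comp_def Hom_iff)
 show "is_functor C D F" by fact
 note \<eta>i = iso_arr_ginv[of C "\<eta> _"] and \<epsilon>i = iso_arr_ginv[of D "\<epsilon> _"]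
 show inj: "f = g" if "f \<in> Arr C" "g \<in> Arr C" "Dom C f = Dom C g" "Cod C f = Cod C g" "arm F f = arm F g" for f g
 proof -
  have e: "Comp C (\<eta> (Cod C f)) f = Comp C (\<eta> (Cod C f)) g"
   using that \<eta>1[of f] \<eta>1[of g] by simp
  have "Comp C (ginv C (\<eta> (Cod C f))) (Comp C (\<eta> (Cod C f)) f) = f"
   "Comp C (ginv C (\<eta> (Cod C f))) (Comp C (\<eta> (Cod C f)) g) = g"
   using that(1-4) Fs(1) \<eta>0[of "Cod C f"] \<eta>i[of "Cod C f"] by (simp_all flip: comp_assoc)
  then show ?thesis using e by metis
 qed
 have injG: "f = g" if "f \<in> Arr D" "g \<in> Arr D" "Dom D f = Dom D g" "Cod D f = Cod D g" "arm G f = arm G g" for f g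
 proof -
  have e: "Comp D f (\<epsilon> (Dom D f)) = Comp D g (\<epsilon> (Dom D f))"
   using that \<epsilon>1[of f] \<epsilon>1[of g] by simp
  have "Comp D (Comp D f (\<epsilon> (Dom D f))) (ginv D (\<epsilon> (Dom D f))) = f"
   "Comp D (Comp D g (\<epsilon> (Dom D f))) (ginv D (\<epsilon> (Dom D f))) = g"
   using that(1-4) Fs(2) \<epsilon>0[of "Dom D f"] \<epsilon>i[of "Dom D f"] by (simp_all add: comp_assoc)
  then show ?thesis using e by metis
 qed
 show "\<exists>f \<in> Arr C. Dom C f = x \<and> Cod C f = y \<and> arm F f = g"
  if "x \<in> Obj C" "y \<in> Obj C" "g \<in> Arr D" "Dom D g = obm F x" "Cod D g = obm F y" for x y g
 proof -
  \<comment> \<open>The only candidate, by naturality of \<open>\<eta>\<close>.\<close>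
  define f where "f = Comp C (ginv C (\<eta> y)) (Comp C (arm G g) (\<eta> x))"
  have f: "f \<in> Arr C" "Dom C f = x" "Cod C f = y"
   using that Fs(1) \<eta>0[of x] \<eta>0[of y] \<eta>i[of y] by (simp_all add: f_def Gs)
  have "Comp C (\<eta> y) f = Comp C (arm G g) (\<eta> x)"
   using that Fs(1) \<eta>0[of x] \<eta>0[of y] \<eta>i[of y] by (simp add: f_def Gs flip: comp_assoc)
  then have e: "Comp C (arm G (arm F f)) (\<eta> x) = Comp C (arm G g) (\<eta> x)"
   using \<eta>1[of f] f by simp
  have "Comp C (Comp C (arm G (arm F f)) (\<eta> x)) (ginv C (\<eta> x)) = arm G (arm F f)"
   "Comp C (Comp C (arm G g) (\<eta> x)) (ginv C (\<eta> x)) = arm G g"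
   using that Fs(1) f \<eta>0[of x] \<eta>i[of x] by (simp_all add: comp_assoc Gs Fs)
  then have "arm G (arm F f) = arm G g" using e by metis
  then have "arm F f = g" using injG[of "arm F f" g] f that by (simp add: Fs)
  then show ?thesis using f by blast
 qed
 show "\<exists>c \<in> Obj C. \<exists>i \<in> Arr D. Dom D i = obm F c \<and> Cod D i = d \<and> iso_arr D i"
  if "d \<in> Obj D" for d
  using \<epsilon>0[OF that] Gs(3)[OF that] by blast
qed

text \<open>The quasi-inverse is chosen on objects by essential surjectivity and on arrows as the
  preimage under \<open>F\<close> of a conjugate by \<open>\<epsilon>\<close>. Its equations, all in
  the source category, are checked after applying the faithful functor \<open>F\<close>.\<close>

lemma equivalenceI:
 assumes F: "is_functor C D F"
  and faithful: "!!f g. [|f \<in> Arr C; g \<in> Arr C; Dom C f = Dom C g; Cod C f = Cod C g; arm F f = arm F g|] ==> f = g"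
  and full: "!!x y g. [|x \<in> Obj C; y \<in> Obj C; g \<in> Arr D; Dom D g = obm F x; Cod D g = obm F y|]
   ==> \<exists>f \<in> Arr C. Dom C f = x \<and> Cod C f = y \<and> arm F f = g"
  and ess: "!!d. d \<in> Obj D ==> \<exists>c \<in> Obj C. \<exists>i \<in> Arr D. Dom D i = obm F c \<and> Cod D i = d \<and> iso_arr D i"
 shows "is_equivalence C D F"
proof -
 note Fs = ftorD[OF F]
 have cC: "category C" and cD: "category D" using Fs by auto
 obtain g0 where g0: "!!d. d \<in> Obj D ==> g0 d \<in> Obj C \<and> (\<exists>i \<in> Arr D. Dom D i = obm F (g0 d) \<and> Cod D i = d \<and> iso_arr D i)"
  using ess by metis
 obtain \<epsilon> where \<epsilon>: "!!d. d \<in> Obj D ==> \<epsilon> d \<in> Arr D \<and> Dom D (\<epsilon> d) = obm F (g0 d) \<and> Cod D (\<epsilon> d) = d \<and> iso_arr D (\<epsilon> d)"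
  using g0 by metis
 define \<epsilon>' where "\<epsilon>' d = ginv D (\<epsilon> d)" for d
 have \<epsilon>': "\<epsilon>' d \<in> Arr D \<and> Dom D (\<epsilon>' d) = d \<and> Cod D (\<epsilon>' d) = obm F (g0 d) \<and>
   Comp D (\<epsilon>' d) (\<epsilon> d) = Idt D (obm F (g0 d)) \<and> Comp D (\<epsilon> d) (\<epsilon>' d) = Idt D d" if "d \<in> Obj D" for d
  using iso_arr_ginv[of D "\<epsilon> d"] \<epsilon>[OF that] by (simp add: \<epsilon>'_def)
 have "\<exists>k \<in> Arr C. Dom C k = g0 (Dom D g) \<and> Cod C k = g0 (Cod D g) \<and>
   arm F k = Comp D (\<epsilon>' (Cod D g)) (Comp D g (\<epsilon> (Dom D g)))" if "g \<in> Arr D" for g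
  using that cD \<epsilon>[of "Dom D g"] \<epsilon>'[of "Cod D g"] by (intro full) (auto simp: g0)
 then obtain g1 where g1: "!!g. g \<in> Arr D ==> g1 g \<in> Arr C \<and> Dom C (g1 g) = g0 (Dom D g) \<and> Cod C (g1 g) = g0 (Cod D g) \<and>
   arm F (g1 g) = Comp D (\<epsilon>' (Cod D g)) (Comp D g (\<epsilon> (Dom D g)))" by metis
 define G where "G = \<lparr>obm = g0, arm = g1\<rparr>"
 have G: "is_functor D C G"
 proof (rule ftorI)
  fix x assume x: "x \<in> Obj D"
  then show "obm G x \<in> Obj C" using g0 by (simp add: G_def)
  show "arm G (Idt D x) = Idt C (obm G x)"
   using x g1[of "Idt D x"] g0[of x] \<epsilon>[of x] \<epsilon>'[of x] cC cD
   by (intro faithful) (auto simp: G_def Fs)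
 next
  fix f g assume fg: "f \<in> Arr D" "g \<in> Arr D" "Cod D f = Dom D g"
  have 1: "Comp D (\<epsilon> (Dom D g)) (Comp D (\<epsilon>' (Dom D g)) z) = z" if "z \<in> Arr D" "Cod D z = Dom D g" for z
   using \<epsilon>[of "Dom D g"] \<epsilon>'[of "Dom D g"] fg cD that by (simp flip: comp_assoc)
  have "Comp D (Comp D (\<epsilon>' (Cod D g)) (Comp D g (\<epsilon> (Dom D g)))) (Comp D (\<epsilon>' (Dom D g)) (Comp D f (\<epsilon> (Dom D f))))
   = Comp D (\<epsilon>' (Cod D g)) (Comp D (Comp D g f) (\<epsilon> (Dom D f)))"
   using fg cD \<epsilon>[of "Dom D g"] \<epsilon>[of "Dom D f"] \<epsilon>'[of "Cod D g"] \<epsilon>'[of "Dom D g"] by (simp add: comp_assoc 1)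
  then show "arm G (Comp D g f) = Comp C (arm G g) (arm G f)"
   using fg g1[of f] g1[of g] g1[of "Comp D g f"] cC cD by (intro faithful) (auto simp: G_def Fs)
 qed (use g1 cC cD in \<open>auto simp: G_def\<close>)
 have "\<exists>k \<in> Arr C. Dom C k = c \<and> Cod C k = g0 (obm F c) \<and> arm F k = \<epsilon>' (obm F c)" if "c \<in> Obj C" for c
  using that \<epsilon>'[of "obm F c"] g0 by (intro full) (auto simp: Fs)
 then obtain \<eta> where \<eta>: "!!c. c \<in> Obj C ==> \<eta> c \<in> Arr C \<and> Dom C (\<eta> c) = c \<and> Cod C (\<eta> c) = g0 (obm F c) \<and> arm F (\<eta> c) = \<epsilon>' (obm F c)"
  by metis
 have \<eta>iso: "iso_arr C (\<eta> c)" if c: "c \<in> Obj C" for c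
 proof -
  \<comment> \<open>The inverse of \<open>\<eta> c\<close> is a preimage of
    \<open>\<epsilon>\<close>, as \<open>\<eta> c\<close> is a preimage of the inverse of
    \<open>\<epsilon>\<close>.\<close>
  have "\<exists>k \<in> Arr C. Dom C k = g0 (obm F c) \<and> Cod C k = c \<and> arm F k = \<epsilon> (obm F c)"
   using c \<epsilon>[of "obm F c"] g0 by (intro full) (auto simp: Fs)
  then obtain k where k: "k \<in> Arr C" "Dom C k = g0 (obm F c)" "Cod C k = c" "arm F k = \<epsilon> (obm F c)" by blast
  have "Comp C k (\<eta> c) = Idt C c" "Comp C (\<eta> c) k = Idt C (g0 (obm F c))"
   using c k \<eta>[OF c] cC g0[of "obm F c"] \<epsilon>'[of "obm F c"] by (auto intro!: faithful simp: Fs)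
  then show ?thesis using k \<eta>[OF c] by (auto simp: iso_arr_def Hom_iff)
 qed
 have "naturally_isomorphic C C (ftor_id C) (ftor_comp C G F)"
  unfolding naturally_isomorphic_def
 proof (rule exI[of _ \<eta>], intro conjI ballI)
  fix f assume f: "f \<in> Arr C"
  have 1: "Comp D (\<epsilon> (obm F (Dom C f))) (\<epsilon>' (obm F (Dom C f))) = Idt D (obm F (Dom C f))"
   using \<epsilon>'[of "obm F (Dom C f)"] f cC by (simp add: Fs)
  show "Comp C (\<eta> (Cod C f)) (arm (ftor_id C) f) = Comp C (arm (ftor_comp C G F) f) (\<eta> (Dom C f))"
   using f cC cD \<eta>[of "Dom C f"] \<eta>[of "Cod C f"] g1[of "arm F f"] 1
    \<epsilon>[of "obm F (Dom C f)"] \<epsilon>'[of "obm F (Dom C f)"]  \<epsilon>'[of "obm F (Cod C f)"]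
   by (intro faithful) (auto simp: Fs G_def ftor_id_def ftor_comp_def comp_assoc)
 qed (use \<eta> \<eta>iso in \<open>auto simp: ftor_id_def ftor_comp_def G_def Hom_iff\<close>)
 moreover have "naturally_isomorphic D D (ftor_comp D F G) (ftor_id D)"
  unfolding naturally_isomorphic_def
 proof (rule exI[of _ \<epsilon>], intro conjI ballI)
  fix f assume f: "f \<in> Arr D"
  have 1: "Comp D (\<epsilon> (Cod D f)) (\<epsilon>' (Cod D f)) = Idt D (Cod D f)"
   using \<epsilon>'[of "Cod D f"] f cD by simp
  show "Comp D (\<epsilon> (Cod D f)) (arm (ftor_comp D F G) f) = Comp D (arm (ftor_id D) f) (\<epsilon> (Dom D f))"
   using f cD g1[of f] 1 \<epsilon>[of "Dom D f"] \<epsilon>[of "Cod D f"] \<epsilon>'[of "Cod D f"]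
   by (auto simp: ftor_id_def ftor_comp_def G_def simp flip: comp_assoc)
 qed (use \<epsilon> in \<open>auto simp: ftor_id_def ftor_comp_def G_def Hom_iff\<close>)
 ultimately show ?thesis using F G by (auto simp: is_equivalence_def equivalence_pair_def)
qed

lemma iso_arr_Idt: "category C ==> x \<in> Obj C ==> iso_arr C (Idt C x)"
 unfolding iso_arr_def by (auto simp: Hom_iff intro!: bexI[of _ "Idt C x"])

lemma ftor_id_equivalence: "category C ==> is_equivalence C C (ftor_id C)"
proof (rule equivalenceI)
 fix d assume "category C" "d \<in> Obj C"
 then show "\<exists>c \<in> Obj C. \<exists>i \<in> Arr C. Dom C i = obm (ftor_id C) c \<and> Cod C i = d \<and> iso_arr C i"
  by (intro bexI[of _ d] bexI[of _ "Idt C d"]) (auto simp: ftor_id_def iso_arr_Idt)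
qed (auto intro!: ftorI simp: ftor_id_def)

section \<open>Maps and homotopies\<close>

lemma grpd_presheafD:
 assumes "grpd_presheaf C F"
 shows "category C" "X \<in> Obj C ==> groupoid (sect F X)" "h \<in> Arr C ==> is_functor (sect F (Cod C h)) (sect F (Dom C h)) (rst F h)"
 using assms by (auto simp: grpd_presheaf_def)

lemma gpshD:
 assumes F: "grpd_presheaf C F"
 shows "category C"
  "X \<in> Obj C ==> groupoid (sect F X)"
  "[|h \<in> Arr C; a \<in> Obj (sect F (Cod C h)); Y = Dom C h|] ==> obm (rst F h) a \<in> Obj (sect F Y)"
  "[|h \<in> Arr C; \<alpha> \<in> Arr (sect F (Cod C h)); Y = Dom C h|] ==> arm (rst F h) \<alpha> \<in> Arr (sect F Y)"
  "[|h \<in> Arr C; \<alpha> \<in> Arr (sect F (Cod C h)); Y = Dom C h|]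
   ==> Dom (sect F Y) (arm (rst F h) \<alpha>) = obm (rst F h) (Dom (sect F (Cod C h)) \<alpha>)"
  "[|h \<in> Arr C; \<alpha> \<in> Arr (sect F (Cod C h)); Y = Dom C h|]
   ==> Cod (sect F Y) (arm (rst F h) \<alpha>) = obm (rst F h) (Cod (sect F (Cod C h)) \<alpha>)"
  "[|h \<in> Arr C; X = Cod C h; a \<in> Obj (sect F X)|]
   ==> arm (rst F h) (Idt (sect F X) a) = Idt (sect F (Dom C h)) (obm (rst F h) a)"
  "[|h \<in> Arr C; X = Cod C h; \<alpha> \<in> Arr (sect F X); \<beta> \<in> Arr (sect F X); Cod (sect F X) \<alpha> = Dom (sect F X) \<beta>|]
   ==> arm (rst F h) (Comp (sect F X) \<beta> \<alpha>) =
    Comp (sect F (Dom C h)) (arm (rst F h) \<beta>) (arm (rst F h) \<alpha>)"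
  "[|X \<in> Obj C; a \<in> Obj (sect F X)|] ==> obm (rst F (Idt C X)) a = a"
  "[|X \<in> Obj C; \<alpha> \<in> Arr (sect F X)|] ==> arm (rst F (Idt C X)) \<alpha> = \<alpha>"
  "[|f \<in> Arr C; g \<in> Arr C; Cod C f = Dom C g; a \<in> Obj (sect F (Cod C g))|]
   ==> obm (rst F (Comp C g f)) a = obm (rst F f) (obm (rst F g) a)"
  "[|f \<in> Arr C; g \<in> Arr C; Cod C f = Dom C g; \<alpha> \<in> Arr (sect F (Cod C g))|]
   ==> arm (rst F (Comp C g f)) \<alpha> = arm (rst F f) (arm (rst F g) \<alpha>)"
  "[|h \<in> Arr C; X = Cod C h; \<alpha> \<in> Arr (sect F X)|]
   ==> arm (rst F h) (ginv (sect F X) \<alpha>) = ginv (sect F (Dom C h)) (arm (rst F h) \<alpha>)"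
proof goal_cases
 { case 9 then show ?case using F by (simp add: grpd_presheaf_def) }
 { case 10 then show ?case using F by (simp add: grpd_presheaf_def) }
 { case 11 then show ?case using F by (auto simp: grpd_presheaf_def Hom_def) }
 { case 12 then show ?case using F by (auto simp: grpd_presheaf_def Hom_def) }
qed (simp_all add: grpd_presheafD[OF F] ftorD[OF grpd_presheafD(3)[OF F]] ftor_ginv[OF grpd_presheafD(3)[OF F]])

lemma gpshI:
 assumes "category C"
  "!!X. X \<in> Obj C ==> groupoid (sect F X)"
  "!!h a. [|h \<in> Arr C; a \<in> Obj (sect F (Cod C h))|] ==> obm (rst F h) a \<in> Obj (sect F (Dom C h))"
  "!!h \<alpha>. [|h \<in> Arr C; \<alpha> \<in> Arr (sect F (Cod C h))|] ==> arm (rst F h) \<alpha> \<in> Arr (sect F (Dom C h))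
   \<and> Dom (sect F (Dom C h)) (arm (rst F h) \<alpha>) = obm (rst F h) (Dom (sect F (Cod C h)) \<alpha>)
   \<and> Cod (sect F (Dom C h)) (arm (rst F h) \<alpha>) = obm (rst F h) (Cod (sect F (Cod C h)) \<alpha>)"
  "!!h a. [|h \<in> Arr C; a \<in> Obj (sect F (Cod C h))|]
   ==> arm (rst F h) (Idt (sect F (Cod C h)) a) = Idt (sect F (Dom C h)) (obm (rst F h) a)"
  "!!h \<alpha> \<beta>. [|h \<in> Arr C; \<alpha> \<in> Arr (sect F (Cod C h)); \<beta> \<in> Arr (sect F (Cod C h)); Cod (sect F (Cod C h)) \<alpha> = Dom (sect F (Cod C h)) \<beta>|]
   ==> arm (rst F h) (Comp (sect F (Cod C h)) \<beta> \<alpha>) =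
    Comp (sect F (Dom C h)) (arm (rst F h) \<beta>) (arm (rst F h) \<alpha>)"
  "!!X a. [|X \<in> Obj C; a \<in> Obj (sect F X)|] ==> obm (rst F (Idt C X)) a = a"
  "!!X \<alpha>. [|X \<in> Obj C; \<alpha> \<in> Arr (sect F X)|] ==> arm (rst F (Idt C X)) \<alpha> = \<alpha>"
  "!!f g a. [|f \<in> Arr C; g \<in> Arr C; Cod C f = Dom C g; a \<in> Obj (sect F (Cod C g))|]
   ==> obm (rst F (Comp C g f)) a = obm (rst F f) (obm (rst F g) a)"
  "!!f g \<alpha>. [|f \<in> Arr C; g \<in> Arr C; Cod C f = Dom C g; \<alpha> \<in> Arr (sect F (Cod C g))|]
   ==> arm (rst F (Comp C g f)) \<alpha> = arm (rst F f) (arm (rst F g) \<alpha>)"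
 shows "grpd_presheaf C F"
 unfolding grpd_presheaf_def
 by (intro conjI ballI allI ftorI) (use assms in \<open>auto simp: Hom_iff\<close>)

lemma grpd_mapD:
 assumes "grpd_map C A B \<phi>"
 shows "grpd_presheaf C A" "grpd_presheaf C B" "X \<in> Obj C ==> is_functor (sect A X) (sect B X) (\<phi> X)"
 using assms by (auto simp: grpd_map_def)

lemma gmapD:
 assumes f: "grpd_map C A B \<phi>"
 shows "grpd_presheaf C A" "grpd_presheaf C B" "category C"
  "[|X \<in> Obj C; a \<in> Obj (sect A X)|] ==> obm (\<phi> X) a \<in> Obj (sect B X)"
  "[|X \<in> Obj C; \<alpha> \<in> Arr (sect A X)|] ==> arm (\<phi> X) \<alpha> \<in> Arr (sect B X)"
  "[|X \<in> Obj C; \<alpha> \<in> Arr (sect A X)|] ==> Dom (sect B X) (arm (\<phi> X) \<alpha>) = obm (\<phi> X) (Dom (sect A X) \<alpha>)"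
  "[|X \<in> Obj C; \<alpha> \<in> Arr (sect A X)|] ==> Cod (sect B X) (arm (\<phi> X) \<alpha>) = obm (\<phi> X) (Cod (sect A X) \<alpha>)"
  "[|X \<in> Obj C; a \<in> Obj (sect A X)|] ==> arm (\<phi> X) (Idt (sect A X) a) = Idt (sect B X) (obm (\<phi> X) a)"
  "[|X \<in> Obj C; \<alpha> \<in> Arr (sect A X); \<beta> \<in> Arr (sect A X); Cod (sect A X) \<alpha> = Dom (sect A X) \<beta>|]
   ==> arm (\<phi> X) (Comp (sect A X) \<beta> \<alpha>) = Comp (sect B X) (arm (\<phi> X) \<beta>) (arm (\<phi> X) \<alpha>)"
  "[|h \<in> Arr C; Y = Dom C h; a \<in> Obj (sect A (Cod C h))|]
   ==> obm (\<phi> Y) (obm (rst A h) a) = obm (rst B h) (obm (\<phi> (Cod C h)) a)"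
  "[|h \<in> Arr C; Y = Dom C h; \<alpha> \<in> Arr (sect A (Cod C h))|]
   ==> arm (\<phi> Y) (arm (rst A h) \<alpha>) = arm (rst B h) (arm (\<phi> (Cod C h)) \<alpha>)"
  "[|X \<in> Obj C; \<alpha> \<in> Arr (sect A X)|] ==> arm (\<phi> X) (ginv (sect A X) \<alpha>) = ginv (sect B X) (arm (\<phi> X) \<alpha>)"
proof goal_cases
 { case 10 then show ?case using f by (auto simp: grpd_map_def) }
 { case 11 then show ?case using f by (auto simp: grpd_map_def) }
qed (simp_all add: grpd_mapD[OF f] gpshD(1,2)[OF grpd_mapD(1)[OF f]] gpshD(2)[OF grpd_mapD(2)[OF f]]
  ftorD[OF grpd_mapD(3)[OF f]] ftor_ginv[OF grpd_mapD(3)[OF f]])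

lemma gmapI:
 assumes "grpd_presheaf C A" "grpd_presheaf C B" "\<phi> \<in> extensional (Obj C)"
  "!!X. X \<in> Obj C ==> obm (\<phi> X) \<in> extensional (Obj (sect A X)) \<and> arm (\<phi> X) \<in> extensional (Arr (sect A X))"
  "!!X a. [|X \<in> Obj C; a \<in> Obj (sect A X)|] ==> obm (\<phi> X) a \<in> Obj (sect B X)"
  "!!X \<alpha>. [|X \<in> Obj C; \<alpha> \<in> Arr (sect A X)|] ==> arm (\<phi> X) \<alpha> \<in> Arr (sect B X)
   \<and> Dom (sect B X) (arm (\<phi> X) \<alpha>) = obm (\<phi> X) (Dom (sect A X) \<alpha>)
   \<and> Cod (sect B X) (arm (\<phi> X) \<alpha>) = obm (\<phi> X) (Cod (sect A X) \<alpha>)"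
  "!!X a. [|X \<in> Obj C; a \<in> Obj (sect A X)|] ==> arm (\<phi> X) (Idt (sect A X) a) = Idt (sect B X) (obm (\<phi> X) a)"
  "!!X \<alpha> \<beta>. [|X \<in> Obj C; \<alpha> \<in> Arr (sect A X); \<beta> \<in> Arr (sect A X); Cod (sect A X) \<alpha> = Dom (sect A X) \<beta>|]
   ==> arm (\<phi> X) (Comp (sect A X) \<beta> \<alpha>) = Comp (sect B X) (arm (\<phi> X) \<beta>) (arm (\<phi> X) \<alpha>)"
  "!!h a. [|h \<in> Arr C; a \<in> Obj (sect A (Cod C h))|]
   ==> obm (\<phi> (Dom C h)) (obm (rst A h) a) = obm (rst B h) (obm (\<phi> (Cod C h)) a)"
  "!!h \<alpha>. [|h \<in> Arr C; \<alpha> \<in> Arr (sect A (Cod C h))|]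
   ==> arm (\<phi> (Dom C h)) (arm (rst A h) \<alpha>) = arm (rst B h) (arm (\<phi> (Cod C h)) \<alpha>)"
 shows "grpd_map C A B \<phi>"
 unfolding grpd_map_def
 by (intro conjI ballI allI ftorI) (use assms gpshD[OF assms(1)] gpshD[OF assms(2)] in \<open>auto\<close>)

text \<open>A map is extensional as a family and in both components, so its values on the carriers
  decide equality.\<close>

lemma gmap_eqI:
 assumes "grpd_map C A B \<phi>" "grpd_map C A B' \<psi>"
  "!!X a. [|X \<in> Obj C; a \<in> Obj (sect A X)|] ==> obm (\<phi> X) a = obm (\<psi> X) a"
  "!!X \<alpha>. [|X \<in> Obj C; \<alpha> \<in> Arr (sect A X)|] ==> arm (\<phi> X) \<alpha> = arm (\<psi> X) \<alpha>"
 shows "\<phi> = \<psi>"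
proof (rule extensionalityI[of _ "Obj C"])
 fix X assume X: "X \<in> Obj C"
 have "obm (\<phi> X) = obm (\<psi> X)"
  by (rule extensionalityI[of _ "Obj (sect A X)"]) (use assms X in \<open>auto simp: grpd_map_def\<close>)
 moreover have "arm (\<phi> X) = arm (\<psi> X)"
  by (rule extensionalityI[of _ "Arr (sect A X)"]) (use assms X in \<open>auto simp: grpd_map_def\<close>)
 ultimately show "\<phi> X = \<psi> X" by (rule ftor.equality) simp
qed (use assms in \<open>auto simp: grpd_map_def\<close>)

lemma gmap_comp_simps [simp]:
 "[|X \<in> Obj C; a \<in> Obj (sect A X)|] ==> obm (gmap_comp C A \<psi> \<phi> X) a = obm (\<psi> X) (obm (\<phi> X) a)"
 "[|X \<in> Obj C; \<alpha> \<in> Arr (sect A X)|] ==> arm (gmap_comp C A \<psi> \<phi> X) \<alpha> = arm (\<psi> X) (arm (\<phi> X) \<alpha>)"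
 by (simp_all add: gmap_comp_def ftor_comp_def)

lemma gmap_id_simps [simp]:
 "[|X \<in> Obj C; a \<in> Obj (sect A X)|] ==> obm (gmap_id C A X) a = a"
 "[|X \<in> Obj C; \<alpha> \<in> Arr (sect A X)|] ==> arm (gmap_id C A X) \<alpha> = \<alpha>"
 by (simp_all add: gmap_id_def ftor_id_def)

lemma gmap_comp_map [intro]:
 assumes "grpd_map C A B \<phi>" "grpd_map C B D \<psi>"
 shows "grpd_map C A D (gmap_comp C A \<psi> \<phi>)"
proof -
 note [simp] = gmapD[OF assms(1)] gmapD[OF assms(2)]
 note [simp] = gpshD[OF gmapD(1)[OF assms(1)]]
 show ?thesis by (rule gmapI) (auto simp: gmap_comp_def ftor_comp_def)
qed

lemma gmap_id_map [intro]:
 assumes "grpd_presheaf C A"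
 shows "grpd_map C A A (gmap_id C A)"
proof -
 note [simp] = gpshD[OF assms]
 show ?thesis by (rule gmapI) (auto simp: gmap_id_def ftor_id_def assms)
qed

lemma gmap_comp_assoc:
 assumes "grpd_map C A B \<phi>" "grpd_map C B D \<psi>" "grpd_map C D E \<chi>"
 shows "gmap_comp C A (gmap_comp C B \<chi> \<psi>) \<phi> = gmap_comp C A \<chi> (gmap_comp C A \<psi> \<phi>)"
 by (rule gmap_eqI) (use assms in \<open>auto simp: gmapD[OF assms(1)]\<close>)

lemma gmap_comp_id:
 assumes "grpd_map C A B \<phi>"
 shows "gmap_comp C A \<phi> (gmap_id C A) = \<phi>" "gmap_comp C A (gmap_id C B) \<phi> = \<phi>"
 by (rule gmap_eqI[OF gmap_comp_map[OF gmap_id_map assms] assms] gmap_eqI[OF gmap_comp_map[OF assms gmap_id_map] assms];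
   use gmapD[OF assms] in simp)+

text \<open>Being an arrow of \<open>Map_grpd\<close>, as a predicate: homotopies with known ends
  are handled without taking triples apart.\<close>

definition hty :: "('o, 'a) cat => ('o, 'a, 'p1, 'q1) gpsh => ('o, 'a, 'p2, 'q2) gpsh
  => ('o, 'p1, 'q1, 'p2, 'q2) gmap => ('o => 'p1 => 'q2) => ('o, 'p1, 'q1, 'p2, 'q2) gmap => bool" where
 "hty C A W \<phi> \<theta> \<psi> \<longleftrightarrow> (\<phi>, \<theta>, \<psi>) \<in> Arr (Map_grpd C A W)"

lemma htyD:
 assumes "hty C A W \<phi> \<theta> \<psi>"
 shows "grpd_map C A W \<phi>" "grpd_map C A W \<psi>"
  "[|X \<in> Obj C; a \<in> Obj (sect A X)|] ==> \<theta> X a \<in> Arr (sect W X)"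
  "[|X \<in> Obj C; a \<in> Obj (sect A X)|] ==> Dom (sect W X) (\<theta> X a) = obm (\<phi> X) a"
  "[|X \<in> Obj C; a \<in> Obj (sect A X)|] ==> Cod (sect W X) (\<theta> X a) = obm (\<psi> X) a"
  "[|h \<in> Arr C; Y = Dom C h; a \<in> Obj (sect A (Cod C h))|] ==>
   \<theta> Y (obm (rst A h) a) = arm (rst W h) (\<theta> (Cod C h) a)"
 using assms unfolding hty_def Map_grpd_def by (auto simp: Hom_def PiE_iff)

lemma hty_nat:
 assumes "hty C A W \<phi> \<theta> \<psi>" "X \<in> Obj C" "\<alpha> \<in> Arr (sect A X)"
 shows "Comp (sect W X) (\<theta> X (Cod (sect A X) \<alpha>)) (arm (\<phi> X) \<alpha>) =
     Comp (sect W X) (arm (\<psi> X) \<alpha>) (\<theta> X (Dom (sect A X) \<alpha>))"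
 using assms unfolding hty_def Map_grpd_def by auto

lemma htyI:
 assumes "grpd_map C A W \<phi>" "grpd_map C A W \<psi>"
  "\<theta> \<in> extensional (Obj C)" "!!X. X \<in> Obj C ==> \<theta> X \<in> extensional (Obj (sect A X))"
  "!!X a. [|X \<in> Obj C; a \<in> Obj (sect A X)|] ==> \<theta> X a \<in> Arr (sect W X) \<and>
   Dom (sect W X) (\<theta> X a) = obm (\<phi> X) a \<and> Cod (sect W X) (\<theta> X a) = obm (\<psi> X) a"
  "!!X \<alpha>. [|X \<in> Obj C; \<alpha> \<in> Arr (sect A X)|] ==>
   Comp (sect W X) (\<theta> X (Cod (sect A X) \<alpha>)) (arm (\<phi> X) \<alpha>) =
     Comp (sect W X) (arm (\<psi> X) \<alpha>) (\<theta> X (Dom (sect A X) \<alpha>))"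
  "!!h a. [|h \<in> Arr C; a \<in> Obj (sect A (Cod C h))|] ==>
   \<theta> (Dom C h) (obm (rst A h) a) = arm (rst W h) (\<theta> (Cod C h) a)"
 shows "hty C A W \<phi> \<theta> \<psi>"
 using assms unfolding hty_def Map_grpd_def by (auto simp: Hom_def PiE_iff)

text \<open>Homotopies are extensional in both arguments; \<open>res2\<close> is the normal form
  that allows them to be given by plain functions and compared pointwise.\<close>

definition res2 :: "('o, 'a) cat => ('o, 'a, 'p, 'q) gpsh => ('o => 'p => 'r) => 'o => 'p => 'r" where
 "res2 C A \<theta> = (\<lambda>X \<in> Obj C. \<lambda>a \<in> Obj (sect A X). \<theta> X a)"

lemma res2_simps [simp]: "X \<in> Obj C ==> a \<in> Obj (sect A X) ==> res2 C A \<theta> X a = \<theta> X a"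
 by (simp add: res2_def)

lemma res2_cong:
 "(!!X a. X \<in> Obj C ==> a \<in> Obj (sect A X) ==> \<theta> X a = \<theta>' X a) ==> res2 C A \<theta> = res2 C A \<theta>'"
 by (auto simp: res2_def fun_eq_iff restrict_def)

lemma res2_eqD: "[|res2 C A \<theta> = res2 C A \<theta>'; X \<in> Obj C; a \<in> Obj (sect A X)|] ==> \<theta> X a = \<theta>' X a"
 by (drule fun_cong[of _ _ X], drule fun_cong[of _ _ a]) simp

lemma hty_res2I:
 assumes "grpd_map C A W \<phi>" "grpd_map C A W \<psi>"
  "!!X a. [|X \<in> Obj C; a \<in> Obj (sect A X)|] ==> \<theta> X a \<in> Arr (sect W X) \<and>
   Dom (sect W X) (\<theta> X a) = obm (\<phi> X) a \<and> Cod (sect W X) (\<theta> X a) = obm (\<psi> X) a"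
  "!!X \<alpha>. [|X \<in> Obj C; \<alpha> \<in> Arr (sect A X)|] ==>
   Comp (sect W X) (\<theta> X (Cod (sect A X) \<alpha>)) (arm (\<phi> X) \<alpha>) =
     Comp (sect W X) (arm (\<psi> X) \<alpha>) (\<theta> X (Dom (sect A X) \<alpha>))"
  "!!h a. [|h \<in> Arr C; a \<in> Obj (sect A (Cod C h))|] ==>
   \<theta> (Dom C h) (obm (rst A h) a) = arm (rst W h) (\<theta> (Cod C h) a)"
 shows "hty C A W \<phi> (res2 C A \<theta>) \<psi>"
proof -
 note [simp] = gpshD[OF gmapD(1)[OF assms(1)]]
 show ?thesis
  by (rule htyI) (use assms in \<open>auto simp: res2_def\<close>)
qed

lemma hty_eqI:
 assumes "hty C A W \<phi> \<theta> \<psi>" "hty C A W' \<phi>' \<theta>' \<psi>'"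
  "!!X a. [|X \<in> Obj C; a \<in> Obj (sect A X)|] ==> \<theta> X a = \<theta>' X a"
 shows "\<theta> = \<theta>'"
proof (rule extensionalityI[of _ "Obj C"])
 show "\<theta> \<in> extensional (Obj C)" "\<theta>' \<in> extensional (Obj C)"
  using assms(1,2) by (auto simp: hty_def Map_grpd_def PiE_iff)
 fix X assume "X \<in> Obj C"
 then show "\<theta> X = \<theta>' X"
  using assms by (intro extensionalityI[of _ "Obj (sect A X)"])
   (auto simp: hty_def Map_grpd_def PiE_iff)
qed

lemma hty_comp:
 assumes "hty C A W \<phi> \<theta> \<psi>" "hty C A W \<psi> \<theta>' \<chi>"
 shows "hty C A W \<phi> (res2 C A (\<lambda>X a. Comp (sect W X) (\<theta>' X a) (\<theta> X a))) \<chi>"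
proof -
 note [simp] = htyD[OF assms(1)] htyD[OF assms(2)] gmapD[OF htyD(1)[OF assms(1)]] gmapD[OF htyD(2)[OF assms(1)]]
  gmapD[OF htyD(2)[OF assms(2)]]
 note [simp] = gpshD[OF gmapD(1)[OF htyD(1)[OF assms(1)]]] gpshD[OF gmapD(2)[OF htyD(1)[OF assms(1)]]]
 show ?thesis
  by (rule hty_res2I) (auto simp: comp_assoc hty_nat[OF assms(1)], simp flip: comp_assoc hty_nat[OF assms(2)])
qed

lemma hty_inv:
 assumes "hty C A W \<phi> \<theta> \<psi>"
 shows "hty C A W \<psi> (res2 C A (\<lambda>X a. ginv (sect W X) (\<theta> X a))) \<phi>"
proof -
 note [simp] = htyD[OF assms(1)] gmapD[OF htyD(1)[OF assms(1)]] gmapD[OF htyD(2)[OF assms(1)]]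
 note [simp] = gpshD[OF gmapD(1)[OF htyD(1)[OF assms(1)]]] gpshD[OF gmapD(2)[OF htyD(1)[OF assms(1)]]]
 show ?thesis
 proof (rule hty_res2I)
  fix X \<alpha> assume a: "X \<in> Obj C" "\<alpha> \<in> Arr (sect A X)"
  let ?W = "sect W X" and ?d = "Dom (sect A X) \<alpha>" and ?c = "Cod (sect A X) \<alpha>"
  \<comment> \<open>The naturality square of \<open>\<theta>\<close>, multiplied by inverses on both
    sides, is the square of the inverse homotopy.\<close>
  have "Comp ?W (ginv ?W (\<theta> X ?c)) (Comp ?W (Comp ?W (arm (\<psi> X) \<alpha>) (\<theta> X ?d)) (ginv ?W (\<theta> X ?d)))
   = Comp ?W (ginv ?W (\<theta> X ?c)) (Comp ?W (Comp ?W (\<theta> X ?c) (arm (\<phi> X) \<alpha>)) (ginv ?W (\<theta> X ?d)))"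
   using hty_nat[OF assms a] by simp
  then show "Comp ?W (ginv ?W (\<theta> X ?c)) (arm (\<psi> X) \<alpha>) = Comp ?W (arm (\<phi> X) \<alpha>) (ginv ?W (\<theta> X ?d))"
   using a by (simp add: comp_assoc)
 qed auto
qed

lemma hty_id:
 assumes "grpd_map C A W \<phi>"
 shows "hty C A W \<phi> (res2 C A (\<lambda>X a. Idt (sect W X) (obm (\<phi> X) a))) \<phi>"
proof -
 note [simp] = gmapD[OF assms] gpshD[OF gmapD(1)[OF assms]] gpshD[OF gmapD(2)[OF assms]]
 show ?thesis by (rule hty_res2I) (auto simp: assms)
qed

lemma hty_pre:
 assumes "hty C B W \<phi> \<theta> \<psi>" "grpd_map C A B f"
 shows "hty C A W (gmap_comp C A \<phi> f) (res2 C A (\<lambda>X a. \<theta> X (obm (f X) a))) (gmap_comp C A \<psi> f)"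
proof -
 note [simp] = htyD[OF assms(1)] gmapD[OF htyD(1)[OF assms(1)]] gmapD[OF htyD(2)[OF assms(1)]] gmapD[OF assms(2)]
 note [simp] = gpshD[OF gmapD(1)[OF assms(2)]]
 show ?thesis
 proof (rule hty_res2I)
  fix X \<alpha> assume "X \<in> Obj C" "\<alpha> \<in> Arr (sect A X)"
  then show "Comp (sect W X) (\<theta> X (obm (f X) (Cod (sect A X) \<alpha>))) (arm (gmap_comp C A \<phi> f X) \<alpha>) =
   Comp (sect W X) (arm (gmap_comp C A \<psi> f X) \<alpha>) (\<theta> X (obm (f X) (Dom (sect A X) \<alpha>)))"
   using hty_nat[OF assms(1), of X "arm (f X) \<alpha>"] by simp
 qed (auto intro: gmap_comp_map[OF assms(2)])
qed

lemma hty_post: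
 assumes "hty C A W \<phi> \<theta> \<psi>" "grpd_map C W V \<kappa>"
 shows "hty C A V (gmap_comp C A \<kappa> \<phi>) (res2 C A (\<lambda>X a. arm (\<kappa> X) (\<theta> X a))) (gmap_comp C A \<kappa> \<psi>)"
proof -
 note [simp] = htyD[OF assms(1)] gmapD[OF htyD(1)[OF assms(1)]] gmapD[OF htyD(2)[OF assms(1)]] gmapD[OF assms(2)]
 note [simp] = gpshD[OF gmapD(1)[OF htyD(1)[OF assms(1)]]] gpshD[OF gmapD(2)[OF htyD(1)[OF assms(1)]]]
 show ?thesis
  by (intro hty_res2I) (auto intro: gmap_comp_map[OF _ assms(2)] simp: hty_nat[OF assms(1)] simp flip: gmapD(9)[OF assms(2)])
qed

lemma Map_grpd_simps [simp]:
 "\<phi> \<in> Obj (Map_grpd C A W) \<longleftrightarrow> grpd_map C A W \<phi>"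
 "(\<phi>, \<theta>, \<psi>) \<in> Arr (Map_grpd C A W) \<longleftrightarrow> hty C A W \<phi> \<theta> \<psi>"
 "Dom (Map_grpd C A W) (\<phi>, \<theta>, \<psi>) = \<phi>" "Cod (Map_grpd C A W) (\<phi>, \<theta>, \<psi>) = \<psi>"
 "Idt (Map_grpd C A W) \<phi> = (\<phi>, res2 C A (\<lambda>X a. Idt (sect W X) (obm (\<phi> X) a)), \<phi>)"
 "Comp (Map_grpd C A W) (\<psi>, \<theta>', \<chi>) (\<phi>, \<theta>, \<psi>') = (\<phi>, res2 C A (\<lambda>X a. Comp (sect W X) (\<theta>' X a) (\<theta> X a)), \<chi>)"
 by (simp_all add: hty_def) (simp_all add: Map_grpd_def res2_def)

lemma Map_grpd_groupoid:
 assumes "grpd_presheaf C A" "grpd_presheaf C W"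
 shows "groupoid (Map_grpd C A W)"
proof (rule groupoidI)
 note [simp] = gpshD[OF assms(1)] gpshD[OF assms(2)]
 show "category (Map_grpd C A W)"
 proof (rule categoryI, goal_cases)
  case (1 f) then show ?case by (cases f) (auto dest: htyD)
 next
  case (2 x) then show ?case by (auto intro: hty_id)
 next
  case (3 f g) then show ?case by (cases f; cases g) (auto intro: hty_comp)
 next
  case (4 f)
  obtain \<phi> \<theta> \<psi> where f: "f = (\<phi>, \<theta>, \<psi>)" by (cases f)
  have h: "hty C A W \<phi> \<theta> \<psi>" using 4 by (simp add: f)
  note [simp] = htyD[OF h]
  show ?case unfolding f
   by (auto intro!: hty_eqI[OF hty_comp[OF hty_id h] h] hty_eqI[OF hty_comp[OF h hty_id] h])
 next
  case (5 f g h)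
  obtain \<phi> \<theta> \<psi> where f: "f = (\<phi>, \<theta>, \<psi>)" by (cases f)
  obtain \<psi>2 \<theta>2 \<chi> where g: "g = (\<psi>2, \<theta>2, \<chi>)" by (cases g)
  obtain \<chi>3 \<theta>3 \<omega> where h: "h = (\<chi>3, \<theta>3, \<omega>)" by (cases h)
  have [simp]: "\<psi>2 = \<psi>" "\<chi>3 = \<chi>" using 5 f g h by auto
  have hs: "hty C A W \<phi> \<theta> \<psi>" "hty C A W \<psi> \<theta>2 \<chi>" "hty C A W \<chi> \<theta>3 \<omega>" using 5 by (auto simp: f g h)
  note [simp] = htyD[OF hs(1)] htyD[OF hs(2)] htyD[OF hs(3)]
  show ?case unfolding f g h
   by (auto intro!: hty_eqI[OF hty_comp[OF hs(1) hty_comp[OF hs(2,3)]] hty_comp[OF hty_comp[OF hs(1,2)] hs(3)]] simp: comp_assoc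
    intro: hty_eqI[symmetric])
 qed
 fix f assume "f \<in> Arr (Map_grpd C A W)"
 then obtain \<phi> \<theta> \<psi> where f: "f = (\<phi>, \<theta>, \<psi>)" and h: "hty C A W \<phi> \<theta> \<psi>" by (cases f) auto
 note [simp] = htyD[OF h]
 show "\<exists>g \<in> Arr (Map_grpd C A W). Dom (Map_grpd C A W) g = Cod (Map_grpd C A W) f \<and> Cod (Map_grpd C A W) g = Dom (Map_grpd C A W) f \<and>
  Comp (Map_grpd C A W) g f = Idt (Map_grpd C A W) (Dom (Map_grpd C A W) f) \<and> Comp (Map_grpd C A W) f g = Idt (Map_grpd C A W) (Cod (Map_grpd C A W) f)"
  unfolding f by (rule bexI[of _ "(\<psi>, res2 C A (\<lambda>X a. ginv (sect W X) (\<theta> X a)), \<phi>)"])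
   (auto simp: hty_inv[OF h] intro!: res2_cong)
qed

text \<open>Restriction along \<open>f\<close> is an equivalence \<open>Map(B, W) \<rightarrow> Map(A, W)\<close>, in elementary terms and without
 restriction on the universe of \<open>W\<close>.\<close>

definition ff_es :: "('o, 'a) cat => ('o, 'a, 'p1, 'q1) gpsh => ('o, 'a, 'p2, 'q2) gpsh
  => ('o, 'p1, 'q1, 'p2, 'q2) gmap => ('o, 'a, 'p3, 'q3) gpsh => bool" where
 "ff_es C A B f W \<longleftrightarrow> grpd_map C A B f \<and>
  (\<forall>\<phi>. grpd_map C A W \<phi> --> (\<exists>\<psi> \<theta>. grpd_map C B W \<psi> \<and> hty C A W (gmap_comp C A \<psi> f) \<theta> \<phi>)) \<and>
  (\<forall>\<psi> \<psi>' \<theta>. grpd_map C B W \<psi> \<and> grpd_map C B W \<psi>' \<and> hty C A W (gmap_comp C A \<psi> f) \<theta> (gmap_comp C A \<psi>' f)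
   --> (\<exists>!\<Theta>. hty C B W \<psi> \<Theta> \<psi>' \<and> (\<forall>X \<in> Obj C. \<forall>a \<in> Obj (sect A X). \<Theta> X (obm (f X) a) = \<theta> X a)))"

lemma ff_esD:
 assumes "ff_es C A B f W"
 shows "grpd_map C A B f"
  "grpd_map C A W \<phi> ==> \<exists>\<psi> \<theta>. grpd_map C B W \<psi> \<and> hty C A W (gmap_comp C A \<psi> f) \<theta> \<phi>"
  "[|grpd_map C B W \<psi>; grpd_map C B W \<psi>'; hty C A W (gmap_comp C A \<psi> f) \<theta> (gmap_comp C A \<psi>' f)|]
   ==> \<exists>!\<Theta>. hty C B W \<psi> \<Theta> \<psi>' \<and> (\<forall>X \<in> Obj C. \<forall>a \<in> Obj (sect A X). \<Theta> X (obm (f X) a) = \<theta> X a)"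
 using assms unfolding ff_es_def by blast+

lemma Map_precomp_functor:
 assumes f: "grpd_map C A B f" and W: "grpd_presheaf C W"
 shows "is_functor (Map_grpd C B W) (Map_grpd C A W) (Map_precomp C A f)"
proof -
 note A = gmapD(1)[OF f] and B = gmapD(2)[OF f]
 note [simp] = gmapD[OF f]
 show ?thesis
  by (rule ftorI; auto simp: Map_grpd_groupoid A B W Map_precomp_def
    res2_def[symmetric] intro: gmap_comp_map[OF f] hty_pre[OF _ f];
   auto simp: res2_def fun_eq_iff restrict_def)+
qed

text \<open>The unique \<open>\<Theta>\<close> in \<open>ff_es\<close> is fullness and faithfulness
  at once, and a homotopy suffices for essential surjectivity because every arrow of
  \<open>Map_grpd\<close> is invertible. Local objects and local equivalences are always handled
  through this form.\<close>

lemma is_equivalence_precomp_iff: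
 fixes f :: "('o, 'p1, 'q1, 'p2, 'q2) gmap" and W :: "('o, 'a, 'p3, 'q3) gpsh"
 assumes f: "grpd_map C A B f" and W: "grpd_presheaf C W"
 shows "is_equivalence (Map_grpd C B W) (Map_grpd C A W) (Map_precomp C A f) \<longleftrightarrow> ff_es C A B f W"
  (is "?L \<longleftrightarrow> ?R")
proof
 note A = gmapD(1)[OF f] and B = gmapD(2)[OF f]
 note [simp] = gmapD[OF f]
 have obm: "obm (Map_precomp C A f) \<psi> = gmap_comp C A \<psi> f" for \<psi> :: "('o, 'p2, 'q2, 'p3, 'q3) gmap"
  by (simp add: Map_precomp_def)
 have arm: "arm (Map_precomp C A f) (\<psi>, \<theta>, \<psi>') = (gmap_comp C A \<psi> f, res2 C A (\<lambda>X a. \<theta> X (obm (f X) a)), gmap_comp C A \<psi>' f)"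
  for \<psi> \<psi>' :: "('o, 'p2, 'q2, 'p3, 'q3) gmap" and \<theta>
  by (simp add: Map_precomp_def res2_def)
 {
  assume L: ?L
  note E = equivalence_full_faithful[OF L]
  show ?R unfolding ff_es_def
  proof (intro conjI allI impI, goal_cases)
   case 1 show ?case by (rule f)
  next
   case (2 \<phi>)
   then show ?case using E(4)[of \<phi>] by (auto simp: obm) blast
  next
   case (3 \<psi> \<psi>' \<theta>)
   then obtain \<Theta> where T: "hty C B W \<psi> \<Theta> \<psi>'" "res2 C A (\<lambda>X a. \<Theta> X (obm (f X) a)) = \<theta>"
    using E(3)[of \<psi> \<psi>' "(gmap_comp C A \<psi> f, \<theta>, gmap_comp C A \<psi>' f)"] by (auto simp: obm arm)
   show ?case
   proof (rule ex1I[of _ \<Theta>])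
    show "hty C B W \<psi> \<Theta> \<psi>' \<and> (\<forall>X\<in>Obj C. \<forall>a\<in>Obj (sect A X). \<Theta> X (obm (f X) a) = \<theta> X a)"
     using T by auto
    fix \<Theta>' assume T': "hty C B W \<psi> \<Theta>' \<psi>' \<and> (\<forall>X\<in>Obj C. \<forall>a\<in>Obj (sect A X). \<Theta>' X (obm (f X) a) = \<theta> X a)"
    then have "res2 C A (\<lambda>X a. \<Theta>' X (obm (f X) a)) = res2 C A (\<lambda>X a. \<Theta> X (obm (f X) a))"
     using T by (intro res2_cong) auto
    then show "\<Theta>' = \<Theta>"
     using E(2)[of "(\<psi>, \<Theta>', \<psi>')" "(\<psi>, \<Theta>, \<psi>')"] T T' by (simp add: arm)
   qed
  qed
 next
  assume R: ?R
  note E = ff_esD[OF R]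
  show ?L
  proof (rule equivalenceI, goal_cases)
   case 1 show ?case by (rule Map_precomp_functor[OF f W])
  next
   case (2 x y)
   obtain \<psi> \<Theta> \<psi>' where x: "x = (\<psi>, \<Theta>, \<psi>')" by (cases x)
   obtain \<Theta>' where y: "y = (\<psi>, \<Theta>', \<psi>')" using 2 x by (cases y) auto
   have h: "hty C B W \<psi> \<Theta> \<psi>'" "hty C B W \<psi> \<Theta>' \<psi>'" using 2 x y by auto
   have "res2 C A (\<lambda>X a. \<Theta>' X (obm (f X) a)) = res2 C A (\<lambda>X a. \<Theta> X (obm (f X) a))" (is "?a = ?b")
    using 2 by (simp add: x y arm)
   then have "\<forall>X\<in>Obj C. \<forall>a\<in>Obj (sect A X). \<Theta>' X (obm (f X) a) = \<Theta> X (obm (f X) a)"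
    by (auto dest: res2_eqD)
   then show ?case using E(3)[OF htyD(1)[OF h(1)] htyD(2)[OF h(1)] hty_pre[OF h(1) f]] h
    by (auto simp: x y)
  next
   case (3 \<psi> \<psi>' g)
   then obtain \<theta> where g: "g = (gmap_comp C A \<psi> f, \<theta>, gmap_comp C A \<psi>' f)" by (cases g) (auto simp: obm)
   have h: "hty C A W (gmap_comp C A \<psi> f) \<theta> (gmap_comp C A \<psi>' f)" using 3 by (simp add: g)
   obtain \<Theta> where T: "hty C B W \<psi> \<Theta> \<psi>'" "\<forall>X \<in> Obj C. \<forall>a \<in> Obj (sect A X). \<Theta> X (obm (f X) a) = \<theta> X a"
    using E(3)[OF _ _ h] 3 by auto
   have "res2 C A (\<lambda>X a. \<Theta> X (obm (f X) a)) = \<theta>"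
    by (rule hty_eqI[OF hty_pre[OF T(1) f] h]) (use T in auto)
   then show ?case using T(1) by (intro bexI[of _ "(\<psi>, \<Theta>, \<psi>')"]) (auto simp: g arm)
  next
   case (4 d)
   then obtain \<psi> \<theta> where "grpd_map C B W \<psi>" "hty C A W (gmap_comp C A \<psi> f) \<theta> d" using E(2)[of d] by auto
   then show ?case using Map_grpd_groupoid[OF A W]
    by (intro bexI[of _ \<psi>] bexI[of _ "(gmap_comp C A \<psi> f, \<theta>, d)"]) (auto simp: obm)
  qed
 }
qed

lemma ff_es_comp:
 assumes f: "ff_es C A B f W" and g: "ff_es C B D g W"
 shows "ff_es C A D (gmap_comp C A g f) W"
 unfolding ff_es_def
proof (intro conjI allI impI, goal_cases)
 note fm = ff_esD(1)[OF f] and gm = ff_esD(1)[OF g]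
 have as: "grpd_map C D W \<chi> ==> gmap_comp C A (gmap_comp C B \<chi> g) f = gmap_comp C A \<chi> (gmap_comp C A g f)" for \<chi>
  by (rule gmap_comp_assoc[OF fm gm])
 {
  case 1 show ?case by (rule gmap_comp_map[OF fm gm])
 next
  case (2 \<phi>)
  obtain \<psi> \<theta> where 3: "grpd_map C B W \<psi>" "hty C A W (gmap_comp C A \<psi> f) \<theta> \<phi>"
   using ff_esD(2)[OF f 2] by blast
  obtain \<chi> \<theta>' where 4: "grpd_map C D W \<chi>" "hty C B W (gmap_comp C B \<chi> g) \<theta>' \<psi>"
   using ff_esD(2)[OF g 3(1)] by blast
  show ?case using hty_comp[OF hty_pre[OF 4(2) fm] 3(2)] 4(1) as[OF 4(1)] by auto
 next
  case (3 \<psi> \<psi>' \<theta>)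
  then have m: "grpd_map C D W \<psi>" "grpd_map C D W \<psi>'"
   and h: "hty C A W (gmap_comp C A (gmap_comp C B \<psi> g) f) \<theta> (gmap_comp C A (gmap_comp C B \<psi>' g) f)"
   by (auto simp: as)
  note m' = gmap_comp_map[OF gm m(1)] gmap_comp_map[OF gm m(2)]
  obtain \<Theta>1 where T1: "hty C B W (gmap_comp C B \<psi> g) \<Theta>1 (gmap_comp C B \<psi>' g)"
   "\<forall>X\<in>Obj C. \<forall>a\<in>Obj (sect A X). \<Theta>1 X (obm (f X) a) = \<theta> X a"
   using ff_esD(3)[OF f m' h] by blast
  obtain \<Theta> where T: "hty C D W \<psi> \<Theta> \<psi>'"
   "\<forall>X\<in>Obj C. \<forall>a\<in>Obj (sect B X). \<Theta> X (obm (g X) a) = \<Theta>1 X a"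
   using ff_esD(3)[OF g m T1(1)] by blast
  note [simp] = gmapD[OF fm] gmapD[OF gm]
  show ?case
  proof (rule ex1I[of _ \<Theta>])
   show "hty C D W \<psi> \<Theta> \<psi>' \<and> (\<forall>X\<in>Obj C. \<forall>a\<in>Obj (sect A X). \<Theta> X (obm (gmap_comp C A g f X) a) = \<theta> X a)"
    using T T1 by simp
   fix \<Theta>' assume T': "hty C D W \<psi> \<Theta>' \<psi>' \<and> (\<forall>X\<in>Obj C. \<forall>a\<in>Obj (sect A X). \<Theta>' X (obm (gmap_comp C A g f X) a) = \<theta> X a)"
   let ?U = "\<lambda>\<Theta>. res2 C B (\<lambda>X a. \<Theta> X (obm (g X) a))"
   \<comment> \<open>Uniqueness is used twice: both restrictions to \<open>B\<close> extend
     \<open>\<theta>\<close>, so they agree by uniqueness along \<open>f\<close>; then uniqueness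
     along \<open>g\<close> applies.\<close>
   have "?U \<Theta>' = ?U \<Theta>"
    using ff_esD(3)[OF f m' h] hty_pre[OF conjunct1[OF T'] gm] hty_pre[OF T(1) gm] T T' T1
    by (auto dest!: ex1_implies_ex simp: ex1_iff_ex_Uniq Uniq_def elim!: allE[of _ "?U \<Theta>'"] allE[of _ "?U \<Theta>"])
   then have "\<forall>X\<in>Obj C. \<forall>a\<in>Obj (sect B X). \<Theta>' X (obm (g X) a) = \<Theta>1 X a"
    using T(2) by (auto dest: res2_eqD)
   then show "\<Theta>' = \<Theta>" using ff_esD(3)[OF g m T1(1)] T T' by blast
  qed
 }
qed

section \<open>Isomorphic copies and transport between types\<close>

text \<open>An isomorphism between presheaves whose value types may differ. It relates presheaves
  built over convenient types to their copies in \<open>'u\<close>, the only ones that the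
  definitions of the local model structure speak about.\<close>

definition giso :: "('o, 'a) cat => ('o, 'a, 'p1, 'q1) gpsh => ('o, 'a, 'p2, 'q2) gpsh
  => ('o, 'p1, 'q1, 'p2, 'q2) gmap => ('o, 'p2, 'q2, 'p1, 'q1) gmap => bool" where
 "giso C A B \<kappa> \<kappa>' \<longleftrightarrow> grpd_map C A B \<kappa> \<and> grpd_map C B A \<kappa>' \<and>
  gmap_comp C A \<kappa>' \<kappa> = gmap_id C A \<and> gmap_comp C B \<kappa> \<kappa>' = gmap_id C B"

lemma gisoD:
 assumes "giso C A B \<kappa> \<kappa>'"
 shows "grpd_map C A B \<kappa>" "grpd_map C B A \<kappa>'"
  "gmap_comp C A \<kappa>' \<kappa> = gmap_id C A" "gmap_comp C B \<kappa> \<kappa>' = gmap_id C B"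
  "X \<in> Obj C ==> a \<in> Obj (sect A X) ==> obm (\<kappa>' X) (obm (\<kappa> X) a) = a"
  "X \<in> Obj C ==> \<alpha> \<in> Arr (sect A X) ==> arm (\<kappa>' X) (arm (\<kappa> X) \<alpha>) = \<alpha>"
  "X \<in> Obj C ==> b \<in> Obj (sect B X) ==> obm (\<kappa> X) (obm (\<kappa>' X) b) = b"
  "X \<in> Obj C ==> \<beta> \<in> Arr (sect B X) ==> arm (\<kappa> X) (arm (\<kappa>' X) \<beta>) = \<beta>"
proof -
 show 1: "grpd_map C A B \<kappa>" "grpd_map C B A \<kappa>'"
  "gmap_comp C A \<kappa>' \<kappa> = gmap_id C A" "gmap_comp C B \<kappa> \<kappa>' = gmap_id C B"
  using assms by (auto simp: giso_def)
 show "X \<in> Obj C ==> a \<in> Obj (sect A X) ==> obm (\<kappa>' X) (obm (\<kappa> X) a) = a"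
  "X \<in> Obj C ==> \<alpha> \<in> Arr (sect A X) ==> arm (\<kappa>' X) (arm (\<kappa> X) \<alpha>) = \<alpha>"
  "X \<in> Obj C ==> b \<in> Obj (sect B X) ==> obm (\<kappa> X) (obm (\<kappa>' X) b) = b"
  "X \<in> Obj C ==> \<beta> \<in> Arr (sect B X) ==> arm (\<kappa> X) (arm (\<kappa>' X) \<beta>) = \<beta>"
  by (metis 1(3) gmap_comp_simps(1) gmap_id_simps(1), metis 1(3) gmap_comp_simps(2) gmap_id_simps(2),
   metis 1(4) gmap_comp_simps(1) gmap_id_simps(1), metis 1(4) gmap_comp_simps(2) gmap_id_simps(2))
qed

lemma giso_sym: "giso C A B \<kappa> \<kappa>' ==> giso C B A \<kappa>' \<kappa>"
 by (auto simp: giso_def)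

lemma gisoI:
 assumes "grpd_map C A B \<kappa>" "grpd_map C B A \<kappa>'"
  "!!X a. X \<in> Obj C ==> a \<in> Obj (sect A X) ==> obm (\<kappa>' X) (obm (\<kappa> X) a) = a"
  "!!X \<alpha>. X \<in> Obj C ==> \<alpha> \<in> Arr (sect A X) ==> arm (\<kappa>' X) (arm (\<kappa> X) \<alpha>) = \<alpha>"
  "!!X b. X \<in> Obj C ==> b \<in> Obj (sect B X) ==> obm (\<kappa> X) (obm (\<kappa>' X) b) = b"
  "!!X \<beta>. X \<in> Obj C ==> \<beta> \<in> Arr (sect B X) ==> arm (\<kappa> X) (arm (\<kappa>' X) \<beta>) = \<beta>"
 shows "giso C A B \<kappa> \<kappa>'"
 unfolding giso_def using assms
 by (intro conjI gmap_eqI[OF gmap_comp_map[OF assms(1,2)] gmap_id_map] gmap_eqI[OF gmap_comp_map[OF assms(2,1)] gmap_id_map])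
  (auto dest: gmapD)

lemma giso_comp_cancel:
 assumes "giso C A B \<kappa> \<kappa>'"
 shows "grpd_map C D A \<phi> ==> gmap_comp C D \<kappa>' (gmap_comp C D \<kappa> \<phi>) = \<phi>"
  "grpd_map C A E \<psi> ==> gmap_comp C A (gmap_comp C B \<psi> \<kappa>') \<kappa> = \<psi>"
 using gmap_comp_assoc[OF _ gisoD(1,2)[OF assms], of D \<phi>] gmap_comp_assoc[OF gisoD(1,2)[OF assms], of E \<psi>]
  gmap_comp_id(2)[of C D A \<phi>] gmap_comp_id(1)[of C A E \<psi>] gisoD(3)[OF assms] by simp_all

text \<open>Restriction along \<open>\<kappa>'\<close> inverts restriction along
  \<open>\<kappa>\<close> strictly, on maps and on homotopies.\<close>

lemma ff_es_iso:
 assumes i: "giso C A B \<kappa> \<kappa>'" and W: "grpd_presheaf C W"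
 shows "ff_es C A B \<kappa> W"
 unfolding ff_es_def
proof (intro conjI allI impI, goal_cases)
 note [simp] = gisoD[OF i] gmapD[OF gisoD(1)[OF i]] gmapD[OF gisoD(2)[OF i]]
 {
  case 1 show ?case by simp
 next
  case (2 \<phi>)
  then have "gmap_comp C A (gmap_comp C B \<phi> \<kappa>') \<kappa> = \<phi>" by (rule giso_comp_cancel(2)[OF i])
  then show ?case using hty_id[OF 2] gmap_comp_map[OF gisoD(2)[OF i] 2] by metis
 next
  case (3 \<psi> \<psi>' \<theta>)
  have eq: "gmap_comp C B (gmap_comp C A \<psi> \<kappa>) \<kappa>' = \<psi>" "gmap_comp C B (gmap_comp C A \<psi>' \<kappa>) \<kappa>' = \<psi>'"
   using 3 giso_comp_cancel(2)[OF giso_sym[OF i]] by auto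
  have h: "hty C B W \<psi> (res2 C B (\<lambda>X b. \<theta> X (obm (\<kappa>' X) b))) \<psi>'"
   using hty_pre[of C A W _ \<theta> _ B \<kappa>'] 3 eq by fastforce
  show ?case
   by (rule ex1I, rule conjI[OF h]) (auto intro!: hty_eqI[OF _ h], metis gisoD(7)[OF i] gmapD(4)[OF gisoD(2)[OF i]])
 }
qed

text \<open>Composition with \<open>\<kappa>\<close> and \<open>\<kappa>'\<close> carries maps and
  homotopies to and fro. So locality can be proved over a convenient type and then used for the copy
  in \<open>'u\<close>, and conversely.\<close>

lemma ff_es_target:
 assumes f: "ff_es C A B f W" and i: "giso C W V \<kappa> \<kappa>'"
 shows "ff_es C A B f V"
 unfolding ff_es_def
proof (intro conjI allI impI, goal_cases)
 note fm = ff_esD(1)[OF f]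
 note [simp] = gisoD[OF i] gmapD[OF gisoD(1)[OF i]] gmapD[OF gisoD(2)[OF i]] gmapD[OF fm]
 note post = gmap_comp_map[OF _ gisoD(1)[OF i]] and post' = gmap_comp_map[OF _ gisoD(2)[OF i]]
 {
  case 1 show ?case by (rule fm)
 next
  case (2 \<phi>)
  obtain \<psi> \<theta> where p: "grpd_map C B W \<psi>" "hty C A W (gmap_comp C A \<psi> f) \<theta> (gmap_comp C A \<kappa>' \<phi>)"
   using ff_esD(2)[OF f post'[OF 2]] by blast
  have "hty C A V (gmap_comp C A \<kappa> (gmap_comp C A \<psi> f)) (res2 C A (\<lambda>X a. arm (\<kappa> X) (\<theta> X a))) \<phi>"
   using hty_post[OF p(2) gisoD(1)[OF i]] by (simp only: giso_comp_cancel(1)[OF giso_sym[OF i] 2])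
  then show ?case using post[OF p(1)] by (auto simp only: gmap_comp_assoc[OF fm p(1) gisoD(1)[OF i], symmetric])
 next
  case (3 \<psi> \<psi>' \<theta>)
  then have m: "grpd_map C B V \<psi>" "grpd_map C B V \<psi>'" and h: "hty C A V (gmap_comp C A \<psi> f) \<theta> (gmap_comp C A \<psi>' f)" by auto
  have as: "gmap_comp C A \<kappa>' (gmap_comp C A \<psi> f) = gmap_comp C A (gmap_comp C B \<kappa>' \<psi>) f"
   "gmap_comp C A \<kappa>' (gmap_comp C A \<psi>' f) = gmap_comp C A (gmap_comp C B \<kappa>' \<psi>') f"
   using gmap_comp_assoc[OF fm _ gisoD(2)[OF i]] m by auto
  have h': "hty C A W (gmap_comp C A (gmap_comp C B \<kappa>' \<psi>) f) (res2 C A (\<lambda>X a. arm (\<kappa>' X) (\<theta> X a))) (gmap_comp C A (gmap_comp C B \<kappa>' \<psi>') f)"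
   using hty_post[OF h gisoD(2)[OF i]] by (simp add: as)
  have ca: "gmap_comp C B \<kappa> (gmap_comp C B \<kappa>' \<psi>) = \<psi>" "gmap_comp C B \<kappa> (gmap_comp C B \<kappa>' \<psi>') = \<psi>'"
   using m giso_comp_cancel(1)[OF giso_sym[OF i]] by auto
  have U: "\<exists>!\<Theta>. hty C B W (gmap_comp C B \<kappa>' \<psi>) \<Theta> (gmap_comp C B \<kappa>' \<psi>') \<and>
    (\<forall>X\<in>Obj C. \<forall>a\<in>Obj (sect A X). \<Theta> X (obm (f X) a) = arm (\<kappa>' X) (\<theta> X a))" (is "\<exists>!\<Theta>. ?P \<Theta>")
   using ff_esD(3)[OF f post'[OF m(1)] post'[OF m(2)] h'] by (simp only: res2_simps cong: ball_cong)
  then obtain \<Theta> where P: "?P \<Theta>" by (rule ex1E)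
  have T: "hty C B W (gmap_comp C B \<kappa>' \<psi>) \<Theta> (gmap_comp C B \<kappa>' \<psi>')"
   "\<forall>X\<in>Obj C. \<forall>a\<in>Obj (sect A X). \<Theta> X (obm (f X) a) = arm (\<kappa>' X) (\<theta> X a)"
   using P by blast+
  have T3: "\<Theta>' = \<Theta>" if "?P \<Theta>'" for \<Theta>' using U that P by (elim ex1E) metis
  have h2: "hty C B V \<psi> (res2 C B (\<lambda>X b. arm (\<kappa> X) (\<Theta> X b))) \<psi>'"
   using hty_post[OF T(1) gisoD(1)[OF i]] by (simp add: ca)
  show ?case
  proof (rule ex1I, rule conjI[OF h2], goal_cases)
   case 1 then show ?case using T(2) htyD[OF h] by simp
  next
   case (2 \<Theta>')
   then have h3: "hty C B V \<psi> \<Theta>' \<psi>'" by simp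
   have "res2 C B (\<lambda>X b. arm (\<kappa>' X) (\<Theta>' X b)) = \<Theta>"
    using 2 by (intro T3 conjI hty_post[OF h3 gisoD(2)[OF i]]) auto
   then have "\<Theta> X b = arm (\<kappa>' X) (\<Theta>' X b)" if "X \<in> Obj C" "b \<in> Obj (sect B X)" for X b
    using that by auto
   then show ?case by (intro hty_eqI[OF h3 h2]) (auto simp: htyD[OF h3])
  qed
 }
qed

lemma lifts_comp:
 assumes j: "grpd_map C A B j" and k: "grpd_map C B D k"
  and l1: "lifts_against C A B j E H p" and l2: "lifts_against C B D k E H p"
  and p: "grpd_map C E H p"
 shows "lifts_against C A D (gmap_comp C A k j) E H p"
 unfolding lifts_against_def
proof (intro allI impI, elim conjE)
 fix u v assume u: "grpd_map C A E u" and v: "grpd_map C D H v"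
  and e: "gmap_comp C A p u = gmap_comp C A v (gmap_comp C A k j)"
 have "gmap_comp C A p u = gmap_comp C A (gmap_comp C B v k) j"
  using e gmap_comp_assoc[OF j k v] by simp
 then obtain l where l: "grpd_map C B E l" "gmap_comp C A l j = u" "gmap_comp C B p l = gmap_comp C B v k"
  using l1 u gmap_comp_map[OF k v] unfolding lifts_against_def by blast
 obtain m where m: "grpd_map C D E m" "gmap_comp C B m k = l" "gmap_comp C D p m = v"
  using l2 l v unfolding lifts_against_def by blast
 have "gmap_comp C A m (gmap_comp C A k j) = u"
  using gmap_comp_assoc[OF j k m(1)] l m by simp
 then show "\<exists>l. grpd_map C D E l \<and> gmap_comp C A l (gmap_comp C A k j) = u \<and> gmap_comp C D p l = v"
  using m by blast
qed

lemma lifts_iso: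
 assumes i: "giso C A B \<kappa> \<kappa>'" and p: "grpd_map C E H p"
 shows "lifts_against C A B \<kappa> E H p"
 unfolding lifts_against_def
proof (intro allI impI, elim conjE)
 fix u v assume u: "grpd_map C A E u" and v: "grpd_map C B H v"
  and e: "gmap_comp C A p u = gmap_comp C A v \<kappa>"
 have "gmap_comp C B p (gmap_comp C B u \<kappa>') = v"
  using e gmap_comp_assoc[OF gisoD(2)[OF i] u p] giso_comp_cancel(2)[OF giso_sym[OF i] v] by simp
 then show "\<exists>l. grpd_map C B E l \<and> gmap_comp C A l \<kappa> = u \<and> gmap_comp C B p l = v"
  using gmap_comp_map[OF gisoD(2)[OF i] u] giso_comp_cancel(2)[OF i u] by blast
qed

text \<open>Transport of structure along the injections \<open>cp\<close> and \<open>cq\<close>.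
  Decoding is by \<open>inv_into\<close>, which is meaningful on the coded carriers only.\<close>

definition coded :: "('o, 'a) cat => ('o => 'p => 'u) => ('o => 'q => 'u) => ('o, 'a, 'p, 'q) gpsh => ('o, 'a, 'u, 'u) gpsh" where
 "coded C cp cq V = (let dp = \<lambda>X. inv_into (Obj (sect V X)) (cp X); dq = \<lambda>X. inv_into (Arr (sect V X)) (cq X) in
  \<lparr>sect = (\<lambda>X. \<lparr>Obj = cp X ` Obj (sect V X), Arr = cq X ` Arr (sect V X),
    Dom = (\<lambda>w. cp X (Dom (sect V X) (dq X w))), Cod = (\<lambda>w. cp X (Cod (sect V X) (dq X w))),
    Idt = (\<lambda>w. cq X (Idt (sect V X) (dp X w))),
    Comp = (\<lambda>w' w. cq X (Comp (sect V X) (dq X w') (dq X w)))\<rparr>),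
   rst = (\<lambda>h. \<lparr>obm = (\<lambda>w. cp (Dom C h) (obm (rst V h) (dp (Cod C h) w))),
    arm = (\<lambda>w. cq (Dom C h) (arm (rst V h) (dq (Cod C h) w)))\<rparr>)\<rparr>)"

definition coded_map :: "('o, 'a) cat => ('o => 'p => 'u) => ('o => 'q => 'u) => ('o, 'a, 'p, 'q) gpsh => ('o, 'p, 'q, 'u, 'u) gmap" where
 "coded_map C cp cq V = (\<lambda>X \<in> Obj C. \<lparr>obm = restrict (cp X) (Obj (sect V X)), arm = restrict (cq X) (Arr (sect V X))\<rparr>)"

definition decoded_map :: "('o, 'a) cat => ('o => 'p => 'u) => ('o => 'q => 'u) => ('o, 'a, 'p, 'q) gpsh => ('o, 'u, 'u, 'p, 'q) gmap" where
 "decoded_map C cp cq V = (\<lambda>X \<in> Obj C. \<lparr>obm = restrict (inv_into (Obj (sect V X)) (cp X)) (cp X ` Obj (sect V X)),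
  arm = restrict (inv_into (Arr (sect V X)) (cq X)) (cq X ` Arr (sect V X))\<rparr>)"

lemma coded_giso:
 assumes V: "grpd_presheaf C V"
  and ip: "!!X. X \<in> Obj C ==> inj_on (cp X) (Obj (sect V X))"
  and iq: "!!X. X \<in> Obj C ==> inj_on (cq X) (Arr (sect V X))"
 shows "giso C V (coded C cp cq V) (coded_map C cp cq V) (decoded_map C cp cq V)"
proof -
 note [simp] = gpshD[OF V]
 have [simp]: "X \<in> Obj C ==> a \<in> Obj (sect V X) ==> inv_into (Obj (sect V X)) (cp X) (cp X a) = a"
  "X \<in> Obj C ==> \<alpha> \<in> Arr (sect V X) ==> inv_into (Arr (sect V X)) (cq X) (cq X \<alpha>) = \<alpha>" for X a \<alpha>
  using ip iq by (auto simp: inv_into_f_f)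
 have sec: "sect (coded C cp cq V) X = \<lparr>Obj = cp X ` Obj (sect V X), Arr = cq X ` Arr (sect V X),
    Dom = (\<lambda>w. cp X (Dom (sect V X) (inv_into (Arr (sect V X)) (cq X) w))), Cod = (\<lambda>w. cp X (Cod (sect V X) (inv_into (Arr (sect V X)) (cq X) w))),
    Idt = (\<lambda>w. cq X (Idt (sect V X) (inv_into (Obj (sect V X)) (cp X) w))),
    Comp = (\<lambda>w' w. cq X (Comp (sect V X) (inv_into (Arr (sect V X)) (cq X) w') (inv_into (Arr (sect V X)) (cq X) w)))\<rparr>" for X
  by (simp add: coded_def)
 have rs: "rst (coded C cp cq V) h = \<lparr>obm = (\<lambda>w. cp (Dom C h) (obm (rst V h) (inv_into (Obj (sect V (Cod C h))) (cp (Cod C h)) w))),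
    arm = (\<lambda>w. cq (Dom C h) (arm (rst V h) (inv_into (Arr (sect V (Cod C h))) (cq (Cod C h)) w)))\<rparr>" for h
  by (simp add: coded_def)
 have inj: "X \<in> Obj C ==> a \<in> Obj (sect V X) ==> b \<in> Obj (sect V X) ==> cp X a = cp X b \<longleftrightarrow> a = b" for X a b
  using ip by (auto dest: inj_onD)
 have inj2: "X \<in> Obj C ==> a \<in> Arr (sect V X) ==> b \<in> Arr (sect V X) ==> cq X a = cq X b \<longleftrightarrow> a = b" for X a b
  using iq by (auto dest: inj_onD)
 have G: "groupoid (sect (coded C cp cq V) X)" if X: "X \<in> Obj C" for X
 proof (rule groupoidI)
  show "category (sect (coded C cp cq V) X)"
   by (rule categoryI) (use X in \<open>auto simp: sec inj inj2 comp_assoc\<close>)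
  fix f assume "f \<in> Arr (sect (coded C cp cq V) X)"
  then obtain \<alpha> where a: "\<alpha> \<in> Arr (sect V X)" "f = cq X \<alpha>" by (auto simp: sec)
  then show "\<exists>g\<in>Arr (sect (coded C cp cq V) X). Dom (sect (coded C cp cq V) X) g = Cod (sect (coded C cp cq V) X) f \<and>
   Cod (sect (coded C cp cq V) X) g = Dom (sect (coded C cp cq V) X) f \<and>
   Comp (sect (coded C cp cq V) X) g f = Idt (sect (coded C cp cq V) X) (Dom (sect (coded C cp cq V) X) f) \<and>
   Comp (sect (coded C cp cq V) X) f g = Idt (sect (coded C cp cq V) X) (Cod (sect (coded C cp cq V) X) f)"
   using X by (intro bexI[of _ "cq X (ginv (sect V X) \<alpha>)"]) (auto simp: sec)
 qed
 have P: "grpd_presheaf C (coded C cp cq V)"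
  by (rule gpshI) (auto simp: G, auto simp: sec rs inj inj2)
 show ?thesis
  by (rule gisoI; (rule gmapI)?) (auto simp: V P, auto simp: sec rs coded_map_def decoded_map_def inj inj2)
qed

section \<open>Covering sieves and local objects\<close>

lemma ex1D: "\<exists>!x. P x ==> P a ==> P b ==> a = b"
 by blast

definition into :: "('o, 'a) cat => 'o => 'a set" where
 "into C X = {h \<in> Arr C. Cod C h = X}"

lemma into_iff [simp]: "h \<in> into C X \<longleftrightarrow> h \<in> Arr C \<and> Cod C h = X"
 by (simp add: into_def)

text \<open>A covering sieve is a sieve that contains a covering family. Sieves are stable under
  pullback and intersection on the nose, and families indexed by them can be restricted without
  leaving the index set.\<close>

definition csv :: "('o, 'a) cat => ('o => 'a set => bool) => 'o => 'a set => bool" where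
 "csv C Cov X P \<longleftrightarrow> X \<in> Obj C \<and> P \<subseteq> into C X \<and>
  (\<forall>u \<in> P. \<forall>k \<in> into C (Dom C u). Comp C u k \<in> P) \<and> (\<exists>S \<subseteq> P. Cov X S)"

lemma csvD:
 assumes "csv C Cov X P"
 shows "X \<in> Obj C" "u \<in> P ==> u \<in> Arr C" "u \<in> P ==> Cod C u = X"
  "[|u \<in> P; k \<in> Arr C; Cod C k = Dom C u|] ==> Comp C u k \<in> P"
 using assms by (auto simp: csv_def)

locale psite = site C Cov for C :: "('o, 'a) cat" and Cov +
 assumes pb: "has_pullbacks C"
begin

lemma catC [simp]: "category C" ..

abbreviation cs :: "'o => 'a set => bool" where "cs \<equiv> csv C Cov"
abbreviation "pre h \<equiv> into C (Dom C h)"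
abbreviation "src \<equiv> Dom C"
abbreviation "tgt \<equiv> Cod C"
abbreviation "cmp \<equiv> Comp C"
abbreviation "arr h \<equiv> h \<in> Arr C"
abbreviation "ob X \<equiv> X \<in> Obj C"

lemma cs_gen:
 assumes "Cov X S"
 shows "cs X {cmp u k | u k. u \<in> S \<and> k \<in> pre u}" (is "cs X ?P")
 unfolding csv_def
proof (intro conjI ballI)
 note S = cov_arrows[OF assms]
 show "ob X" using S by simp
 show "?P \<subseteq> into C X" using S by auto
 show "cmp v l \<in> ?P" if "v \<in> ?P" "l \<in> pre v" for v l
 proof -
  obtain u k where "u \<in> S" "k \<in> pre u" "v = cmp u k" using \<open>v \<in> ?P\<close> by blast
  then show ?thesis using S that(2)
   by (intro CollectI exI[of _ u] exI[of _ "cmp k l"]) (auto simp: comp_assoc)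
 qed
 have "S \<subseteq> ?P"
 proof
  fix u assume "u \<in> S"
  then show "u \<in> ?P" using S by (intro CollectI exI[of _ u] exI[of _ "Idt C (src u)"]) auto
 qed
 then show "\<exists>S\<subseteq>?P. Cov X S" using assms by blast
qed

lemma cs_mono:
 assumes "cs X P" "P \<subseteq> Q" "Q \<subseteq> into C X" "!!u k. [|u \<in> Q; arr k; tgt k = src u|] ==> cmp u k \<in> Q"
 shows "cs X Q"
 unfolding csv_def
proof (intro conjI ballI)
 show "\<exists>S\<subseteq>Q. Cov X S" using assms(1,2) unfolding csv_def by blast
qed (use assms csvD(1)[OF assms(1)] in auto)

lemma cs_into: "ob X ==> cs X (into C X)"
 unfolding csv_def using cov_iso[OF iso_arr_Idt[of C X]] by (auto intro!: exI[of _ "{Idt C X}"])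

text \<open>Here the pullbacks of the site enter: the projections \<open>p u\<close> of the pulled
  back cover satisfy \<open>cmp f (p u) = cmp u (q u)\<close>, and the right side lies in the sieve
  \<open>P\<close>.\<close>

lemma cs_pull:
 assumes P: "cs X P" and f: "arr f" "tgt f = X" "Y = src f"
 shows "cs Y {k \<in> into C Y. cmp f k \<in> P}"
 unfolding csv_def
proof (intro conjI ballI)
 obtain S where S: "S \<subseteq> P" "Cov X S" using P by (auto simp: csv_def)
 note SX = cov_arrows[OF S(2)]
 have "\<forall>u \<in> S. \<exists>p q. is_pullback C f u p q"
  using pb SX f unfolding has_pullbacks_def by simp
 then obtain p q where pq: "!!u. u \<in> S ==> is_pullback C f u (p u) (q u)" by metis
 have "Cov Y (p ` S)"
  by (rule cov_pullback[OF S(2)]) (use f pq in \<open>auto simp: Hom_iff\<close>)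
 moreover have "p ` S \<subseteq> {k \<in> into C Y. cmp f k \<in> P}"
 proof clarsimp
  fix u assume u: "u \<in> S"
  show "p u \<in> Arr C \<and> tgt (p u) = Y \<and> cmp f (p u) \<in> P"
   using pq[OF u] f S u csvD(4)[OF P, of u "q u"] by (auto simp: is_pullback_def)
 qed
 ultimately show "\<exists>S\<subseteq>{k \<in> into C Y. cmp f k \<in> P}. Cov Y S" by blast
qed (use assms csvD[OF P] in \<open>auto simp flip: comp_assoc\<close>)

text \<open>Locality: a cover inside \<open>P\<close>, composed with covers inside the pullbacks of
  \<open>Q\<close> along its members, is a cover inside \<open>Q\<close>.\<close>

lemma cs_trans:
 assumes P: "cs X P" and Q: "Q \<subseteq> into C X" "!!u k. [|u \<in> Q; arr k; tgt k = src u|] ==> cmp u k \<in> Q"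
  and loc: "!!u. u \<in> P ==> cs (src u) {k \<in> pre u. cmp u k \<in> Q}"
 shows "cs X Q"
 unfolding csv_def
proof (intro conjI ballI)
 obtain S where S: "S \<subseteq> P" "Cov X S" using P by (auto simp: csv_def)
 have "\<forall>u \<in> S. \<exists>T. Cov (src u) T \<and> T \<subseteq> {k \<in> pre u. cmp u k \<in> Q}"
  using loc S unfolding csv_def by blast
 then obtain T where T: "!!u. u \<in> S ==> Cov (src u) (T u) \<and> T u \<subseteq> {k \<in> pre u. cmp u k \<in> Q}"
  by metis
 have "Cov X {cmp u v | u v. u \<in> S \<and> v \<in> T u}"
  by (rule cov_trans[OF S(2)]) (use T in auto)
 moreover have "{cmp u v | u v. u \<in> S \<and> v \<in> T u} \<subseteq> Q" using T by blast
 ultimately show "\<exists>S\<subseteq>Q. Cov X S" by blast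
qed (use assms csvD(1)[OF P] in auto)

text \<open>Along a member of \<open>P\<close> the condition on \<open>P\<close> is automatic, so
  the intersection and \<open>Q\<close> have the same pullback there.\<close>

lemma cs_Int:
 assumes P: "cs X P" and Q: "cs X Q"
 shows "cs X (P \<inter> Q)"
proof (rule cs_trans[OF P])
 show "cs (src u) {k \<in> pre u. cmp u k \<in> P \<inter> Q}" if u: "u \<in> P" for u
 proof -
  have "{k \<in> pre u. cmp u k \<in> P \<inter> Q} = {k \<in> pre u. cmp u k \<in> Q}"
   using csvD[OF P] u by auto
  then show ?thesis using cs_pull[OF Q, of u] csvD[OF P] u by simp
 qed
qed (use csvD[OF P] csvD[OF Q] in auto)

end

section \<open>Representables, nerves and local objects\<close>

lemma rep_simps [simp]:
 "Obj (sect (rep C X) Y) = Hom C Y X" "Arr (sect (rep C X) Y) = Hom C Y X"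
 "Dom (sect (rep C X) Y) f = f" "Cod (sect (rep C X) Y) f = f" "Idt (sect (rep C X) Y) f = f"
 "Comp (sect (rep C X) Y) g f = f" "obm (rst (rep C X) h) k = Comp C k h" "arm (rst (rep C X) h) k = Comp C k h"
 by (simp_all add: rep_def)

lemma rep_gpsh:
 assumes [simp]: "category C" shows "grpd_presheaf C (rep C X)"
 by (rule gpshI; (rule groupoidI categoryI)?) (auto simp: Hom_iff comp_assoc intro!: groupoidI categoryI)

lemma nerve_simps [simp]:
 "(u, k) \<in> Obj (sect (nerve_grpd C S) Y) \<longleftrightarrow> u \<in> S \<and> k \<in> Hom C Y (Dom C u)"
 "((u, k), (u', k')) \<in> Arr (sect (nerve_grpd C S) Y) \<longleftrightarrow> u \<in> S \<and> k \<in> Hom C Y (Dom C u) \<and>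
     u' \<in> S \<and> k' \<in> Hom C Y (Dom C u') \<and> Comp C u k = Comp C u' k'"
 "Dom (sect (nerve_grpd C S) Y) (x, y) = x" "Cod (sect (nerve_grpd C S) Y) (x, y) = y"
 "Idt (sect (nerve_grpd C S) Y) x = (x, x)"
 "Comp (sect (nerve_grpd C S) Y) (z, w) (x, y) = (x, w)"
 "obm (rst (nerve_grpd C S) h) (u, k) = (u, Comp C k h)"
 "arm (rst (nerve_grpd C S) h) ((u, k), (u', k')) = ((u, Comp C k h), (u', Comp C k' h))"
 by (simp_all add: nerve_grpd_def)

lemma nerve_gpsh:
 assumes [simp]: "category C" and S: "!!u. u \<in> S ==> u \<in> Arr C"
 shows "grpd_presheaf C (nerve_grpd C S)"
proof -
 have G: "groupoid (sect (nerve_grpd C S) X)" for X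
 proof (rule groupoidI)
  show "category (sect (nerve_grpd C S) X)"
   by (rule categoryI) auto
  fix f assume f: "f \<in> Arr (sect (nerve_grpd C S) X)"
  obtain u k u' k' where e: "f = ((u, k), (u', k'))" by (metis prod.exhaust)
  show "\<exists>g\<in>Arr (sect (nerve_grpd C S) X). Dom (sect (nerve_grpd C S) X) g = Cod (sect (nerve_grpd C S) X) f \<and>
     Cod (sect (nerve_grpd C S) X) g = Dom (sect (nerve_grpd C S) X) f \<and>
     Comp (sect (nerve_grpd C S) X) g f = Idt (sect (nerve_grpd C S) X) (Dom (sect (nerve_grpd C S) X) f) \<and>
     Comp (sect (nerve_grpd C S) X) f g = Idt (sect (nerve_grpd C S) X) (Cod (sect (nerve_grpd C S) X) f)"
   using f unfolding e by (intro bexI[of _ "((u', k'), (u, k))"]) auto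
 qed
 show ?thesis
 proof (rule gpshI)
  fix h \<alpha> assume h: "h \<in> Arr C" "\<alpha> \<in> Arr (sect (nerve_grpd C S) (Cod C h))"
  obtain u k u' k' where e: "\<alpha> = ((u, k), (u', k'))" by (metis prod.exhaust)
  have "Comp C u (Comp C k h) = Comp C u' (Comp C k' h)"
   using h S comp_assoc[of C h k u] comp_assoc[of C h k' u'] by (auto simp: e Hom_iff)
  then show "arm (rst (nerve_grpd C S) h) \<alpha> \<in> Arr (sect (nerve_grpd C S) (Dom C h)) \<and>
   Dom (sect (nerve_grpd C S) (Dom C h)) (arm (rst (nerve_grpd C S) h) \<alpha>) = obm (rst (nerve_grpd C S) h) (Dom (sect (nerve_grpd C S) (Cod C h)) \<alpha>) \<and>
   Cod (sect (nerve_grpd C S) (Dom C h)) (arm (rst (nerve_grpd C S) h) \<alpha>) = obm (rst (nerve_grpd C S) h) (Cod (sect (nerve_grpd C S) (Cod C h)) \<alpha>)"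
   using h by (auto simp: e Hom_iff)
 qed (use S in \<open>auto simp: G Hom_iff comp_assoc\<close>)
qed

lemma nerve_map_simps [simp]:
 "[|Y \<in> Obj C; u \<in> S; k \<in> Hom C Y (Dom C u)|] ==> obm (nerve_map C S Y) (u, k) = Comp C u k"
 "[|Y \<in> Obj C; ((u, k), x) \<in> Arr (sect (nerve_grpd C S) Y)|] ==> arm (nerve_map C S Y) ((u, k), x) = Comp C u k"
 by (auto simp: nerve_map_def split: prod.splits)

lemma nerve_map_map:
 assumes [simp]: "category C" and S: "!!u. u \<in> S ==> u \<in> Arr C \<and> Cod C u = X"
 shows "grpd_map C (nerve_grpd C S) (rep C X) (nerve_map C S)"
proof -
 note [simp] = nerve_gpsh[of C S] rep_gpsh S
 show ?thesis
 proof (rule gmapI)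
  show "nerve_map C S \<in> extensional (Obj C)" by (simp add: nerve_map_def)
  show "obm (nerve_map C S X) \<in> extensional (Obj (sect (nerve_grpd C S) X)) \<and>
     arm (nerve_map C S X) \<in> extensional (Arr (sect (nerve_grpd C S) X))" if "X \<in> Obj C" for X
   using that by (simp add: nerve_map_def)
  fix h \<alpha> assume h: "h \<in> Arr C" "\<alpha> \<in> Arr (sect (nerve_grpd C S) (Cod C h))"
  obtain u k u' k' where e: "\<alpha> = ((u, k), (u', k'))" by (metis prod.exhaust)
  have "Comp C u (Comp C k h) = Comp C u' (Comp C k' h)"
   using h S comp_assoc[of C h k u] comp_assoc[of C h k' u'] by (auto simp: e Hom_iff)
  then show "arm (nerve_map C S (Dom C h)) (arm (rst (nerve_grpd C S) h) \<alpha>) = arm (rst (rep C X) h) (arm (nerve_map C S (Cod C h)) \<alpha>)"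
   using h by (auto simp: e Hom_iff comp_assoc)
 qed (auto simp: Hom_iff comp_assoc)
qed

text \<open>The map of the Yoneda lemma with value \<open>x\<close> at the identity of
  \<open>X\<close>; a representable has only identity arrows, hence the second component.\<close>

definition yo :: "('o, 'a) cat => ('o, 'a, 'p, 'q) gpsh => 'o => 'p => ('o, 'a, 'a, 'p, 'q) gmap" where
 "yo C W X x = (\<lambda>Y \<in> Obj C. \<lparr>obm = (\<lambda>f \<in> Hom C Y X. obm (rst W f) x),
  arm = (\<lambda>f \<in> Hom C Y X. Idt (sect W Y) (obm (rst W f) x))\<rparr>)"

lemma yo_simps [simp]:
 "[|Y \<in> Obj C; f \<in> Hom C Y X|] ==> obm (yo C W X x Y) f = obm (rst W f) x"
 "[|Y \<in> Obj C; f \<in> Hom C Y X|] ==> arm (yo C W X x Y) f = Idt (sect W Y) (obm (rst W f) x)"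
 by (auto simp: yo_def)

lemma yo_map:
 assumes W: "grpd_presheaf C W" and x: "X \<in> Obj C" "x \<in> Obj (sect W X)"
 shows "grpd_map C (rep C X) W (yo C W X x)"
proof -
 note [simp] = gpshD[OF W]
 show ?thesis
  by (rule gmapI) (use x in \<open>auto simp: rep_gpsh W Hom_iff, auto simp: yo_def\<close>)
qed

lemma rep_map_eq:
 assumes p: "grpd_map C (rep C X) W \<phi>" and X: "X \<in> Obj C"
 shows "obm (\<phi> X) (Idt C X) \<in> Obj (sect W X)" "\<phi> = yo C W X (obm (\<phi> X) (Idt C X))"
proof -
 note [simp] = gmapD[OF p]
 show x: "obm (\<phi> X) (Idt C X) \<in> Obj (sect W X)" using X by (simp add: Hom_iff)
 have o: "obm (\<phi> Y) f = obm (rst W f) (obm (\<phi> X) (Idt C X))" if "f \<in> Hom C Y X" for Y f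
  using gmapD(10)[OF p, of f Y "Idt C X"] that X by (simp add: Hom_iff)
 show "\<phi> = yo C W X (obm (\<phi> X) (Idt C X))"
 proof (rule gmap_eqI[OF p yo_map[OF gmapD(2)[OF p] X x]])
  fix Y f assume Y: "Y \<in> Obj C" and f: "f \<in> Arr (sect (rep C X) Y)"
  then show "arm (\<phi> Y) f = arm (yo C W X (obm (\<phi> X) (Idt C X)) Y) f"
   using gmapD(8)[OF p Y, of f] by (simp add: o)
 qed (use o in auto)
qed

text \<open>One half of being a stack: the isomorphisms between two objects over \<open>X\<close>
  form a sheaf. On a sieve, compatibility of the family \<open>\<phi>\<close> is just compatibility
  with restriction.\<close>

definition hom_sheaf :: "('o, 'a) cat => ('o => 'a set => bool) => ('o, 'a, 'p, 'q) gpsh => bool" where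
 "hom_sheaf C Cov W \<longleftrightarrow> (\<forall>X P x y \<phi>. csv C Cov X P \<and> x \<in> Obj (sect W X) \<and> y \<in> Obj (sect W X) \<and>
  (\<forall>u \<in> P. \<phi> u \<in> Arr (sect W (Dom C u)) \<and> Dom (sect W (Dom C u)) (\<phi> u) = obm (rst W u) x \<and>
   Cod (sect W (Dom C u)) (\<phi> u) = obm (rst W u) y) \<and>
  (\<forall>u \<in> P. \<forall>k \<in> into C (Dom C u). \<phi> (Comp C u k) = arm (rst W k) (\<phi> u))
  --> (\<exists>!\<psi>. \<psi> \<in> Arr (sect W X) \<and> Dom (sect W X) \<psi> = x \<and> Cod (sect W X) \<psi> = y \<and> (\<forall>u \<in> P. arm (rst W u) \<psi> = \<phi> u)))"

text \<open>The other half: a map from the nerve is a descent datum, and effectiveness says that it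
  is homotopic to the restriction of one object over \<open>X\<close>.\<close>

definition descent :: "('o, 'a) cat => ('o => 'a set => bool) => ('o, 'a, 'p, 'q) gpsh => bool" where
 "descent C Cov W \<longleftrightarrow> (\<forall>X S \<omega>. Cov X S \<and> grpd_map C (nerve_grpd C S) W \<omega> -->
  (\<exists>x \<in> Obj (sect W X). \<exists>\<delta>. hty C (nerve_grpd C S) W (gmap_comp C (nerve_grpd C S) (yo C W X x) (nerve_map C S)) \<delta> \<omega>))"

lemma hom_sheaf_ex:
 assumes "hom_sheaf C Cov W" "csv C Cov X P" "x \<in> Obj (sect W X)" "y \<in> Obj (sect W X)"
  "!!u. u \<in> P ==> \<phi> u \<in> Arr (sect W (Dom C u)) \<and> Dom (sect W (Dom C u)) (\<phi> u) = obm (rst W u) x \<and>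
   Cod (sect W (Dom C u)) (\<phi> u) = obm (rst W u) y"
  "!!u k. u \<in> P ==> k \<in> Arr C ==> Cod C k = Dom C u ==> \<phi> (Comp C u k) = arm (rst W k) (\<phi> u)"
 obtains \<psi> where "\<psi> \<in> Arr (sect W X)" "Dom (sect W X) \<psi> = x" "Cod (sect W X) \<psi> = y" "!!u. u \<in> P ==> arm (rst W u) \<psi> = \<phi> u"
proof -
 have "\<exists>!\<psi>. \<psi> \<in> Arr (sect W X) \<and> Dom (sect W X) \<psi> = x \<and> Cod (sect W X) \<psi> = y \<and> (\<forall>u \<in> P. arm (rst W u) \<psi> = \<phi> u)"
  by (rule assms(1)[unfolded hom_sheaf_def, rule_format]) (use assms in auto)
 then show ?thesis using that by auto
qed

text \<open>The sheaf condition for the family of restrictions of \<open>\<phi>\<close>, which both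
  arrows glue.\<close>

lemma hom_sheaf_unique:
 assumes W: "hom_sheaf C Cov W" "grpd_presheaf C W" and P: "csv C Cov X P"
  and f: "\<phi> \<in> Arr (sect W X)" "\<psi> \<in> Arr (sect W X)" "Dom (sect W X) \<phi> = Dom (sect W X) \<psi>" "Cod (sect W X) \<phi> = Cod (sect W X) \<psi>"
   "!!u. u \<in> P ==> arm (rst W u) \<phi> = arm (rst W u) \<psi>"
 shows "\<phi> = \<psi>"
proof -
 note [simp] = gpshD[OF W(2)]
 note P' = csvD[OF P]
 have "\<exists>!\<chi>. \<chi> \<in> Arr (sect W X) \<and> Dom (sect W X) \<chi> = Dom (sect W X) \<phi> \<and> Cod (sect W X) \<chi> = Cod (sect W X) \<phi> \<and>
   (\<forall>u \<in> P. arm (rst W u) \<chi> = arm (rst W u) \<phi>)"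
  by (rule W(1)[unfolded hom_sheaf_def, rule_format]) (use P P' f(1) in auto)
 then show ?thesis using f by (elim ex1E) metis
qed

context psite begin

lemma cov_nerve_map:
 assumes "Cov X S"
 shows "grpd_map C (nerve_grpd C S) (rep C X) (nerve_map C S)" "grpd_presheaf C (nerve_grpd C S)"
 using cov_arrows[OF assms] by (auto intro!: nerve_map_map nerve_gpsh)

text \<open>By the Yoneda lemma, maps out of \<open>rep C X\<close> are objects over
  \<open>X\<close>, and homotopies between them are single arrows over \<open>X\<close>. Essential
  surjectivity is then \<open>descent\<close>; a homotopy on the nerve amounts to a compatible
  family of arrows on the sieve generated by \<open>S\<close>, which \<open>hom_sheaf\<close> glues
  in a unique way.\<close>

lemma local_objectI:
 assumes W: "grpd_presheaf C W" and hs: "hom_sheaf C Cov W" and de: "descent C Cov W" and S: "Cov X S"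
 shows "ff_es C (nerve_grpd C S) (rep C X) (nerve_map C S) W"
 unfolding ff_es_def
proof (intro conjI allI impI, goal_cases)
 let ?N = "nerve_grpd C S" and ?nm = "nerve_map C S"
 note SX = cov_arrows[OF S]
 note nm = cov_nerve_map[OF S]
 note [simp] = gpshD[OF W]
 {
  case 1 show ?case by (rule nm)
 next
  case (2 \<phi>)
  then obtain x \<delta> where "x \<in> Obj (sect W X)" "hty C ?N W (gmap_comp C ?N (yo C W X x) ?nm) \<delta> \<phi>"
   using de S unfolding descent_def by blast
  then show ?case using yo_map[OF W, of X x] SX by blast
 next
  case (3 \<psi> \<psi>' \<theta>)
  define x where "x = obm (\<psi> X) (Idt C X)"
  define y where "y = obm (\<psi>' X) (Idt C X)"
  have x: "x \<in> Obj (sect W X)" "\<psi> = yo C W X x" and y: "y \<in> Obj (sect W X)" "\<psi>' = yo C W X y"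
   using rep_map_eq[of C X W \<psi>] rep_map_eq[of C X W \<psi>'] 3 SX by (auto simp: x_def y_def)
  have h: "hty C ?N W (gmap_comp C ?N (yo C W X x) ?nm) \<theta> (gmap_comp C ?N (yo C W X y) ?nm)"
   using 3 x y by simp
  note [simp] = htyD(3-5)[OF h]
  let ?P = "{cmp u k | u k. u \<in> S \<and> k \<in> pre u}"
  note P = cs_gen[OF S]
  note P' = csvD[OF P]
  \<comment> \<open>Each arrow of the sieve gets one factorization through the cover, and
    \<open>\<phi>\<close> is \<open>\<theta>\<close> at this factorization.\<close>
  have "\<forall>r \<in> ?P. \<exists>p. fst p \<in> S \<and> snd p \<in> pre (fst p) \<and> r = cmp (fst p) (snd p)" by force
  from bchoice[OF this] obtain cc where cc: "\<forall>r \<in> ?P. fst (cc r) \<in> S \<and> snd (cc r) \<in> pre (fst (cc r)) \<and> r = cmp (fst (cc r)) (snd (cc r))"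
   by blast
  define cu ck where "cu = fst \<circ> cc" and "ck = snd \<circ> cc"
  have c: "cu r \<in> S" "ck r \<in> Arr C" "tgt (ck r) = src (cu r)" "cmp (cu r) (ck r) = r" if "r \<in> ?P" for r
   using bspec[OF cc that] unfolding cu_def ck_def comp_apply by (simp_all del: mem_Collect_eq)
  define \<phi> where "\<phi> r = \<theta> (src r) (cu r, ck r)" for r
  \<comment> \<open>Independence of the factorization: two of them are joined by an arrow of the
    nerve, which both maps send to an identity, so naturality of \<open>\<theta>\<close> identifies
    the two values.\<close>
  have th: "\<theta> (src k) (u, k) = \<phi> (cmp u k)" if "u \<in> S" "arr k" "tgt k = src u" for u k
  proof -
   have r: "cmp u k \<in> ?P" using that by auto
   let ?r = "cmp u k"
   have d: "src (ck ?r) = src k"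
    using arg_cong[OF c(4)[OF r], of "src"] c(1-3)[OF r] SX that by simp
   have a: "((u, k), (cu ?r, ck ?r)) \<in> Arr (sect ?N (src k))"
    using c[OF r] that SX d by (auto simp: Hom_iff)
   show ?thesis
    using hty_nat[OF h _ a] that SX c[OF r] d a x y by (simp add: \<phi>_def Hom_iff)
  qed
  obtain \<chi> where \<chi>: "\<chi> \<in> Arr (sect W X)" "Dom (sect W X) \<chi> = x" "Cod (sect W X) \<chi> = y"
   "!!u. u \<in> ?P ==> arm (rst W u) \<chi> = \<phi> u"
  proof (rule hom_sheaf_ex[OF hs P x(1) y(1)])
   fix r assume r: "r \<in> ?P"
   then obtain u k where uk: "u \<in> S" "k \<in> pre u" "r = cmp u k" by blast
   then show "\<phi> r \<in> Arr (sect W (src r)) \<and> Dom (sect W (src r)) (\<phi> r) = obm (rst W r) x \<and>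
    Cod (sect W (src r)) (\<phi> r) = obm (rst W r) y"
    using SX th[of u k, symmetric] by (simp add: Hom_iff)
   fix l assume l: "arr l" "tgt l = src r"
   have "\<phi> (cmp r l) = \<theta> (src l) (u, cmp k l)"
    using th[of u "cmp k l"] uk l SX by (simp add: comp_assoc)
   also have "\<dots> = arm (rst W l) (\<theta> (src k) (u, k))"
   proof -
    have dl: "tgt l = src k" using l uk SX by simp
    have "\<theta> (src l) (obm (rst ?N l) (u, k)) = arm (rst W l) (\<theta> (tgt l) (u, k))"
     by (rule htyD(6)[OF h]) (use uk l(1) dl in \<open>auto simp: Hom_iff\<close>)
    then show ?thesis unfolding dl by simp
   qed
   finally show "\<phi> (cmp r l) = arm (rst W l) (\<phi> r)" using th[of u k] uk by simp
  qed blast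
  let ?T = "res2 C (rep C X) (\<lambda>Y f. arm (rst W f) \<chi>)"
  have hT: "hty C (rep C X) W \<psi> ?T \<psi>'"
   unfolding x(2) y(2) by (rule hty_res2I) (use SX x(1) y(1) \<chi> in \<open>auto simp: yo_map[OF W] Hom_iff\<close>)
  show ?case
  proof (rule ex1I, rule conjI[OF hT], goal_cases)
   case 1
   then show ?case using SX by (auto simp: Hom_iff th \<chi>(4)) (metis (mono_tags, lifting) \<chi>(4) into_iff mem_Collect_eq th)
  next
   case (2 \<Theta>)
   note T = conjunct1[OF 2]
   \<comment> \<open>A homotopy on a representable is determined by its value at the identity, so
     uniqueness reduces to separatedness.\<close>
   have *: "\<Theta> X (Idt C X) = \<chi>"
   proof (rule hom_sheaf_unique[OF hs W P])
    fix r assume r: "r \<in> ?P"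
    then obtain u k where uk: "u \<in> S" "k \<in> pre u" "r = cmp u k" by blast
    have "arm (rst W r) (\<Theta> X (Idt C X)) = \<Theta> (src r) r"
     using htyD(6)[OF T, of r "src r" "Idt C X"] P'(2,3)[of r] r SX by (simp add: Hom_iff)
    also have "\<dots> = \<theta> (src k) (u, k)"
     using 2 uk SX by (auto simp: Hom_iff dest!: bspec[of _ _ "src k"] bspec[of _ _ "(u,k)"])
    also have "\<dots> = arm (rst W r) \<chi>" using \<chi>(4)[OF r] th uk by simp
    finally show "arm (rst W r) (\<Theta> X (Idt C X)) = arm (rst W r) \<chi>" .
   qed (use htyD(3-5)[OF T, of X "Idt C X"] SX \<chi> x y in \<open>auto simp: Hom_iff\<close>)
   show ?case
   proof (rule hty_eqI[OF T hT])
    fix Y f assume Y: "ob Y" "f \<in> Obj (sect (rep C X) Y)"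
    then show "\<Theta> Y f = ?T Y f"
     using htyD(6)[OF T, of f Y "Idt C X"] SX by (simp add: Hom_iff *)
   qed
  qed
 }
qed

text \<open>The nerve sees only covering families. Hence separatedness is proved for covers
  (\<open>sep\<close>); a family on a sieve \<open>P\<close> is then glued along a cover inside
  \<open>P\<close>, and \<open>sep\<close> shows that the result is right on all of
  \<open>P\<close>.\<close>

lemma local_objectD:
 assumes W: "grpd_presheaf C W" and ff: "!!X S. Cov X S ==> ff_es C (nerve_grpd C S) (rep C X) (nerve_map C S) W"
 shows "hom_sheaf C Cov W" "descent C Cov W"
proof -
 note [simp] = gpshD[OF W]
 have hyo: "hty C (rep C X) W (yo C W X x) (res2 C (rep C X) (\<lambda>Y f. arm (rst W f) \<chi>)) (yo C W X y)"
  if "ob X" "\<chi> \<in> Arr (sect W X)" "x = Dom (sect W X) \<chi>" "y = Cod (sect W X) \<chi>" for X \<chi> x y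
  by (rule hty_res2I) (use that in \<open>auto simp: yo_map[OF W] Hom_iff\<close>)
 \<comment> \<open>Two arrows with equal restrictions to the cover give homotopies on the
   representable that agree on the nerve, and an extension from the nerve is unique.\<close>
 have sep: "\<phi> = \<psi>" if S: "Cov X S" and f: "\<phi> \<in> Arr (sect W X)" "\<psi> \<in> Arr (sect W X)"
  "Dom (sect W X) \<phi> = Dom (sect W X) \<psi>" "Cod (sect W X) \<phi> = Cod (sect W X) \<psi>"
  "!!u. u \<in> S ==> arm (rst W u) \<phi> = arm (rst W u) \<psi>" for X S \<phi> \<psi>
 proof -
  note SX = cov_arrows[OF S] and nm = cov_nerve_map[OF S]
  have X: "ob X" using SX by simp
  let ?T = "\<lambda>\<phi>. res2 C (rep C X) (\<lambda>Y f. arm (rst W f) \<phi>)" and ?x = "Dom (sect W X) \<phi>" and ?y = "Cod (sect W X) \<phi>"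
  have h: "hty C (rep C X) W (yo C W X ?x) (?T \<phi>) (yo C W X ?y)" "hty C (rep C X) W (yo C W X ?x) (?T \<psi>) (yo C W X ?y)"
   using hyo[OF X f(1) refl refl] hyo[OF X f(2,3,4)] by auto
  have x: "?x \<in> Obj (sect W X)" "?y \<in> Obj (sect W X)" using f X by auto
  have U: "\<exists>!\<Theta>. hty C (rep C X) W (yo C W X ?x) \<Theta> (yo C W X ?y) \<and>
   (\<forall>Y \<in> Obj C. \<forall>a \<in> Obj (sect (nerve_grpd C S) Y). \<Theta> Y (obm (nerve_map C S Y) a) = res2 C (nerve_grpd C S) (\<lambda>Y a. ?T \<phi> Y (obm (nerve_map C S Y) a)) Y a)" (is "\<exists>!\<Theta>. ?P \<Theta>")
   using ff_esD(3)[OF ff[OF S] yo_map[OF W X x(1)] yo_map[OF W X x(2)] hty_pre[OF h(1) nm(1)]] by simp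
  have e: "?T \<phi> Y (obm (nerve_map C S Y) a) = ?T \<psi> Y (obm (nerve_map C S Y) a)"
   if "ob Y" "a \<in> Obj (sect (nerve_grpd C S) Y)" for Y a
   using that SX f by (cases a) (auto simp: Hom_iff)
  have "?P (?T \<phi>)" using h(1) by simp
  moreover have "?P (?T \<psi>)" using h(2) e by simp
  ultimately have "?T \<phi> = ?T \<psi>" by (rule ex1D[OF U])
  then have "?T \<phi> X (Idt C X) = ?T \<psi> X (Idt C X)" by simp
  then show ?thesis using X f by (simp add: Hom_iff)
 qed
 show "hom_sheaf C Cov W" unfolding hom_sheaf_def
 proof (intro allI impI, elim conjE)
  fix X P x y \<phi>
  assume P: "cs X P" and x: "x \<in> Obj (sect W X)" and y: "y \<in> Obj (sect W X)"
   and f: "\<forall>u \<in> P. \<phi> u \<in> Arr (sect W (src u)) \<and> Dom (sect W (src u)) (\<phi> u) = obm (rst W u) x \<and>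
   Cod (sect W (src u)) (\<phi> u) = obm (rst W u) y"
   and n: "\<forall>u \<in> P. \<forall>k \<in> pre u. \<phi> (cmp u k) = arm (rst W k) (\<phi> u)"
  obtain S where S: "S \<subseteq> P" "Cov X S" using P by (auto simp: csv_def)
  note SX = cov_arrows[OF S(2)] and nm = cov_nerve_map[OF S(2)]
  note P' = csvD[OF P]
  have X: "ob X" using SX by simp
  let ?N = "nerve_grpd C S"
  have fP: "\<phi> (cmp u k) \<in> Arr (sect W (src k))" "Dom (sect W (src k)) (\<phi> (cmp u k)) = obm (rst W k) (obm (rst W u) x)"
   "Cod (sect W (src k)) (\<phi> (cmp u k)) = obm (rst W k) (obm (rst W u) y)"
   if "u \<in> S" "arr k" "tgt k = src u" for u k
   using f[rule_format, of "cmp u k"] P'(4)[of u k] that S SX x y by (auto simp: subset_iff)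
  have h: "hty C ?N W (gmap_comp C ?N (yo C W X x) (nerve_map C S)) (res2 C ?N (\<lambda>Y (u,k). \<phi> (cmp u k))) (gmap_comp C ?N (yo C W X y) (nerve_map C S))"
  proof (rule hty_res2I)
   fix Y \<alpha> assume a: "ob Y" "\<alpha> \<in> Arr (sect ?N Y)"
   then obtain u k u' k' where al: "\<alpha> = ((u,k),(u',k'))" by (metis prod.exhaust)
   show "Comp (sect W Y) (case Cod (sect ?N Y) \<alpha> of (u, k) => \<phi> (cmp u k)) (arm (gmap_comp C ?N (yo C W X x) (nerve_map C S) Y) \<alpha>) =
    Comp (sect W Y) (arm (gmap_comp C ?N (yo C W X y) (nerve_map C S) Y) \<alpha>) (case Dom (sect ?N Y) \<alpha> of (u, k) => \<phi> (cmp u k))"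
    using a SX fP[of u k] fP[of u' k'] x y
    by (auto simp: al Hom_iff)
  next
   fix g a assume "arr g" "a \<in> Obj (sect ?N (tgt g))"
   then show "(case obm (rst ?N g) a of (u, k) => \<phi> (cmp u k)) = arm (rst W g) (case a of (u, k) => \<phi> (cmp u k))"
    using S SX P' n[rule_format, of "cmp (fst a) (snd a)" g] by (cases a) (auto simp: Hom_iff comp_assoc)
  qed (use SX fP x y X in \<open>auto simp: yo_map[OF W] Hom_iff intro!: gmap_comp_map[OF nm(1)]\<close>)
  obtain \<Theta> where T: "hty C (rep C X) W (yo C W X x) \<Theta> (yo C W X y)"
   "\<forall>Y \<in> Obj C. \<forall>a \<in> Obj (sect ?N Y). \<Theta> Y (obm (nerve_map C S Y) a) = res2 C ?N (\<lambda>Y (u,k). \<phi> (cmp u k)) Y a"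
   using ff_esD(3)[OF ff[OF S(2)] yo_map[OF W X x] yo_map[OF W X y] h] by (elim ex1E) blast
  let ?\<psi> = "\<Theta> X (Idt C X)"
  have p: "?\<psi> \<in> Arr (sect W X)" "Dom (sect W X) ?\<psi> = x" "Cod (sect W X) ?\<psi> = y"
   using htyD(3-5)[OF T(1), of X "Idt C X"] X x y by (auto simp: Hom_iff)
  have pS: "arm (rst W u) ?\<psi> = \<phi> u" if u: "u \<in> S" for u
  proof -
   have "arm (rst W u) ?\<psi> = \<Theta> (src u) u"
    using htyD(6)[OF T(1), of u "src u" "Idt C X"] u SX by (simp add: Hom_iff)
   also have "\<dots> = \<phi> u"
    using T(2)[rule_format, of "src u" "(u, Idt C (src u))"] u SX by (simp add: Hom_iff)
   finally show ?thesis .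
  qed
  show "\<exists>!\<psi>. \<psi> \<in> Arr (sect W X) \<and> Dom (sect W X) \<psi> = x \<and> Cod (sect W X) \<psi> = y \<and> (\<forall>u \<in> P. arm (rst W u) \<psi> = \<phi> u)"
  proof (rule ex1I[of _ ?\<psi>], intro conjI p ballI)
   fix r assume r: "r \<in> P"
   have ra: "arr r" "tgt r = X" using P' r by auto
   \<comment> \<open>For \<open>r\<close> in \<open>P\<close> but possibly not in the cover: the
     sieve generated by \<open>S\<close>, pulled back along \<open>r\<close>, contains a cover of
     \<open>src r\<close> on which both sides agree.\<close>
   define Q where "Q = {cmp u k | u k. u \<in> S \<and> k \<in> pre u}"
   have "cs (src r) {k \<in> pre r. cmp r k \<in> Q}"
    unfolding Q_def by (rule cs_pull[OF cs_gen[OF S(2)]]) (use ra in auto)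
   then obtain T' where T': "Cov (src r) T'" "T' \<subseteq> {k \<in> pre r. cmp r k \<in> Q}"
    by (auto simp: csv_def)
   show "arm (rst W r) ?\<psi> = \<phi> r"
   proof (rule sep[OF T'(1)])
    fix k assume k: "k \<in> T'"
    then have k': "arr k" "tgt k = src r" using T' by auto
    obtain u l where u: "u \<in> S" "arr l" "tgt l = src u" "cmp r k = cmp u l"
     using k T' by (auto simp: Q_def)
    have "arm (rst W k) (arm (rst W r) ?\<psi>) = arm (rst W (cmp r k)) ?\<psi>" using k' ra p by simp
    also have "\<dots> = arm (rst W l) (\<phi> u)" using u p SX pS by simp
    also have "\<dots> = \<phi> (cmp r k)" using n u S by auto
    also have "\<dots> = arm (rst W k) (\<phi> r)" using n k' r by simp
    finally show "arm (rst W k) (arm (rst W r) ?\<psi>) = arm (rst W k) (\<phi> r)" .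
   qed (use p ra f r in auto)
  next
   fix \<psi> assume "\<psi> \<in> Arr (sect W X) \<and> Dom (sect W X) \<psi> = x \<and> Cod (sect W X) \<psi> = y \<and> (\<forall>u \<in> P. arm (rst W u) \<psi> = \<phi> u)"
   then show "\<psi> = ?\<psi>" using p pS S by - (rule sep[OF S(2)], auto)
  qed
 qed
 show "descent C Cov W" unfolding descent_def
 proof (intro allI impI, elim conjE)
  fix X S \<omega> assume S: "Cov X S" and w: "grpd_map C (nerve_grpd C S) W \<omega>"
  have X: "ob X" using cov_arrows[OF S] by simp
  obtain \<psi> \<theta> where p: "grpd_map C (rep C X) W \<psi>" "hty C (nerve_grpd C S) W (gmap_comp C (nerve_grpd C S) \<psi> (nerve_map C S)) \<theta> \<omega>"
   using ff_esD(2)[OF ff[OF S] w] by blast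
  then show "\<exists>x \<in> Obj (sect W X). \<exists>\<delta>. hty C (nerve_grpd C S) W (gmap_comp C (nerve_grpd C S) (yo C W X x) (nerve_map C S)) \<delta> \<omega>"
   by (intro bexI[OF _ rep_map_eq(1)[OF p(1) X]] exI[of _ \<theta>]) (simp add: p(2) flip: rep_map_eq(2)[OF p(1) X])
 qed
qed

lemma local_object_iff:
 "local_object C Cov W \<longleftrightarrow> grpd_presheaf C W \<and> hom_sheaf C Cov W \<and> descent C Cov W"
proof (cases "grpd_presheaf C W")
 case True
 have "is_equivalence (Map_grpd C (rep C X) W) (Map_grpd C (nerve_grpd C S) W)
    (Map_precomp C (nerve_grpd C S) (nerve_map C S)) \<longleftrightarrow> ff_es C (nerve_grpd C S) (rep C X) (nerve_map C S) W"
  if "Cov X S" for X S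
  by (rule is_equivalence_precomp_iff[OF cov_nerve_map(1)[OF that] True])
 then have "local_object C Cov W \<longleftrightarrow> (\<forall>X S. Cov X S --> ff_es C (nerve_grpd C S) (rep C X) (nerve_map C S) W)"
  using True unfolding local_object_def by auto
 then show ?thesis using local_objectI[OF True] local_objectD[OF True] True by blast
qed (auto simp: local_object_def)

end

section \<open>Sets that are small relative to the universe\<close>

context set_universe begin

text \<open>A set counts as small when it injects into \<open>'u\<close>; pairs of elements are
  coded by \<open>enc\<close>.\<close>

lemma lepoll_Times:
 fixes A :: "'p set" and B :: "'q set"
 assumes "A \<lesssim> (UNIV :: 'u set)" "B \<lesssim> (UNIV :: 'u set)"
 shows "A \<times> B \<lesssim> (UNIV :: 'u set)"
proof -
 obtain f g where "inj_on f A" "f ` A \<subseteq> (UNIV :: 'u set)" "inj_on g B" "g ` B \<subseteq> (UNIV :: 'u set)"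
  using assms unfolding lepoll_def by blast
 then have "inj_on (\<lambda>(x, y). enc (f x, g y)) (A \<times> B)"
  by (auto intro!: inj_onI dest!: injD[OF enc_inj] dest: inj_onD)
 then show ?thesis unfolding lepoll_def by blast
qed

lemma lepoll_nat: "(A :: nat set) \<lesssim> (UNIV :: 'u set)"
 using infinite_le_lepoll[of "UNIV :: 'u set"] infinite_universe subset_imp_lepoll[of A UNIV] lepoll_trans by blast

lemma lepoll_Un:
 fixes A B :: "'p set"
 assumes "A \<lesssim> (UNIV :: 'u set)" "B \<lesssim> (UNIV :: 'u set)"
 shows "A \<union> B \<lesssim> (UNIV :: 'u set)"
proof -
 obtain f g where fg: "inj_on f A" "f ` A \<subseteq> (UNIV :: 'u set)" "inj_on g B" "g ` B \<subseteq> (UNIV :: 'u set)"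
  using assms unfolding lepoll_def by blast
 \<comment> \<open>Two tags keep the codes of the two sets apart.\<close>
 obtain a b :: 'u where "a \<noteq> b"
  using infinite_universe by (metis (full_types) UNIV_I finite.simps subsetI finite_subset singleton_iff)
 then have "inj_on (\<lambda>x. if x \<in> A then enc (a, f x) else enc (b, g x)) (A \<union> B)"
  using fg by (auto intro!: inj_onI dest!: injD[OF enc_inj] dest: inj_onD split: if_splits)
 then show ?thesis unfolding lepoll_def by blast
qed

lemma lepoll_image:
 fixes A :: "'p set"
 shows "A \<lesssim> (UNIV :: 'u set) ==> B \<subseteq> f ` A ==> B \<lesssim> (UNIV :: 'u set)"
 by (meson image_lepoll lepoll_trans subset_imp_lepoll)

lemma lepoll_inj:
 fixes A :: "'p set"
 assumes "inj_on f A" "f ` A \<subseteq> B" "B \<lesssim> (UNIV :: 'u set)"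
 shows "A \<lesssim> (UNIV :: 'u set)"
proof -
 have "A \<lesssim> B" using assms(1,2) unfolding lepoll_def by blast
 then show ?thesis using assms(3) by (rule lepoll_trans)
qed

lemma lepoll_fun:
 fixes B :: "'q set"
 assumes "B \<lesssim> (UNIV :: 'u set)"
 shows "(Arr C \<rightarrow>\<^sub>E B) \<lesssim> (UNIV :: 'u set)"
proof -
 obtain g where g: "inj_on g B" "g ` B \<subseteq> (UNIV :: 'u set)" using assms unfolding lepoll_def by blast
 obtain e :: "('a => 'u) => 'u" where e: "inj_on e (Arr C \<rightarrow>\<^sub>E UNIV)" using small_category by blast
 have 1: "(Arr C \<rightarrow>\<^sub>E (UNIV :: 'u set)) \<lesssim> (UNIV :: 'u set)" using e unfolding lepoll_def by blast
 have "inj_on (\<lambda>f. \<lambda>x \<in> Arr C. g (f x)) (Arr C \<rightarrow>\<^sub>E B)"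
 proof (rule inj_onI)
  fix f f' assume f: "f \<in> Arr C \<rightarrow>\<^sub>E B" "f' \<in> Arr C \<rightarrow>\<^sub>E B" and e: "(\<lambda>x \<in> Arr C. g (f x)) = (\<lambda>x \<in> Arr C. g (f' x))"
  show "f = f'"
  proof (rule PiE_ext[OF f])
   fix x assume x: "x \<in> Arr C"
   have "g (f x) = g (f' x)" using fun_cong[OF e, of x] x by simp
   then show "f x = f' x" using g(1) f x by (meson PiE_mem inj_onD)
  qed
 qed
 moreover have "(\<lambda>f. \<lambda>x \<in> Arr C. g (f x)) ` (Arr C \<rightarrow>\<^sub>E B) \<subseteq> Arr C \<rightarrow>\<^sub>E UNIV" by auto
 ultimately show ?thesis using 1 by (rule lepoll_inj)
qed

text \<open>An arrow is coded by its indicator function, and functions on \<open>Arr C\<close> with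
  small values are small.\<close>

lemma lepoll_Arr: "Arr C \<lesssim> (UNIV :: 'u set)"
proof -
 have "inj_on (\<lambda>f. \<lambda>x \<in> Arr C. if x = f then 1 else (0::nat)) (Arr C)"
 proof (rule inj_onI)
  fix x y assume x: "x \<in> Arr C" "y \<in> Arr C"
   and e: "(\<lambda>z \<in> Arr C. if z = x then 1 else (0::nat)) = (\<lambda>z \<in> Arr C. if z = y then 1 else 0)"
  show "x = y" using fun_cong[OF e, of x] x by (simp split: if_splits)
 qed
 then show ?thesis by (rule lepoll_inj[OF _ _ lepoll_fun[OF lepoll_nat[of UNIV]]]) auto
qed

lemma lepoll_option:
 fixes A :: "'p set"
 assumes "A \<lesssim> (UNIV :: 'u set)"
 shows "insert None (Some ` A) \<lesssim> (UNIV :: 'u set)"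
proof -
 have "{None} \<lesssim> (UNIV :: 'u set)" unfolding lepoll_def by (auto intro: exI[of _ "\<lambda>_. undefined"])
 then show ?thesis using lepoll_Un[OF _ lepoll_image[OF assms order_refl, of Some], of "{None}"] by simp
qed

end

section \<open>Cofibrations and local equivalences built from covers\<close>

text \<open>The presheaf of groupoids freely generated by the arrows \<open>snd i\<close> into \<open>X\<close> (the first components only
 distinguish copies), where two of them become uniquely isomorphic wherever they agree and have a
 composite in \<open>Q\<close>. With \<open>Q = UNIV\<close> and \<open>Q\<close> a covering sieve it provides the cofibrations against
 which local fibrations are tested.\<close>

definition EQ :: "('o, 'a) cat => (nat \<times> 'a) set => 'a set
  => ('o, 'a, (nat \<times> 'a) \<times> 'a, ((nat \<times> 'a) \<times> 'a) \<times> ((nat \<times> 'a) \<times> 'a)) gpsh" where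
 "EQ C I Q =
  \<lparr>sect = (\<lambda>Y. \<lparr>Obj = {(i, k). i \<in> I \<and> k \<in> Hom C Y (Dom C (snd i))},
    Arr = {((i, k), (i', k')). i \<in> I \<and> k \<in> Hom C Y (Dom C (snd i)) \<and>
     i' \<in> I \<and> k' \<in> Hom C Y (Dom C (snd i')) \<and> Comp C (snd i) k = Comp C (snd i') k' \<and>
     (i = i' \<or> Comp C (snd i) k \<in> Q)},
    Dom = fst, Cod = snd, Idt = (\<lambda>x. (x, x)), Comp = (\<lambda>g f. (fst f, snd g))\<rparr>),
   rst = (\<lambda>h. \<lparr>obm = (\<lambda>(i, k). (i, Comp C k h)),
    arm = (\<lambda>((i, k), (i', k')). ((i, Comp C k h), (i', Comp C k' h)))\<rparr>)\<rparr>"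

lemma EQ_simps [simp]:
 "(i, k) \<in> Obj (sect (EQ C I Q) Y) \<longleftrightarrow> i \<in> I \<and> k \<in> Hom C Y (Dom C (snd i))"
 "((i, k), (i', k')) \<in> Arr (sect (EQ C I Q) Y) \<longleftrightarrow> i \<in> I \<and> k \<in> Hom C Y (Dom C (snd i)) \<and>
     i' \<in> I \<and> k' \<in> Hom C Y (Dom C (snd i')) \<and> Comp C (snd i) k = Comp C (snd i') k' \<and>
     (i = i' \<or> Comp C (snd i) k \<in> Q)"
 "Dom (sect (EQ C I Q) Y) \<alpha> = fst \<alpha>" "Cod (sect (EQ C I Q) Y) \<alpha> = snd \<alpha>"
 "Idt (sect (EQ C I Q) Y) x = (x, x)"
 "Comp (sect (EQ C I Q) Y) \<beta> \<alpha> = (fst \<alpha>, snd \<beta>)"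
 "obm (rst (EQ C I Q) h) (i, k) = (i, Comp C k h)"
 "arm (rst (EQ C I Q) h) ((i, k), (i', k')) = ((i, Comp C k h), (i', Comp C k' h))"
 by (simp_all add: EQ_def)

lemma EQ_arm: "arm (rst (EQ C I Q) h) (x, y) = (obm (rst (EQ C I Q) h) x, obm (rst (EQ C I Q) h) y)"
 by (cases x; cases y) simp

text \<open>\<open>Q\<close> is only asked to absorb composition on the right, so that both
  \<open>UNIV\<close> and a sieve on \<open>X\<close> qualify.\<close>

definition EQ_data :: "('o, 'a) cat => 'o => (nat \<times> 'a) set => 'a set => bool" where
 "EQ_data C X I Q \<longleftrightarrow> category C \<and> X \<in> Obj C \<and> (\<forall>i \<in> I. snd i \<in> into C X) \<and>
  (\<forall>u \<in> Q. \<forall>k. u \<in> Arr C \<and> k \<in> Arr C \<and> Cod C k = Dom C u --> Comp C u k \<in> Q)"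

lemma EQ_dataD:
 assumes "EQ_data C X I Q"
 shows "category C" "X \<in> Obj C" "i \<in> I ==> snd i \<in> Arr C" "i \<in> I ==> Cod C (snd i) = X"
  "[|u \<in> Q; u \<in> Arr C; k \<in> Arr C; Cod C k = Dom C u|] ==> Comp C u k \<in> Q"
 using assms by (auto simp: EQ_data_def)

lemma EQ_arr_restrict:
 assumes D: "EQ_data C X I Q" and h: "h \<in> Arr C" "\<alpha> \<in> Arr (sect (EQ C I Q) (Cod C h))"
 shows "arm (rst (EQ C I Q) h) \<alpha> \<in> Arr (sect (EQ C I Q) (Dom C h))"
proof -
 note [simp] = EQ_dataD[OF D]
 obtain i k i' k' where e: "\<alpha> = ((i, k), (i', k'))" by (metis prod.exhaust)
 have k: "i \<in> I" "k \<in> Arr C" "Dom C k = Cod C h" "Cod C k = Dom C (snd i)" "i' \<in> I" "k' \<in> Arr C" "Dom C k' = Cod C h"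
  "Cod C k' = Dom C (snd i')" and v: "Comp C (snd i) k = Comp C (snd i') k'" and Q: "i = i' \<or> Comp C (snd i) k \<in> Q"
  using h(2) by (auto simp: e Hom_iff)
 have 1: "Comp C (snd i) (Comp C k h) = Comp C (Comp C (snd i) k) h" "Comp C (snd i') (Comp C k' h) = Comp C (Comp C (snd i') k') h"
  using k h(1) by (simp_all add: comp_assoc)
 have "Comp C (snd i) (Comp C k h) \<in> Q" if "Comp C (snd i) k \<in> Q"
  unfolding 1 using EQ_dataD(5)[OF D that, of h] k h(1) by simp
 moreover have "Comp C (snd i) (Comp C k h) = Comp C (snd i') (Comp C k' h)" by (simp only: 1 v)
 ultimately show ?thesis unfolding e EQ_simps using Q k h(1) by (simp add: Hom_iff) blast
qed

lemma EQ_groupoid: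
 assumes [simp]: "category C"
 shows "groupoid (sect (EQ C I Q) Y)"
proof (rule groupoidI)
 show "category (sect (EQ C I Q) Y)"
  by (rule categoryI) auto
 fix f assume f: "f \<in> Arr (sect (EQ C I Q) Y)"
 obtain i k i' k' where e: "f = ((i, k), (i', k'))" by (metis prod.exhaust)
 show "\<exists>g\<in>Arr (sect (EQ C I Q) Y). Dom (sect (EQ C I Q) Y) g = Cod (sect (EQ C I Q) Y) f \<and>
   Cod (sect (EQ C I Q) Y) g = Dom (sect (EQ C I Q) Y) f \<and>
   Comp (sect (EQ C I Q) Y) g f = Idt (sect (EQ C I Q) Y) (Dom (sect (EQ C I Q) Y) f) \<and>
   Comp (sect (EQ C I Q) Y) f g = Idt (sect (EQ C I Q) Y) (Cod (sect (EQ C I Q) Y) f)"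
  using f unfolding e by (intro bexI[of _ "((i', k'), (i, k))"]) auto
qed

lemma EQ_gpsh:
 assumes D: "EQ_data C X I Q"
 shows "grpd_presheaf C (EQ C I Q)"
proof -
 note [simp] = EQ_dataD[OF D]
 show ?thesis
 proof (rule gpshI)
  fix h \<alpha> assume h: "h \<in> Arr C" "\<alpha> \<in> Arr (sect (EQ C I Q) (Cod C h))"
  then show "arm (rst (EQ C I Q) h) \<alpha> \<in> Arr (sect (EQ C I Q) (Dom C h)) \<and>
   Dom (sect (EQ C I Q) (Dom C h)) (arm (rst (EQ C I Q) h) \<alpha>) = obm (rst (EQ C I Q) h) (Dom (sect (EQ C I Q) (Cod C h)) \<alpha>) \<and>
   Cod (sect (EQ C I Q) (Dom C h)) (arm (rst (EQ C I Q) h) \<alpha>) = obm (rst (EQ C I Q) h) (Cod (sect (EQ C I Q) (Cod C h)) \<alpha>)"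
   using EQ_arr_restrict[OF D h] by (cases \<alpha>) (simp add: EQ_arm)
 qed (auto simp: EQ_groupoid Hom_iff comp_assoc)
qed

definition EQ_incl :: "('o, 'a) cat => (nat \<times> 'a) set => 'a set
  => ('o, (nat \<times> 'a) \<times> 'a, ((nat \<times> 'a) \<times> 'a) \<times> ((nat \<times> 'a) \<times> 'a), (nat \<times> 'a) \<times> 'a, ((nat \<times> 'a) \<times> 'a) \<times> ((nat \<times> 'a) \<times> 'a)) gmap" where
 "EQ_incl C I Q = gmap_id C (EQ C I Q)"

lemma EQ_incl_map:
 assumes D: "EQ_data C X I Q" "EQ_data C X J Q'" and s: "I \<subseteq> J" "Q \<subseteq> Q'"
 shows "grpd_map C (EQ C I Q) (EQ C J Q') (EQ_incl C I Q)"
proof -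
 note [simp] = gmapD[OF gmap_id_map[OF EQ_gpsh[OF D(1)]]]
 have *: "a \<in> Obj (sect (EQ C I Q) Y) ==> a \<in> Obj (sect (EQ C J Q') Y)" for a Y
  using s by (cases a) auto
 have **: "\<alpha> \<in> Arr (sect (EQ C I Q) Y) ==> \<alpha> \<in> Arr (sect (EQ C J Q') Y)" for \<alpha> Y
  using s by (cases \<alpha>; cases "fst \<alpha>"; cases "snd \<alpha>") auto
 note [simp] = gpshD[OF EQ_gpsh[OF D(1)]]
 have [simp]: "obm (rst (EQ C J Q') h) a = obm (rst (EQ C I Q) h) a" "arm (rst (EQ C J Q') h) \<alpha> = arm (rst (EQ C I Q) h) \<alpha>" for h a \<alpha>
  by (simp_all add: EQ_def)
 have G: "groupoid (sect (EQ C I Q) Y)" for Y by (rule EQ_groupoid) simp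
 have e: "X \<in> Obj C ==> \<alpha> \<in> Arr (sect (EQ C I Q) X) ==> fst \<alpha> \<in> Obj (sect (EQ C I Q) X) \<and> snd \<alpha> \<in> Obj (sect (EQ C I Q) X)" for X \<alpha>
  by (cases \<alpha>; cases "fst \<alpha>"; cases "snd \<alpha>") auto
 show ?thesis unfolding EQ_incl_def
 proof (rule gmapI, goal_cases)
  case (8 X \<alpha> \<beta>)
  have "Comp (sect (EQ C I Q) X) \<beta> \<alpha> \<in> Arr (sect (EQ C I Q) X)"
   using 8 G[of X] by (intro cat_simps(6)) auto
  then show ?case using 8 by simp
 next
  case (7 X a)
  have "Idt (sect (EQ C I Q) X) a \<in> Arr (sect (EQ C I Q) X)"
   using 7 G[of X] by (intro cat_simps(3)) auto
  then show ?case using 7 by simp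
 qed (auto simp: * ** e EQ_gpsh[OF D(1)] EQ_gpsh[OF D(2)], auto simp: gmap_id_def ftor_id_def)
qed

text \<open>An object \<open>b\<close> is at least isomorphic to an image; lifting the inverse of
  this isomorphism gives an arrow whose source lies over \<open>b\<close> itself. The unique lifting
  of arrows between given ends is full faithfulness.\<close>

lemma trivial_fibration:
 assumes p: "levelwise_fibration C E H p" "levelwise_equivalence C E H p" and X: "X \<in> Obj C"
 shows "b \<in> Obj (sect H X) ==> \<exists>e \<in> Obj (sect E X). obm (p X) e = b"
  and "[|x \<in> Obj (sect E X); y \<in> Obj (sect E X); \<beta> \<in> Arr (sect H X); Dom (sect H X) \<beta> = obm (p X) x; Cod (sect H X) \<beta> = obm (p X) y|]
   ==> \<exists>!\<alpha>. \<alpha> \<in> Arr (sect E X) \<and> Dom (sect E X) \<alpha> = x \<and> Cod (sect E X) \<alpha> = y \<and> arm (p X) \<alpha> = \<beta>"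
proof -
 have m: "grpd_map C E H p" using p by (auto simp: levelwise_fibration_def)
 note [simp] = gmapD[OF m] gpshD[OF gmapD(1)[OF m]] gpshD[OF gmapD(2)[OF m]]
 have eq: "is_equivalence (sect E X) (sect H X) (p X)" using p X by (auto simp: levelwise_equivalence_def)
 note E = equivalence_full_faithful[OF eq]
 show "\<exists>e \<in> Obj (sect E X). obm (p X) e = b" if b: "b \<in> Obj (sect H X)"
 proof -
  obtain e i where e: "e \<in> Obj (sect E X)" "i \<in> Arr (sect H X)" "Dom (sect H X) i = obm (p X) e" "Cod (sect H X) i = b"
   using E(4)[OF b] by blast
  have "grpd_fibration (sect E X) (sect H X) (p X)" using p X by (auto simp: levelwise_fibration_def)
  moreover have "ginv (sect H X) i \<in> Arr (sect H X)" "Cod (sect H X) (ginv (sect H X) i) = obm (p X) e" using e X by auto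
  ultimately obtain \<beta> where "\<beta> \<in> Arr (sect E X)" "Cod (sect E X) \<beta> = e" "arm (p X) \<beta> = ginv (sect H X) i"
   using e unfolding grpd_fibration_def by blast
  then show ?thesis using X e gmapD(6)[OF m X, of \<beta>] by (intro bexI[of _ "Dom (sect E X) \<beta>"]) auto
 qed
 show "\<exists>!\<alpha>. \<alpha> \<in> Arr (sect E X) \<and> Dom (sect E X) \<alpha> = x \<and> Cod (sect E X) \<alpha> = y \<and> arm (p X) \<alpha> = \<beta>"
  if "x \<in> Obj (sect E X)" "y \<in> Obj (sect E X)" "\<beta> \<in> Arr (sect H X)" "Dom (sect H X) \<beta> = obm (p X) x" "Cod (sect H X) \<beta> = obm (p X) y"
  using E(3)[OF that] E(2) by (metis (full_types))
qed

text \<open>As a presheaf of sets, the objects of \<open>EQ\<close> are freely generated by the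
  pairs \<open>(i, Idt)\<close>. Lifting a map thus means choosing a lift for each new generator;
  arrows then lift uniquely. This makes the inclusions cofibrations.\<close>

lemma EQ_incl_lifts:
 assumes D: "EQ_data C X I Q" "EQ_data C X J Q'" and s: "I \<subseteq> J" "Q \<subseteq> Q'"
  and p: "levelwise_fibration C E H p" "levelwise_equivalence C E H p"
 shows "lifts_against C (EQ C I Q) (EQ C J Q') (EQ_incl C I Q) E H p"
 unfolding lifts_against_def
proof (intro allI impI, elim conjE)
 fix u v assume u: "grpd_map C (EQ C I Q) E u" and v: "grpd_map C (EQ C J Q') H v"
  and e: "gmap_comp C (EQ C I Q) p u = gmap_comp C (EQ C I Q) v (EQ_incl C I Q)"
 have m: "grpd_map C E H p" using p by (auto simp: levelwise_fibration_def)
 note tf = trivial_fibration[OF p]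
 note [simp] = gmapD[OF m] gpshD[OF gmapD(1)[OF m]] gpshD[OF gmapD(2)[OF m]] EQ_dataD[OF D(1)] EQ_dataD[OF D(2)]
 note [simp] = gmapD[OF u] gmapD[OF v]
 have pu: "obm (p Y) (obm (u Y) a) = obm (v Y) a" if "Y \<in> Obj C" "a \<in> Obj (sect (EQ C I Q) Y)" for Y a
  using arg_cong[OF e, of "\<lambda>f. obm (f Y) a"] that by (simp add: EQ_incl_def)
 have pu2: "arm (p Y) (arm (u Y) a) = arm (v Y) a" if "Y \<in> Obj C" "a \<in> Arr (sect (EQ C I Q) Y)" for Y a
  using arg_cong[OF e, of "\<lambda>f. arm (f Y) a"] that by (simp add: EQ_incl_def)
 have "\<forall>i \<in> J. \<exists>y. y \<in> Obj (sect E (Dom C (snd i))) \<and> obm (p (Dom C (snd i))) y = obm (v (Dom C (snd i))) (i, Idt C (Dom C (snd i)))"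
 proof
  fix i assume i: "i \<in> J"
  then have "obm (v (Dom C (snd i))) (i, Idt C (Dom C (snd i))) \<in> Obj (sect H (Dom C (snd i)))" by (simp add: Hom_iff)
  then show "\<exists>y. y \<in> Obj (sect E (Dom C (snd i))) \<and> obm (p (Dom C (snd i))) y = obm (v (Dom C (snd i))) (i, Idt C (Dom C (snd i)))"
   using tf(1)[of "Dom C (snd i)"] i by auto
 qed
 from bchoice[OF this] obtain y where y: "!!i. i \<in> J ==> y i \<in> Obj (sect E (Dom C (snd i)))"
  "!!i. i \<in> J ==> obm (p (Dom C (snd i))) (y i) = obm (v (Dom C (snd i))) (i, Idt C (Dom C (snd i)))"
  by blast
 \<comment> \<open>On old generators the lift is prescribed by \<open>u\<close>, on new ones it is
   the restriction of the chosen \<open>y\<close>.\<close>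
 define ob where "ob Y a = (if fst a \<in> I then obm (u Y) a else obm (rst E (snd a)) (y (fst a)))" for Y a
 have ob: "ob Y a \<in> Obj (sect E Y)" "obm (p Y) (ob Y a) = obm (v Y) a" if Y: "Y \<in> Obj C" and a: "a \<in> Obj (sect (EQ C J Q') Y)" for Y a
 proof -
  obtain i k where ik: "a = (i, k)" by (cases a)
  have k: "i \<in> J" "k \<in> Arr C" "Dom C k = Y" "Cod C k = Dom C (snd i)" using a by (auto simp: ik Hom_iff)
  show "ob Y a \<in> Obj (sect E Y)" using Y k y(1)[of i] by (auto simp: ob_def ik Hom_iff)
  have "obm (v Y) (obm (rst (EQ C J Q') k) (i, Idt C (Dom C (snd i)))) = obm (rst H k) (obm (v (Cod C k)) (i, Idt C (Dom C (snd i))))"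
   by (rule gmapD(10)[OF v]) (use k in \<open>auto simp: Hom_iff\<close>)
  then show "obm (p Y) (ob Y a) = obm (v Y) a" using Y k y[of i] pu[of Y a] by (auto simp: ob_def ik Hom_iff)
 qed
 define P where "P Y \<alpha> \<beta> \<longleftrightarrow> \<beta> \<in> Arr (sect E Y) \<and> Dom (sect E Y) \<beta> = ob Y (fst \<alpha>) \<and> Cod (sect E Y) \<beta> = ob Y (snd \<alpha>) \<and> arm (p Y) \<beta> = arm (v Y) \<alpha>" for Y \<alpha> \<beta>
 have G: "\<alpha> \<in> Arr (sect (EQ C J Q') Y) ==> fst \<alpha> \<in> Obj (sect (EQ C J Q') Y) \<and> snd \<alpha> \<in> Obj (sect (EQ C J Q') Y)" for \<alpha> Y
  by (cases \<alpha>; cases "fst \<alpha>"; cases "snd \<alpha>") auto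
 \<comment> \<open>With the objects fixed there is exactly one lift of each arrow, so every equation
   between lifted arrows below follows by comparing ends and images in \<open>H\<close>.\<close>
 have ex: "\<exists>!\<beta>. P Y \<alpha> \<beta>" if Y: "Y \<in> Obj C" and a: "\<alpha> \<in> Arr (sect (EQ C J Q') Y)" for Y \<alpha>
  unfolding P_def by (rule tf(2)[OF Y]) (use Y a G[OF a] ob[OF Y] in auto)
 define ar where "ar Y \<alpha> = (THE \<beta>. P Y \<alpha> \<beta>)" for Y \<alpha>
 have ar: "P Y \<alpha> (ar Y \<alpha>)" if Y: "Y \<in> Obj C" and a: "\<alpha> \<in> Arr (sect (EQ C J Q') Y)" for Y \<alpha>
  unfolding ar_def by (rule theI'[OF ex[OF that]])
 have aru: "ar Y \<alpha> = \<beta>" if Y: "Y \<in> Obj C" and a: "\<alpha> \<in> Arr (sect (EQ C J Q') Y)" and "P Y \<alpha> \<beta>" for Y \<alpha> \<beta>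
  by (rule ex1D[OF ex[OF Y a] ar[OF Y a] that(3)])
 note arD = ar[unfolded P_def]
 define l where "l = (\<lambda>Y \<in> Obj C. \<lparr>obm = restrict (ob Y) (Obj (sect (EQ C J Q') Y)), arm = restrict (ar Y) (Arr (sect (EQ C J Q') Y))\<rparr>)"
 have l1: "Y \<in> Obj C ==> a \<in> Obj (sect (EQ C J Q') Y) ==> obm (l Y) a = ob Y a"
  and l2: "Y \<in> Obj C ==> \<alpha> \<in> Arr (sect (EQ C J Q') Y) ==> arm (l Y) \<alpha> = ar Y \<alpha>" for Y a \<alpha>
  by (auto simp: l_def)
 note EJ = EQ_gpsh[OF D(2)] and EI = EQ_gpsh[OF D(1)]
 note EJs = gpshD[OF EJ]
 have obr: "ob (Dom C h) (obm (rst (EQ C J Q') h) a) = obm (rst E h) (ob (Cod C h) a)" if h: "h \<in> Arr C" "a \<in> Obj (sect (EQ C J Q') (Cod C h))" for h a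
 proof -
  obtain i k where ik: "a = (i, k)" by (cases a)
  show ?thesis
  proof (cases "i \<in> I")
   case True
   have "obm (u (Dom C h)) (obm (rst (EQ C I Q) h) a) = obm (rst E h) (obm (u (Cod C h)) a)"
    by (rule gmapD(10)[OF u]) (use h True ik in auto)
   then show ?thesis using True by (simp add: ob_def ik)
  next
   case False
   then show ?thesis using h y(1)[of i] by (simp add: ob_def ik Hom_iff)
  qed
 qed
 have lm: "grpd_map C (EQ C J Q') E l"
 proof (rule gmapI, goal_cases)
  case (5 Y a) then show ?case using ob[of Y a] by (simp add: l1)
 next
  case (6 Y a) then show ?case using arD[of Y a] G[of a Y] by (simp add: l2 l1)
 next
  case (7 Y a)
  have i: "Idt (sect (EQ C J Q') Y) a \<in> Arr (sect (EQ C J Q') Y)" using 7 EJs by (intro cat_simps(3)) auto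
  have "ar Y (Idt (sect (EQ C J Q') Y) a) = Idt (sect E Y) (ob Y a)"
   by (rule aru[OF 7(1) i]) (use 7 ob[OF 7] gmapD(8)[OF v 7] in \<open>auto simp: P_def\<close>)
  then show ?case using i 7 by (simp add: l1 l2)
 next
  case (8 Y \<alpha> \<beta>)
  have i: "Comp (sect (EQ C J Q') Y) \<beta> \<alpha> \<in> Arr (sect (EQ C J Q') Y)" using 8 EJs by (intro cat_simps(6)) auto
  have "ar Y (Comp (sect (EQ C J Q') Y) \<beta> \<alpha>) = Comp (sect E Y) (ar Y \<beta>) (ar Y \<alpha>)"
   by (rule aru[OF 8(1) i]) (use 8 arD[OF 8(1,2)] arD[OF 8(1,3)] gmapD(9)[OF v 8] in \<open>auto simp: P_def\<close>)
  then show ?case using i 8 by (simp add: l2)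
 next
  case (9 h a)
  then show ?case using obr[OF 9] EJs by (simp add: l1)
 next
  case (10 h \<alpha>)
  have i: "arm (rst (EQ C J Q') h) \<alpha> \<in> Arr (sect (EQ C J Q') (Dom C h))" using 10 EJs by simp
  have Y: "Cod C h \<in> Obj C" "Dom C h \<in> Obj C" using 10 by auto
  have f: "fst (arm (rst (EQ C J Q') h) \<alpha>) = obm (rst (EQ C J Q') h) (fst \<alpha>)" "snd (arm (rst (EQ C J Q') h) \<alpha>) = obm (rst (EQ C J Q') h) (snd \<alpha>)"
   by (cases \<alpha>; simp add: EQ_arm)+
  have "ar (Dom C h) (arm (rst (EQ C J Q') h) \<alpha>) = arm (rst E h) (ar (Cod C h) \<alpha>)"
   by (rule aru[OF Y(2) i]) (use 10 arD[OF Y(1) 10(2)] gmapD(11)[OF v 10(1) refl 10(2)] G[OF 10(2)] obr[OF 10(1)] in \<open>auto simp: P_def f\<close>)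
  then show ?case using i 10 Y by (simp add: l2)
 qed (auto simp: EJ l_def)
 have sub: "a \<in> Obj (sect (EQ C I Q) Y) ==> a \<in> Obj (sect (EQ C J Q') Y)" "\<alpha> \<in> Arr (sect (EQ C I Q) Y) ==> \<alpha> \<in> Arr (sect (EQ C J Q') Y)" for Y a \<alpha>
  using s by (cases a, auto) (cases \<alpha>; cases "fst \<alpha>"; cases "snd \<alpha>", auto)
 have obI: "ob Y a = obm (u Y) a" if "a \<in> Obj (sect (EQ C I Q) Y)" for Y a
  using that by (cases a) (simp add: ob_def)
 have GI: "\<alpha> \<in> Arr (sect (EQ C I Q) Y) ==> fst \<alpha> \<in> Obj (sect (EQ C I Q) Y) \<and> snd \<alpha> \<in> Obj (sect (EQ C I Q) Y)" for \<alpha> Y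
  by (cases \<alpha>; cases "fst \<alpha>"; cases "snd \<alpha>") auto
 have "gmap_comp C (EQ C I Q) l (EQ_incl C I Q) = u"
 proof (rule gmap_eqI[OF gmap_comp_map[OF EQ_incl_map[OF D s] lm] u])
  fix Y \<alpha> assume a: "Y \<in> Obj C" "\<alpha> \<in> Arr (sect (EQ C I Q) Y)"
  have "ar Y \<alpha> = arm (u Y) \<alpha>"
   by (rule aru[OF a(1) sub(2)[OF a(2)]]) (use a GI[OF a(2)] pu2[OF a] in \<open>auto simp: P_def obI\<close>)
  then show "arm (gmap_comp C (EQ C I Q) l (EQ_incl C I Q) Y) \<alpha> = arm (u Y) \<alpha>"
   using a sub by (simp add: l2 EQ_incl_def)
 qed (simp add: EQ_incl_def l1 sub obI)
 moreover have "gmap_comp C (EQ C J Q') p l = v"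
  by (rule gmap_eqI[OF gmap_comp_map[OF lm m] v]) (use ob arD in \<open>auto simp: l1 l2\<close>)
 ultimately show "\<exists>l. grpd_map C (EQ C J Q') E l \<and> gmap_comp C (EQ C I Q) l (EQ_incl C I Q) = u \<and> gmap_comp C (EQ C J Q') p l = v"
  using lm by blast
qed

text \<open>The new map sends \<open>b\<close> to the codomain of \<open>\<xi>\<close> and
  conjugates arrows by \<open>\<xi>\<close>; compatibility with restriction is inherited from
  \<open>\<xi>\<close>.\<close>

lemma conj_map:
 assumes c: "grpd_map C B W \<chi>"
  and x: "!!Y b. Y \<in> Obj C ==> b \<in> Obj (sect B Y) ==> \<xi> Y b \<in> Arr (sect W Y) \<and> Dom (sect W Y) (\<xi> Y b) = obm (\<chi> Y) b"
  and n: "!!h b. h \<in> Arr C ==> b \<in> Obj (sect B (Cod C h)) ==> \<xi> (Dom C h) (obm (rst B h) b) = arm (rst W h) (\<xi> (Cod C h) b)"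
 shows "\<exists>\<psi>. hty C B W \<chi> (res2 C B \<xi>) \<psi>"
proof -
 note [simp] = gmapD[OF c] gpshD[OF gmapD(1)[OF c]] gpshD[OF gmapD(2)[OF c]]
 define ar where "ar Y \<beta> = Comp (sect W Y) (\<xi> Y (Cod (sect B Y) \<beta>)) (Comp (sect W Y) (arm (\<chi> Y) \<beta>) (ginv (sect W Y) (\<xi> Y (Dom (sect B Y) \<beta>))))" for Y \<beta>
 define \<psi> where "\<psi> = (\<lambda>Y \<in> Obj C. \<lparr>obm = (\<lambda>b \<in> Obj (sect B Y). Cod (sect W Y) (\<xi> Y b)), arm = restrict (ar Y) (Arr (sect B Y))\<rparr>)"
 have l1: "Y \<in> Obj C ==> b \<in> Obj (sect B Y) ==> obm (\<psi> Y) b = Cod (sect W Y) (\<xi> Y b)"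
  and l2: "Y \<in> Obj C ==> \<beta> \<in> Arr (sect B Y) ==> arm (\<psi> Y) \<beta> = ar Y \<beta>" for Y b \<beta>
  by (auto simp: \<psi>_def)
 note [simp] = l1 l2
 note [simp] = x[THEN conjunct1] x[THEN conjunct2] n
 have "grpd_map C B W \<psi>"
  by (rule gmapI) (auto simp: ar_def comp_assoc, auto simp: \<psi>_def)
 then have "hty C B W \<chi> (res2 C B \<xi>) \<psi>"
  by (intro hty_res2I) (auto simp: c ar_def comp_assoc)
 then show ?thesis by blast
qed

text \<open>The augmentation of \<open>EQ\<close> to \<open>X\<close>: the arrow into
  \<open>X\<close> that an object stands for.\<close>

definition vl :: "('o, 'a) cat => (nat \<times> 'a) \<times> 'a => 'a" where
 "vl C a = Comp C (snd (fst a)) (snd a)"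

lemma vl_pair [simp]: "vl C (i, k) = Comp C (snd i) k"
 by (simp add: vl_def)

lemma EQ_Obj_iff: "a \<in> Obj (sect (EQ C I Q) Y) \<longleftrightarrow> fst a \<in> I \<and> snd a \<in> Hom C Y (Dom C (snd (fst a)))"
 by (cases a) simp

lemma EQ_Arr_iff: "(a, b) \<in> Arr (sect (EQ C I Q) Y) \<longleftrightarrow> a \<in> Obj (sect (EQ C I Q) Y) \<and> b \<in> Obj (sect (EQ C I Q) Y)
  \<and> vl C a = vl C b \<and> (fst a = fst b \<or> vl C a \<in> Q)"
 by (cases a; cases b) auto

lemma vl_arr:
 assumes "EQ_data C X I Q" "a \<in> Obj (sect (EQ C I Q) Y)"
 shows "vl C a \<in> Arr C" "Dom C (vl C a) = Y" "Cod C (vl C a) = X"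
 using assms EQ_dataD[OF assms(1)] by (auto simp: EQ_Obj_iff Hom_iff vl_def)

lemma vl_rst:
 assumes "EQ_data C X I Q" "a \<in> Obj (sect (EQ C I Q) Y)" "l \<in> Arr C" "Cod C l = Y"
 shows "vl C (obm (rst (EQ C I' Q') l) a) = Comp C (vl C a) l"
 using assms EQ_dataD[OF assms(1)] by (cases a) (auto simp: Hom_iff comp_assoc)

text \<open>Maps that collapse all isomorphisms of \<open>EQ\<close> to identities, which is
  possible when isomorphic objects have the same image. The lifting problems for fibrations with
  discrete fibers are built from them.\<close>

definition disc_map :: "('o, 'a) cat => (nat \<times> 'a) set => 'a set => ('o, 'a, 'p, 'q) gpsh => ('o => (nat \<times> 'a) \<times> 'a => 'p)
  => ('o, (nat \<times> 'a) \<times> 'a, ((nat \<times> 'a) \<times> 'a) \<times> ((nat \<times> 'a) \<times> 'a), 'p, 'q) gmap" where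
 "disc_map C I Q W ob = (\<lambda>Y \<in> Obj C. \<lparr>obm = restrict (ob Y) (Obj (sect (EQ C I Q) Y)),
  arm = (\<lambda>\<alpha> \<in> Arr (sect (EQ C I Q) Y). Idt (sect W Y) (ob Y (fst \<alpha>)))\<rparr>)"

lemma disc_map_simps [simp]:
 "[|Y \<in> Obj C; a \<in> Obj (sect (EQ C I Q) Y)|] ==> obm (disc_map C I Q W ob Y) a = ob Y a"
 "[|Y \<in> Obj C; \<alpha> \<in> Arr (sect (EQ C I Q) Y)|] ==> arm (disc_map C I Q W ob Y) \<alpha> = Idt (sect W Y) (ob Y (fst \<alpha>))"
 by (auto simp: disc_map_def)

lemma disc_map_map:
 assumes D: "EQ_data C X I Q" and W: "grpd_presheaf C W"
  and o: "!!Y a. Y \<in> Obj C ==> a \<in> Obj (sect (EQ C I Q) Y) ==> ob Y a \<in> Obj (sect W Y)"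
  and r: "!!h a. h \<in> Arr C ==> a \<in> Obj (sect (EQ C I Q) (Cod C h)) ==> ob (Dom C h) (obm (rst (EQ C I Q) h) a) = obm (rst W h) (ob (Cod C h) a)"
  and e: "!!Y a b. Y \<in> Obj C ==> (a, b) \<in> Arr (sect (EQ C I Q) Y) ==> ob Y a = ob Y b"
 shows "grpd_map C (EQ C I Q) W (disc_map C I Q W ob)"
proof -
 note [simp] = gpshD[OF EQ_gpsh[OF D]] gpshD[OF W]
 have G: "fst \<alpha> \<in> Obj (sect (EQ C I Q) Y)" "snd \<alpha> \<in> Obj (sect (EQ C I Q) Y)" "ob Y (snd \<alpha>) = ob Y (fst \<alpha>)"
  if "Y \<in> Obj C" "\<alpha> \<in> Arr (sect (EQ C I Q) Y)" for Y \<alpha>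
  using that e[of Y "fst \<alpha>" "snd \<alpha>"] EQ_Arr_iff[of "fst \<alpha>" "snd \<alpha>" C I Q Y] by auto
 show ?thesis
 proof (rule gmapI, goal_cases)
  case (8 Y \<alpha> \<beta>)
  have i: "Comp (sect (EQ C I Q) Y) \<beta> \<alpha> \<in> Arr (sect (EQ C I Q) Y)" using 8 by (intro cat_simps(6)) auto
  show ?case using 8 i G[of Y \<alpha>] G[of Y \<beta>] o by simp
 next
  case (7 Y a)
  have i: "Idt (sect (EQ C I Q) Y) a \<in> Arr (sect (EQ C I Q) Y)" using 7 by (intro cat_simps(3)) auto
  show ?case using 7 i by simp
 next
  case (10 h \<alpha>)
  have i: "arm (rst (EQ C I Q) h) \<alpha> \<in> Arr (sect (EQ C I Q) (Dom C h))" using 10 by simp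
  have f: "fst (arm (rst (EQ C I Q) h) \<alpha>) = obm (rst (EQ C I Q) h) (fst \<alpha>)"
   by (cases \<alpha>) (simp add: EQ_arm)
  show ?case using 10 i f G[of "Cod C h" \<alpha>] r o by simp
 qed (use o r G in \<open>auto simp: EQ_gpsh[OF D] W, auto simp: disc_map_def\<close>)
qed

text \<open>The augmentation \<open>vl\<close> followed by the map from \<open>X\<close> to
  \<open>W\<close> that \<open>x\<close> represents.\<close>

abbreviation val_map :: "('o, 'a) cat => (nat \<times> 'a) set => 'a set => ('o, 'a, 'p, 'q) gpsh => 'p
  => ('o, (nat \<times> 'a) \<times> 'a, ((nat \<times> 'a) \<times> 'a) \<times> ((nat \<times> 'a) \<times> 'a), 'p, 'q) gmap" where
 "val_map C I Q W x \<equiv> disc_map C I Q W (\<lambda>Y a. obm (rst W (vl C a)) x)"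

lemma val_map_map:
 assumes D: "EQ_data C X I Q" and W: "grpd_presheaf C W" and x: "x \<in> Obj (sect W X)"
 shows "grpd_map C (EQ C I Q) W (val_map C I Q W x)"
proof -
 note [simp] = gpshD[OF W] EQ_dataD[OF D]
 show ?thesis
  by (rule disc_map_map[OF D W]) (use x in \<open>auto simp: EQ_Arr_iff vl_arr[OF D] vl_rst[OF D]\<close>)
qed

context psite begin

text \<open>Over the covering sieve \<open>K\<close> every object of the larger presheaf is
  isomorphic to an object of the smaller one with the same value in \<open>X\<close>. A homotopy on
  the smaller presheaf therefore has a forced value on these pieces of each new object, and
  \<open>hom_sheaf\<close> glues the pieces. Essential surjectivity is the last assumption.\<close>

lemma EQ_ff_es:
 assumes D: "EQ_data C X I Q" "EQ_data C X J UNIV" and IJ: "I \<subseteq> J"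
  and W: "grpd_presheaf C W" "hom_sheaf C Cov W"
  and K: "cs X K" "!!r. r \<in> K ==> r \<in> Q \<and> (\<exists>a \<in> Obj (sect (EQ C I Q) (src r)). vl C a = r)"
  and es: "!!\<omega>. grpd_map C (EQ C I Q) W \<omega> ==> \<exists>x \<in> Obj (sect W X). \<exists>\<delta>. hty C (EQ C I Q) W (val_map C I Q W x) \<delta> \<omega>"
 shows "ff_es C (EQ C I Q) (EQ C J UNIV) (EQ_incl C I Q) W"
 unfolding ff_es_def
proof (intro conjI allI impI, goal_cases)
 let ?I = "EQ C I Q" and ?J = "EQ C J UNIV" and ?j = "EQ_incl C I Q"
 note EI = EQ_gpsh[OF D(1)] and EJ = EQ_gpsh[OF D(2)]
 note EIs = gpshD[OF EI] and EJs = gpshD[OF EJ]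
 note jm = EQ_incl_map[OF D IJ subset_UNIV]
 note [simp] = gpshD[OF W(1)]
 note K' = csvD[OF K(1)]
 have sub: "a \<in> Obj (sect ?I Y) ==> a \<in> Obj (sect ?J Y)" for a Y
  using IJ by (auto simp: EQ_Obj_iff)
 have subA: "\<alpha> \<in> Arr (sect ?I Y) ==> \<alpha> \<in> Arr (sect ?J Y)" for \<alpha> Y
  using sub by (cases \<alpha>) (auto simp only: EQ_Arr_iff UNIV_I)
 have rr: "obm (rst ?J h) a = obm (rst ?I h) a" for h a by (simp add: EQ_def)
 note vlJ = vl_arr[OF D(2)] and vlI = vl_arr[OF D(1)]
 have j1: "ob Y ==> a \<in> Obj (sect ?I Y) ==> obm (?j Y) a = a"
  and j2: "ob Y ==> \<alpha> \<in> Arr (sect ?I Y) ==> arm (?j Y) \<alpha> = \<alpha>" for Y a \<alpha>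
  by (simp_all add: EQ_incl_def)
 {
  case 1 show ?case by (rule jm)
 next
  case (2 \<omega>)
  obtain x \<delta> where x: "x \<in> Obj (sect W X)" and d: "hty C ?I W (val_map C I Q W x) \<delta> \<omega>" using es[OF 2] by blast
  \<comment> \<open>The old generators are moved by \<open>\<delta>\<close> and the new ones stay
    fixed; conjugation then turns the map given by \<open>x\<close> into one whose restriction is
    homotopic to \<open>\<omega>\<close>.\<close>
  let ?\<xi> = "\<lambda>Y a. if fst a \<in> I then \<delta> Y a else Idt (sect W Y) (obm (rst W (vl C a)) x)"
  have v: "grpd_map C ?J W (val_map C J UNIV W x)" by (rule val_map_map[OF D(2) W(1) x])
  have "\<exists>\<psi>. hty C ?J W (val_map C J UNIV W x) (res2 C ?J ?\<xi>) \<psi>"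
  proof (rule conj_map[OF v], goal_cases)
   case (1 Y a)
   have "fst a \<in> I ==> a \<in> Obj (sect ?I Y)" using 1 by (auto simp: EQ_Obj_iff)
   then show ?case using 1 x htyD(3,4)[OF d, of Y a] by (auto simp: vlJ)
  next
   case (2 h a)
   have "fst a \<in> I ==> a \<in> Obj (sect ?I (tgt h))" using 2 by (auto simp: EQ_Obj_iff)
   moreover have "fst (obm (rst ?J h) a) = fst a" by (cases a) simp
   ultimately show ?case using 2 x htyD(6)[OF d, of h "src h" a] by (auto simp: rr vlJ vl_rst[OF D(2)])
  qed
  then obtain \<psi> where h: "hty C ?J W (val_map C J UNIV W x) (res2 C ?J ?\<xi>) \<psi>" by blast
  have "gmap_comp C ?I (val_map C J UNIV W x) ?j = val_map C I Q W x"
   by (rule gmap_eqI[OF gmap_comp_map[OF jm v] val_map_map[OF D(1) W(1) x]]) (auto simp: j1 j2 sub subA)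
  then have "hty C ?I W (val_map C I Q W x) (res2 C ?I (\<lambda>Y a. res2 C ?J ?\<xi> Y (obm (?j Y) a))) (gmap_comp C ?I \<psi> ?j)"
   using hty_pre[OF h jm] by simp
  from hty_comp[OF hty_inv[OF this] d] htyD(2)[OF h] show ?case by blast
 next
  case (3 \<psi> \<psi>' \<theta>)
  then have p: "grpd_map C ?J W \<psi>" and p': "grpd_map C ?J W \<psi>'"
   and h: "hty C ?I W (gmap_comp C ?I \<psi> ?j) \<theta> (gmap_comp C ?I \<psi>' ?j)" by auto
  have AJ: "(a, b) \<in> Arr (sect ?J Z) \<longleftrightarrow> a \<in> Obj (sect ?J Z) \<and> b \<in> Obj (sect ?J Z) \<and> vl C a = vl C b" for a b Z
   by (simp only: EQ_Arr_iff UNIV_I simp_thms)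
  have pin: "arm (\<psi> Z) (a, b) \<in> Arr (sect W Z)" "Dom (sect W Z) (arm (\<psi> Z) (a, b)) = obm (\<psi> Z) a"
   "Cod (sect W Z) (arm (\<psi> Z) (a, b)) = obm (\<psi> Z) b" "arm (\<psi>' Z) (a, b) \<in> Arr (sect W Z)" "Dom (sect W Z) (arm (\<psi>' Z) (a, b)) = obm (\<psi>' Z) a"
   "Cod (sect W Z) (arm (\<psi>' Z) (a, b)) = obm (\<psi>' Z) b"
   if "ob Z" "a \<in> Obj (sect ?J Z)" "b \<in> Obj (sect ?J Z)" "vl C a = vl C b" for Z a b
   using gmapD(5-7)[OF p, of Z "(a,b)"] gmapD(5-7)[OF p', of Z "(a,b)"] that by (simp_all add: AJ)
  have pc: "Comp (sect W Z) (arm (\<psi> Z) (b, c)) (arm (\<psi> Z) (a, b)) = arm (\<psi> Z) (a, c)"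
   "Comp (sect W Z) (arm (\<psi>' Z) (b, c)) (arm (\<psi>' Z) (a, b)) = arm (\<psi>' Z) (a, c)"
   if "ob Z" "a \<in> Obj (sect ?J Z)" "b \<in> Obj (sect ?J Z)" "c \<in> Obj (sect ?J Z)" "vl C a = vl C b" "vl C b = vl C c" for Z a b c
   using gmapD(9)[OF p, of Z "(a,b)" "(b,c)"] gmapD(9)[OF p', of Z "(a,b)" "(b,c)"] that by (simp_all add: AJ)
  have pid: "arm (\<psi> Z) (a, a) = Idt (sect W Z) (obm (\<psi> Z) a)" "arm (\<psi>' Z) (a, a) = Idt (sect W Z) (obm (\<psi>' Z) a)"
   if "ob Z" "a \<in> Obj (sect ?J Z)" for Z a
   using gmapD(8)[OF p that] gmapD(8)[OF p' that] by simp_all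
  have pr: "arm (rst W l) (arm (\<psi> (tgt l)) (a, b)) = arm (\<psi> (src l)) (obm (rst ?J l) a, obm (rst ?J l) b)"
   "arm (rst W l) (arm (\<psi>' (tgt l)) (a, b)) = arm (\<psi>' (src l)) (obm (rst ?J l) a, obm (rst ?J l) b)"
   if "arr l" "a \<in> Obj (sect ?J (tgt l))" "b \<in> Obj (sect ?J (tgt l))" "vl C a = vl C b" for l a b
   using gmapD(11)[OF p that(1) refl, of "(a,b)"] gmapD(11)[OF p' that(1) refl, of "(a,b)"] that by (simp_all add: AJ EQ_arm)
  have po: "obm (\<psi> Z) a \<in> Obj (sect W Z)" "obm (\<psi>' Z) a \<in> Obj (sect W Z)" if "ob Z" "a \<in> Obj (sect ?J Z)" for Z a
   using gmapD(4)[OF p that] gmapD(4)[OF p' that] by auto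
  have por: "obm (\<psi> (src l)) (obm (rst ?J l) a) = obm (rst W l) (obm (\<psi> (tgt l)) a)"
    "obm (\<psi>' (src l)) (obm (rst ?J l) a) = obm (rst W l) (obm (\<psi>' (tgt l)) a)" if "arr l" "a \<in> Obj (sect ?J (tgt l))" for l a
   using gmapD(10)[OF p that(1) refl that(2)] gmapD(10)[OF p' that(1) refl that(2)] by auto
  have th: "\<theta> Z a \<in> Arr (sect W Z)" "Dom (sect W Z) (\<theta> Z a) = obm (\<psi> Z) a" "Cod (sect W Z) (\<theta> Z a) = obm (\<psi>' Z) a"
   if "ob Z" "a \<in> Obj (sect ?I Z)" for Z a
   using htyD(3-5)[OF h that] that by (simp_all add: j1 gmap_comp_simps)
  \<comment> \<open>The forced value at \<open>b\<close>: pass to \<open>a\<close> by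
    \<open>\<psi>\<close>, apply \<open>\<theta>\<close> there, return by
    \<open>\<psi>'\<close>.\<close>
  define T where "T Z b a = Comp (sect W Z) (arm (\<psi>' Z) (a, b)) (Comp (sect W Z) (\<theta> Z a) (arm (\<psi> Z) (b, a)))" for Z b a
  have T1: "T Z b a \<in> Arr (sect W Z)" "Dom (sect W Z) (T Z b a) = obm (\<psi> Z) b" "Cod (sect W Z) (T Z b a) = obm (\<psi>' Z) b"
   if "ob Z" "b \<in> Obj (sect ?J Z)" "a \<in> Obj (sect ?I Z)" "vl C a = vl C b" for Z a b
   using that pin[OF that(1) sub[OF that(3)] that(2,4)] pin[OF that(1,2) sub[OF that(3)] that(4)[symmetric]] th[OF that(1,3)]
   by (auto simp: T_def)
  \<comment> \<open>Two possible partners of \<open>b\<close> are joined by an arrow of the smaller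
    presheaf, since their common value lies in \<open>Q\<close>; naturality of
    \<open>\<theta>\<close> along it gives equality.\<close>
  have T2: "T Z b a = T Z b a'"
   if z: "ob Z" "b \<in> Obj (sect ?J Z)" "a \<in> Obj (sect ?I Z)" "vl C a = vl C b" "a' \<in> Obj (sect ?I Z)" "vl C a' = vl C b" "vl C b \<in> Q" for Z a b a'
  proof -
   have a: "(a, a') \<in> Arr (sect ?I Z)" using z by (simp add: EQ_Arr_iff)
   have n: "Comp (sect W Z) (\<theta> Z a') (arm (\<psi> Z) (a, a')) = Comp (sect W Z) (arm (\<psi>' Z) (a, a')) (\<theta> Z a)"
    using hty_nat[OF h z(1) a] z a by (simp add: j2)
   have "T Z b a' = Comp (sect W Z) (arm (\<psi>' Z) (a', b)) (Comp (sect W Z) (\<theta> Z a') (Comp (sect W Z) (arm (\<psi> Z) (a, a')) (arm (\<psi> Z) (b, a))))"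
    unfolding T_def using z sub by (simp add: pc)
   also have "\<dots> = Comp (sect W Z) (arm (\<psi>' Z) (a', b)) (Comp (sect W Z) (Comp (sect W Z) (\<theta> Z a') (arm (\<psi> Z) (a, a'))) (arm (\<psi> Z) (b, a)))"
    using z sub by (simp add: comp_assoc pin th)
   also have "\<dots> = Comp (sect W Z) (Comp (sect W Z) (arm (\<psi>' Z) (a', b)) (arm (\<psi>' Z) (a, a'))) (Comp (sect W Z) (\<theta> Z a) (arm (\<psi> Z) (b, a)))"
    unfolding n using z sub by (simp add: comp_assoc pin th)
   also have "\<dots> = T Z b a" unfolding T_def using z sub by (simp add: pc)
   finally show ?thesis by simp
  qed
  have T3: "arm (rst W l) (T (tgt l) b a) = T (src l) (obm (rst ?J l) b) (obm (rst ?I l) a)"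
   if z: "arr l" "b \<in> Obj (sect ?J (tgt l))" "a \<in> Obj (sect ?I (tgt l))" "vl C a = vl C b" for l a b
   using z sub[OF z(3)] pr[OF z(1,2) sub[OF z(3)]] pr[OF z(1) sub[OF z(3)] z(2)] htyD(6)[OF h z(1) refl z(3)]
   unfolding T_def by (simp add: pin th rr)
  have T4: "Comp (sect W Z) (T Z b' a) (arm (\<psi> Z) (b, b')) = Comp (sect W Z) (arm (\<psi>' Z) (b, b')) (T Z b a)"
   if z: "ob Z" "b \<in> Obj (sect ?J Z)" "a \<in> Obj (sect ?I Z)" "vl C a = vl C b" "b' \<in> Obj (sect ?J Z)" "vl C b' = vl C b" for Z a b b'
  proof -
   have "Comp (sect W Z) (T Z b' a) (arm (\<psi> Z) (b, b')) = Comp (sect W Z) (arm (\<psi>' Z) (a, b')) (Comp (sect W Z) (\<theta> Z a) (arm (\<psi> Z) (b, a)))"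
    unfolding T_def using z sub[OF z(3)] by (simp add: comp_assoc pin th pc)
   also have "\<dots> = Comp (sect W Z) (Comp (sect W Z) (arm (\<psi>' Z) (b, b')) (arm (\<psi>' Z) (a, b))) (Comp (sect W Z) (\<theta> Z a) (arm (\<psi> Z) (b, a)))"
    using z sub[OF z(3)] by (simp add: pc)
   also have "\<dots> = Comp (sect W Z) (arm (\<psi>' Z) (b, b')) (T Z b a)"
    unfolding T_def using z sub[OF z(3)] by (simp add: comp_assoc pin th)
   finally show ?thesis .
  qed
  have "\<forall>r \<in> K. \<exists>a. a \<in> Obj (sect ?I (src r)) \<and> vl C a = r" using K(2) by blast
  from bchoice[OF this] obtain q where q: "!!r. r \<in> K ==> q r \<in> Obj (sect ?I (src r))" "!!r. r \<in> K ==> vl C (q r) = r" by blast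
  \<comment> \<open>The arrows over which \<open>b\<close> acquires a partner in the smaller
    presheaf; \<open>t b l\<close> below is the forced value there.\<close>
  define P where "P Y b = {l \<in> into C Y. cmp (vl C b) l \<in> K}" for Y b
  have P: "cs Y (P Y b)" if "ob Y" "b \<in> Obj (sect ?J Y)" for Y b
   unfolding P_def by (rule cs_pull[OF K(1)]) (use vlJ[OF that(2)] in auto)
  define t where "t b l = T (src l) (obm (rst ?J l) b) (q (cmp (vl C b) l))" for b l
  \<comment> \<open>The chosen partner may be replaced by any other one. This is what makes
    \<open>t b\<close> compatible with restriction, as \<open>q\<close> itself is not.\<close>
  have tT: "t b l = T (src l) (obm (rst ?J l) b) a"
   if "ob Y" "b \<in> Obj (sect ?J Y)" "l \<in> P Y b" "a \<in> Obj (sect ?I (src l))" "vl C a = cmp (vl C b) l" for Y b l a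
   unfolding t_def using that EJs vl_rst[OF D(2) that(2), of l] q[of "cmp (vl C b) l"] vlJ[OF that(2)] K(2)[of "cmp (vl C b) l"]
   by (intro T2) (auto simp: P_def)
  have qP: "q (cmp (vl C b) l) \<in> Obj (sect ?I (src l))" "vl C (q (cmp (vl C b) l)) = cmp (vl C b) l"
   if "b \<in> Obj (sect ?J Y)" "l \<in> P Y b" for Y b l
   using that q[of "cmp (vl C b) l"] vlJ[OF that(1)] by (auto simp: P_def)
  have ex: "\<exists>\<chi>. \<chi> \<in> Arr (sect W Y) \<and> Dom (sect W Y) \<chi> = obm (\<psi> Y) b \<and> Cod (sect W Y) \<chi> = obm (\<psi>' Y) b \<and> (\<forall>l \<in> P Y b. arm (rst W l) \<chi> = t b l)"
   if Y: "ob Y" and b: "b \<in> Obj (sect ?J Y)" for Y b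
  proof -
   obtain \<chi> where "\<chi> \<in> Arr (sect W Y)" "Dom (sect W Y) \<chi> = obm (\<psi> Y) b" "Cod (sect W Y) \<chi> = obm (\<psi>' Y) b" "!!l. l \<in> P Y b ==> arm (rst W l) \<chi> = t b l"
   proof (rule hom_sheaf_ex[OF W(2) P[OF Y b] po[OF Y b], where \<phi>="t b"], goal_cases)
    case (1 l)
    then have l: "arr l" "tgt l = Y" by (auto simp: P_def)
    show ?case unfolding t_def
     using T1[of "src l" "obm (rst ?J l) b" "q (cmp (vl C b) l)"] l b qP[OF b 1(2)] vl_rst[OF D(2) b l] por[of l b] EJs by auto
   next
    case (2 l k)
    then have l: "arr l" "tgt l = Y" by (auto simp: P_def)
    have lk: "cmp l k \<in> P Y b" using csvD(4)[OF P[OF Y b] 2(2-4)] .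
    have bl: "obm (rst ?J l) b \<in> Obj (sect ?J (src l))" using l b EJs by simp
    have "arm (rst W k) (t b l) = T (src k) (obm (rst ?J k) (obm (rst ?J l) b)) (obm (rst ?I k) (q (cmp (vl C b) l)))"
     unfolding t_def using T3[OF 2(3), of "obm (rst ?J l) b" "q (cmp (vl C b) l)"] 2(4) bl qP[OF b 2(2)] vl_rst[OF D(2) b l] by simp
    also have "\<dots> = t b (cmp l k)"
     using tT[OF Y b lk, of "obm (rst ?I k) (q (cmp (vl C b) l))"] qP[OF b 2(2)] l 2(2-4) b EIs EJs
      vl_rst[OF D(1) qP(1)[OF b 2(2)], of k] vlJ[OF b] by (simp add: comp_assoc)
    finally show ?case by simp
   qed blast
   then show ?thesis by blast
  qed
  define \<Theta> where "\<Theta> Y b = (SOME \<chi>. \<chi> \<in> Arr (sect W Y) \<and> Dom (sect W Y) \<chi> = obm (\<psi> Y) b \<and> Cod (sect W Y) \<chi> = obm (\<psi>' Y) b \<and>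
   (\<forall>l \<in> P Y b. arm (rst W l) \<chi> = t b l))" for Y b
  have TH: "\<Theta> Y b \<in> Arr (sect W Y)" "Dom (sect W Y) (\<Theta> Y b) = obm (\<psi> Y) b" "Cod (sect W Y) (\<Theta> Y b) = obm (\<psi>' Y) b"
   "l \<in> P Y b ==> arm (rst W l) (\<Theta> Y b) = t b l" if "ob Y" "b \<in> Obj (sect ?J Y)" for Y b l
   using someI_ex[OF ex[OF that], folded \<Theta>_def] by auto
  have hT: "hty C ?J W \<psi> (res2 C ?J \<Theta>) \<psi>'"
  proof (rule hty_res2I[OF p p'], goal_cases)
   case (1 Y b) then show ?case using TH by auto
  next
   case (2 Y \<alpha>)
   obtain b b' where al: "\<alpha> = (b, b')" by (cases \<alpha>)
   have b: "b \<in> Obj (sect ?J Y)" "b' \<in> Obj (sect ?J Y)" "vl C b = vl C b'" using 2 by (auto simp only: al AJ)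
   have pe: "P Y b' = P Y b" by (simp add: P_def b)
   show ?case
   proof (rule hom_sheaf_unique[OF W(2,1) P[OF 2(1) b(1)]], goal_cases)
    case (5 l)
    then have l: "arr l" "tgt l = Y" by (auto simp: P_def)
    have bl: "obm (rst ?J l) b \<in> Obj (sect ?J (src l))" "obm (rst ?J l) b' \<in> Obj (sect ?J (src l))" using l b EJs by simp_all
    have "Comp (sect W (src l)) (t b' l) (arm (\<psi> (src l)) (obm (rst ?J l) b, obm (rst ?J l) b')) =
     Comp (sect W (src l)) (arm (\<psi>' (src l)) (obm (rst ?J l) b, obm (rst ?J l) b')) (t b l)"
     unfolding t_def using T4[of "src l" "obm (rst ?J l) b" "q (cmp (vl C b) l)" "obm (rst ?J l) b'"] l bl qP[OF b(1) 5]
      vl_rst[OF D(2) b(1) l] vl_rst[OF D(2) b(2) l] by (simp add: b(3))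
    then show ?case using TH(4)[OF 2(1) b(1) 5] TH(4)[OF 2(1) b(2), of l] 5 pe l pr[OF l(1), of b b'] b 2 TH(1-3)[OF 2(1)] pin[OF 2(1) b]
     by (simp add: al)
   qed (use 2 b TH(1-3) pin[OF 2(1) b] in \<open>simp_all add: al\<close>)
  next
   case (3 k b)
   have b: "obm (rst ?J k) b \<in> Obj (sect ?J (src k))" using 3 EJs by simp
   have Y: "tgt k \<in> Obj C" "src k \<in> Obj C" using 3 by auto
   show ?case
   proof (rule hom_sheaf_unique[OF W(2,1) P[OF Y(2) b]], goal_cases)
    case (5 l)
    then have l: "arr l" "tgt l = src k" by (auto simp: P_def)
    have kl: "cmp k l \<in> P (tgt k) b"
     using 5 l 3 vl_rst[OF D(2) 3(2,1) refl] vlJ[OF 3(2)] by (simp add: P_def comp_assoc)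
    have "arm (rst W l) (arm (rst W k) (\<Theta> (tgt k) b)) = t b (cmp k l)"
     using TH(4)[OF Y(1) 3(2) kl] TH(1)[OF Y(1) 3(2)] l 3 by simp
    also have "\<dots> = t (obm (rst ?J k) b) l"
     unfolding t_def using l 3 EJs vl_rst[OF D(2) 3(2,1) refl] vlJ[OF 3(2)] by (simp add: comp_assoc)
    finally show ?case using TH(4)[OF Y(2) b 5] by simp
   qed (use 3 b Y TH(1-3) por[OF 3] in simp_all)
  qed
  \<comment> \<open>Naturality of an arbitrary extension along the arrow from \<open>b\<close> to
    its partner leaves no freedom over the sieve.\<close>
  have key: "\<Theta>' Y b = \<Theta> Y b" if T': "hty C ?J W \<psi> \<Theta>' \<psi>'" "\<forall>X\<in>Obj C. \<forall>a\<in>Obj (sect ?I X). \<Theta>' X a = \<theta> X a"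
   and Y: "ob Y" and b: "b \<in> Obj (sect ?J Y)" for \<Theta>' Y b
  proof (rule hom_sheaf_unique[OF W(2,1) P[OF Y b]], goal_cases)
   case (5 l)
   then have l: "arr l" "tgt l = Y" by (auto simp: P_def)
   let ?b = "obm (rst ?J l) b" and ?a = "q (cmp (vl C b) l)" and ?W = "sect W (src l)"
   note qq = qP[OF b 5]
   have bl: "?b \<in> Obj (sect ?J (src l))" using l b EJs by simp
   have a: "(?b, ?a) \<in> Arr (sect ?J (src l))" using bl qq sub vl_rst[OF D(2) b l] by (simp add: AJ)
   have n: "Comp ?W (\<theta> (src l) ?a) (arm (\<psi> (src l)) (?b, ?a)) = Comp ?W (arm (\<psi>' (src l)) (?b, ?a)) (\<Theta>' (src l) ?b)"
    using hty_nat[OF T'(1) _ a] T'(2) qq l by simp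
   have "t b l = Comp ?W (arm (\<psi>' (src l)) (?a, ?b)) (Comp ?W (arm (\<psi>' (src l)) (?b, ?a)) (\<Theta>' (src l) ?b))"
    unfolding t_def T_def n by simp
   also have "\<dots> = Comp ?W (arm (\<psi>' (src l)) (?b, ?b)) (\<Theta>' (src l) ?b)"
    using l bl qq sub[OF qq(1)] vl_rst[OF D(2) b l] htyD(3-5)[OF T'(1), of "src l" ?b] by (simp flip: comp_assoc add: pc pin)
   also have "\<dots> = \<Theta>' (src l) ?b"
    using l bl htyD(3-5)[OF T'(1), of "src l" ?b] by (simp add: pid)
   finally show ?case using TH(4)[OF Y b 5] htyD(6)[OF T'(1) l(1) refl, of b] l b by simp
  qed (use htyD(3-5)[OF T'(1) Y b] TH(1-3)[OF Y b] in simp_all)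
  show ?case
  proof (rule ex1I, rule conjI[OF hT], goal_cases)
   case 1
   show ?case
   proof (intro ballI)
    fix Y a assume Y: "ob Y" and a: "a \<in> Obj (sect ?I Y)"
    note b = sub[OF a]
    have "\<Theta> Y a = \<theta> Y a"
    proof (rule hom_sheaf_unique[OF W(2,1) P[OF Y b]], goal_cases)
     case (5 l)
     then have l: "arr l" "tgt l = Y" by (auto simp: P_def)
     have al: "obm (rst ?I l) a \<in> Obj (sect ?I (src l))" using a l EIs by simp
     have "t a l = T (src l) (obm (rst ?J l) a) (obm (rst ?I l) a)"
      by (rule tT[OF Y b 5 al]) (use vl_rst[OF D(1) a l] in simp)
     also have "\<dots> = \<theta> (src l) (obm (rst ?I l) a)"
      unfolding T_def rr using l al sub[OF al] by (simp add: pid th)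
     finally show ?case using TH(4)[OF Y b 5] htyD(6)[OF h l(1) refl, of a] l a by simp
    qed (use TH(1-3)[OF Y b] th[OF Y a] in simp_all)
    then show "res2 C ?J \<Theta> Y (obm (?j Y) a) = \<theta> Y a" using Y a b by (simp add: j1)
   qed
  next
   case (2 \<Theta>')
   then have "\<forall>X\<in>Obj C. \<forall>a\<in>Obj (sect ?I X). \<Theta>' X a = \<theta> X a" by (auto simp: j1)
   then show ?case using 2 key by (intro hty_eqI[OF conjunct1[OF 2] hT]) auto
  qed
 }
qed

end

locale uni_site = psite C Cov + set_universe C enc
 for C :: "('o, 'a) cat" and Cov and enc :: "'u \<times> 'u => 'u"
begin

lemma coded_exists:
 fixes V :: "('o, 'a, 'p, 'q) gpsh"
 assumes V: "grpd_presheaf C V"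
  and p: "!!X. ob X ==> Obj (sect V X) \<lesssim> (UNIV :: 'u set)"
  and q: "!!X. ob X ==> Arr (sect V X) \<lesssim> (UNIV :: 'u set)"
 obtains V' :: "('o, 'a, 'u) ugpsh" and \<kappa> \<kappa>' where "giso C V V' \<kappa> \<kappa>'"
proof -
 have "\<forall>X. \<exists>f :: 'p => 'u. ob X --> inj_on f (Obj (sect V X))" using p unfolding lepoll_def by blast
 then obtain cp :: "'o => 'p => 'u" where cp: "!!X. ob X ==> inj_on (cp X) (Obj (sect V X))" by metis
 have "\<forall>X. \<exists>f :: 'q => 'u. ob X --> inj_on f (Arr (sect V X))" using q unfolding lepoll_def by blast
 then obtain cq :: "'o => 'q => 'u" where cq: "!!X. ob X ==> inj_on (cq X) (Arr (sect V X))" by metis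
 show ?thesis by (rule that[OF coded_giso[OF V cp cq]])
qed

lemma EQ_coded:
 assumes D: "EQ_data C X I Q"
 obtains A :: "('o, 'a, 'u) ugpsh" and \<kappa> \<kappa>' where "giso C (EQ C I Q) A \<kappa> \<kappa>'"
proof (rule coded_exists[OF EQ_gpsh[OF D]])
 have o: "Obj (sect (EQ C I Q) Y) \<lesssim> (UNIV :: 'u set)" for Y
 proof (rule lepoll_image[OF lepoll_Times[OF lepoll_Times[OF lepoll_nat[of UNIV] lepoll_Arr] lepoll_Arr], where f="\<lambda>x. x"])
  show "Obj (sect (EQ C I Q) Y) \<subseteq> (\<lambda>x. x) ` ((UNIV \<times> Arr C) \<times> Arr C)"
   using EQ_dataD(3)[OF D] by (auto simp: Hom_iff)
 qed
 show "Arr (sect (EQ C I Q) Y) \<lesssim> (UNIV :: 'u set)" for Y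
  by (rule lepoll_image[OF lepoll_Times[OF o[of Y] o[of Y]], where f="\<lambda>x. x"]) (auto simp only: EQ_Arr_iff image_ident mem_Times_iff fst_conv snd_conv)
 show "Obj (sect (EQ C I Q) Y) \<lesssim> (UNIV :: 'u set)" for Y by (rule o)
qed

text \<open>The empty presheaf is \<open>EQ\<close> without generators, so cofibrancy of every
  \<open>EQ\<close> is an instance of the lifting property of inclusions.\<close>

lemma empty_giso:
 obtains \<kappa> \<kappa>' where "giso C (empty_gpsh :: ('o, 'a, 'u) ugpsh) (EQ C {} {}) \<kappa> \<kappa>'"
proof -
 let ?E = "empty_gpsh :: ('o, 'a, 'u) ugpsh"
 have D: "ob X ==> EQ_data C X {} {}" for X by (simp add: EQ_data_def)
 have s: "Obj (sect ?E X) = {}" "Arr (sect ?E X) = {}" "Obj (sect (EQ C {} {}) X) = {}" "Arr (sect (EQ C {} {}) X) = {}" for X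
  by (auto simp: empty_gpsh_def EQ_def)
 have g1: "groupoid (sect ?E X)" for X by (rule groupoidI, rule categoryI) (auto simp: s)
 have g2: "groupoid (sect (EQ C {} {}) X)" for X by (rule EQ_groupoid) simp
 note g = g1 g2
 have e: "grpd_presheaf C ?E" "grpd_presheaf C (EQ C {} {})"
  by (rule gpshI; auto simp: s g)+
 show ?thesis
  by (rule that[of "\<lambda>X \<in> Obj C. \<lparr>obm = \<lambda>_. undefined, arm = \<lambda>_. undefined\<rparr>" "\<lambda>X \<in> Obj C. \<lparr>obm = \<lambda>_. undefined, arm = \<lambda>_. undefined\<rparr>"],
   rule gisoI; (rule gmapI)?) (auto simp: s e)
qed

lemma levelwise_equivalence_id: "grpd_presheaf C A ==> levelwise_equivalence C A A (gmap_id C A)"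
 unfolding levelwise_equivalence_def
proof (intro conjI ballI gmap_id_map)
 fix X assume "grpd_presheaf C A" "ob X"
 then show "is_equivalence (sect A X) (sect A X) (gmap_id C A X)"
  using ftor_id_equivalence[of "sect A X"] gpshD(2)[of C A X] by (simp add: gmap_id_def)
qed

text \<open>Local fibrations are tested only against maps between presheaves with values in
  \<open>'u\<close>. The inclusion is therefore replaced by a coded copy \<open>j\<close>, which is
  a cofibration and a local equivalence, and the lifting property is carried back along the
  isomorphisms.\<close>

lemma local_fibration_EQ_lifts:
 fixes E H :: "('o, 'a, 'u) ugpsh"
 assumes p: "local_fibration C Cov E H p"
  and D: "EQ_data C X I Q" "EQ_data C X J UNIV" and IJ: "I \<subseteq> J"
  and ff: "!!W :: ('o, 'a, 'u) ugpsh. local_object C Cov W ==> ff_es C (EQ C I Q) (EQ C J UNIV) (EQ_incl C I Q) W"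
 shows "lifts_against C (EQ C I Q) (EQ C J UNIV) (EQ_incl C I Q) E H p"
proof -
 obtain A :: "('o, 'a, 'u) ugpsh" and \<alpha> \<alpha>' where A: "giso C (EQ C I Q) A \<alpha> \<alpha>'" by (rule EQ_coded[OF D(1)])
 obtain B :: "('o, 'a, 'u) ugpsh" and \<beta> \<beta>' where B: "giso C (EQ C J UNIV) B \<beta> \<beta>'" by (rule EQ_coded[OF D(2)])
 obtain \<epsilon> \<epsilon>' where E: "giso C (empty_gpsh :: ('o, 'a, 'u) ugpsh) (EQ C {} {}) \<epsilon> \<epsilon>'" by (rule empty_giso)
 note Am = gisoD(1,2)[OF A] and Bm = gisoD(1,2)[OF B] and Em = gisoD(1)[OF E]
 let ?i = "EQ_incl C I Q"
 note im = EQ_incl_map[OF D IJ subset_UNIV]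
 have D0: "EQ_data C X {} {}" using D(1) by (simp add: EQ_data_def)
 define k where "k = gmap_comp C A ?i \<alpha>'"
 define j where "j = gmap_comp C A \<beta> k"
 have km: "grpd_map C A (EQ C J UNIV) k" unfolding k_def by (rule gmap_comp_map[OF Am(2) im])
 have jm: "grpd_map C A B j" unfolding j_def by (rule gmap_comp_map[OF km Bm(1)])
 have pm: "grpd_map C E H p" using p by (simp add: local_fibration_def)
 have cof: "cofibration C A B j"
  unfolding cofibration_def
 proof (intro conjI jm allI impI, elim conjE)
  fix E H :: "('o, 'a, 'u) ugpsh" and p
  assume t: "levelwise_fibration C E H p" "levelwise_equivalence C E H p"
  then have pm: "grpd_map C E H p" by (simp add: levelwise_fibration_def)
  have "lifts_against C A (EQ C J UNIV) k E H p" unfolding k_def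
   by (rule lifts_comp[OF Am(2) im lifts_iso[OF giso_sym[OF A] pm] EQ_incl_lifts[OF D IJ subset_UNIV t] pm])
  then show "lifts_against C A B j E H p" unfolding j_def
   by (rule lifts_comp[OF km Bm(1) _ lifts_iso[OF B pm] pm])
 qed
 have cofibrant: "cofibrant C A'" if A': "giso C (EQ C I' Q') A' \<alpha>1 \<alpha>2" and D': "EQ_data C X I' Q'"
  for A' :: "('o, 'a, 'u) ugpsh" and I' Q' \<alpha>1 \<alpha>2
  unfolding cofibrant_def cofibration_def
 proof (rule exI[of _ "gmap_comp C empty_gpsh \<alpha>1 (gmap_comp C empty_gpsh (EQ_incl C {} {}) \<epsilon>)"], intro conjI allI impI)
  note im0 = EQ_incl_map[OF D0 D' empty_subsetI empty_subsetI]
  note m1 = gmap_comp_map[OF Em im0]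
  show "grpd_map C empty_gpsh A' (gmap_comp C empty_gpsh \<alpha>1 (gmap_comp C empty_gpsh (EQ_incl C {} {}) \<epsilon>))"
   by (rule gmap_comp_map[OF m1 gisoD(1)[OF A']])
  fix E H :: "('o, 'a, 'u) ugpsh" and p
  assume "levelwise_fibration C E H p \<and> levelwise_equivalence C E H p"
  then have t: "levelwise_fibration C E H p" "levelwise_equivalence C E H p" and pm: "grpd_map C E H p"
   by (auto simp: levelwise_fibration_def)
  have "lifts_against C empty_gpsh (EQ C I' Q') (gmap_comp C empty_gpsh (EQ_incl C {} {}) \<epsilon>) E H p"
   by (rule lifts_comp[OF Em im0 lifts_iso[OF E pm] EQ_incl_lifts[OF D0 D' empty_subsetI empty_subsetI t] pm])
  then show "lifts_against C empty_gpsh A' (gmap_comp C empty_gpsh \<alpha>1 (gmap_comp C empty_gpsh (EQ_incl C {} {}) \<epsilon>)) E H p"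
   by (rule lifts_comp[OF m1 gisoD(1)[OF A'] _ lifts_iso[OF A' pm] pm])
 qed
 \<comment> \<open>Both ends of \<open>j\<close> are cofibrant, so \<open>j\<close> serves as its
   own cofibrant approximation, with identities as comparison maps.\<close>
 have "local_equivalence C Cov A B j"
  unfolding local_equivalence_def
 proof (rule conjI[OF jm], rule exI[of _ A], rule exI[of _ B], rule exI[of _ j], rule exI[of _ "gmap_id C A"], rule exI[of _ "gmap_id C B"],
   intro conjI jm allI impI)
  show "cofibrant C A" "cofibrant C B" using cofibrant A B D by blast+
  show "levelwise_equivalence C A A (gmap_id C A)" "levelwise_equivalence C B B (gmap_id C B)"
   using gmapD(1,2)[OF jm] by (auto intro: levelwise_equivalence_id)
  show "gmap_comp C A j (gmap_id C A) = gmap_comp C A (gmap_id C B) j"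
   by (simp add: gmap_comp_id[OF jm])
  fix W :: "('o, 'a, 'u) ugpsh" assume W: "local_object C Cov W"
  then have Wp: "grpd_presheaf C W" by (simp add: local_object_def)
  have "ff_es C A B j W" unfolding j_def k_def
   by (rule ff_es_comp[OF ff_es_comp[OF ff_es_iso[OF giso_sym[OF A] Wp] ff[OF W]] ff_es_iso[OF B Wp]])
  then show "is_equivalence (Map_grpd C B W) (Map_grpd C A W) (Map_precomp C A j)"
   using is_equivalence_precomp_iff[OF jm Wp] by simp
 qed
 then have L: "lifts_against C A B j E H p" using p cof unfolding local_fibration_def by blast
 have L1: "lifts_against C (EQ C I Q) B (gmap_comp C (EQ C I Q) j \<alpha>) E H p"
  by (rule lifts_comp[OF Am(1) jm lifts_iso[OF A pm] L pm])
 have L2: "lifts_against C (EQ C I Q) (EQ C J UNIV) (gmap_comp C (EQ C I Q) \<beta>' (gmap_comp C (EQ C I Q) j \<alpha>)) E H p"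
  by (rule lifts_comp[OF gmap_comp_map[OF Am(1) jm] Bm(2) L1 lifts_iso[OF giso_sym[OF B] pm] pm])
 \<comment> \<open>Removing the codings at both ends of \<open>j\<close> gives back the
   inclusion.\<close>
 have "gmap_comp C (EQ C I Q) \<beta>' (gmap_comp C (EQ C I Q) j \<alpha>) = ?i"
  unfolding j_def k_def using gmap_comp_assoc[OF Am(1) gmap_comp_map[OF Am(2) im] Bm(1)]
   giso_comp_cancel(2)[OF A im] giso_comp_cancel(1)[OF B im] by simp
 then show ?thesis using L2 by simp
qed

text \<open>With all indices equal to 0 and \<open>Q = UNIV\<close>, \<open>EQ\<close> is the nerve
  of \<open>S\<close> up to renaming; \<open>\<kappa>\<close> and \<open>\<kappa>'\<close> are the
  renamings, along which \<open>descent\<close> is carried over.\<close>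

lemma nerve_EQ_ES:
 fixes W :: "('o, 'a, 'p, 'q) gpsh"
 assumes W: "grpd_presheaf C W" "descent C Cov W" and S: "Cov X S"
  and w: "grpd_map C (EQ C ({0} \<times> S) UNIV) W \<omega>"
 shows "\<exists>x \<in> Obj (sect W X). \<exists>\<delta>. hty C (EQ C ({0} \<times> S) UNIV) W (val_map C ({0} \<times> S) UNIV W x) \<delta> \<omega>"
proof -
 let ?E = "EQ C ({0::nat} \<times> S) UNIV" and ?N = "nerve_grpd C S"
 note SX = cov_arrows[OF S]
 note nm = cov_nerve_map[OF S]
 have D: "EQ_data C X ({0} \<times> S) UNIV" using SX by (auto simp: EQ_data_def)
 define \<kappa> where "\<kappa> = (\<lambda>Y \<in> Obj C. \<lparr>obm = (\<lambda>(u, k) \<in> Obj (sect ?N Y). ((0::nat, u), k)), arm = (\<lambda>((u, k), (u', k')) \<in> Arr (sect ?N Y). (((0::nat, u), k), ((0::nat, u'), k')))\<rparr>)"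
 define \<kappa>' where "\<kappa>' = (\<lambda>Y \<in> Obj C. \<lparr>obm = (\<lambda>((n, u), k) \<in> Obj (sect ?E Y). (u, k)), arm = (\<lambda>(((n, u), k), ((n', u'), k')) \<in> Arr (sect ?E Y). ((u, k), (u', k')))\<rparr>)"
 have k: "obm (\<kappa> Y) (u, k) = ((0, u), k)" if "ob Y" "(u, k) \<in> Obj (sect ?N Y)" for Y u k
  using that by (simp add: \<kappa>_def)
 have k2: "arm (\<kappa> Y) ((u, k), (u', k')) = (((0, u), k), ((0, u'), k'))" if "ob Y" "((u, k), (u', k')) \<in> Arr (sect ?N Y)" for Y u k u' k'
  using that by (simp add: \<kappa>_def)
 have k': "obm (\<kappa>' Y) ((n, u), k) = (u, k)" if "ob Y" "((n, u), k) \<in> Obj (sect ?E Y)" for Y u k n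
  using that by (simp add: \<kappa>'_def)
 have k2': "arm (\<kappa>' Y) (((n, u), k), ((n', u'), k')) = ((u, k), (u', k'))" if "ob Y" "(((n, u), k), ((n', u'), k')) \<in> Arr (sect ?E Y)" for Y u k u' k' n n'
  using that by (simp add: \<kappa>'_def)
 note EE = EQ_gpsh[OF D]
 note [simp] = gpshD[OF EE] gpshD[OF nm(2)]
 have rN: "arm (rst ?N h) ((u, k), (u', k')) \<in> Arr (sect ?N (src h))" if "arr h" "((u, k), (u', k')) \<in> Arr (sect ?N (tgt h))" for h u k u' k'
  using that by (intro gpshD(4)[OF nm(2)]) auto
 have rE: "arm (rst ?E h) (((n, u), k), ((n', u'), k')) \<in> Arr (sect ?E (src h))" if "arr h" "(((n, u), k), ((n', u'), k')) \<in> Arr (sect ?E (tgt h))" for h u k u' k' n n'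
  using that by (intro gpshD(4)[OF EE]) auto
 have m1: "grpd_map C ?N ?E \<kappa>"
 proof (rule gmapI, goal_cases)
  case (10 h \<alpha>)
  obtain u k u' k' where e: "\<alpha> = ((u, k), (u', k'))" by (metis prod.exhaust)
  show ?case using 10 rN[of h u k u' k'] k2[of "src h"] k2[of "tgt h"] unfolding e by (simp del: nerve_simps(2))
 qed (auto simp: EE nm(2) k k2, auto simp: \<kappa>_def Hom_iff)
 have m2: "grpd_map C ?E ?N \<kappa>'"
 proof (rule gmapI, goal_cases)
  case (10 h \<alpha>)
  obtain n u k n' u' k' where e: "\<alpha> = (((n, u), k), ((n', u'), k'))" by (metis prod.exhaust)
  show ?case using 10 rE[of h n u k n' u' k'] k2'[of "src h"] k2'[of "tgt h"] unfolding e by (simp del: EQ_simps(2))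
 qed (auto simp: EE nm(2) k' k2', auto simp: \<kappa>'_def Hom_iff)
 have g: "giso C ?N ?E \<kappa> \<kappa>'"
  by (rule gisoI[OF m1 m2]) (auto simp: k k' k2 k2')
 obtain x \<delta> where x: "x \<in> Obj (sect W X)" and d: "hty C ?N W (gmap_comp C ?N (yo C W X x) (nerve_map C S)) \<delta> (gmap_comp C ?N \<omega> \<kappa>)"
  using W(2) S gmap_comp_map[OF m1 w] unfolding descent_def by blast
 have X: "ob X" using SX by simp
 have ym: "grpd_map C (rep C X) W (yo C W X x)" by (rule yo_map[OF W(1) X x])
 have "gmap_comp C ?E (gmap_comp C ?N (yo C W X x) (nerve_map C S)) \<kappa>' = val_map C ({0} \<times> S) UNIV W x"
  by (rule gmap_eqI[OF gmap_comp_map[OF m2 gmap_comp_map[OF nm(1) ym]] val_map_map[OF D W(1) x]])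
   (use SX in \<open>auto simp: k' k2' Hom_iff\<close>)
 then show ?thesis
  using hty_pre[OF d m2] giso_comp_cancel(2)[OF giso_sym[OF g] w] x by auto
qed

text \<open>Gluing: the cylinder of the map from the nerve of \<open>S\<close> to \<open>X\<close>.\<close>

lemma EQ_cover_ff_es:
 fixes W :: "('o, 'a, 'p, 'q) gpsh"
 assumes W: "grpd_presheaf C W" "hom_sheaf C Cov W" "descent C Cov W" and S: "Cov X S"
 shows "ff_es C (EQ C ({0} \<times> S) UNIV) (EQ C (insert (1, Idt C X) ({0} \<times> S)) UNIV) (EQ_incl C ({0} \<times> S) UNIV) W"
proof (rule EQ_ff_es[OF _ _ _ W(1,2) cs_gen[OF S]])
 show "EQ_data C X ({0} \<times> S) UNIV" "EQ_data C X (insert (1, Idt C X) ({0} \<times> S)) UNIV"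
  using cov_arrows[OF S] by (auto simp: EQ_data_def)
 show "r \<in> UNIV \<and> (\<exists>a\<in>Obj (sect (EQ C ({0} \<times> S) UNIV) (src r)). vl C a = r)"
  if r: "r \<in> {cmp u k |u k. u \<in> S \<and> k \<in> pre u}" for r
 proof -
  obtain u k where "u \<in> S" "k \<in> pre u" "r = cmp u k" using r by blast
  then show ?thesis using cov_arrows[OF S] by (intro conjI UNIV_I bexI[of _ "((0, u), k)"]) (auto simp: Hom_iff)
 qed
 show "\<exists>x\<in>Obj (sect W X). \<exists>\<delta>. hty C (EQ C ({0} \<times> S) UNIV) W (val_map C ({0} \<times> S) UNIV W x) \<delta> \<omega>"
  if "grpd_map C (EQ C ({0} \<times> S) UNIV) W \<omega>" for \<omega> by (rule nerve_EQ_ES[OF W(1,3) S that])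
qed auto

text \<open>Uniqueness of gluing: two copies of \<open>X\<close>, identified up to isomorphism over a covering sieve \<open>P\<close>.\<close>

lemma EQ_sieve_ff_es:
 fixes W :: "('o, 'a, 'p, 'q) gpsh"
 assumes W: "grpd_presheaf C W" "hom_sheaf C Cov W" and P: "cs X P"
 shows "ff_es C (EQ C {(1, Idt C X), (2, Idt C X)} P) (EQ C {(1, Idt C X), (2, Idt C X)} UNIV) (EQ_incl C {(1, Idt C X), (2, Idt C X)} P) W"
proof (rule EQ_ff_es[OF _ _ _ W P])
 let ?I = "{(1::nat, Idt C X), (2, Idt C X)}"
 note P' = csvD[OF P]
 note [simp] = gpshD[OF W(1)]
 show D: "EQ_data C X ?I P" and "EQ_data C X ?I UNIV"
  using P' by (auto simp: EQ_data_def)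
 show "r \<in> P \<and> (\<exists>a\<in>Obj (sect (EQ C ?I P) (src r)). vl C a = r)" if "r \<in> P" for r
  using that P' by (auto simp: Hom_iff intro!: bexI[of _ "((1, Idt C X), r)"])
 show "\<exists>x\<in>Obj (sect W X). \<exists>\<delta>. hty C (EQ C ?I P) W (val_map C ?I P W x) \<delta> \<omega>"
  if w: "grpd_map C (EQ C ?I P) W \<omega>" for \<omega>
 proof -
  let ?E = "EQ C ?I P"
  note [simp] = gmapD[OF w]
  \<comment> \<open>The values at the two copies of \<open>X\<close>; \<open>a i j k\<close> below
    is the image of the arrow from copy \<open>i\<close> to copy \<open>j\<close>, which exists over
    \<open>k\<close> in \<open>P\<close>.\<close>
  define x where "x i = obm (\<omega> X) ((i, Idt C X), Idt C X)" for i :: nat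
  have x: "x 1 \<in> Obj (sect W X)" "x 2 \<in> Obj (sect W X)" using P' by (auto simp: x_def Hom_iff)
  have xr: "obm (\<omega> Y) ((i, Idt C X), k) = obm (rst W k) (x i)" if "i = 1 \<or> i = 2" "arr k" "src k = Y" "tgt k = X" for i k Y
   using gmapD(10)[OF w that(2) refl, of "((i, Idt C X), Idt C X)"] that P'(1) by (auto simp: x_def Hom_iff)
  define a where "a i j k = arm (\<omega> (src k)) (((i, Idt C X), k), ((j, Idt C X), k))" for i j :: nat and k
  have A: "(((i, Idt C X), k), ((j, Idt C X), k)) \<in> Arr (sect ?E (src k))" if "i = 1 \<or> i = 2" "j = 1 \<or> j = 2" "k \<in> P" for i j k
   using that P' by (auto simp: Hom_iff)
  have a1: "a i j k \<in> Arr (sect W (src k))" "Dom (sect W (src k)) (a i j k) = obm (rst W k) (x i)" "Cod (sect W (src k)) (a i j k) = obm (rst W k) (x j)"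
   if "i = 1 \<or> i = 2" "j = 1 \<or> j = 2" "k \<in> P" for i j k
   using gmapD(5-7)[OF w _ A[OF that]] that P' xr[of i k] xr[of j k] by (simp_all add: a_def)
  have a2: "arm (rst W l) (a i j k) = a i j (cmp k l)" if "i = 1 \<or> i = 2" "j = 1 \<or> j = 2" "k \<in> P" "arr l" "tgt l = src k" for i j k l
   using gmapD(11)[OF w that(4) refl, of "(((i, Idt C X), k), ((j, Idt C X), k))"] A[OF that(1-3)] that P' by (simp add: a_def del: EQ_simps(2))
  \<comment> \<open>The arrows from copy 1 to copy 2 over \<open>P\<close> match, hence come from an
    arrow over \<open>X\<close>.\<close>
  obtain \<phi> where f: "\<phi> \<in> Arr (sect W X)" "Dom (sect W X) \<phi> = x 1" "Cod (sect W X) \<phi> = x 2" "!!u. u \<in> P ==> arm (rst W u) \<phi> = a 1 2 u"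
   by (rule hom_sheaf_ex[OF W(2) P x, where \<phi>="a 1 2"]) (use a1[of 1 2] a2[of 1 2] in auto)
  \<comment> \<open>Starting from the map given by \<open>x 1\<close>: the identity on copy 1, the
    glued arrow on copy 2.\<close>
  let ?d = "\<lambda>Y b. if fst (fst b) = (1::nat) then Idt (sect W Y) (obm (rst W (snd b)) (x 1)) else arm (rst W (snd b)) \<phi>"
  have aid: "a i i k = Idt (sect W (src k)) (obm (rst W k) (x i))" if "i = 1 \<or> i = 2" "k \<in> P" for i k
   using gmapD(8)[OF w, of "src k" "((i, Idt C X), k)"] that P' xr[of i k] by (auto simp: a_def Hom_iff)
  have cc: "Comp (sect W (src k)) (a 2 1 k) (a 1 2 k) = a 1 1 k" if "k \<in> P" for k
   using gmapD(9)[OF w, of "src k" "(((1, Idt C X), k), ((2, Idt C X), k))" "(((2, Idt C X), k), ((1, Idt C X), k))"] A that P' by (simp add: a_def del: EQ_simps(2))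
  have "hty C ?E W (val_map C ?I P W (x 1)) (res2 C ?E ?d) \<omega>"
  proof (rule hty_res2I[OF val_map_map[OF D W(1) x(1)] w], goal_cases)
   case (1 Y b)
   then show ?case using f x P' xr by (cases b) (auto simp: Hom_iff)
  next
   case (2 Y \<alpha>)
   obtain i u k i' u' k' where e: "\<alpha> = (((i, u), k), ((i', u'), k'))" by (metis prod.exhaust)
   have uu: "u = Idt C X" "u' = Idt C X" "arr k" "tgt k = X" "src k = Y" "k' = k" and i: "i = 1 \<or> i = 2" "i' = 1 \<or> i' = 2" "i = i' \<or> k \<in> P"
   proof -
    have m: "(i, u) \<in> ?I" "(i', u') \<in> ?I" "k \<in> Hom C Y (src u)" "k' \<in> Hom C Y (src u')" "cmp u k = cmp u' k'" "(i, u) = (i', u') \<or> cmp u k \<in> P"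
     using 2(2) unfolding e EQ_simps(2) snd_conv by blast+
    show u: "u = Idt C X" "u' = Idt C X" and "i = 1 \<or> i = 2" "i' = 1 \<or> i' = 2" using m(1,2) by auto
    show "arr k" "tgt k = X" "src k = Y" using m(3) P'(1) by (auto simp: u Hom_iff)
    show "k' = k" "i = i' \<or> k \<in> P" using m(3-6) P'(1) by (auto simp: u Hom_iff)
   qed
   have ar: "arm (\<omega> Y) \<alpha> = a i i' k" using uu by (simp add: a_def e)
   have aii: "a i i k = Idt (sect W Y) (obm (rst W k) (x i))"
    using gmapD(8)[OF w 2(1), of "((i, Idt C X), k)"] uu i xr[of i k] P'(1) by (auto simp: a_def Hom_iff)
   have m: "arm (val_map C ?I P W (x 1) Y) \<alpha> = Idt (sect W Y) (obm (rst W k) (x 1))"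
    using 2 uu P'(1) by (simp add: e)
   let ?D = "\<lambda>i. if i = (1::nat) then Idt (sect W Y) (obm (rst W k) (x 1)) else arm (rst W k) \<phi>"
   \<comment> \<open>An arrow of the source either stays in one copy or crosses between the copies
     over an element of \<open>P\<close>.\<close>
   consider "i = i'" "i = 1" | "i = i'" "i = 2" | "i = 1" "i' = 2" "k \<in> P" | "i = 2" "i' = 1" "k \<in> P" using i by auto
   then have "Comp (sect W Y) (?D i') (Idt (sect W Y) (obm (rst W k) (x 1))) = Comp (sect W Y) (a i i' k) (?D i)"
    by cases (use uu x f 2(1) aii cc[of k] aid[of 1 k] in \<open>simp_all add: a1 aid\<close>)
   then show ?case unfolding ar m using uu by (simp only: e EQ_simps fst_conv snd_conv)
  next
   case (3 h b)
   then show ?case using x f P'(1) by (cases b) (auto simp: Hom_iff)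
  qed
  then show ?thesis using x by blast
 qed
qed auto

end

section \<open>Local fibrations with discrete fibers give sheaves\<close>

lemma slice_simps [simp]:
 "(X, f) \<in> Obj (slice C M) \<longleftrightarrow> X \<in> Obj C \<and> f \<in> Obj (sect M X)"
 "((X, f), (h, \<alpha>), (X', g)) \<in> Arr (slice C M) \<longleftrightarrow>
    X \<in> Obj C \<and> f \<in> Obj (sect M X) \<and> X' \<in> Obj C \<and> g \<in> Obj (sect M X') \<and>
    h \<in> Hom C X X' \<and> \<alpha> \<in> Hom (sect M X) f (obm (rst M h) g)"
 "Dom (slice C M) (x, m, y) = x" "Cod (slice C M) (x, m, y) = y"
 "Idt (slice C M) (X, f) = ((X, f), (Idt C X, Idt (sect M X) f), (X, f))"
 "Comp (slice C M) (y', (k, \<beta>), z) (x, (h, \<alpha>), y) =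
    (x, (Comp C k h, Comp (sect M (fst x)) (arm (rst M h) \<beta>) \<alpha>), z)"
 by (simp_all add: slice_def)

lemma slice_arr_cases:
 obtains X f h \<alpha> X' g where "r = ((X, f), (h, \<alpha>), (X', g))"
 by (metis prod.exhaust)

lemma slice_category:
 assumes M: "grpd_presheaf C M"
 shows "category (slice C M)"
proof -
 note [simp] = gpshD[OF M]
 show ?thesis
 proof (rule categoryI, goal_cases)
  case (1 f) then show ?case by (cases f rule: slice_arr_cases) auto
 next
  case (2 x) then show ?case by (cases x) (auto simp: Hom_iff)
 next
  case (3 f g)
  then show ?case by (cases f rule: slice_arr_cases; cases g rule: slice_arr_cases) (auto simp: Hom_iff)
 next
  case (4 f) then show ?case by (cases f rule: slice_arr_cases) (auto simp: Hom_iff)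
 next
  case (5 f g h)
  then show ?case
   by (cases f rule: slice_arr_cases; cases g rule: slice_arr_cases; cases h rule: slice_arr_cases) (auto simp: Hom_iff comp_assoc)
 qed
qed

text \<open>Restriction along an arrow of \<open>C\<close> paired with an identity of
  \<open>M\<close>. Together with \<open>iso_act\<close> it generates the whole action of
  \<open>C/M\<close>.\<close>

definition gr :: "('o, 'a) cat => ('o, 'a, 'u) ugpsh => ('o \<times> 'u, ('o, 'a, 'u) slice_arr, 'u) set_psh => 'a => 'u => 'u => 'u" where
 "gr C M G k m x = rs G ((Dom C k, obm (rst M k) m), (k, Idt (sect M (Dom C k)) (obm (rst M k) m)), (Cod C k, m)) x"

locale slice_psh =
 fixes C :: "('o, 'a) cat" and M :: "('o, 'a, 'u) ugpsh" and G :: "('o \<times> 'u, ('o, 'a, 'u) slice_arr, 'u) set_psh"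
 assumes M: "grpd_presheaf C M" and G: "presheaf (slice C M) G"
begin

lemmas Ms = gpshD[OF M]

abbreviation "rG \<equiv> gr C M G"
abbreviation "aG \<equiv> iso_act C M G"
abbreviation "rO h \<equiv> obm (rst M h)"
abbreviation "rA h \<equiv> arm (rst M h)"
abbreviation "MD h \<equiv> sect M (Dom C h)"
abbreviation "OM X \<equiv> Obj (sect M X)"
abbreviation "AM X \<equiv> Arr (sect M X)"

lemma rs_in: "[|r \<in> Arr (slice C M); s \<in> at G (Cod (slice C M) r)|] ==> rs G r s \<in> at G (Dom (slice C M) r)"
 using G unfolding presheaf_def by blast

lemma rs_Comp: "[|f \<in> Arr (slice C M); g \<in> Arr (slice C M); Cod (slice C M) f = Dom (slice C M) g; s \<in> at G (Cod (slice C M) g)|]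
  ==> rs G (Comp (slice C M) g f) s = rs G f (rs G g s)"
 using G unfolding presheaf_def Hom_def by blast

lemma rs_Idt: "[|x \<in> Obj (slice C M); s \<in> at G x|] ==> rs G (Idt (slice C M) x) s = s"
 using G unfolding presheaf_def by blast

lemma gr_in: "[|k \<in> Arr C; m \<in> OM (Cod C k); x \<in> at G (Cod C k, m); Y = Dom C k|] ==> rG k m x \<in> at G (Y, rO k m)"
 unfolding gr_def using rs_in[of "((Dom C k, rO k m), (k, Idt (MD k) (rO k m)), (Cod C k, m))" x]
 by (simp add: Ms Hom_iff)

lemma gr_Idt: "[|X \<in> Obj C; m \<in> OM X; x \<in> at G (X, m)|] ==> rG (Idt C X) m x = x"
 unfolding gr_def using rs_Idt[of "(X, m)" x] by (simp add: Ms)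

lemma gr_Comp: "[|f \<in> Arr C; g \<in> Arr C; Cod C f = Dom C g; m \<in> OM (Cod C g); x \<in> at G (Cod C g, m)|]
 ==> rG (Comp C g f) m x = rG f (rO g m) (rG g m x)"
 unfolding gr_def using rs_Comp[of "((Dom C f, rO f (rO g m)), (f, Idt (MD f) (rO f (rO g m))), (Cod C f, rO g m))"
   "((Dom C g, rO g m), (g, Idt (MD g) (rO g m)), (Cod C g, m))" x]
 by (simp add: Ms Hom_iff)

lemma ga_in: "[|X \<in> Obj C; \<alpha> \<in> AM X; s \<in> at G (X, Cod (sect M X) \<alpha>)|] ==> aG X \<alpha> s \<in> at G (X, Dom (sect M X) \<alpha>)"
 unfolding iso_act_def using rs_in[of "((X, Dom (sect M X) \<alpha>), (Idt C X, \<alpha>), (X, Cod (sect M X) \<alpha>))" s]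
 by (simp add: Ms Hom_iff)

lemma ga_Idt: "[|X \<in> Obj C; m \<in> OM X; s \<in> at G (X, m)|] ==> aG X (Idt (sect M X) m) s = s"
 unfolding iso_act_def using rs_Idt[of "(X, m)" s] by (simp add: Ms)

lemma ga_Comp: "[|X \<in> Obj C; \<alpha> \<in> AM X; \<beta> \<in> AM X; Cod (sect M X) \<alpha> = Dom (sect M X) \<beta>; s \<in> at G (X, Cod (sect M X) \<beta>)|]
 ==> aG X (Comp (sect M X) \<beta> \<alpha>) s = aG X \<alpha> (aG X \<beta> s)"
 unfolding iso_act_def using rs_Comp[of "((X, Dom (sect M X) \<alpha>), (Idt C X, \<alpha>), (X, Cod (sect M X) \<alpha>))" "((X, Dom (sect M X) \<beta>), (Idt C X, \<beta>), (X, Cod (sect M X) \<beta>))" s]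
 by (simp add: Ms Hom_iff)

text \<open>The arrow \<open>(h, \<alpha>)\<close> factors as \<open>\<alpha>\<close> over the
  identity of \<open>X\<close>, followed by \<open>h\<close> paired with an identity.\<close>

lemma rs_dec: "[|((X, f), (h, \<alpha>), (X', g)) \<in> Arr (slice C M); s \<in> at G (X', g)|]
 ==> rs G ((X, f), (h, \<alpha>), (X', g)) s = aG X \<alpha> (rG h g s)"
 unfolding iso_act_def gr_def using rs_Comp[of "((X, f), (Idt C X, \<alpha>), (X, rO h g))" "((X, rO h g), (h, Idt (sect M X) (rO h g)), (X', g))" s]
 by (simp add: Ms Hom_iff)

text \<open>Both sides restrict along the same arrow of \<open>C/M\<close>, the one with components
  \<open>k\<close> and \<open>rA k \<alpha>\<close>.\<close>

lemma gr_ga: "[|k \<in> Arr C; X = Cod C k; \<alpha> \<in> AM X; s \<in> at G (X, Cod (sect M X) \<alpha>); m = Dom (sect M X) \<alpha>|]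
 ==> rG k m (aG X \<alpha> s) = aG (Dom C k) (rA k \<alpha>) (rG k (Cod (sect M X) \<alpha>) s)"
 unfolding gr_def iso_act_def
 using rs_Comp[of "((Dom C k, rO k (Dom (sect M X) \<alpha>)), (k, Idt (MD k) (rO k (Dom (sect M X) \<alpha>))), (Cod C k, Dom (sect M X) \<alpha>))"
  "((X, Dom (sect M X) \<alpha>), (Idt C X, \<alpha>), (X, Cod (sect M X) \<alpha>))" s]
  rs_Comp[of "((Dom C k, rO k (Dom (sect M X) \<alpha>)), (Idt C (Dom C k), rA k \<alpha>), (Dom C k, rO k (Cod (sect M X) \<alpha>)))"
  "((Dom C k, rO k (Cod (sect M X) \<alpha>)), (k, Idt (MD k) (rO k (Cod (sect M X) \<alpha>))), (Cod C k, Cod (sect M X) \<alpha>))" s]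
 by (simp add: Ms Hom_iff)

lemma ga_inv: "[|X \<in> Obj C; \<alpha> \<in> AM X; s \<in> at G (X, Cod (sect M X) \<alpha>)|] ==> aG X (ginv (sect M X) \<alpha>) (aG X \<alpha> s) = s"
 "[|X \<in> Obj C; \<alpha> \<in> AM X; s \<in> at G (X, Dom (sect M X) \<alpha>)|] ==> aG X \<alpha> (aG X (ginv (sect M X) \<alpha>) s) = s"
 using ga_Comp[of X "ginv (sect M X) \<alpha>" \<alpha> s] ga_Comp[of X \<alpha> "ginv (sect M X) \<alpha>" s] by (simp_all add: Ms ga_Idt)

end

locale dfib =
 fixes C :: "('o, 'a) cat" and F M :: "('o, 'a, 'u) ugpsh" and \<pi> :: "('o, 'u) ugmap"
 assumes fib: "levelwise_fibration C F M \<pi>" and df: "discrete_fibers C F M \<pi>"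
begin

lemma pim: "grpd_map C F M \<pi>" using fib by (simp add: levelwise_fibration_def)

lemmas Ps = gmapD[OF pim]
lemmas Fs = gpshD[OF gmapD(1)[OF pim]]
lemmas Ms = gpshD[OF gmapD(2)[OF pim]]

definition lft :: "'o => 'u => 'u => 'u" where
 "lft X \<alpha> c = (THE \<beta>. \<beta> \<in> Arr (sect F X) \<and> Cod (sect F X) \<beta> = c \<and> arm (\<pi> X) \<beta> = \<alpha>)"

abbreviation tr :: "'o => 'u => 'u => 'u" where
 "tr X \<alpha> c \<equiv> Dom (sect F X) (lft X \<alpha> c)"

text \<open>The point where discreteness turns isomorphisms into equalities: an arrow over an
  identity is itself an identity.\<close>

lemma over_Idt:
 assumes "X \<in> Obj C" "\<beta> \<in> Arr (sect F X)" "arm (\<pi> X) \<beta> = Idt (sect M X) a" "a \<in> Obj (sect M X)"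
 shows "Cod (sect F X) \<beta> = Dom (sect F X) \<beta>"
proof -
 have "\<beta> = Idt (sect F X) (Dom (sect F X) \<beta>)" using df assms unfolding discrete_fibers_def by blast
 then show ?thesis using assms(1,2) Fs(1,2) by (metis cat_simps(1,5) groupoid_category)
qed

text \<open>Two lifts with the same target differ by an arrow over an identity, which is
  trivial.\<close>

lemma lift_unique:
 assumes "X \<in> Obj C" "\<beta> \<in> Arr (sect F X)" "\<beta>' \<in> Arr (sect F X)" "Cod (sect F X) \<beta> = Cod (sect F X) \<beta>'"
  "arm (\<pi> X) \<beta> = arm (\<pi> X) \<beta>'"
 shows "\<beta> = \<beta>'"
proof -
 let ?g = "Comp (sect F X) (ginv (sect F X) \<beta>') \<beta>"
 note [simp] = Ps Fs Ms
 have g: "?g \<in> Arr (sect F X)" "arm (\<pi> X) ?g = Idt (sect M X) (obm (\<pi> X) (Dom (sect F X) \<beta>'))" using assms by auto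
 have "?g = Idt (sect F X) (Dom (sect F X) ?g)"
  by (rule df[unfolded discrete_fibers_def, rule_format, OF assms(1) _ g]) (use assms in auto)
 then have e: "?g = Idt (sect F X) (Dom (sect F X) \<beta>)" using assms by simp
 have d: "Dom (sect F X) \<beta> = Dom (sect F X) \<beta>'" using arg_cong[OF e, of "Cod (sect F X)"] assms by simp
 have "Comp (sect F X) \<beta>' (Idt (sect F X) (Dom (sect F X) \<beta>)) = \<beta>" unfolding e[symmetric] using assms(1-4) by simp
 moreover have "Comp (sect F X) \<beta>' (Idt (sect F X) (Dom (sect F X) \<beta>)) = \<beta>'" using assms(1,3) d by simp
 ultimately show ?thesis by metis
qed

lemma lft:
 assumes "X \<in> Obj C" "\<alpha> \<in> Arr (sect M X)" "c \<in> Obj (sect F X)" "Cod (sect M X) \<alpha> = obm (\<pi> X) c"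
 shows "lft X \<alpha> c \<in> Arr (sect F X)" "Cod (sect F X) (lft X \<alpha> c) = c" "arm (\<pi> X) (lft X \<alpha> c) = \<alpha>"
  "tr X \<alpha> c \<in> Obj (sect F X)" "obm (\<pi> X) (tr X \<alpha> c) = Dom (sect M X) \<alpha>"
proof -
 have "\<exists>\<beta>. \<beta> \<in> Arr (sect F X) \<and> Cod (sect F X) \<beta> = c \<and> arm (\<pi> X) \<beta> = \<alpha>"
  using fib assms unfolding levelwise_fibration_def grpd_fibration_def by blast
 then obtain \<beta> where b: "\<beta> \<in> Arr (sect F X)" "Cod (sect F X) \<beta> = c" "arm (\<pi> X) \<beta> = \<alpha>" by blast
 have "\<exists>!\<beta>. \<beta> \<in> Arr (sect F X) \<and> Cod (sect F X) \<beta> = c \<and> arm (\<pi> X) \<beta> = \<alpha>"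
  by (rule ex1I[of _ \<beta>]) (use b in simp, rule lift_unique[OF assms(1)], use b in auto)
 from theI'[OF this, folded lft_def]
 show 1: "lft X \<alpha> c \<in> Arr (sect F X)" "Cod (sect F X) (lft X \<alpha> c) = c" "arm (\<pi> X) (lft X \<alpha> c) = \<alpha>" by auto
 show "tr X \<alpha> c \<in> Obj (sect F X)" "obm (\<pi> X) (tr X \<alpha> c) = Dom (sect M X) \<alpha>"
  using 1 assms(1) Ps(6)[OF assms(1) 1(1)] by (auto simp: Fs)
qed

text \<open>The laws of the transport \<open>tr\<close> below all arise in this way: an arrow with
  the right target and image is exhibited and recognized as the lift.\<close>

lemma lft_eq:
 assumes "X \<in> Obj C" "\<beta> \<in> Arr (sect F X)"
 shows "lft X (arm (\<pi> X) \<beta>) (Cod (sect F X) \<beta>) = \<beta>"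
 by (rule lift_unique[OF assms(1)]) (use assms lft[OF assms(1), of "arm (\<pi> X) \<beta>" "Cod (sect F X) \<beta>"] Ps Fs in auto)

lemma tr_Idt:
 assumes "X \<in> Obj C" "c \<in> Obj (sect F X)" "a = obm (\<pi> X) c"
 shows "tr X (Idt (sect M X) a) c = c"
 using lft_eq[of X "Idt (sect F X) c"] assms by (simp add: Ps Fs)

lemma tr_Comp:
 assumes "X \<in> Obj C" "\<alpha> \<in> Arr (sect M X)" "\<beta> \<in> Arr (sect M X)" "Cod (sect M X) \<alpha> = Dom (sect M X) \<beta>"
  "c \<in> Obj (sect F X)" "Cod (sect M X) \<beta> = obm (\<pi> X) c"
 shows "tr X (Comp (sect M X) \<beta> \<alpha>) c = tr X \<alpha> (tr X \<beta> c)"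
proof -
 note b = lft[OF assms(1,3,5,6)]
 have a: "Cod (sect M X) \<alpha> = obm (\<pi> X) (tr X \<beta> c)" using b assms by simp
 note a' = lft[OF assms(1,2) b(4) a]
 show ?thesis using lft_eq[of X "Comp (sect F X) (lft X \<beta> c) (lft X \<alpha> (tr X \<beta> c))"] assms a' b by (simp add: Ps Fs)
qed

lemma tr_rst:
 assumes "h \<in> Arr C" "\<alpha> \<in> Arr (sect M (Cod C h))" "c \<in> Obj (sect F (Cod C h))" "Cod (sect M (Cod C h)) \<alpha> = obm (\<pi> (Cod C h)) c"
 shows "obm (rst F h) (tr (Cod C h) \<alpha> c) = tr (Dom C h) (arm (rst M h) \<alpha>) (obm (rst F h) c)"
proof -
 have X: "Cod C h \<in> Obj C" "Dom C h \<in> Obj C" using assms Fs by auto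
 note b = lft[OF X(1) assms(2-4)]
 have "lft (Dom C h) (arm (\<pi> (Dom C h)) (arm (rst F h) (lft (Cod C h) \<alpha> c))) (Cod (sect F (Dom C h)) (arm (rst F h) (lft (Cod C h) \<alpha> c))) = arm (rst F h) (lft (Cod C h) \<alpha> c)"
  by (rule lft_eq) (use X b assms in \<open>auto simp: Fs\<close>)
 then have "lft (Dom C h) (arm (rst M h) \<alpha>) (obm (rst F h) c) = arm (rst F h) (lft (Cod C h) \<alpha> c)"
  using b X assms by (simp add: Ps Fs)
 then show ?thesis using b X assms by (simp add: Fs)
qed

lemma tr_inv:
 assumes "X \<in> Obj C" "\<alpha> \<in> Arr (sect M X)" "c \<in> Obj (sect F X)" "Dom (sect M X) \<alpha> = obm (\<pi> X) c"
 shows "tr X \<alpha> (tr X (ginv (sect M X) \<alpha>) c) = c"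
 using tr_Comp[of X \<alpha> "ginv (sect M X) \<alpha>" c] assms by (simp add: Ms tr_Idt)

lemma tr_inv2:
 assumes "X \<in> Obj C" "\<alpha> \<in> Arr (sect M X)" "c \<in> Obj (sect F X)" "Cod (sect M X) \<alpha> = obm (\<pi> X) c"
 shows "tr X (ginv (sect M X) \<alpha>) (tr X \<alpha> c) = c"
 using tr_inv[of X "ginv (sect M X) \<alpha>" c] assms by (simp add: Ms)

abbreviation "\<Gamma> \<equiv> Gamma_psh C (F, \<pi>)"

lemma Gamma_at: "at \<Gamma> (X, a) = {c \<in> Obj (sect F X). obm (\<pi> X) c = a}"
 by (simp add: Gamma_psh_def)

lemma Gamma_rs: "rs \<Gamma> ((X, f), (h, \<alpha>), (X', g)) s = tr X \<alpha> (obm (rst F h) s)"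
 by (simp add: Gamma_psh_def lft_def)

lemma Gamma_presheaf: "presheaf (slice C M) \<Gamma>"
 unfolding presheaf_def
proof (intro conjI ballI allI)
 note [simp] = Ps Fs Ms
 show "category (slice C M)" by (rule slice_category[OF gmapD(2)[OF pim]])
 fix r assume r: "r \<in> Arr (slice C M)"
 obtain X f h \<alpha> X' g where e: "r = ((X, f), (h, \<alpha>), (X', g))" by (rule slice_arr_cases)
 show "rs \<Gamma> r \<in> at \<Gamma> (Cod (slice C M) r) \<rightarrow> at \<Gamma> (Dom (slice C M) r)"
 proof
  fix s assume s: "s \<in> at \<Gamma> (Cod (slice C M) r)"
  then show "rs \<Gamma> r s \<in> at \<Gamma> (Dom (slice C M) r)"
   using r lft[of X \<alpha> "obm (rst F h) s"] by (auto simp: e Gamma_at Gamma_rs Hom_iff)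
 qed
next
 note [simp] = Ps Fs Ms
 fix x s assume "x \<in> Obj (slice C M)" "s \<in> at \<Gamma> x"
 then show "rs \<Gamma> (Idt (slice C M) x) s = s" by (cases x) (auto simp: Gamma_at Gamma_rs tr_Idt)
next
 note [simp] = Ps Fs Ms
 fix x y z f g s assume f: "f \<in> Hom (slice C M) x y" and g: "g \<in> Hom (slice C M) y z" and s: "s \<in> at \<Gamma> z"
 obtain X a h \<alpha> X' b where e: "f = ((X, a), (h, \<alpha>), (X', b))" by (metis prod.exhaust)
 obtain Y' b' k \<beta> Z c where e': "g = ((Y', b'), (k, \<beta>), (Z, c))" by (metis prod.exhaust)
 have "x = (X, a)" "y = (X', b)" "Y' = X'" "b' = b" "z = (Z, c)" using f g by (auto simp: e e' Hom_iff)
 then show "rs \<Gamma> (Comp (slice C M) g f) s = rs \<Gamma> f (rs \<Gamma> g s)"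
  using f g s tr_rst[of h \<beta> "obm (rst F k) s"] by (auto simp: e e' Gamma_at Gamma_rs Hom_iff tr_Comp)
qed

end

context uni_site begin

text \<open>The lifts produce isomorphisms in \<open>F\<close> over identities of \<open>M\<close>,
  and by discreteness these are equalities. To bring a matching family into the shape of a lifting
  problem, its members are moved into the fibers over the restrictions of the single object
  \<open>a\<close>.\<close>

lemma Gamma_sheaf:
 fixes F M :: "('o, 'a, 'u) ugpsh"
 assumes fib: "levelwise_fibration C F M \<pi>" and df: "discrete_fibers C F M \<pi>" and lf: "local_fibration C Cov F M \<pi>"
 shows "sheaf (slice C M) (slice_cov C Cov M) (Gamma_psh C (F, \<pi>))"
proof -
 interpret dfib C F M \<pi> by unfold_locales fact+
 note [simp] = Ps Fs Ms
 note Mp = gmapD(2)[OF pim] and Fp = gmapD(1)[OF pim]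
 show ?thesis unfolding sheaf_def
 proof (intro conjI allI impI, rule Gamma_presheaf, elim conjE)
  fix x R s
  assume R: "slice_cov C Cov M x R"
   and s1: "\<forall>u\<in>R. s u \<in> at \<Gamma> (Dom (slice C M) u)"
   and s2: "\<forall>u\<in>R. \<forall>v\<in>R. \<forall>Y. \<forall>g\<in>Hom (slice C M) Y (Dom (slice C M) u). \<forall>h\<in>Hom (slice C M) Y (Dom (slice C M) v).
    Comp (slice C M) u g = Comp (slice C M) v h --> rs \<Gamma> g (s u) = rs \<Gamma> h (s v)"
  obtain X a where x: "x = (X, a)" by (cases x)
  define hh :: "('o, 'a, 'u) slice_arr => 'a" where "hh = (\<lambda>(y, (h, \<alpha>), z). h)"
  define al :: "('o, 'a, 'u) slice_arr => 'u" where "al = (\<lambda>(y, (h, \<alpha>), z). \<alpha>)"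
  define S where "S = hh ` R"
  have S: "Cov X S" and Xa: "ob X" "a \<in> Obj (sect M X)" using R by (auto simp: slice_cov_def x S_def hh_def)
  note SX = cov_arrows[OF S]
  have Rr: "r = ((src (hh r), Dom (sect M (src (hh r))) (al r)), (hh r, al r), (X, a))"
   "hh r \<in> Arr C" "tgt (hh r) = X" "al r \<in> Arr (sect M (src (hh r)))"
   "Cod (sect M (src (hh r))) (al r) = obm (rst M (hh r)) a" if r: "r \<in> R" for r
  proof -
   have ra: "r \<in> Arr (slice C M)" "Cod (slice C M) r = x" using R r by (auto simp: slice_cov_def)
   obtain Y f h \<alpha> X' g where e: "r = ((Y, f), (h, \<alpha>), (X', g))" by (rule slice_arr_cases)
   show "r = ((src (hh r), Dom (sect M (src (hh r))) (al r)), (hh r, al r), (X, a))"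
   "hh r \<in> Arr C" "tgt (hh r) = X" "al r \<in> Arr (sect M (src (hh r)))"
   "Cod (sect M (src (hh r))) (al r) = obm (rst M (hh r)) a"
    using ra by (auto simp: e x hh_def al_def Hom_iff)
  qed
  have sr: "s r \<in> Obj (sect F (src (hh r)))" "obm (\<pi> (src (hh r))) (s r) = Dom (sect M (src (hh r))) (al r)" if r: "r \<in> R" for r
  proof -
   have "Dom (slice C M) r = (src (hh r), Dom (sect M (src (hh r))) (al r))" by (subst Rr(1)[OF r]) simp
   then show "s r \<in> Obj (sect F (src (hh r)))" "obm (\<pi> (src (hh r))) (s r) = Dom (sect M (src (hh r))) (al r)"
    using bspec[OF s1 r] by (auto simp: Gamma_at)
  qed
  \<comment> \<open>A cover in \<open>C/M\<close> carries isomorphisms \<open>al r\<close>;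
    transport along their inverses removes them, and only arrows of \<open>C\<close> remain.\<close>
  define y where "y r = tr (src (hh r)) (ginv (sect M (src (hh r))) (al r)) (s r)" for r
  have y: "y r \<in> Obj (sect F (src (hh r)))" "obm (\<pi> (src (hh r))) (y r) = obm (rst M (hh r)) a"
   "tr (src (hh r)) (al r) (y r) = s r" if r: "r \<in> R" for r
   using lft(4,5)[of "src (hh r)" "ginv (sect M (src (hh r))) (al r)" "s r"] sr[OF r] Rr(2-5)[OF r] tr_inv[of "src (hh r)" "al r" "s r"]
   by (auto simp: y_def)
  have match: "obm (rst F k) (y r) = obm (rst F k') (y r')"
   if r: "r \<in> R" "r' \<in> R" and k: "arr k" "tgt k = src (hh r)" "arr k'" "tgt k' = src (hh r')" and e: "cmp (hh r) k = cmp (hh r') k'"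
   for r r' k k'
  proof -
   have dk: "src k' = src k" using arg_cong[OF e, of "src"] k Rr(2)[OF r(1)] Rr(2)[OF r(2)] by simp
   let ?Y = "(src k, obm (rst M (cmp (hh r) k)) a)"
   \<comment> \<open>Test arrows whose second component cancels \<open>al r\<close>: after
     composition with \<open>r\<close> it becomes an identity, so two composites in
     \<open>C/M\<close> agree as soon as the composites in \<open>C\<close> do.\<close>
   let ?g = "\<lambda>r k. (?Y, (k, arm (rst M k) (ginv (sect M (src (hh r))) (al r))), (src (hh r), Dom (sect M (src (hh r))) (al r)))"
   have D: "Dom (slice C M) r = (src (hh r), Dom (sect M (src (hh r))) (al r))" if "r \<in> R" for r by (subst Rr(1)[OF that]) simp
   have g: "?g r k \<in> Hom (slice C M) ?Y (Dom (slice C M) r)"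
    using k Rr(2-5)[OF r(1)] Xa by (auto simp: D[OF r(1)] Hom_iff)
   have ea: "obm (rst M k) (obm (rst M (hh r)) a) = obm (rst M k') (obm (rst M (hh r')) a)"
    using arg_cong[OF e, of "\<lambda>f. obm (rst M f) a"] k Rr(2-3)[OF r(1)] Rr(2-3)[OF r(2)] Xa by simp
   have g': "?g r' k' \<in> Hom (slice C M) ?Y (Dom (slice C M) r')"
    using k dk Rr(2-5)[OF r(2)]  Rr(2-5)[OF r(1)] Xa ea by (auto simp: D[OF r(2)] Hom_iff)
   have "Comp (slice C M) r (?g r k) = (?Y, (cmp (hh r) k, Idt (sect M (src k)) (obm (rst M k) (obm (rst M (hh r)) a))), (X, a))"
    by (subst Rr(1)[OF r(1)]) (use k Rr(2-5)[OF r(1)] in \<open>simp add: Ms(8)[symmetric]\<close>)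
   moreover have "Comp (slice C M) r' (?g r' k') = (?Y, (cmp (hh r') k', Idt (sect M (src k)) (obm (rst M k') (obm (rst M (hh r')) a))), (X, a))"
    by (subst Rr(1)[OF r(2)]) (use k dk Rr(2-5)[OF r(2)] in \<open>simp add: Ms(8)[symmetric]\<close>)
   ultimately have "rs \<Gamma> (?g r k) (s r) = rs \<Gamma> (?g r' k') (s r')"
    using s2[rule_format, OF r g g'] ea e by simp
   then show ?thesis unfolding Gamma_rs y_def
    using tr_rst[of k "ginv (sect M (src (hh r))) (al r)" "s r"] tr_rst[of k' "ginv (sect M (src (hh r'))) (al r')" "s r'"]
     k dk sr[OF r(1)] sr[OF r(2)] Rr(2-5)[OF r(1)] Rr(2-5)[OF r(2)] by simp
  qed
  have rst1: "rs \<Gamma> r t = tr (src (hh r)) (al r) (obm (rst F (hh r)) t)" if "r \<in> R" for r t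
   by (subst Rr(1)[OF that]) (simp add: Gamma_rs)
  let ?K = "{cmp u k | u k. u \<in> S \<and> k \<in> pre u}"
  show "\<exists>!t. t \<in> at \<Gamma> x \<and> (\<forall>u\<in>R. rs \<Gamma> u t = s u)"
  proof (rule ex_ex1I)
   let ?I = "{0::nat} \<times> S" and ?J = "insert (1::nat, Idt C X) ({0} \<times> S)"
   have D: "EQ_data C X ?I UNIV" "EQ_data C X ?J UNIV" using SX by (auto simp: EQ_data_def)
   have L: "lifts_against C (EQ C ?I UNIV) (EQ C ?J UNIV) (EQ_incl C ?I UNIV) F M \<pi>"
    by (rule local_fibration_EQ_lifts[OF lf D]) (use EQ_cover_ff_es[OF _ _ _ S] local_object_iff in auto)
   \<comment> \<open>Several members of the cover of \<open>C/M\<close> may lie over the same arrow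
     of \<open>C\<close>; one of them is chosen.\<close>
   have "\<forall>u \<in> S. \<exists>r. r \<in> R \<and> hh r = u" unfolding S_def by blast
   from bchoice[OF this] obtain c where c: "!!u. u \<in> S ==> c u \<in> R" "!!u. u \<in> S ==> hh (c u) = u" by blast
   \<comment> \<open>The square: the nerve of \<open>S\<close> is mapped to \<open>F\<close> by the
     sections \<open>y\<close>, with isomorphic objects sent to equal ones because of
     \<open>match\<close>, and the cylinder is mapped to \<open>M\<close> by
     \<open>a\<close>.\<close>
   let ?ob = "\<lambda>Y b. obm (rst F (snd b)) (y (c (snd (fst b))))"
   let ?w = "disc_map C ?I UNIV F ?ob" and ?v = "val_map C ?J UNIV M a"
   have w: "grpd_map C (EQ C ?I UNIV) F ?w"
   proof (rule disc_map_map[OF D(1) Fp], goal_cases)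
    case (1 Y b) then show ?case using y(1)[OF c(1)] c(2) by (cases b) (auto simp: Hom_iff)
   next
    case (2 h b) then show ?case using y(1)[OF c(1)] c(2) by (cases b) (auto simp: Hom_iff)
   next
    case (3 Y b b')
    then show ?case using match[of "c (snd (fst b))" "c (snd (fst b'))" "snd b" "snd b'"] c
     by (cases b; cases b') (auto simp: Hom_iff)
   qed
   have v: "grpd_map C (EQ C ?J UNIV) M ?v" by (rule val_map_map[OF D(2) Mp Xa(2)])
   note im = EQ_incl_map[OF D subset_insertI subset_UNIV]
   have "gmap_comp C (EQ C ?I UNIV) \<pi> ?w = gmap_comp C (EQ C ?I UNIV) ?v (EQ_incl C ?I UNIV)"
   proof (rule gmap_eqI[OF gmap_comp_map[OF w pim] gmap_comp_map[OF im v]])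
    have o: "obm (\<pi> Y) (?ob Y b) = obm (rst M (vl C b)) a" "?ob Y b \<in> Obj (sect F Y)" if "ob Y" "b \<in> Obj (sect (EQ C ?I UNIV) Y)" for Y b
     using that y[OF c(1)] c(2) SX Xa by (cases b, auto simp: Hom_iff)+
    have sJ: "b \<in> Obj (sect (EQ C ?J UNIV) Y)" if "b \<in> Obj (sect (EQ C ?I UNIV) Y)" for Y b
     using that by (cases b) auto
    have sJ2: "\<alpha> \<in> Arr (sect (EQ C ?J UNIV) Y)" "fst \<alpha> \<in> Obj (sect (EQ C ?I UNIV) Y)" if "\<alpha> \<in> Arr (sect (EQ C ?I UNIV) Y)" for Y \<alpha>
     using that by (cases \<alpha>; cases "fst \<alpha>"; cases "snd \<alpha>"; auto)+
    show "obm (gmap_comp C (EQ C ?I UNIV) \<pi> ?w Y) b = obm (gmap_comp C (EQ C ?I UNIV) ?v (EQ_incl C ?I UNIV) Y) b"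
     if "ob Y" "b \<in> Obj (sect (EQ C ?I UNIV) Y)" for Y b
     using that o[OF that] sJ by (simp add: EQ_incl_def)
    show "arm (gmap_comp C (EQ C ?I UNIV) \<pi> ?w Y) \<alpha> = arm (gmap_comp C (EQ C ?I UNIV) ?v (EQ_incl C ?I UNIV) Y) \<alpha>"
     if "ob Y" "\<alpha> \<in> Arr (sect (EQ C ?I UNIV) Y)" for Y \<alpha>
     using that o[OF that(1) sJ2(2)[OF that(2)]] sJ2[OF that(2)] by (simp add: EQ_incl_def)
   qed
   then obtain l where l: "grpd_map C (EQ C ?J UNIV) F l" "gmap_comp C (EQ C ?I UNIV) l (EQ_incl C ?I UNIV) = ?w" "gmap_comp C (EQ C ?J UNIV) \<pi> l = ?v"
    using L w v unfolding lifts_against_def by blast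
   have lw: "obm (l Y) b = ?ob Y b" if "ob Y" "b \<in> Obj (sect (EQ C ?I UNIV) Y)" for Y b
    using arg_cong[OF l(2), of "\<lambda>f. obm (f Y) b"] that by (simp add: EQ_incl_def)
   have lv: "obm (\<pi> Y) (obm (l Y) b) = obm (rst M (vl C b)) a" if "ob Y" "b \<in> Obj (sect (EQ C ?J UNIV) Y)" for Y b
    using arg_cong[OF l(3), of "\<lambda>f. obm (f Y) b"] that by simp
   have lv2: "arm (\<pi> Y) (arm (l Y) \<alpha>) = Idt (sect M Y) (obm (rst M (vl C (fst \<alpha>))) a)" if "ob Y" "\<alpha> \<in> Arr (sect (EQ C ?J UNIV) Y)" for Y \<alpha>
    using arg_cong[OF l(3), of "\<lambda>f. arm (f Y) \<alpha>"] that by simp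
   define t where "t = obm (l X) ((1, Idt C X), Idt C X)"
   have o1: "((1, Idt C X), Idt C X) \<in> Obj (sect (EQ C ?J UNIV) X)" using Xa by (simp add: Hom_iff)
   have t: "t \<in> Obj (sect F X)" "obm (\<pi> X) t = a" using gmapD(4)[OF l(1) Xa(1) o1] lv[OF Xa(1) o1] Xa by (auto simp: t_def)
   have tu: "obm (rst F u) t = y (c u)" if u: "u \<in> S" for u
   proof -
    have ua: "arr u" "tgt u = X" using SX u by auto
    \<comment> \<open>The arrow of the cylinder that joins the restriction of the new vertex
      \<open>X\<close> along \<open>u\<close> to the vertex of \<open>u\<close>. Its image lies over
      an identity, so \<open>t\<close> restricts to \<open>y\<close>.\<close>
    let ?\<alpha> = "(((1::nat, Idt C X), u), ((0::nat, u), Idt C (src u)))"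
    have al: "?\<alpha> \<in> Arr (sect (EQ C ?J UNIV) (src u))" using u ua Xa by (auto simp: Hom_iff)
    have "Cod (sect F (src u)) (arm (l (src u)) ?\<alpha>) = Dom (sect F (src u)) (arm (l (src u)) ?\<alpha>)"
     by (rule over_Idt[OF _ _ lv2[OF _ al]]) (use al ua Xa gmapD(5)[OF l(1) _ al] in auto)
    then have "obm (l (src u)) ((0, u), Idt C (src u)) = obm (l (src u)) ((1, Idt C X), u)"
     using gmapD(6,7)[OF l(1) _ al] ua by simp
    also have "\<dots> = obm (rst F u) t"
     using gmapD(10)[OF l(1) ua(1) refl, of "((1, Idt C X), Idt C X)"] o1 ua by (simp add: t_def)
    finally show ?thesis using lw[of "src u" "((0, u), Idt C (src u))"] u ua y(1)[OF c(1)[OF u]] c(2)[OF u] by (simp add: Hom_iff)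
   qed
   show "\<exists>t. t \<in> at \<Gamma> x \<and> (\<forall>u\<in>R. rs \<Gamma> u t = s u)"
   proof (intro exI[of _ t] conjI ballI)
    show "t \<in> at \<Gamma> x" using t by (simp add: x Gamma_at)
    fix r assume r: "r \<in> R"
    have hS: "hh r \<in> S" using r by (simp add: S_def)
    \<comment> \<open>The matching condition at identities shows that the choice \<open>c\<close>
      among members over the same arrow does not matter.\<close>
    have "obm (rst F (Idt C (src (hh r)))) (y (c (hh r))) = obm (rst F (Idt C (src (hh r)))) (y r)"
     by (rule match) (use r c[OF hS] Rr(2)[OF r] in auto)
    then have "obm (rst F (hh r)) t = y r" using tu[OF hS] y(1)[OF r] y(1)[OF c(1)[OF hS]] c(2)[OF hS] Rr(2)[OF r] by simp
    then show "rs \<Gamma> r t = s r" using rst1[OF r] y(3)[OF r] by simp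
   qed
  next
   let ?I = "{(1::nat, Idt C X), (2, Idt C X)}"
   fix t t' assume t: "t \<in> at \<Gamma> x \<and> (\<forall>u\<in>R. rs \<Gamma> u t = s u)" and t': "t' \<in> at \<Gamma> x \<and> (\<forall>u\<in>R. rs \<Gamma> u t' = s u)"
   have tt: "t \<in> Obj (sect F X)" "obm (\<pi> X) t = a" "t' \<in> Obj (sect F X)" "obm (\<pi> X) t' = a" using t t' by (auto simp: x Gamma_at)
   have eq: "obm (rst F u) t = obm (rst F u) t'" if u: "u \<in> S" for u
   proof -
    obtain r where r: "r \<in> R" "hh r = u" using u by (auto simp: S_def)
    have "tr (src u) (al r) (obm (rst F u) t) = tr (src u) (al r) (obm (rst F u) t')"
     using rst1[OF r(1), of t] rst1[OF r(1), of t'] t t' r by metis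
    moreover have "tr (src u) (ginv (sect M (src u)) (al r)) (tr (src u) (al r) (obm (rst F u) t)) = obm (rst F u) t"
     "tr (src u) (ginv (sect M (src u)) (al r)) (tr (src u) (al r) (obm (rst F u) t')) = obm (rst F u) t'"
     using Rr(2-5)[OF r(1)] tt by (auto intro!: tr_inv2 simp: r(2))
    ultimately show ?thesis by metis
   qed
   have D: "EQ_data C X ?I ?K" "EQ_data C X ?I UNIV" using Xa csvD(4)[OF cs_gen[OF S]] by (auto simp: EQ_data_def)
   have L: "lifts_against C (EQ C ?I ?K) (EQ C ?I UNIV) (EQ_incl C ?I ?K) F M \<pi>"
    by (rule local_fibration_EQ_lifts[OF lf D]) (use EQ_sieve_ff_es[OF _ _ cs_gen[OF S]] local_object_iff in auto)
   \<comment> \<open>One copy of \<open>X\<close> goes to \<open>t\<close>, the other to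
     \<open>t'\<close>; they agree over the sieve, which is exactly where the copies are identified
     in the source.\<close>
   let ?ob = "\<lambda>Y b. obm (rst F (vl C b)) (if fst (fst b) = (1::nat) then t else t')"
   let ?w = "disc_map C ?I ?K F ?ob" and ?v = "val_map C ?I UNIV M a"
   note va = vl_arr[OF D(1)] and va2 = vl_arr[OF D(2)]
   have w: "grpd_map C (EQ C ?I ?K) F ?w"
   proof (rule disc_map_map[OF D(1) Fp], goal_cases)
    case (1 Y b) then show ?case using va tt by auto
   next
    case (2 h b)
    have "fst (obm (rst (EQ C ?I ?K) h) b) = fst b" by (cases b) simp
    then show ?case using 2 va tt vl_rst[OF D(1) 2(2,1)] by auto
   next
    case (3 Y b b')
    have b: "vl C b = vl C b'" "fst b = fst b' \<or> vl C b \<in> ?K" using 3(2) unfolding EQ_Arr_iff by blast+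
    have *: "obm (rst F (vl C b)) t = obm (rst F (vl C b)) t'" if K: "vl C b \<in> ?K"
    proof -
     obtain u k where "u \<in> S" "k \<in> pre u" "vl C b = cmp u k" using K by blast
     then show ?thesis using eq SX tt by simp
    qed
    from b(2) show ?case
    proof
     assume "vl C b \<in> ?K"
     from *[OF this] show ?case by (simp add: b(1))
    qed (simp add: b(1))
   qed
   have v: "grpd_map C (EQ C ?I UNIV) M ?v" by (rule val_map_map[OF D(2) Mp Xa(2)])
   note im = EQ_incl_map[OF D order_refl subset_UNIV]
   have "gmap_comp C (EQ C ?I ?K) \<pi> ?w = gmap_comp C (EQ C ?I ?K) ?v (EQ_incl C ?I ?K)"
   proof (rule gmap_eqI[OF gmap_comp_map[OF w pim] gmap_comp_map[OF im v]])
    have o: "obm (\<pi> Y) (?ob Y b) = obm (rst M (vl C b)) a" "?ob Y b \<in> Obj (sect F Y)" if "ob Y" "b \<in> Obj (sect (EQ C ?I ?K) Y)" for Y b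
     using va[OF that(2)] tt by auto
    have sJ: "b \<in> Obj (sect (EQ C ?I UNIV) Y)" if "b \<in> Obj (sect (EQ C ?I ?K) Y)" for Y b
     using that by (simp only: EQ_Obj_iff)
    have sJ2: "\<alpha> \<in> Arr (sect (EQ C ?I UNIV) Y)" "fst \<alpha> \<in> Obj (sect (EQ C ?I ?K) Y)" if "\<alpha> \<in> Arr (sect (EQ C ?I ?K) Y)" for Y \<alpha>
     using that sJ by (cases \<alpha>; simp only: EQ_Arr_iff fst_conv UNIV_I simp_thms)+
    show "obm (gmap_comp C (EQ C ?I ?K) \<pi> ?w Y) b = obm (gmap_comp C (EQ C ?I ?K) ?v (EQ_incl C ?I ?K) Y) b"
     if "ob Y" "b \<in> Obj (sect (EQ C ?I ?K) Y)" for Y b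
     using that o[OF that] sJ by (simp add: EQ_incl_def)
    show "arm (gmap_comp C (EQ C ?I ?K) \<pi> ?w Y) \<alpha> = arm (gmap_comp C (EQ C ?I ?K) ?v (EQ_incl C ?I ?K) Y) \<alpha>"
     if "ob Y" "\<alpha> \<in> Arr (sect (EQ C ?I ?K) Y)" for Y \<alpha>
     using that o[OF that(1) sJ2(2)[OF that(2)]] sJ2[OF that(2)] by (simp add: EQ_incl_def)
   qed
   then obtain l where l: "grpd_map C (EQ C ?I UNIV) F l" "gmap_comp C (EQ C ?I ?K) l (EQ_incl C ?I ?K) = ?w" "gmap_comp C (EQ C ?I UNIV) \<pi> l = ?v"
    using L w v unfolding lifts_against_def by blast
   let ?b = "\<lambda>i. ((i::nat, Idt C X), Idt C X)"
   have bI: "i = 1 \<or> i = 2 ==> ?b i \<in> Obj (sect (EQ C ?I ?K) X)" for i using Xa by (auto simp: Hom_iff)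
   have lw: "obm (l X) (?b i) = ?ob X (?b i)" if "i = 1 \<or> i = 2" for i
    using arg_cong[OF l(2), of "\<lambda>f. obm (f X) (?b i)"] Xa bI[OF that] by (simp add: EQ_incl_def)
   \<comment> \<open>In the target of the inclusion the two copies are isomorphic over
     \<open>X\<close> itself; the lifted isomorphism lies over an identity.\<close>
   have al: "(?b 1, ?b 2) \<in> Arr (sect (EQ C ?I UNIV) X)" using Xa by (auto simp: Hom_iff)
   have "arm (\<pi> X) (arm (l X) (?b 1, ?b 2)) = Idt (sect M X) a"
    using arg_cong[OF l(3), of "\<lambda>f. arm (f X) (?b 1, ?b 2)"] al Xa by simp
   from over_Idt[OF Xa(1) gmapD(5)[OF l(1) Xa(1) al] this Xa(2)]
   have "obm (l X) (?b 2) = obm (l X) (?b 1)" using gmapD(6,7)[OF l(1) Xa(1) al] by simp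
   then show "t = t'" using lw[of 1] lw[of 2] Xa tt by simp
  qed
 qed
qed

end

section \<open>The stack of sheaves locally induced by \<open>G\<close>\<close>

text \<open>Presheaves on the part \<open>Q\<close> of \<open>C/X\<close>: \<open>v h\<close> holds
  the sections over \<open>h\<close>, and \<open>r h k\<close> restricts from \<open>h\<close> to
  \<open>Comp C h k\<close>. With arrows of \<open>C\<close> as indices, pulling back along
  \<open>f\<close> is precomposition of the indices with \<open>f\<close>, and no category has to be
  formed for \<open>C/X\<close>.\<close>

definition pshf :: "('o, 'a) cat => 'a set => ('a => 'u set) => ('a => 'a => 'u => 'u) => bool" where
 "pshf C Q v r \<longleftrightarrow> (\<forall>h \<in> Q. \<forall>x \<in> v h. r h (Idt C (Dom C h)) x = x \<and> (\<forall>k \<in> into C (Dom C h). r h k x \<in> v (Comp C h k) \<and>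
  (\<forall>l \<in> into C (Dom C k). r (Comp C h k) l (r h k x) = r h (Comp C k l) x)))"

definition shf :: "('o, 'a) cat => ('o => 'a set => bool) => 'a set => ('a => 'u set) => ('a => 'a => 'u => 'u) => bool" where
 "shf C Cov Q v r \<longleftrightarrow> pshf C Q v r \<and> (\<forall>h \<in> Q. \<forall>P x. csv C Cov (Dom C h) P \<and> (\<forall>u \<in> P. x u \<in> v (Comp C h u)) \<and>
  (\<forall>u \<in> P. \<forall>k \<in> into C (Dom C u). x (Comp C u k) = r (Comp C h u) k (x u)) -->
  (\<exists>!y. y \<in> v h \<and> (\<forall>u \<in> P. r h u y = x u)))"

definition natm :: "('o, 'a) cat => 'a set => ('a => 'u set) => ('a => 'a => 'u => 'u) => ('a => 'u set) => ('a => 'a => 'u => 'u)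
  => ('a => 'u => 'u) => bool" where
 "natm C Q v r v' r' \<sigma> \<longleftrightarrow> (\<forall>h \<in> Q. \<forall>x \<in> v h. \<sigma> h x \<in> v' h \<and>
  (\<forall>k \<in> into C (Dom C h). \<sigma> (Comp C h k) (r h k x) = r' h k (\<sigma> h x)))"

lemma pshfD:
 assumes "pshf C Q v r" "h \<in> Q" "x \<in> v h"
 shows "r h (Idt C (Dom C h)) x = x"
  "[|k \<in> Arr C; Cod C k = Dom C h|] ==> r h k x \<in> v (Comp C h k)"
  "[|k \<in> Arr C; Cod C k = Dom C h; l \<in> Arr C; Cod C l = Dom C k|] ==> r (Comp C h k) l (r h k x) = r h (Comp C k l) x"
 using assms unfolding pshf_def by auto

lemma natmD:
 assumes "natm C Q v r v' r' \<sigma>" "h \<in> Q" "x \<in> v h"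
 shows "\<sigma> h x \<in> v' h" "[|k \<in> Arr C; Cod C k = Dom C h|] ==> \<sigma> (Comp C h k) (r h k x) = r' h k (\<sigma> h x)"
 using assms unfolding natm_def by auto

lemma shf_pshf: "shf C Cov Q v r ==> pshf C Q v r"
 by (simp add: shf_def)

lemma shf_ex:
 assumes "shf C Cov Q v r" "h \<in> Q" "csv C Cov (Dom C h) P" "!!u. u \<in> P ==> x u \<in> v (Comp C h u)"
  "!!u k. [|u \<in> P; k \<in> Arr C; Cod C k = Dom C u|] ==> x (Comp C u k) = r (Comp C h u) k (x u)"
 shows "\<exists>y \<in> v h. \<forall>u \<in> P. r h u y = x u"
proof -
 have "\<exists>!y. y \<in> v h \<and> (\<forall>u \<in> P. r h u y = x u)"
  by (rule assms(1)[unfolded shf_def, THEN conjunct2, rule_format]) (use assms in auto)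
 then show ?thesis by blast
qed

lemma shf_sep:
 assumes "shf C Cov Q v r" "h \<in> Q" "csv C Cov (Dom C h) P" "y \<in> v h" "z \<in> v h" "!!u. u \<in> P ==> r h u y = r h u z"
 shows "y = z"
proof -
 note p = pshfD[OF shf_pshf[OF assms(1)] assms(2,5)]
 note P = csvD[OF assms(3)]
 have U: "\<exists>!y. y \<in> v h \<and> (\<forall>u \<in> P. r h u y = r h u z)"
  by (rule assms(1)[unfolded shf_def, THEN conjunct2, rule_format]) (use assms p P in auto)
 show ?thesis by (rule ex1D[OF U]) (use assms in auto)
qed

context psite begin

text \<open>The images under \<open>\<sigma>\<close> of the restrictions of \<open>x\<close> to the
  pulled back sieve match, and their gluing in the target sheaf is the value of
  \<open>\<Sigma>\<close> at \<open>x\<close>.\<close>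

lemma hom_glue:
 assumes X: "ob X" and v: "pshf C (into C X) v r" and v': "shf C Cov (into C X) v' r'" and P: "cs X P"
  and s: "natm C P v r v' r' \<sigma>"
 shows "\<exists>\<Sigma>. natm C (into C X) v r v' r' \<Sigma> \<and> (\<forall>h \<in> P. \<forall>x \<in> v h. \<Sigma> h x = \<sigma> h x)"
proof -
 note vD = pshfD[OF v] and vD' = pshfD[OF shf_pshf[OF v']]
 note P' = csvD[OF P]
 define PP where "PP h = {l \<in> pre h. cmp h l \<in> P}" for h
 have PP: "cs (src h) (PP h)" if "h \<in> into C X" for h
  unfolding PP_def by (rule cs_pull[OF P]) (use that in auto)
 have ex: "\<exists>y \<in> v' h. \<forall>l \<in> PP h. r' h l y = \<sigma> (cmp h l) (r h l x)" if h: "h \<in> into C X" and x: "x \<in> v h" for h x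
 proof (rule shf_ex[OF v' h PP[OF h]])
  fix l assume l: "l \<in> PP h"
  then have l': "arr l" "tgt l = src h" "cmp h l \<in> P" by (auto simp: PP_def)
  show "\<sigma> (cmp h l) (r h l x) \<in> v' (cmp h l)"
   by (rule natmD(1)[OF s l'(3) vD(2)[OF h x l'(1,2)]])
  fix k assume k: "arr k" "tgt k = src l"
  show "\<sigma> (cmp h (cmp l k)) (r h (cmp l k) x) = r' (cmp h l) k (\<sigma> (cmp h l) (r h l x))"
   using natmD(2)[OF s l'(3) vD(2)[OF h x l'(1,2)] k(1)] vD(3)[OF h x l'(1,2) k] k l' h by (simp add: comp_assoc)
 qed
 define \<Sigma> where "\<Sigma> h x = (SOME y. y \<in> v' h \<and> (\<forall>l \<in> PP h. r' h l y = \<sigma> (cmp h l) (r h l x)))" for h x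
 have S: "\<Sigma> h x \<in> v' h" "!!l. l \<in> PP h ==> r' h l (\<Sigma> h x) = \<sigma> (cmp h l) (r h l x)" if h: "h \<in> into C X" and x: "x \<in> v h" for h x
  using someI_ex[OF ex[OF that, unfolded Bex_def], folded \<Sigma>_def] by auto
 have "natm C (into C X) v r v' r' \<Sigma>" unfolding natm_def
 proof (intro ballI conjI)
  fix h x assume h: "h \<in> into C X" and x: "x \<in> v h"
  show "\<Sigma> h x \<in> v' h" by (rule S(1)[OF h x])
  fix k assume "k \<in> pre h"
  then have k: "arr k" "tgt k = src h" by auto
  have hk: "cmp h k \<in> into C X" "src (cmp h k) = src k" using h k by auto
  show "\<Sigma> (cmp h k) (r h k x) = r' h k (\<Sigma> h x)"
  proof (rule shf_sep[OF v' hk(1) PP[OF hk(1)] S(1)[OF hk(1) vD(2)[OF h x k]] vD'(2)[OF h S(1)[OF h x] k]])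
   fix l assume l: "l \<in> PP (cmp h k)"
   then have l': "arr l" "tgt l = src k" "cmp k l \<in> PP h" using h k by (auto simp: PP_def comp_assoc)
   show "r' (cmp h k) l (\<Sigma> (cmp h k) (r h k x)) = r' (cmp h k) l (r' h k (\<Sigma> h x))"
    using S(2)[OF hk(1) vD(2)[OF h x k] l] S(2)[OF h x l'(3)] vD(3)[OF h x k l'(1,2)] vD'(3)[OF h S(1)[OF h x] k l'(1,2)] h k l' by (simp add: comp_assoc)
  qed
 qed
 moreover have "\<Sigma> h x = \<sigma> h x" if h: "h \<in> P" and x: "x \<in> v h" for h x
 proof -
  have h': "h \<in> into C X" using P' h by auto
  have i: "Idt C (src h) \<in> PP h" using h h' by (simp add: PP_def)
  show ?thesis using S(2)[OF h' x i] vD(1)[OF h' x] vD'(1)[OF h' S(1)[OF h' x]] h' by simp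
 qed
 ultimately show ?thesis by blast
qed

lemma hom_glue_unique:
 assumes v: "pshf C (into C X) v r" and v': "shf C Cov (into C X) v' r'" and P: "cs X P"
  and s: "natm C (into C X) v r v' r' \<sigma>" "natm C (into C X) v r v' r' \<tau>"
  and e: "!!h x. h \<in> P ==> x \<in> v h ==> \<sigma> h x = \<tau> h x" and h: "h \<in> into C X" "x \<in> v h"
 shows "\<sigma> h x = \<tau> h x"
proof (rule shf_sep[OF v' h(1) cs_pull[OF P]])
 fix k assume k: "k \<in> {k \<in> pre h. cmp h k \<in> P}"
 show "r' h k (\<sigma> h x) = r' h k (\<tau> h x)"
  using natmD(2)[OF s(1) h, of k] natmD(2)[OF s(2) h, of k] k e[OF _ pshfD(2)[OF v h, of k]] by simp
qed (use h natmD(1)[OF s(1) h] natmD(1)[OF s(2) h] in auto)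

text \<open>Injectivity is separatedness of the source. For surjectivity the local preimages are
  glued; they match because \<open>\<sigma>\<close> is injective on the sieve.\<close>

lemma loc_bij:
 assumes v: "shf C Cov (into C X) v r" and v': "shf C Cov (into C X) v' r'" and P: "cs X P"
  and s: "natm C (into C X) v r v' r' \<sigma>" and b: "!!h. h \<in> P ==> bij_betw (\<sigma> h) (v h) (v' h)" and h: "h \<in> into C X"
 shows "bij_betw (\<sigma> h) (v h) (v' h)"
proof -
 note vD = pshfD[OF shf_pshf[OF v]] and vD' = pshfD[OF shf_pshf[OF v']]
 note P' = csvD[OF P]
 let ?P = "{k \<in> pre h. cmp h k \<in> P}"
 have PP: "cs (src h) ?P" by (rule cs_pull[OF P]) (use h in auto)
 have inj: "x = y" if "x \<in> v h" "y \<in> v h" "\<sigma> h x = \<sigma> h y" for x y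
 proof (rule shf_sep[OF v h PP that(1,2)])
  fix k assume k: "k \<in> ?P"
  have "\<sigma> (cmp h k) (r h k x) = \<sigma> (cmp h k) (r h k y)"
   using natmD(2)[OF s h that(1)] natmD(2)[OF s h that(2)] that(3) k by simp
  then show "r h k x = r h k y"
   using b[of "cmp h k"] k vD(2)[OF h that(1)] vD(2)[OF h that(2)] by (auto simp: bij_betw_def dest: inj_onD)
 qed
 have "\<exists>x \<in> v h. \<sigma> h x = z" if z: "z \<in> v' h" for z
 proof -
  define g where "g k = inv_into (v (cmp h k)) (\<sigma> (cmp h k)) (r' h k z)" for k
  have g: "g k \<in> v (cmp h k)" "\<sigma> (cmp h k) (g k) = r' h k z" if k: "k \<in> ?P" for k
  proof -
   have "r' h k z \<in> \<sigma> (cmp h k) ` v (cmp h k)"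
    using b[of "cmp h k"] k vD'(2)[OF h z] by (auto simp: bij_betw_def)
   then show "g k \<in> v (cmp h k)" "\<sigma> (cmp h k) (g k) = r' h k z"
    unfolding g_def by (rule inv_into_into, rule f_inv_into_f)
  qed
  have gn: "g (cmp k l) = r (cmp h k) l (g k)" if k: "k \<in> ?P" and l: "arr l" "tgt l = src k" for k l
  proof -
   have k': "cmp h k \<in> into C X" "arr k" "tgt k = src h" "src (cmp h k) = src k" using k h by auto
   have kl: "cmp k l \<in> ?P" "cmp (cmp h k) l = cmp h (cmp k l)" using csvD(4)[OF PP k l] h k' l by (auto simp: comp_assoc)
   have "\<sigma> (cmp h (cmp k l)) (r (cmp h k) l (g k)) = r' h (cmp k l) z"
    using natmD(2)[OF s k'(1) g(1)[OF k] l(1)] g(2)[OF k] vD'(3)[OF h z k'(2,3) l] kl(2) l k' by simp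
   moreover have "r (cmp h k) l (g k) \<in> v (cmp h (cmp k l))"
    using vD(2)[OF k'(1) g(1)[OF k] l(1)] l k' kl(2) by simp
   moreover have "inj_on (\<sigma> (cmp h (cmp k l))) (v (cmp h (cmp k l)))"
    using b[of "cmp h (cmp k l)"] kl by (simp add: bij_betw_def)
   ultimately show ?thesis using g[OF kl(1)] by (metis inj_onD)
  qed
  obtain x where x: "x \<in> v h" "\<forall>k \<in> ?P. r h k x = g k"
   using shf_ex[OF v h PP g(1) gn] by blast
  have "\<sigma> h x = z"
  proof (rule shf_sep[OF v' h PP natmD(1)[OF s h x(1)] z])
   fix k assume k: "k \<in> ?P"
   show "r' h k (\<sigma> h x) = r' h k z" using natmD(2)[OF s h x(1), of k] x(2) k g(2)[OF k] by simp
  qed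
  then show ?thesis using x by blast
 qed
 then show ?thesis using inj natmD(1)[OF s h] by (auto simp: bij_betw_def inj_on_def)
qed

end

context uni_site begin

text \<open>The extension consists of the matching families, coded in the universe.\<close>

lemma ext_sheaf:
 fixes v :: "'a => 'u set"
 assumes P: "cs X P" and v: "shf C Cov P v r"
 shows "\<exists>V R \<iota>. shf C Cov (into C X) V R \<and> natm C P v r V R \<iota> \<and> (\<forall>h \<in> P. bij_betw (\<iota> h) (v h) (V h))"
proof -
 note P' = csvD[OF P]
 note vD = pshfD[OF shf_pshf[OF v]]
 obtain e :: "('a => 'u) => 'u" where e: "inj_on e (Arr C \<rightarrow>\<^sub>E UNIV)" using small_category by blast
 define PP where "PP h = {l \<in> pre h. cmp h l \<in> P}" for h
 have PP: "cs (src h) (PP h)" if "h \<in> into C X" for h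
  unfolding PP_def by (rule cs_pull[OF P]) (use that in auto)
 \<comment> \<open>Matching families on the sieve \<open>PP h\<close>, extensional so that they are
   functions on \<open>Arr C\<close> in the domain where \<open>e\<close> is injective.\<close>
 define F where "F h = {f \<in> extensional (PP h). (\<forall>l \<in> PP h. f l \<in> v (cmp h l)) \<and>
  (\<forall>l \<in> PP h. \<forall>k \<in> pre l. f (cmp l k) = r (cmp h l) k (f l))}" for h
 have FA: "F h \<subseteq> Arr C \<rightarrow>\<^sub>E UNIV" for h
  unfolding F_def PP_def by (auto simp: extensional_def)
 have einj: "f = g" if "f \<in> F h" "g \<in> F h'" "e f = e g" for f g h h'
  using inj_onD[OF e, of f g] subsetD[OF FA that(1)] subsetD[OF FA that(2)] that(3) by simp
 define V where "V h = e ` F h" for h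
 define d where "d h = inv_into (F h) e" for h
 have d: "d h (e f) = f" if "f \<in> F h" for f h
  unfolding d_def by (rule inv_into_f_f[OF inj_on_subset[OF e FA] that])
 define sh where "sh h k f = (\<lambda>l \<in> PP (cmp h k). f (cmp k l))" for h k and f :: "'a => 'u"
 define R where "R h k x = e (sh h k (d h x))" for h k x
 have FD: "f l \<in> v (cmp h l)" "arr k ==> tgt k = src l ==> f (cmp l k) = r (cmp h l) k (f l)"
  if "f \<in> F h" "l \<in> PP h" for f h l k
  using that by (auto simp: F_def)
 have Fext: "f = g" if "f \<in> F h" "g \<in> F h" "!!l. l \<in> PP h ==> f l = g l" for f g h
  by (rule extensionalityI[of _ "PP h"]) (use that in \<open>auto simp: F_def\<close>)
 have kP: "cmp k l \<in> PP h" if "l \<in> PP (cmp h k)" "h \<in> into C X" "arr k" "tgt k = src h" for h k l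
  using that by (auto simp: PP_def comp_assoc)
 have PPc: "cmp l k \<in> PP h" if "h \<in> into C X" "l \<in> PP h" "arr k" "tgt k = src l" for h l k
  using csvD(4)[OF PP[OF that(1)] that(2-4)] .
 have shF: "sh h k f \<in> F (cmp h k)" if f: "f \<in> F h" and h: "h \<in> into C X" and k: "arr k" "tgt k = src h" for f h k
 proof -
  have hk: "cmp h k \<in> into C X" using h k by auto
  have A: "cmp (cmp h k) l = cmp h (cmp k l)" if "l \<in> PP (cmp h k)" for l
   using that h k by (auto simp: PP_def comp_assoc)
  have B: "cmp (cmp k l) m = cmp k (cmp l m)" if "l \<in> PP (cmp h k)" "arr m" "tgt m = src l" for l m
   using that h k by (auto simp: PP_def comp_assoc)
  have D: "src (cmp k l) = src l" if "l \<in> PP (cmp h k)" for l using that h k by (auto simp: PP_def)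
  show ?thesis unfolding F_def sh_def
   using FD[OF f kP[OF _ h k]] PPc[OF hk] by (auto simp: A D B[symmetric])
 qed
 have Rin: "R h k (e f) = e (sh h k f)" if "f \<in> F h" for h k f using d[OF that] by (simp add: R_def)
 have V1: "pshf C (into C X) V R" unfolding pshf_def
 proof (intro ballI conjI)
  fix h x assume h: "h \<in> into C X" and "x \<in> V h"
  then obtain f where f: "f \<in> F h" "x = e f" by (auto simp: V_def)
  have "sh h (Idt C (src h)) f = f"
  proof (rule Fext[OF _ f(1)])
   show "sh h (Idt C (src h)) f \<in> F h" using shF[OF f(1) h, of "Idt C (src h)"] h by simp
   show "sh h (Idt C (src h)) f l = f l" if "l \<in> PP h" for l using that h by (auto simp: sh_def PP_def)
  qed
  then show "R h (Idt C (src h)) x = x" using Rin[OF f(1)] f(2) by simp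
  fix k assume "k \<in> pre h"
  then have k: "arr k" "tgt k = src h" by auto
  note s = shF[OF f(1) h k]
  show "R h k x \<in> V (cmp h k)" using s Rin[OF f(1)] f(2) by (simp add: V_def)
  fix l assume "l \<in> pre k"
  then have l: "arr l" "tgt l = src k" by auto
  have "sh (cmp h k) l (sh h k f) = sh h (cmp k l) f"
   unfolding sh_def using h k l by (auto simp: fun_eq_iff restrict_def PP_def comp_assoc)
  then show "R (cmp h k) l (R h k x) = R h (cmp k l) x"
   using Rin[OF f(1)] Rin[OF s] f(2) by simp
 qed
 have "shf C Cov (into C X) V R" unfolding shf_def
 proof (intro conjI V1 ballI allI impI, elim conjE)
  fix h T x assume h: "h \<in> into C X" and T: "cs (src h) T" and x: "\<forall>u \<in> T. x u \<in> V (cmp h u)"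
   and xn: "\<forall>u\<in>T. \<forall>k\<in>pre u. x (cmp u k) = R (cmp h u) k (x u)"
  note T' = csvD[OF T]
  have h': "arr h" "tgt h = X" using h by auto
  \<comment> \<open>A section of the extension over each \<open>u\<close> is decoded to a family, so
    the data to be glued are a family of families.\<close>
  define f where "f u = d (cmp h u) (x u)" for u
  have f: "f u \<in> F (cmp h u)" "x u = e (f u)" if "u \<in> T" for u
   using x that d by (auto simp: V_def f_def)
  have fn: "f (cmp u k) = sh (cmp h u) k (f u)" if u: "u \<in> T" "arr k" "tgt k = src u" for u k
  proof (rule einj[OF f(1)[OF T'(4)[OF u]]])
   show "sh (cmp h u) k (f u) \<in> F (cmp (cmp h u) k)" by (rule shF[OF f(1)[OF u(1)]]) (use u h' T' in auto)
   show "e (f (cmp u k)) = e (sh (cmp h u) k (f u))"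
    using xn u f(2)[OF T'(4)[OF u]] f[OF u(1)] Rin by auto
  qed
  have idP: "Idt C (src u) \<in> PP (cmp h u)" if "u \<in> T" "cmp h u \<in> P" for u using that T' h' by (auto simp: PP_def)
  \<comment> \<open>The member of \<open>f u\<close> at \<open>l\<close> depends only on the
    composite \<open>cmp u l\<close>: it is the member of \<open>f (cmp u l)\<close> at the
    identity.\<close>
  have f0: "f (cmp u l) (Idt C (src l)) = f u l" if u: "u \<in> T" and l: "l \<in> PP (cmp h u)" for u l
  proof -
   have l': "arr l" "tgt l = src u" "cmp (cmp h u) l \<in> P" using l u T' h' by (auto simp: PP_def)
   have "Idt C (src l) \<in> PP (cmp (cmp h u) l)" using l' u T' h' by (auto simp: PP_def)
   then show ?thesis using fn[OF u l'(1,2)] l' by (simp add: sh_def)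
  qed
  define Tl where "Tl l = {w \<in> pre l. cmp l w \<in> T}" for l
  have Tl: "cs (src l) (Tl l)" if "l \<in> PP h" for l unfolding Tl_def by (rule cs_pull[OF T]) (use that in \<open>auto simp: PP_def\<close>)
  have w: "arr w" "tgt w = src l" "cmp l w \<in> T" "arr l" "tgt l = src h" "cmp h l \<in> P" "cmp (cmp h l) w \<in> P"
   "cmp h (cmp l w) = cmp (cmp h l) w" "w \<in> PP (cmp h l)" if "l \<in> PP h" "w \<in> Tl l" for l w
   using that h' P'(4)[of "cmp h l" w] by (auto simp: PP_def Tl_def comp_assoc)
  \<comment> \<open>The member of the glued family at \<open>l\<close> is itself glued, in the
    original sheaf, from the members over those \<open>w\<close> for which \<open>cmp l w\<close>
    lies in \<open>T\<close>.\<close>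
  have ex: "\<exists>y \<in> v (cmp h l). \<forall>w \<in> Tl l. r (cmp h l) w y = f (cmp l w) (Idt C (src w))" if l: "l \<in> PP h" for l
  proof (rule shf_ex[OF v])
   show hl: "cmp h l \<in> P" using l by (simp add: PP_def)
   show "cs (src (cmp h l)) (Tl l)" using Tl[OF l] l h' by (simp add: PP_def)
   fix u assume u: "u \<in> Tl l"
   note wu = w[OF l u]
   have i: "Idt C (src u) \<in> PP (cmp h (cmp l u))" using idP[OF wu(3)] wu by simp
   show "f (cmp l u) (Idt C (src u)) \<in> v (cmp (cmp h l) u)"
    using FD(1)[OF f(1)[OF wu(3)] i] wu h' by simp
   fix k assume k: "arr k" "tgt k = src u"
   have kk: "k \<in> PP (cmp h (cmp l u))" using k wu P'(4)[OF wu(7) k(1)] h' by (auto simp: PP_def)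
   have "f (cmp l (cmp u k)) (Idt C (src k)) = f (cmp l u) k"
    using f0[OF wu(3) kk] k wu by (simp add: comp_assoc)
   also have "\<dots> = r (cmp (cmp h l) u) k (f (cmp l u) (Idt C (src u)))"
    using FD(2)[OF f(1)[OF wu(3)] i, of k] k wu h' by simp
   finally show "f (cmp l (cmp u k)) (Idt C (src (cmp u k))) = r (cmp (cmp h l) u) k (f (cmp l u) (Idt C (src u)))"
    using k wu by simp
  qed
  define g where "g = (\<lambda>l \<in> PP h. SOME y. y \<in> v (cmp h l) \<and> (\<forall>w \<in> Tl l. r (cmp h l) w y = f (cmp l w) (Idt C (src w))))"
  have g: "g l \<in> v (cmp h l)" "!!w. w \<in> Tl l ==> r (cmp h l) w (g l) = f (cmp l w) (Idt C (src w))" if l: "l \<in> PP h" for l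
   using someI_ex[OF ex[OF l, unfolded Bex_def]] l by (auto simp: g_def)
  have gF: "g \<in> F h" unfolding F_def
  proof (intro CollectI conjI ballI)
   show "g \<in> extensional (PP h)" by (simp add: g_def)
   show "g l \<in> v (cmp h l)" if "l \<in> PP h" for l by (rule g(1)[OF that])
   fix l k assume l: "l \<in> PP h" and "k \<in> pre l"
   then have k: "arr k" "tgt k = src l" and l': "arr l" "tgt l = src h" "cmp h l \<in> P" by (auto simp: PP_def)
   note lk = PPc[OF h l k]
   have A: "cmp (cmp h l) k = cmp h (cmp l k)" using h' l' k by (simp add: comp_assoc)
   show "g (cmp l k) = r (cmp h l) k (g l)"
   proof (rule shf_sep[OF v])
    show "cmp h (cmp l k) \<in> P" using lk by (simp add: PP_def)
    show "cs (src (cmp h (cmp l k))) (Tl (cmp l k))" using Tl[OF lk] h' l' k by simp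
    show "g (cmp l k) \<in> v (cmp h (cmp l k))" by (rule g(1)[OF lk])
    show "r (cmp h l) k (g l) \<in> v (cmp h (cmp l k))" using vD(2)[OF l'(3) g(1)[OF l] k(1)] k l' h' A by simp
    fix u assume u: "u \<in> Tl (cmp l k)"
    have u': "arr u" "tgt u = src k" "cmp k u \<in> Tl l" using u k l' by (auto simp: Tl_def comp_assoc)
    show "r (cmp h (cmp l k)) u (g (cmp l k)) = r (cmp h (cmp l k)) u (r (cmp h l) k (g l))"
     using g(2)[OF lk u] g(2)[OF l u'(3)] vD(3)[OF l'(3) g(1)[OF l] k(1) _ u'(1,2)] k l' h' u' by (simp add: A comp_assoc)
   qed
  qed
  have sg: "sh h u g = f u" if u: "u \<in> T" for u
  proof (rule Fext[OF shF[OF gF h] f(1)[OF u]])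
   show u': "arr u" "tgt u = src h" using T' u by auto
   fix l assume l: "l \<in> PP (cmp h u)"
   note ul = kP[OF l h u']
   have l': "arr l" "tgt l = src u" using l u' h' by (auto simp: PP_def)
   have i: "Idt C (src l) \<in> Tl (cmp u l)" using l' u u' T'(4)[OF u l'] by (simp add: Tl_def)
   have hP: "cmp h (cmp u l) \<in> P" using ul by (simp add: PP_def)
   have "g (cmp u l) = f (cmp u l) (Idt C (src l))"
    using g(2)[OF ul i] vD(1)[OF hP g(1)[OF ul]] l' u' h' by simp
   then show "sh h u g l = f u l" using l f0[OF u l] by (simp add: sh_def)
  qed
  show "\<exists>!y. y \<in> V h \<and> (\<forall>u\<in>T. R h u y = x u)"
  proof (rule ex1I[of _ "e g"])
   show "e g \<in> V h \<and> (\<forall>u\<in>T. R h u (e g) = x u)" using gF sg f(2) Rin[OF gF] by (auto simp: V_def)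
   fix y assume y: "y \<in> V h \<and> (\<forall>u\<in>T. R h u y = x u)"
   then obtain g' where g': "g' \<in> F h" "y = e g'" by (auto simp: V_def)
   have s': "sh h u g' = sh h u g" if u: "u \<in> T" for u
   proof (rule einj[OF shF[OF g'(1) h] shF[OF gF h]])
    show "e (sh h u g') = e (sh h u g)" using y g' u Rin[OF g'(1)] sg[OF u] f(2)[OF u] by simp
   qed (use T' u in auto)
   have "g' = g"
   proof (rule Fext[OF g'(1) gF])
    fix l assume l: "l \<in> PP h"
    have hl: "cmp h l \<in> P" "arr l" "tgt l = src h" using l by (auto simp: PP_def)
    show "g' l = g l"
    proof (rule shf_sep[OF v hl(1) _ FD(1)[OF g'(1) l] FD(1)[OF gF l]])
     show "cs (src (cmp h l)) (Tl l)" using Tl[OF l] hl h' by simp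
     fix u assume u: "u \<in> Tl l"
     note wu = w[OF l u]
     have i: "Idt C (src u) \<in> PP (cmp h (cmp l u))" using idP[OF wu(3)] wu by simp
     have "g' (cmp l u) = g (cmp l u)"
      using fun_cong[OF s'[OF wu(3)], of "Idt C (src u)"] i wu by (simp add: sh_def)
     then show "r (cmp h l) u (g' l) = r (cmp h l) u (g l)"
      using FD(2)[OF g'(1) l wu(1,2)] FD(2)[OF gF l wu(1,2)] by simp
    qed
   qed
   then show "y = e g" using g' by simp
  qed
 qed
 moreover
 \<comment> \<open>On \<open>P\<close> itself a section is sent to the family of its
   restrictions.\<close>
 define \<iota> where "\<iota> h x = e (\<lambda>l \<in> PP h. r h l x)" for h x
 have PPP: "PP h = pre h" if "h \<in> P" for h using that P'(4) by (auto simp: PP_def)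
 have iF: "(\<lambda>l \<in> PP h. r h l x) \<in> F h" if h: "h \<in> P" and x: "x \<in> v h" for h x
  unfolding F_def using vD[OF h x] P'(2)[OF h] by (auto simp: PPP[OF h])
 have "natm C P v r V R \<iota>" unfolding natm_def
 proof (intro ballI conjI)
  fix h x k assume h: "h \<in> P" and x: "x \<in> v h"
  show "\<iota> h x \<in> V h" using iF[OF h x] by (simp add: V_def \<iota>_def)
  assume "k \<in> pre h"
  then have k: "arr k" "tgt k = src h" by auto
  note hk = P'(4)[OF h k]
  have "sh h k (\<lambda>l \<in> PP h. r h l x) = (\<lambda>l \<in> PP (cmp h k). r (cmp h k) l (r h k x))"
   unfolding sh_def using P'(2)[OF h] k vD(3)[OF h x k] by (auto simp: fun_eq_iff restrict_def PPP[OF h] PPP[OF hk])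
  then show "\<iota> (cmp h k) (r h k x) = R h k (\<iota> h x)"
   unfolding \<iota>_def Rin[OF iF[OF h x]] by simp
 qed
 moreover have "bij_betw (\<iota> h) (v h) (V h)" if h: "h \<in> P" for h
  unfolding bij_betw_def
 proof
  have i: "Idt C (src h) \<in> PP h" using P'(2)[OF h] by (simp add: PPP[OF h])
  show "inj_on (\<iota> h) (v h)"
  proof (rule inj_onI)
   fix x y assume x: "x \<in> v h" and y: "y \<in> v h" and "\<iota> h x = \<iota> h y"
   then have eq: "(\<lambda>l \<in> PP h. r h l x) = (\<lambda>l \<in> PP h. r h l y)" using einj[OF iF[OF h x] iF[OF h y]] by (simp add: \<iota>_def)
   show "x = y" using fun_cong[OF eq, of "Idt C (src h)"] i vD(1)[OF h x] vD(1)[OF h y] by simp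
  qed
  show "\<iota> h ` v h = V h"
  proof (rule equalityI)
   show "\<iota> h ` v h \<subseteq> V h" using iF[OF h] by (auto simp: V_def \<iota>_def)
   show "V h \<subseteq> \<iota> h ` v h"
   proof
    fix x assume "x \<in> V h"
    then obtain f where f: "f \<in> F h" "x = e f" by (auto simp: V_def)
    \<comment> \<open>Over an arrow of \<open>P\<close> the sieve contains the identity, and
      evaluation there inverts \<open>\<iota>\<close>.\<close>
    let ?x = "f (Idt C (src h))"
    have x: "?x \<in> v h" using FD(1)[OF f(1) i] P'(2)[OF h] by simp
    have "(\<lambda>l \<in> PP h. r h l ?x) = f"
    proof (rule Fext[OF iF[OF h x] f(1)])
     fix l assume "l \<in> PP h"
     then show "(\<lambda>l \<in> PP h. r h l ?x) l = f l" using FD(2)[OF f(1) i, of l] P'(2)[OF h] by (auto simp: PPP[OF h])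
    qed
    then have "\<iota> h ?x = x" using f(2) by (simp add: \<iota>_def)
    then show "x \<in> \<iota> h ` v h" using x by blast
   qed
  qed
 qed
 ultimately show ?thesis by blast
qed

end

section \<open>The sheaves induced by \<open>G\<close> and their comparison in charts\<close>

locale stk = uni_site C Cov enc + slice_psh C M G
 for C :: "('o, 'a) cat" and Cov and enc :: "'u \<times> 'u => 'u" and M :: "('o, 'a, 'u) ugpsh"
  and G :: "('o \<times> 'u, ('o, 'a, 'u) slice_arr, 'u) set_psh" +
 assumes G_sheaf: "sheaf (slice C M) (slice_cov C Cov M) G"
begin

text \<open>The sheaf condition on \<open>C/M\<close>, applied to the cover of \<open>(Y, m)\<close>
  by the arrows of \<open>S\<close> paired with identities of \<open>M\<close>.\<close>

lemma cover_ex1: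
 assumes S: "Cov Y S" and m: "m \<in> OM Y" and x: "!!u. u \<in> S ==> x u \<in> at G (src u, rO u m)"
  and xn: "!!u v k l. [|u \<in> S; v \<in> S; arr k; arr l; tgt k = src u; tgt l = src v; cmp u k = cmp v l|]
   ==> rG k (rO u m) (x u) = rG l (rO v m) (x v)"
 shows "\<exists>!t. t \<in> at G (Y, m) \<and> (\<forall>u \<in> S. rG u m t = x u)"
proof -
 note SX = cov_arrows[OF S]
 note [simp] = Ms
 let ?r = "\<lambda>u. ((src u, rO u m), (u, Idt (MD u) (rO u m)), (Y, m))"
 let ?s = "(\<lambda>(y, (u, \<alpha>), z). x u) :: ('o, 'a, 'u) slice_arr => 'u"
 have rG: "rG u m t = rs G (?r u) t" if "u \<in> S" for u t using SX that by (simp add: gr_def)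
 have arr: "?r u \<in> Arr (slice C M)" if "u \<in> S" for u using that SX m by (auto simp: Hom_iff)
 have R: "slice_cov C Cov M (Y, m) (?r ` S)"
 proof -
  have "(\<lambda>(y, (h, \<alpha>), z). h) ` ?r ` S = S" by (force simp: image_iff)
  then show ?thesis unfolding slice_cov_def using S SX m arr by auto
 qed
 have sh: "(\<forall>r \<in> ?r ` S. s r \<in> at G (Dom (slice C M) r)) \<and>
   (\<forall>u\<in>?r ` S. \<forall>v\<in>?r ` S. \<forall>Y. \<forall>g\<in>Hom (slice C M) Y (Dom (slice C M) u). \<forall>h\<in>Hom (slice C M) Y (Dom (slice C M) v).
    Comp (slice C M) u g = Comp (slice C M) v h --> rs G g (s u) = rs G h (s v))
   ==> \<exists>!t. t \<in> at G (Y, m) \<and> (\<forall>u\<in>?r ` S. rs G u t = s u)" for s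
  by (rule G_sheaf[unfolded sheaf_def, THEN conjunct2, THEN spec, THEN spec, THEN mp, OF R, THEN spec, THEN mp])
 have "\<exists>!t. t \<in> at G (Y, m) \<and> (\<forall>r\<in>?r ` S. rs G r t = ?s r)"
 proof (rule sh, intro conjI ballI allI impI)
  fix r assume "r \<in> ?r ` S"
  then show "?s r \<in> at G (Dom (slice C M) r)" using x by auto
 next
  fix r r' Z g h
  assume "r \<in> ?r ` S" "r' \<in> ?r ` S" and g: "g \<in> Hom (slice C M) Z (Dom (slice C M) r)" and h: "h \<in> Hom (slice C M) Z (Dom (slice C M) r')"
   and e: "Comp (slice C M) r g = Comp (slice C M) r' h"
  then obtain u v where u: "u \<in> S" "r = ?r u" "v \<in> S" "r' = ?r v" by blast
  obtain Y1 f k \<alpha> Y2 f2 where g': "g = ((Y1, f), (k, \<alpha>), (Y2, f2))" by (rule slice_arr_cases)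
  obtain Y3 f3 l \<beta> Y4 f4 where h': "h = ((Y3, f3), (l, \<beta>), (Y4, f4))" by (rule slice_arr_cases)
  have a: "g = ((Y1, f), (k, \<alpha>), (src u, rO u m))" "h = ((Y1, f), (l, \<beta>), (src v, rO v m))" "src k = Y1" "src l = Y1"
   using g h u by (auto simp: g' h' Hom_iff)
  have aa: "((Y1, f), (k, \<alpha>), (src u, rO u m)) \<in> Arr (slice C M)" "((Y1, f), (l, \<beta>), (src v, rO v m)) \<in> Arr (slice C M)"
   using g h unfolding a(1,2) by (simp_all add: Hom_iff del: slice_simps)
  have k: "arr k" "arr l" "tgt k = src u" "tgt l = src v" "\<alpha> \<in> AM Y1" "\<beta> \<in> AM Y1"
    "Cod (sect M Y1) \<alpha> = rO k (rO u m)"  "Cod (sect M Y1) \<beta> = rO l (rO v m)"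
   using g h u by (auto simp: a Hom_iff)
  have "ob Y1" using cat_simps(1)[OF catC k(1)] a(3) by simp
  \<comment> \<open>The members of this cover have identity second components, so equal composites
    force equal isomorphisms; matching in \<open>C\<close> is then acted on by one and the same
    isomorphism.\<close>
  then have ek: "cmp u k = cmp v l" "\<alpha> = \<beta>" using e u k SX m a(3,4) by (auto simp: a)
  have "rG k (rO u m) (x u) = rG l (rO v m) (x v)" by (rule xn[OF u(1,3) k(1-4) ek(1)])
  moreover have "rs G g (x u) = aG Y1 \<alpha> (rG k (rO u m) (x u))" unfolding a by (rule rs_dec[OF aa(1) x[OF u(1)]])
  moreover have "rs G h (x v) = aG Y1 \<beta> (rG l (rO v m) (x v))" unfolding a by (rule rs_dec[OF aa(2) x[OF u(3)]])
  ultimately show "rs G g (?s r) = rs G h (?s r')" using a(3,4) ek(2) by (simp add: u)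
 qed
 then show ?thesis using rG by simp
qed

lemma cover_sep:
 assumes S: "Cov Y S" and m: "m \<in> OM Y" and t: "t \<in> at G (Y, m)" "t' \<in> at G (Y, m)" "!!u. u \<in> S ==> rG u m t = rG u m t'"
 shows "t = t'"
proof -
 note SX = cov_arrows[OF S]
 have "\<exists>!t0. t0 \<in> at G (Y, m) \<and> (\<forall>u \<in> S. rG u m t0 = rG u m t')"
 proof (rule cover_ex1[OF S m])
  fix u v k l assume a: "u \<in> S" "v \<in> S" "arr k" "arr l" "tgt k = src u" "tgt l = src v" "cmp u k = cmp v l"
  then show "rG k (rO u m) (rG u m t') = rG l (rO v m) (rG v m t')"
   using gr_Comp[of k u m t'] gr_Comp[of l v m t'] SX m t by simp
 qed (use SX m t in \<open>auto intro: gr_in\<close>)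
 then show ?thesis by (rule ex1D) (use t in auto)
qed

abbreviation "gv m h \<equiv> at G (src h, rO h m)"
abbreviation "grs m \<equiv> (\<lambda>h k. rG k (rO h m))"

text \<open>The sheaf \<open>m\<^sup>*G\<close>. A matching family on a sieve is glued along a cover
  inside it; for the other members of the sieve the equality is checked on a pulled back
  cover.\<close>

lemma G_shf:
 assumes X: "ob X" and m: "m \<in> OM X"
 shows "shf C Cov (into C X) (gv m) (grs m)"
proof -
 note [simp] = Ms
 have p: "pshf C (into C X) (gv m) (grs m)" unfolding pshf_def
  using m by (auto simp: gr_Idt gr_in gr_Comp)
 show ?thesis unfolding shf_def
 proof (intro conjI p ballI allI impI, elim conjE)
  fix h P x assume h: "h \<in> into C X" and P: "cs (src h) P" and x: "\<forall>u\<in>P. x u \<in> at G (src (cmp h u), rO (cmp h u) m)"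
   and xn: "\<forall>u\<in>P. \<forall>k\<in>pre u. x (cmp u k) = rG k (rO (cmp h u) m) (x u)"
  note P' = csvD[OF P]
  obtain S where S: "S \<subseteq> P" "Cov (src h) S" using P by (auto simp: csv_def)
  have m': "rO h m \<in> Obj (MD h)" using h m by simp
  have hu: "src (cmp h u) = src u" "rO (cmp h u) m = rO u (rO h m)" if "u \<in> P" for u
   using that P' h m by auto
  have U: "\<exists>!t. t \<in> gv m h \<and> (\<forall>u \<in> S. rG u (rO h m) t = x u)"
  proof (rule cover_ex1[OF S(2) m'])
   fix u v k l assume a: "u \<in> S" "v \<in> S" "arr k" "arr l" "tgt k = src u" "tgt l = src v" "cmp u k = cmp v l"
   then show "rG k (rO u (rO h m)) (x u) = rG l (rO v (rO h m)) (x v)"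
    using xn[rule_format, of u k] xn[rule_format, of v l] subsetD[OF S(1) a(1)] subsetD[OF S(1) a(2)] hu by auto
  qed (use x S(1) hu in auto)
  have *: "rG w (rO h m) t = x w" if t: "t \<in> gv m h" "\<forall>u \<in> S. rG u (rO h m) t = x u" and w: "w \<in> P" for t w
  proof -
   have wa: "arr w" "tgt w = src h" using P' w by auto
   define Q where "Q = {cmp u k | u k. u \<in> S \<and> k \<in> pre u}"
   have "cs (src w) {k \<in> pre w. cmp w k \<in> Q}"
    unfolding Q_def by (rule cs_pull[OF cs_gen[OF S(2)]]) (use wa in auto)
   then obtain T' where T': "Cov (src w) T'" "T' \<subseteq> {k \<in> pre w. cmp w k \<in> Q}"
    by (auto simp: csv_def)
   show ?thesis
   proof (rule cover_sep[OF T'(1)])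
    show "rO w (rO h m) \<in> Obj (MD w)" using wa m' by simp
    show "rG w (rO h m) t \<in> gv (rO h m) w" using gr_in wa m' t by simp
    show "x w \<in> gv (rO h m) w" using x w hu by auto
    fix k assume k: "k \<in> T'"
    then have k': "arr k" "tgt k = src w" using T' by auto
    obtain u l where u: "u \<in> S" "arr l" "tgt l = src u" "cmp w k = cmp u l" using k T' by (auto simp: Q_def)
    have uP: "u \<in> P" and ua: "arr u" "tgt u = src h" using u S P' by auto
    have "rG k (rO w (rO h m)) (rG w (rO h m) t) = rG (cmp u l) (rO h m) t"
     using gr_Comp[of k w "rO h m" t] k' wa m' t u by simp
    also have "\<dots> = rG l (rO u (rO h m)) (x u)" using gr_Comp[of l u "rO h m" t] u ua m' t by simp
    also have "\<dots> = x (cmp w k)" using xn[rule_format, OF uP, of l] u hu[OF uP] by simp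
    also have "\<dots> = rG k (rO w (rO h m)) (x w)" using xn[rule_format, OF w, of k] k' hu[OF w] by simp
    finally show "rG k (rO w (rO h m)) (rG w (rO h m) t) = rG k (rO w (rO h m)) (x w)" .
   qed
  qed
  show "\<exists>!y. y \<in> gv m h \<and> (\<forall>u\<in>P. rG u (rO h m) y = x u)"
  proof (rule ex_ex1I)
   show "\<exists>y. y \<in> gv m h \<and> (\<forall>u\<in>P. rG u (rO h m) y = x u)"
    using ex1_implies_ex[OF U] * by blast
   fix y y' assume y: "y \<in> gv m h \<and> (\<forall>u\<in>P. rG u (rO h m) y = x u)"
    "y' \<in> gv m h \<and> (\<forall>u\<in>P. rG u (rO h m) y' = x u)"
   show "y = y'" by (rule ex1D[OF U]) (use y S(1) in auto)
  qed
 qed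
qed

text \<open>\<open>crel m \<phi> m' \<phi>' s u \<alpha>\<close>: over \<open>u\<close>, the charts \<open>\<phi>\<close> and \<open>\<phi>'\<close> correspond under \<open>s\<close> up to the action of \<open>\<alpha>\<close>.\<close>

definition crel :: "'u => ('a => 'u => 'u) => 'u => ('a => 'u => 'u) => ('a => 'u => 'u) => 'a => 'u => bool" where
 "crel m \<phi> m' \<phi>' s u \<alpha> \<longleftrightarrow> \<alpha> \<in> Arr (MD u) \<and> Dom (MD u) \<alpha> = rO u m \<and>
  Cod (MD u) \<alpha> = rO u m' \<and>
  (\<forall>k \<in> pre u. \<forall>x \<in> gv (rO u m') k.
   \<phi>' (cmp u k) x = s (cmp u k) (\<phi> (cmp u k) (aG (src k) (rA k \<alpha>) x)))"

text \<open>The isomorphism \<open>\<alpha>\<close> is not recorded, and the ones over different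
  \<open>u\<close> need not be compatible. So automorphisms in \<open>M\<close> that act trivially
  on \<open>G\<close> leave no trace, and the relation becomes a local property of the charts and of
  \<open>s\<close>.\<close>

definition crs :: "'o => 'u => ('a => 'u => 'u) => 'u => ('a => 'u => 'u) => ('a => 'u => 'u) => 'a set" where
 "crs Y m \<phi> m' \<phi>' s = {u \<in> into C Y. \<exists>\<alpha>. crel m \<phi> m' \<phi>' s u \<alpha>}"

abbreviation "rel Y m \<phi> m' \<phi>' s \<equiv> cs Y (crs Y m \<phi> m' \<phi>' s)"

lemma crel_comp:
 assumes m: "m \<in> OM Y" "m' \<in> OM Y" and u: "arr u" "tgt u = Y" and c: "crel m \<phi> m' \<phi>' s u \<alpha>"
  and k: "arr k" "tgt k = src u"
 shows "crel m \<phi> m' \<phi>' s (cmp u k) (rA k \<alpha>)"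
 unfolding crel_def
proof (intro conjI ballI)
 note [simp] = Ms
 have a: "\<alpha> \<in> Arr (MD u)" "Dom (MD u) \<alpha> = rO u m" "Cod (MD u) \<alpha> = rO u m'"
  using c by (auto simp: crel_def)
 show "rA k \<alpha> \<in> AM (src (cmp u k))"
  "Dom (sect M (src (cmp u k))) (rA k \<alpha>) = rO (cmp u k) m"
  "Cod (sect M (src (cmp u k))) (rA k \<alpha>) = rO (cmp u k) m'"
  using a m u k by auto
 fix l x assume l: "l \<in> pre (cmp u k)" and x: "x \<in> at G (src l, rO l (rO (cmp u k) m'))"
 then show "\<phi>' (cmp (cmp u k) l) x = s (cmp (cmp u k) l) (\<phi> (cmp (cmp u k) l) (aG (src l) (rA l (rA k \<alpha>)) x))"
  using c[unfolded crel_def, THEN conjunct2, THEN conjunct2, THEN conjunct2, rule_format, of "cmp k l" x] a m u k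
  by (simp add: comp_assoc)
qed

lemma crs_into: "crs Y m \<phi> m' \<phi>' s \<subseteq> into C Y"
 by (auto simp: crs_def)

lemma crs_comp:
 assumes "m \<in> OM Y" "m' \<in> OM Y" "u \<in> crs Y m \<phi> m' \<phi>' s" "arr k" "tgt k = src u"
 shows "cmp u k \<in> crs Y m \<phi> m' \<phi>' s"
proof -
 obtain \<alpha> where u: "arr u" "tgt u = Y" and a: "crel m \<phi> m' \<phi>' s u \<alpha>" using assms(3) by (auto simp: crs_def)
 then show ?thesis using crel_comp[OF assms(1,2) u a assms(4,5)] assms(4,5) unfolding crs_def by auto
qed

lemma crel_trans:
 assumes m: "m \<in> OM Y" "m' \<in> OM Y" "m'' \<in> OM Y" and u: "arr u" "tgt u = Y"
  and c: "crel m \<phi> m' \<phi>' s u \<alpha>" "crel m' \<phi>' m'' \<phi>'' s' u \<beta>"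
  and e: "!!k x. [|arr k; tgt k = src u; x \<in> gv (rO u m) k|]
   ==> s' (cmp u k) (s (cmp u k) (\<phi> (cmp u k) x)) = s'' (cmp u k) (\<phi> (cmp u k) x)"
 shows "crel m \<phi> m'' \<phi>'' s'' u (Comp (MD u) \<beta> \<alpha>)"
 unfolding crel_def
proof (intro conjI ballI)
 note [simp] = Ms
 have a: "\<alpha> \<in> Arr (MD u)" "Dom (MD u) \<alpha> = rO u m" "Cod (MD u) \<alpha> = rO u m'"
  using c by (auto simp: crel_def)
 have b: "\<beta> \<in> Arr (MD u)" "Dom (MD u) \<beta> = rO u m'" "Cod (MD u) \<beta> = rO u m''"
  using c by (auto simp: crel_def)
 show "Comp (MD u) \<beta> \<alpha> \<in> Arr (MD u)" "Dom (MD u) (Comp (MD u) \<beta> \<alpha>) = rO u m"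
  "Cod (MD u) (Comp (MD u) \<beta> \<alpha>) = rO u m''"
  using a b u by auto
 fix k x assume k: "k \<in> pre u" and x: "x \<in> gv (rO u m'') k"
 have bx: "aG (src k) (rA k \<beta>) x \<in> gv (rO u m') k"
  using ga_in[of "src k" "rA k \<beta>" x] k b x u by simp
 have abx: "aG (src k) (rA k \<alpha>) (aG (src k) (rA k \<beta>) x) \<in> gv (rO u m) k"
  using ga_in[of "src k" "rA k \<alpha>" "aG (src k) (rA k \<beta>) x"] k a bx u by simp
 have "\<phi>'' (cmp u k) x = s' (cmp u k) (\<phi>' (cmp u k) (aG (src k) (rA k \<beta>) x))"
  using c(2) k x by (auto simp: crel_def)
 also have "\<dots> = s' (cmp u k) (s (cmp u k) (\<phi> (cmp u k) (aG (src k) (rA k \<alpha>) (aG (src k) (rA k \<beta>) x))))"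
  using c(1) k bx by (auto simp: crel_def)
 also have "\<dots> = s'' (cmp u k) (\<phi> (cmp u k) (aG (src k) (rA k \<alpha>) (aG (src k) (rA k \<beta>) x)))"
  using e abx k by simp
 also have "aG (src k) (rA k \<alpha>) (aG (src k) (rA k \<beta>) x) = aG (src k) (rA k (Comp (MD u) \<beta> \<alpha>)) x"
  using ga_Comp[of "src k" "rA k \<alpha>" "rA k \<beta>" x] k a b x u by simp
 finally show "\<phi>'' (cmp u k) x = s'' (cmp u k) (\<phi> (cmp u k) (aG (src k) (rA k (Comp (MD u) \<beta> \<alpha>)) x))" .
qed

text \<open>The two relations may hold on different covering sieves; on their intersection the
  isomorphisms compose.\<close>

lemma rel_trans:
 assumes m: "m \<in> OM Y" "m' \<in> OM Y" "m'' \<in> OM Y"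
  and c: "rel Y m \<phi> m' \<phi>' s" "rel Y m' \<phi>' m'' \<phi>'' s'"
  and e: "!!k x. [|arr k; tgt k = Y; x \<in> gv m k|] ==> s' k (s k (\<phi> k x)) = s'' k (\<phi> k x)"
 shows "rel Y m \<phi> m'' \<phi>'' s''"
proof (rule cs_mono[OF cs_Int[OF c]])
 note [simp] = Ms
 show "crs Y m \<phi> m' \<phi>' s \<inter> crs Y m' \<phi>' m'' \<phi>'' s' \<subseteq> crs Y m \<phi> m'' \<phi>'' s''"
 proof
  fix u assume "u \<in> crs Y m \<phi> m' \<phi>' s \<inter> crs Y m' \<phi>' m'' \<phi>'' s'"
  then obtain \<alpha> \<beta> where u: "arr u" "tgt u = Y" and a: "crel m \<phi> m' \<phi>' s u \<alpha>" "crel m' \<phi>' m'' \<phi>'' s' u \<beta>" by (auto simp: crs_def)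
  have "crel m \<phi> m'' \<phi>'' s'' u (Comp (MD u) \<beta> \<alpha>)"
   by (rule crel_trans[OF m u a e]) (use u m in auto)
  then show "u \<in> crs Y m \<phi> m'' \<phi>'' s''" using u by (auto simp: crs_def)
 qed
qed (use crs_into crs_comp[OF m(1,3)] in auto)

lemma crel_sym:
 assumes m: "m \<in> OM Y" "m' \<in> OM Y" and u: "arr u" "tgt u = Y"
  and c: "crel m \<phi> m' \<phi>' s u \<alpha>"
  and e: "!!k x. [|arr k; tgt k = src u; x \<in> gv (rO u m) k|]
   ==> s' (cmp u k) (s (cmp u k) (\<phi> (cmp u k) x)) = \<phi> (cmp u k) x"
 shows "crel m' \<phi>' m \<phi> s' u (ginv (MD u) \<alpha>)"
 unfolding crel_def
proof (intro conjI ballI)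
 note [simp] = Ms
 have a: "\<alpha> \<in> Arr (MD u)" "Dom (MD u) \<alpha> = rO u m" "Cod (MD u) \<alpha> = rO u m'"
  using c by (auto simp: crel_def)
 show "ginv (MD u) \<alpha> \<in> Arr (MD u)" "Dom (MD u) (ginv (MD u) \<alpha>) = rO u m'"
  "Cod (MD u) (ginv (MD u) \<alpha>) = rO u m"
  using a u by auto
 fix k x assume k: "k \<in> pre u" and x: "x \<in> gv (rO u m) k"
 let ?x = "aG (src k) (rA k (ginv (MD u) \<alpha>)) x"
 have x': "?x \<in> gv (rO u m') k" "aG (src k) (rA k \<alpha>) ?x = x"
  using ga_in[of "src k" "ginv (MD k) (rA k \<alpha>)" x] ga_inv(2)[of "src k" "rA k \<alpha>" x] k a x u by auto
 have "\<phi>' (cmp u k) ?x = s (cmp u k) (\<phi> (cmp u k) x)" using c k x' by (auto simp: crel_def)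
 then show "\<phi> (cmp u k) x = s' (cmp u k) (\<phi>' (cmp u k) ?x)" using e k x by simp
qed

lemma rel_sym:
 assumes m: "m \<in> OM Y" "m' \<in> OM Y" and c: "rel Y m \<phi> m' \<phi>' s"
  and e: "!!k x. [|arr k; tgt k = Y; x \<in> gv m k|] ==> s' k (s k (\<phi> k x)) = \<phi> k x"
 shows "rel Y m' \<phi>' m \<phi> s'"
proof (rule cs_mono[OF c])
 note [simp] = Ms
 show "crs Y m \<phi> m' \<phi>' s \<subseteq> crs Y m' \<phi>' m \<phi> s'"
 proof
  fix u assume "u \<in> crs Y m \<phi> m' \<phi>' s"
  then obtain \<alpha> where u: "arr u" "tgt u = Y" and a: "crel m \<phi> m' \<phi>' s u \<alpha>" by (auto simp: crs_def)
  have "crel m' \<phi>' m \<phi> s' u (ginv (MD u) \<alpha>)" by (rule crel_sym[OF m u a e]) (use u m in auto)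
  then show "u \<in> crs Y m' \<phi>' m \<phi> s'" using u by (auto simp: crs_def)
 qed
qed (use crs_into crs_comp[OF m(2,1)] in auto)

lemma crel_pull:
 assumes m: "m \<in> OM Y" "m' \<in> OM Y" and f: "arr f" "tgt f = Y" and u: "arr u" "tgt u = src f"
  and p: "!!k x. arr k ==> tgt k = src f ==> \<psi> k x = \<phi> (cmp f k) x" "!!k x. arr k ==> tgt k = src f ==> \<psi>' k x = \<phi>' (cmp f k) x"
   "!!k x. arr k ==> tgt k = src f ==> t k x = s (cmp f k) x"
 shows "crel (rO f m) \<psi> (rO f m') \<psi>' t u \<alpha> \<longleftrightarrow> crel m \<phi> m' \<phi>' s (cmp f u) \<alpha>"
 unfolding crel_def using m f u by (auto simp: Ms p comp_assoc)

text \<open>Existence of isomorphisms on some covering sieve is itself a local condition, by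
  locality of covering sieves. This is the reason why the morphisms defined below can be composed
  and glued.\<close>

lemma rel_loc:
 assumes m: "m \<in> OM Y" "m' \<in> OM Y" and P: "cs Y P"
  and c: "!!f. f \<in> P ==> rel (src f) (rO f m) (\<lambda>k. \<phi> (cmp f k)) (rO f m') (\<lambda>k. \<phi>' (cmp f k)) (\<lambda>k. s (cmp f k))"
 shows "rel Y m \<phi> m' \<phi>' s"
proof (rule cs_trans[OF P])
 fix f assume f: "f \<in> P"
 have f': "arr f" "tgt f = Y" using csvD[OF P] f by auto
 have "crs (src f) (rO f m) (\<lambda>k. \<phi> (cmp f k)) (rO f m') (\<lambda>k. \<phi>' (cmp f k)) (\<lambda>k. s (cmp f k)) = {u \<in> pre f. cmp f u \<in> crs Y m \<phi> m' \<phi>' s}"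
  unfolding crs_def using crel_pull[OF m f', of _ "\<lambda>k. \<phi> (cmp f k)" \<phi> "\<lambda>k. \<phi>' (cmp f k)" \<phi>' "\<lambda>k. s (cmp f k)" s] f' by auto
 then show "cs (src f) {k \<in> pre f. cmp f k \<in> crs Y m \<phi> m' \<phi>' s}" using c[OF f] by simp
qed (use crs_into crs_comp[OF m] in auto)

lemma rel_refl:
 assumes Y: "ob Y" and m: "m \<in> OM Y"
  and e: "!!k x. [|arr k; tgt k = Y; x \<in> gv m k|] ==> \<phi>' k x = s k (\<phi> k x)"
 shows "rel Y m \<phi> m \<phi>' s"
proof (rule cs_mono[OF cs_into[OF Y]])
 note [simp] = Ms
 have "crel m \<phi> m \<phi>' s u (Idt (MD u) (rO u m))" if "u \<in> into C Y" for u
  unfolding crel_def using that m e by (auto simp: ga_Idt)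
 then show "into C Y \<subseteq> crs Y m \<phi> m \<phi>' s" unfolding crs_def by blast
qed (use crs_into crs_comp[OF m m] in auto)

end

section \<open>Objects and morphisms of the stack\<close>

text \<open>An object over \<open>X\<close> of the stack: a sheaf on \<open>C/X\<close> (\<open>tval\<close>, \<open>tres\<close>) that is locally isomorphic
 to sheaves induced by \<open>G\<close> via charts \<open>(h, m, \<phi>)\<close> with \<open>\<phi> : m\<^sup>*G \<rightarrow> h\<^sup>*(tval)\<close>, and an optional global
 section \<open>tpt\<close>.\<close>

record ('a, 'u) tors =
 tval :: "'a => 'u set"
 tres :: "'a => 'a => 'u => 'u"
 tcht :: "('a \<times> 'u \<times> ('a => 'u => 'u)) set"
 tpt :: "'u option"

text \<open>The default values off the arrows into the new base make restriction strictly
  functorial: together with the normalization in \<open>valid\<close>, restricting along an identity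
  or a composite gives equal records. The point is restricted from the identity of the old
  base.\<close>

definition tsub :: "('o, 'a) cat => 'a => ('a, 'u) tors => ('a, 'u) tors" where
 "tsub C f y = \<lparr>tval = (\<lambda>h. if h \<in> into C (Dom C f) then tval y (Comp C f h) else {}),
  tres = (\<lambda>h. if h \<in> into C (Dom C f) then tres y (Comp C f h) else undefined),
  tcht = {(h, m, \<phi>). h \<in> into C (Dom C f) \<and> (Comp C f h, m, \<phi>) \<in> tcht y},
  tpt = map_option (tres y (Idt C (Cod C f)) f) (tpt y)\<rparr>"

lemma tsub_simps [simp]:
 "[|h \<in> Arr C; Cod C h = Dom C f|] ==> tval (tsub C f y) h = tval y (Comp C f h)"
 "[|h \<in> Arr C; Cod C h = Dom C f|] ==> tres (tsub C f y) h = tres y (Comp C f h)"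
 "(h, m, \<phi>) \<in> tcht (tsub C f y) \<longleftrightarrow> h \<in> Arr C \<and> Cod C h = Dom C f \<and> (Comp C f h, m, \<phi>) \<in> tcht y"
 "tpt (tsub C f y) = map_option (tres y (Idt C (Cod C f)) f) (tpt y)"
 by (auto simp: tsub_def)

definition msub :: "('o, 'a) cat => 'a => ('a => 'u => 'u) => 'a => 'u => 'u" where
 "msub C f \<sigma> = (\<lambda>h \<in> into C (Dom C f). \<sigma> (Comp C f h))"

lemma msub_simp [simp]: "[|h \<in> Arr C; Cod C h = Dom C f|] ==> msub C f \<sigma> h = \<sigma> (Comp C f h)"
 by (simp add: msub_def)

definition mcomp :: "('o, 'a) cat => 'o => ('a, 'u) tors => ('a => 'u => 'u) => ('a => 'u => 'u) => 'a => 'u => 'u" where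
 "mcomp C X y \<sigma>' \<sigma> = (\<lambda>h \<in> into C X. \<lambda>x \<in> tval y h. \<sigma>' h (\<sigma> h x))"

lemma mcomp_simp [simp]: "[|h \<in> Arr C; Cod C h = X; x \<in> tval y h|] ==> mcomp C X y \<sigma>' \<sigma> h x = \<sigma>' h (\<sigma> h x)"
 by (simp add: mcomp_def)

context stk begin

text \<open>The isomorphisms \<open>\<alpha>\<close> are kept while charts and comparison change. It
  is enough that the equation which \<open>\<alpha>\<close> yields for the old charts implies the
  one for the new charts.\<close>

lemma rel_map:
 assumes m: "m \<in> OM Y" "m' \<in> OM Y" and c: "rel Y m \<phi> m' \<phi>' s"
  and p: "!!k x x'. [|arr k; tgt k = Y; x \<in> gv m k; x' \<in> gv m' k;
   \<phi>' k x' = s k (\<phi> k x)|] ==> \<psi>' k x' = t k (\<psi> k x)"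
 shows "rel Y m \<psi> m' \<psi>' t"
proof (rule cs_mono[OF c])
 note [simp] = Ms
 have "crel m \<psi> m' \<psi>' t u \<alpha>" if u: "u \<in> into C Y" and a: "crel m \<phi> m' \<phi>' s u \<alpha>" for u \<alpha>
  unfolding crel_def
 proof (intro conjI ballI)
  show a': "\<alpha> \<in> Arr (MD u)" "Dom (MD u) \<alpha> = rO u m" "Cod (MD u) \<alpha> = rO u m'"
   using a by (auto simp: crel_def)
  fix k x assume k: "k \<in> pre u" and x: "x \<in> gv (rO u m') k"
  have x': "aG (src k) (rA k \<alpha>) x \<in> gv (rO u m) k"
   using ga_in[of "src k" "rA k \<alpha>" x] k a' x u by simp
  show "\<psi>' (cmp u k) x = t (cmp u k) (\<psi> (cmp u k) (aG (src k) (rA k \<alpha>) x))"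
   by (rule p) (use a k x u m x' in \<open>simp_all add: crel_def\<close>)
 qed
 then show "crs Y m \<phi> m' \<phi>' s \<subseteq> crs Y m \<psi> m' \<psi>' t" unfolding crs_def by blast
qed (use crs_into crs_comp[OF m] in auto)

lemma rel_cong:
 assumes m: "m \<in> OM Y" "m' \<in> OM Y" and c: "rel Y m \<phi> m' \<phi>' s"
  and p: "!!k x. arr k ==> tgt k = Y ==> \<psi> k x = \<phi> k x" "!!k x. arr k ==> tgt k = Y ==> \<psi>' k x = \<phi>' k x"
   "!!k x. arr k ==> tgt k = Y ==> x \<in> gv m k ==> t k (\<phi> k x) = s k (\<phi> k x)"
 shows "rel Y m \<psi> m' \<psi>' t"
 by (rule rel_map[OF m c]) (use p in simp)

text \<open>Charts play the role of an atlas: their domains form a covering sieve, they can be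
  restricted, and any two over the same arrow are locally related by elements of \<open>M\<close>.
  Nothing is required of the point beyond being a global section.\<close>

definition valid :: "'o => ('a, 'u) tors => bool" where
 "valid X y \<longleftrightarrow> (\<forall>h. h \<notin> into C X --> tval y h = {} \<and> tres y h = undefined) \<and> shf C Cov (into C X) (tval y) (tres y) \<and>
  (\<forall>h m \<phi>. (h, m, \<phi>) \<in> tcht y --> h \<in> into C X \<and> m \<in> Obj (MD h) \<and>
   (\<forall>k \<in> pre h. bij_betw (\<phi> k) (gv m k) (tval y (cmp h k)) \<and>
    (\<forall>x \<in> gv m k. \<forall>l \<in> pre k. \<phi> (cmp k l) (rG l (rO k m) x) = tres y (cmp h k) l (\<phi> k x))) \<and>
   (\<forall>k \<in> pre h. (cmp h k, rO k m, \<lambda>l \<in> pre k. \<phi> (cmp k l)) \<in> tcht y)) \<and>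
  (\<forall>h m \<phi> m' \<phi>'. (h, m, \<phi>) \<in> tcht y \<and> (h, m', \<phi>') \<in> tcht y --> rel (src h) m \<phi> m' \<phi>' (\<lambda>_ z. z)) \<and>
  cs X {h \<in> into C X. \<exists>m \<phi>. (h, m, \<phi>) \<in> tcht y} \<and> (\<forall>x. tpt y = Some x --> x \<in> tval y (Idt C X))"

lemma validD:
 assumes "valid X y"
 shows "shf C Cov (into C X) (tval y) (tres y)" "ob X"
  "[|(h, m, \<phi>) \<in> tcht y; (h, m', \<phi>') \<in> tcht y|] ==> rel (src h) m \<phi> m' \<phi>' (\<lambda>_ z. z)"
  "cs X {h \<in> into C X. \<exists>m \<phi>. (h, m, \<phi>) \<in> tcht y}" "tpt y = Some x ==> x \<in> tval y (Idt C X)"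
proof -
 note v = assms[unfolded valid_def]
 show "shf C Cov (into C X) (tval y) (tres y)" using v by (elim conjE)
 show cs: "cs X {h \<in> into C X. \<exists>m \<phi>. (h, m, \<phi>) \<in> tcht y}" using v by (elim conjE)
 show "ob X" by (rule csvD(1)[OF cs])
 show "tpt y = Some x ==> x \<in> tval y (Idt C X)" using v by (elim conjE) simp
 show "[|(h, m, \<phi>) \<in> tcht y; (h, m', \<phi>') \<in> tcht y|] ==> rel (src h) m \<phi> m' \<phi>' (\<lambda>_ z. z)"
  by (rule v[THEN conjunct2, THEN conjunct2, THEN conjunct2, THEN conjunct1, rule_format]) simp
qed

lemma valid_norm: "valid X y ==> h \<notin> into C X ==> tval y h = {} \<and> tres y h = undefined"
 unfolding valid_def by blast

lemma valid_chart:
 assumes "valid X y" "(h, m, \<phi>) \<in> tcht y"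
 shows "h \<in> into C X \<and> m \<in> Obj (MD h) \<and>
   (\<forall>k \<in> pre h. bij_betw (\<phi> k) (gv m k) (tval y (cmp h k)) \<and>
    (\<forall>x \<in> gv m k. \<forall>l \<in> pre k. \<phi> (cmp k l) (rG l (rO k m) x) = tres y (cmp h k) l (\<phi> k x))) \<and>
   (\<forall>k \<in> pre h. (cmp h k, rO k m, \<lambda>l \<in> pre k. \<phi> (cmp k l)) \<in> tcht y)"
 using assms unfolding valid_def by blast

lemma chartD:
 assumes "valid X y" "(h, m, \<phi>) \<in> tcht y"
 shows "arr h" "tgt h = X" "m \<in> Obj (MD h)"
  "[|arr k; tgt k = src h|] ==> bij_betw (\<phi> k) (gv m k) (tval y (cmp h k))"
  "[|arr k; tgt k = src h; x \<in> gv m k; arr l; tgt l = src k|]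
   ==> \<phi> (cmp k l) (rG l (rO k m) x) = tres y (cmp h k) l (\<phi> k x)"
  "[|arr k; tgt k = src h|] ==> (cmp h k, rO k m, \<lambda>l \<in> pre k. \<phi> (cmp k l)) \<in> tcht y"
 using valid_chart[OF assms] by simp_all

lemma chart_in:
 assumes "valid X y" "(h, m, \<phi>) \<in> tcht y" "arr k" "tgt k = src h" "x \<in> gv m k"
 shows "\<phi> k x \<in> tval y (cmp h k)"
 using chartD(4)[OF assms(1-4)] assms(5) by (auto simp: bij_betw_def)

lemma valid_tsub:
 assumes y: "valid X y" and f: "arr f" "tgt f = X"
 shows "valid (src f) (tsub C f y)"
proof -
 note [simp] = Ms f
 note v = validD[OF y]
 note p = pshfD[OF shf_pshf[OF v(1)]]
 have sh: "shf C Cov (pre f) (tval (tsub C f y)) (tres (tsub C f y))"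
  unfolding shf_def
 proof (intro conjI ballI allI impI, goal_cases)
  case 1
  show ?case unfolding pshf_def
  proof (intro ballI)
   fix h x assume h: "h \<in> pre f" and "x \<in> tval (tsub C f y) h"
   then have "cmp f h \<in> into C X" "x \<in> tval y (cmp f h)" by auto
   from p[OF this] h
   show "tres (tsub C f y) h (Idt C (src h)) x = x \<and>
    (\<forall>k\<in>pre h. tres (tsub C f y) h k x \<in> tval (tsub C f y) (cmp h k) \<and>
     (\<forall>l\<in>pre k. tres (tsub C f y) (cmp h k) l (tres (tsub C f y) h k x) = tres (tsub C f y) h (cmp k l) x))"
    by (auto simp: comp_assoc)
  qed
 next
  case (2 h P x)
  have "\<exists>!z. z \<in> tval y (cmp f h) \<and> (\<forall>u \<in> P. tres y (cmp f h) u z = x u)"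
   by (rule v(1)[unfolded shf_def, THEN conjunct2, rule_format]) (use 2 csvD[of C Cov "src h" P] in \<open>auto simp: comp_assoc[symmetric]\<close>)
  then show ?case using 2 by simp
 qed
 show ?thesis unfolding valid_def
 proof (intro conjI allI impI, goal_cases)
  case (1 h) then show ?case by (auto simp: tsub_def)
 next
  case (2 h) then show ?case by (auto simp: tsub_def)
 next
  case 3 show ?case by (rule sh)
 next
  case (4 h m \<phi>) then show ?case by simp
 next
  case (5 h m \<phi>) then show ?case using chartD(3)[OF y, of "cmp f h" m \<phi>] by simp
 next
  case (6 h m \<phi>)
  then show ?case using chartD(4,5)[OF y, of "cmp f h" m \<phi>] by (auto simp: comp_assoc[symmetric])
 next
  case (7 h m \<phi>)
  then show ?case using chartD(6)[OF y, of "cmp f h" m \<phi>] by (auto simp: comp_assoc[symmetric])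
 next
  case (8 h m \<phi> m' \<phi>')
  then show ?case using v(3)[of "cmp f h" m \<phi> m' \<phi>'] by simp
 next
  case 9
  have "{h \<in> pre f. \<exists>m \<phi>. (h, m, \<phi>) \<in> tcht (tsub C f y)} = {h \<in> pre f. cmp f h \<in> {h \<in> into C X. \<exists>m \<phi>. (h, m, \<phi>) \<in> tcht y}}"
   by auto
  then show ?case using cs_pull[OF v(4), of f] by simp
 next
  case (10 x)
  then show ?case using v(5) p(2)[of "Idt C X" _ f] v(2) by auto
 qed
qed

lemma tsub_Idt:
 assumes y: "valid X y" shows "tsub C (Idt C X) y = y"
proof -
 note v = validD[OF y] and n = valid_norm[OF y]
 have "tpt (tsub C (Idt C X) y) = tpt y"
  using v(2,5) pshfD(1)[OF shf_pshf[OF v(1)], of "Idt C X"] by (cases "tpt y") auto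
 moreover have "tcht (tsub C (Idt C X) y) = tcht y"
 proof -
  have "(h, m, \<phi>) \<in> tcht (tsub C (Idt C X) y) \<longleftrightarrow> (h, m, \<phi>) \<in> tcht y" for h m \<phi>
   using v(2) chartD(1,2)[OF y, of h m \<phi>] by auto
  then show ?thesis by (simp only: set_eq_iff split_paired_All simp_thms)
 qed
 moreover have "tval (tsub C (Idt C X) y) = tval y" "tres (tsub C (Idt C X) y) = tres y"
  using v(2) n by (auto simp: tsub_def fun_eq_iff)
 ultimately show ?thesis by simp
qed

lemma tsub_Comp:
 assumes y: "valid X y" and f: "arr f" "arr g" "tgt f = src g" "tgt g = X"
 shows "tsub C (cmp g f) y = tsub C f (tsub C g y)"
proof -
 note v = validD[OF y]
 have "tpt (tsub C (cmp g f) y) = tpt (tsub C f (tsub C g y))"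
  using v(2,5) pshfD(3)[OF shf_pshf[OF v(1)], of "Idt C X" _ g f] f by (cases "tpt y") auto
 moreover have "tcht (tsub C (cmp g f) y) = tcht (tsub C f (tsub C g y))"
  using f by (auto simp: tsub_def comp_assoc)
 moreover have "tval (tsub C (cmp g f) y) = tval (tsub C f (tsub C g y))" "tres (tsub C (cmp g f) y) = tres (tsub C f (tsub C g y))"
  using f by (auto simp: tsub_def fun_eq_iff comp_assoc)
 ultimately show ?thesis by simp
qed

text \<open>An isomorphism of sheaves which, read in any pair of charts over the same arrow, is
  locally the action of an element of \<open>M\<close>. Points are left to \<open>pres\<close>, so
  that one notion serves both stacks.\<close>

definition mor :: "'o => ('a, 'u) tors => ('a => 'u => 'u) => ('a, 'u) tors => bool" where
 "mor X y \<sigma> y' \<longleftrightarrow> \<sigma> \<in> extensional (into C X) \<and> (\<forall>h \<in> into C X. \<sigma> h \<in> extensional (tval y h) \<and> bij_betw (\<sigma> h) (tval y h) (tval y' h)) \<and>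
  natm C (into C X) (tval y) (tres y) (tval y') (tres y') \<sigma> \<and>
  (\<forall>h m \<phi> m' \<phi>'. (h, m, \<phi>) \<in> tcht y \<and> (h, m', \<phi>') \<in> tcht y' --> rel (src h) m \<phi> m' \<phi>' (\<lambda>k. \<sigma> (cmp h k)))"

lemma morD:
 assumes "mor X y \<sigma> y'"
 shows "natm C (into C X) (tval y) (tres y) (tval y') (tres y') \<sigma>"
  "[|arr h; tgt h = X|] ==> bij_betw (\<sigma> h) (tval y h) (tval y' h)"
  "[|(h, m, \<phi>) \<in> tcht y; (h, m', \<phi>') \<in> tcht y'|] ==> rel (src h) m \<phi> m' \<phi>' (\<lambda>k. \<sigma> (cmp h k))"
  "[|arr h; tgt h = X; x \<in> tval y h|] ==> \<sigma> h x \<in> tval y' h"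
  "[|arr h; tgt h = X; x \<in> tval y h; arr k; tgt k = src h|] ==> \<sigma> (cmp h k) (tres y h k x) = tres y' h k (\<sigma> h x)"
 using assms unfolding mor_def natm_def by auto

lemma mor_eqI:
 assumes "mor X y \<sigma> y'" "mor X y \<tau> y''" "!!h x. arr h ==> tgt h = X ==> x \<in> tval y h ==> \<sigma> h x = \<tau> h x"
 shows "\<sigma> = \<tau>"
proof (rule extensionalityI[of _ "into C X"])
 fix h assume h: "h \<in> into C X"
 show "\<sigma> h = \<tau> h" by (rule extensionalityI[of _ "tval y h"]) (use assms h in \<open>auto simp: mor_def\<close>)
qed (use assms in \<open>auto simp: mor_def\<close>)

lemma morI_restrict:
 assumes "natm C (into C X) (tval y) (tres y) (tval y') (tres y') \<sigma>" and y: "valid X y" "valid X y'"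
  and "!!h. arr h ==> tgt h = X ==> bij_betw (\<sigma> h) (tval y h) (tval y' h)"
  and r: "!!h m \<phi> m' \<phi>'. (h, m, \<phi>) \<in> tcht y ==> (h, m', \<phi>') \<in> tcht y' ==> rel (src h) m \<phi> m' \<phi>' (\<lambda>k. \<sigma> (cmp h k))"
 shows "mor X y (\<lambda>h \<in> into C X. \<lambda>x \<in> tval y h. \<sigma> h x) y'" (is "mor X y ?s y'")
 unfolding mor_def
proof (intro conjI ballI allI impI, goal_cases)
 case (3 h) then show ?case using assms(4)[of h] by (auto cong: bij_betw_cong)
next
 case 4
 then show ?case using assms(1) pshfD[OF shf_pshf[OF validD(1)[OF y(1)]]] unfolding natm_def by auto
next
 case (5 h m \<phi> m' \<phi>')
 then have c: "(h, m, \<phi>) \<in> tcht y" "(h, m', \<phi>') \<in> tcht y'" by auto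
 note a = chartD[OF y(1) c(1)] and b = chartD[OF y(2) c(2)]
 show ?case
  by (rule rel_cong[OF a(3) b(3) r[OF c]]) (use a chart_in[OF y(1) c(1)] in auto)
qed auto

lemma mor_id:
 assumes y: "valid X y"
 shows "mor X y (\<lambda>h \<in> into C X. \<lambda>x \<in> tval y h. x) y"
proof (rule morI_restrict[OF _ y y])
 show "natm C (into C X) (tval y) (tres y) (tval y) (tres y) (\<lambda>h x. x)" by (auto simp: natm_def)
 show "rel (src h) m \<phi> m' \<phi>' (\<lambda>k x. x)" if "(h, m, \<phi>) \<in> tcht y" "(h, m', \<phi>') \<in> tcht y" for h m \<phi> m' \<phi>'
  using validD(3)[OF y that] .
qed (auto simp: bij_betw_def)

text \<open>The middle object may have no chart over \<open>h\<close>. It has charts on a covering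
  sieve of the source of \<open>h\<close>, where the two relations compose, and \<open>rel\<close>
  is local.\<close>

lemma mor_comp:
 assumes y: "valid X y" "valid X y'" "valid X y''" and s: "mor X y \<sigma> y'" "mor X y' \<tau> y''"
 shows "mor X y (mcomp C X y \<tau> \<sigma>) y''"
 unfolding mcomp_def
proof (rule morI_restrict[OF _ y(1,3)])
 note a = morD[OF s(1)] and b = morD[OF s(2)]
 show "natm C (into C X) (tval y) (tres y) (tval y'') (tres y'') (\<lambda>h x. \<tau> h (\<sigma> h x))"
  using a b by (auto simp: natm_def)
 show "bij_betw (\<lambda>x. \<tau> h (\<sigma> h x)) (tval y h) (tval y'' h)" if "arr h" "tgt h = X" for h
  using bij_betw_trans[OF a(2)[OF that] b(2)[OF that]] by (simp add: comp_def)
 fix h m \<phi> m'' \<phi>'' assume c: "(h, m, \<phi>) \<in> tcht y" "(h, m'', \<phi>'') \<in> tcht y''"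
 note c1 = chartD[OF y(1) c(1)] and c2 = chartD[OF y(3) c(2)]
 note [simp] = Ms
 let ?P = "{k \<in> pre h. cmp h k \<in> {h \<in> into C X. \<exists>m \<phi>. (h, m, \<phi>) \<in> tcht y'}}"
 show "rel (src h) m \<phi> m'' \<phi>'' (\<lambda>k x. \<tau> (cmp h k) (\<sigma> (cmp h k) x))"
 proof (rule rel_loc[OF c1(3) c2(3), of ?P])
  show "cs (src h) ?P" by (rule cs_pull[OF validD(4)[OF y(2)]]) (use c1 in auto)
  fix k assume "k \<in> ?P"
  then obtain m' \<phi>' where k: "arr k" "tgt k = src h" and c': "(cmp h k, m', \<phi>') \<in> tcht y'" by auto
  note c3 = chartD[OF y(2) c']
  have d: "src (cmp h k) = src k" using k c1 by simp
  have o: "rO k m \<in> Obj (MD k)" "m' \<in> Obj (MD k)" "rO k m'' \<in> Obj (MD k)" using k c1 c2 c3 d by auto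
  show "rel (src k) (rO k m) (\<lambda>l. \<phi> (cmp k l)) (rO k m'') (\<lambda>l. \<phi>'' (cmp k l)) (\<lambda>l x. \<tau> (cmp h (cmp k l)) (\<sigma> (cmp h (cmp k l)) x))"
   by (rule rel_cong[OF o(1,3) rel_trans[OF o a(3)[OF c1(6)[OF k] c', unfolded d] b(3)[OF c' c2(6)[OF k], unfolded d] refl]])
    (use k c1 in \<open>auto simp: comp_assoc\<close>)
 qed
qed

lemma mor_inv:
 assumes y: "valid X y" "valid X y'" and s: "mor X y \<sigma> y'"
 shows "mor X y' (\<lambda>h \<in> into C X. \<lambda>z \<in> tval y' h. inv_into (tval y h) (\<sigma> h) z) y"
proof (rule morI_restrict[OF _ y(2,1)])
 note a = morD[OF s]
 note p = pshfD[OF shf_pshf[OF validD(1)[OF y(1)]]] and p' = pshfD[OF shf_pshf[OF validD(1)[OF y(2)]]]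
 let ?t = "\<lambda>h z. inv_into (tval y h) (\<sigma> h) z"
 have t: "?t h z \<in> tval y h" "\<sigma> h (?t h z) = z" if "arr h" "tgt h = X" "z \<in> tval y' h" for h z
  using a(2)[OF that(1,2)] that(3) by (auto simp: bij_betw_def f_inv_into_f intro: inv_into_into)
 have t2: "?t h (\<sigma> h x) = x" if "arr h" "tgt h = X" "x \<in> tval y h" for h x
  using a(2)[OF that(1,2)] that(3) by (auto simp: bij_betw_def)
 show "natm C (into C X) (tval y') (tres y') (tval y) (tres y) ?t" unfolding natm_def
 proof (intro ballI conjI)
  fix h z k assume h: "h \<in> into C X" and z: "z \<in> tval y' h"
  show "?t h z \<in> tval y h" using t h z by simp
  assume k: "k \<in> pre h"
  show "?t (cmp h k) (tres y' h k z) = tres y h k (?t h z)"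
   using t2[of "cmp h k" "tres y h k (?t h z)"] a(5)[of h "?t h z" k] t[of h z] h z k p(2)[of h "?t h z" k] by simp
 qed
 show "bij_betw (?t h) (tval y' h) (tval y h)" if "arr h" "tgt h = X" for h
  by (rule bij_betw_inv_into[OF a(2)[OF that]])
 show "rel (src h) m \<phi> m' \<phi>' (\<lambda>k. ?t (cmp h k))" if c: "(h, m, \<phi>) \<in> tcht y'" "(h, m', \<phi>') \<in> tcht y" for h m \<phi> m' \<phi>'
  by (rule rel_sym[OF _ _ a(3)[OF c(2,1)]])
   (use chartD[OF y(1) c(2)] chartD[OF y(2) c(1)] chart_in[OF y(1) c(2)] t2 in auto)
qed

lemma mor_sub:
 assumes y: "valid X y" "valid X y'" and s: "mor X y \<sigma> y'" and f: "arr f" "tgt f = X"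
 shows "mor (src f) (tsub C f y) (msub C f \<sigma>) (tsub C f y')"
proof -
 note a = morD[OF s]
 have "mor (src f) (tsub C f y) (\<lambda>h \<in> pre f. \<lambda>x \<in> tval (tsub C f y) h. \<sigma> (cmp f h) x) (tsub C f y')"
 proof (rule morI_restrict[OF _ valid_tsub[OF y(1) f] valid_tsub[OF y(2) f]])
  show "natm C (pre f) (tval (tsub C f y)) (tres (tsub C f y)) (tval (tsub C f y')) (tres (tsub C f y')) (\<lambda>h. \<sigma> (cmp f h))"
   unfolding natm_def using a(4,5) f by (auto simp: comp_assoc[symmetric])
  show "rel (src h) m \<phi> m' \<phi>' (\<lambda>k. \<sigma> (cmp f (cmp h k)))" if "(h, m, \<phi>) \<in> tcht (tsub C f y)" "(h, m', \<phi>') \<in> tcht (tsub C f y')" for h m \<phi> m' \<phi>'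
  proof -
   have h: "arr h" "tgt h = src f" and c: "(cmp f h, m, \<phi>) \<in> tcht y" "(cmp f h, m', \<phi>') \<in> tcht y'" using that by auto
   show ?thesis
    by (rule rel_cong[OF _ _ a(3)[OF c, unfolded cat_simps(7)[OF catC h(1) f(1) h(2)]]])
     (use chartD(3)[OF y(1) c(1)] chartD(3)[OF y(2) c(2)] h f in \<open>auto simp: comp_assoc\<close>)
  qed
 qed (use a(2) f in auto)
 moreover have "(\<lambda>h \<in> pre f. \<lambda>x \<in> tval (tsub C f y) h. \<sigma> (cmp f h) x) = msub C f \<sigma>"
 proof (rule extensionalityI[of _ "pre f"])
  fix h assume h: "h \<in> pre f"
  then have "\<sigma> (cmp f h) \<in> extensional (tval y (cmp f h))" using s f by (simp add: mor_def)
  then show "(\<lambda>h \<in> pre f. \<lambda>x \<in> tval (tsub C f y) h. \<sigma> (cmp f h) x) h = msub C f \<sigma> h"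
   using h by (auto simp: fun_eq_iff restrict_def extensional_def)
 qed (auto simp: msub_def)
 ultimately show ?thesis by simp
qed

text \<open>Maps of sheaves glue, bijectivity is local by \<open>loc_bij\<close>, and the chart
  condition is local by \<open>rel_loc\<close>.\<close>

lemma mor_glue:
 assumes y: "valid X y" "valid X y'" and P: "cs X P" and s: "!!u. u \<in> P ==> mor (src u) (tsub C u y) (\<sigma> u) (tsub C u y')"
  and sn: "!!u k. u \<in> P ==> arr k ==> tgt k = src u ==> \<sigma> (cmp u k) = msub C k (\<sigma> u)"
 shows "\<exists>\<Sigma>. mor X y \<Sigma> y' \<and> (\<forall>u \<in> P. msub C u \<Sigma> = \<sigma> u)"
proof -
 note P' = csvD[OF P]
 note v = validD[OF y(1)] and v' = validD[OF y(2)]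
 \<comment> \<open>A compatible family of morphisms is determined by its values at identities, which
   form one natural map on the sieve.\<close>
 let ?s = "\<lambda>r. \<sigma> r (Idt C (src r))"
 have s0: "?s (cmp u k) = \<sigma> u k" if "u \<in> P" "arr k" "tgt k = src u" for u k
  using sn[OF that] that P' by simp
 have sm: "\<sigma> u k x \<in> tval y' (cmp u k)" "arr l ==> tgt l = src k ==> \<sigma> u (cmp k l) (tres y (cmp u k) l x) = tres y' (cmp u k) l (\<sigma> u k x)"
  if "u \<in> P" "arr k" "tgt k = src u" "x \<in> tval y (cmp u k)" for u k x l
  using morD(4,5)[OF s[OF that(1)] that(2,3), of x] that by auto
 have "natm C P (tval y) (tres y) (tval y') (tres y') ?s" unfolding natm_def
 proof (intro ballI conjI)
  fix h x k assume h: "h \<in> P" and x: "x \<in> tval y h"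
  show "?s h x \<in> tval y' h" using sm(1)[OF h, of "Idt C (src h)" x] x P' h by simp
  assume "k \<in> pre h"
  then show "?s (cmp h k) (tres y h k x) = tres y' h k (?s h x)"
   using s0[OF h] sm(2)[OF h, of "Idt C (src h)" x k] x P' h by simp
 qed
 from hom_glue[OF v(2) shf_pshf[OF v(1)] v'(1) P this]
 obtain \<Sigma> where S: "natm C (into C X) (tval y) (tres y) (tval y') (tres y') \<Sigma>" "!!h x. h \<in> P ==> x \<in> tval y h ==> \<Sigma> h x = ?s h x" by blast
 have b: "bij_betw (\<Sigma> h) (tval y h) (tval y' h)" if "h \<in> into C X" for h
 proof (rule loc_bij[OF v(1) v'(1) P S(1) _ that])
  fix r assume r: "r \<in> P"
  have "bij_betw (?s r) (tval y r) (tval y' r)"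
   using morD(2)[OF s[OF r], of "Idt C (src r)"] P' r by simp
  then show "bij_betw (\<Sigma> r) (tval y r) (tval y' r)" using S(2)[OF r] by (simp cong: bij_betw_cong)
 qed
 let ?S = "\<lambda>h \<in> into C X. \<lambda>x \<in> tval y h. \<Sigma> h x"
 have m: "mor X y ?S y'"
 proof (rule morI_restrict[OF S(1) y b])
  fix h m \<phi> m' \<phi>' assume c: "(h, m, \<phi>) \<in> tcht y" "(h, m', \<phi>') \<in> tcht y'"
  note c1 = chartD[OF y(1) c(1)] and c2 = chartD[OF y(2) c(2)]
  let ?P = "{k \<in> pre h. cmp h k \<in> P}"
  show "rel (src h) m \<phi> m' \<phi>' (\<lambda>k. \<Sigma> (cmp h k))"
  proof (rule rel_loc[OF c1(3) c2(3), of ?P])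
   show "cs (src h) ?P" by (rule cs_pull[OF P]) (use c1 in auto)
   fix k assume "k \<in> ?P"
   then have k: "arr k" "tgt k = src h" "cmp h k \<in> P" by auto
   have d: "src (cmp h k) = src k" using k c1 by simp
   \<comment> \<open>A chart over \<open>cmp h k\<close> is, after restriction along
     \<open>cmp h k\<close>, a chart over the identity, where the given morphism is known to respect
     charts.\<close>
   let ?i = "Idt C (src k)"
   have i: "(?i, rO k m, \<lambda>l \<in> pre k. \<phi> (cmp k l)) \<in> tcht (tsub C (cmp h k) y)"
     "(?i, rO k m', \<lambda>l \<in> pre k. \<phi>' (cmp k l)) \<in> tcht (tsub C (cmp h k) y')"
    using c1(6)[OF k(1,2)] c2(6)[OF k(1,2)] k c1 by (auto simp: d)
   have "src ?i = src k" using k by simp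
   note r = morD(3)[OF s[OF k(3)] i, unfolded this]
   show "rel (src k) (rO k m) (\<lambda>l. \<phi> (cmp k l)) (rO k m') (\<lambda>l. \<phi>' (cmp k l)) (\<lambda>l. \<Sigma> (cmp h (cmp k l)))"
   proof (rule rel_cong[OF _ _ r])
    show "rO k m \<in> Obj (MD k)" "rO k m' \<in> Obj (MD k)" using k c1 c2 by (auto simp: Ms)
    fix l x assume l: "arr l" "tgt l = src k" and x: "x \<in> gv (rO k m) l"
    have kl: "cmp h (cmp k l) \<in> P" using P'(4)[OF k(3), of l] k l c1 by (simp add: comp_assoc)
    have px: "\<phi> (cmp k l) x \<in> tval y (cmp h (cmp k l))" by (rule chart_in[OF y(1) c(1)]) (use k l x c1 in \<open>auto simp: Ms\<close>)
    show "\<Sigma> (cmp h (cmp k l)) ((\<lambda>l \<in> pre k. \<phi> (cmp k l)) l x) = \<sigma> (cmp h k) (cmp ?i l) ((\<lambda>l \<in> pre k. \<phi> (cmp k l)) l x)"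
     using S(2)[OF kl px] s0[OF k(3), of l] k l c1 by (simp add: comp_assoc)
   qed auto
  qed
 qed auto
 moreover have "msub C u ?S = \<sigma> u" if u: "u \<in> P" for u
 proof (rule mor_eqI[OF mor_sub[OF y m] s[OF u]])
  fix h x assume h: "arr h" "tgt h = src u" "x \<in> tval (tsub C u y) h"
  show "msub C u ?S h x = \<sigma> u h x"
   using h S(2)[OF P'(4)[OF u h(1,2)], of x] s0[OF u h(1,2)] P' u by simp
 qed (use P' u in auto)
 ultimately show ?thesis by blast
qed

lemma mor_sep:
 assumes y: "valid X y" "valid X y'" and P: "cs X P" and s: "mor X y \<sigma> y'" "mor X y \<tau> y'"
  and e: "!!u x. u \<in> P ==> x \<in> tval y u ==> \<sigma> u x = \<tau> u x"
 shows "\<sigma> = \<tau>"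
 by (rule mor_eqI[OF s], rule hom_glue_unique[OF shf_pshf[OF validD(1)[OF y(1)]] validD(1)[OF y(2)] P morD(1)[OF s(1)] morD(1)[OF s(2)] e])
  auto

section \<open>The two stacks and effective descent\<close>

definition pres :: "'o => ('a, 'u) tors => ('a => 'u => 'u) => ('a, 'u) tors => bool" where
 "pres X y \<sigma> y' \<longleftrightarrow> tpt y' = map_option (\<sigma> (Idt C X)) (tpt y)"

text \<open>For \<open>b\<close> true the objects are pointed and the morphisms preserve the points.\<close>

definition WW :: "bool => ('o => ('a, 'u) tors set) => ('o, 'a, ('a, 'u) tors, ('a, 'u) tors \<times> ('a => 'u => 'u) \<times> ('a, 'u) tors) gpsh" where
 "WW b U = \<lparr>sect = (\<lambda>X. \<lparr>Obj = {y \<in> U X. b --> tpt y \<noteq> None},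
   Arr = {(y, \<sigma>, y'). y \<in> U X \<and> y' \<in> U X \<and> mor X y \<sigma> y' \<and> (b --> tpt y \<noteq> None \<and> pres X y \<sigma> y')},
   Dom = (\<lambda>(y, \<sigma>, y'). y), Cod = (\<lambda>(y, \<sigma>, y'). y'), Idt = (\<lambda>y. (y, (\<lambda>h \<in> into C X. \<lambda>x \<in> tval y h. x), y)),
   Comp = (\<lambda>(z, \<tau>, y'') (y, \<sigma>, y'). (y, mcomp C X y \<tau> \<sigma>, y''))\<rparr>),
  rst = (\<lambda>f. \<lparr>obm = tsub C f, arm = (\<lambda>(y, \<sigma>, y'). (tsub C f y, msub C f \<sigma>, tsub C f y'))\<rparr>)\<rparr>"

lemma WW_simps [simp]:
 "y \<in> Obj (sect (WW b U) X) \<longleftrightarrow> y \<in> U X \<and> (b --> tpt y \<noteq> None)"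
 "(y, \<sigma>, y') \<in> Arr (sect (WW b U) X) \<longleftrightarrow> y \<in> U X \<and> y' \<in> U X \<and> mor X y \<sigma> y' \<and> (b --> tpt y \<noteq> None \<and> pres X y \<sigma> y')"
 "Dom (sect (WW b U) X) (y, \<sigma>, y') = y" "Cod (sect (WW b U) X) (y, \<sigma>, y') = y'"
 "Idt (sect (WW b U) X) y = (y, (\<lambda>h \<in> into C X. \<lambda>x \<in> tval y h. x), y)"
 "Comp (sect (WW b U) X) (z, \<tau>, y'') (y, \<sigma>, y') = (y, mcomp C X y \<tau> \<sigma>, y'')"
 "obm (rst (WW b U) f) y = tsub C f y" "arm (rst (WW b U) f) (y, \<sigma>, y') = (tsub C f y, msub C f \<sigma>, tsub C f y')"
 by (simp_all add: WW_def)

text \<open>\<open>U\<close> cuts the valid objects down to a collection that will be small; closure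
  under restriction keeps \<open>WW\<close> a presheaf.\<close>

definition closedU :: "('o => ('a, 'u) tors set) => bool" where
 "closedU U \<longleftrightarrow> (\<forall>X \<in> Obj C. \<forall>y \<in> U X. valid X y) \<and> (\<forall>f \<in> Arr C. \<forall>y \<in> U (tgt f). tsub C f y \<in> U (src f))"

lemma pres_sub:
 assumes y: "valid X y" "valid X y'" and s: "mor X y \<sigma> y'" and p: "pres X y \<sigma> y'" and f: "arr f" "tgt f = X"
 shows "pres (src f) (tsub C f y) (msub C f \<sigma>) (tsub C f y')"
proof (cases "tpt y")
 case (Some x)
 then show ?thesis using p f morD(5)[OF s, of "Idt C X" x f] validD(2,5)[OF y(1)] by (auto simp: pres_def)
qed (use p f in \<open>auto simp: pres_def\<close>)

lemma pres_comp:
 assumes y: "valid X y" and p: "pres X y \<sigma> y'" "pres X y' \<tau> y''"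
 shows "pres X y (mcomp C X y \<tau> \<sigma>) y''"
 using assms validD(2,5)[OF y] by (cases "tpt y") (auto simp: pres_def)

lemma pres_inv:
 assumes y: "valid X y" "valid X y'" and s: "mor X y \<sigma> y'" and p: "pres X y \<sigma> y'"
 shows "pres X y' (\<lambda>h \<in> into C X. \<lambda>z \<in> tval y' h. inv_into (tval y h) (\<sigma> h) z) y"
 using p validD(2,5)[OF y(1)] validD(5)[OF y(2)] morD(2)[OF s, of "Idt C X"]
 by (cases "tpt y") (auto simp: pres_def bij_betw_def)

lemma WW_gpsh:
 assumes U: "closedU U"
 shows "grpd_presheaf C (WW b U)"
proof -
 have val: "valid X y" if "ob X" "y \<in> U X" for X y using U that by (auto simp: closedU_def)
 have sub: "tsub C f y \<in> U (src f)" if "arr f" "y \<in> U (tgt f)" for f y using U that by (auto simp: closedU_def)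
 have cat: "category (sect (WW b U) X)" if X: "ob X" for X
 proof (rule categoryI, goal_cases)
  case (1 f) then show ?case by (cases f) (auto simp: pres_def)
 next
  case (2 y) then show ?case using mor_id[OF val[OF X]] validD(5)[OF val[OF X]] X by (cases "tpt y") (auto simp: pres_def)
 next
  case (3 f g)
  then show ?case using mor_comp[OF val[OF X] val[OF X] val[OF X]] pres_comp[OF val[OF X]] by (cases f; cases g) auto
 next
  case (4 f)
  obtain y \<sigma> y' where f: "f = (y, \<sigma>, y')" by (cases f)
  have m: "mor X y \<sigma> y'" and y: "valid X y" "valid X y'" using 4 val[OF X] by (auto simp: f)
  show ?case unfolding f using morD(4)[OF m]
   by (auto intro!: mor_eqI[OF mor_comp[OF y(1) y(1) y(2) mor_id[OF y(1)] m] m] mor_eqI[OF mor_comp[OF y(1) y(2) y(2) m mor_id[OF y(2)]] m])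
 next
  case (5 f g h)
  obtain y \<sigma> y' where f: "f = (y, \<sigma>, y')" by (cases f)
  obtain \<tau> y'' where g: "g = (y', \<tau>, y'')" using 5(4) f by (cases g) auto
  obtain \<rho> y3 where h: "h = (y'', \<rho>, y3)" using 5(5) g by (cases h) auto
  have m: "mor X y \<sigma> y'" "mor X y' \<tau> y''" "mor X y'' \<rho> y3" and y: "valid X y" "valid X y'" "valid X y''" "valid X y3" using 5 val[OF X] by (auto simp: f g h)
  show ?case unfolding f g h using morD(4)[OF m(1)]
   by (auto intro!: mor_eqI[OF mor_comp[OF y(1,2,4) m(1) mor_comp[OF y(2-4) m(2,3)]] mor_comp[OF y(1,3,4) mor_comp[OF y(1-3) m(1,2)] m(3)]])
 qed
 have G: "groupoid (sect (WW b U) X)" if X: "ob X" for X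
 proof (rule groupoidI[OF cat[OF X]])
  fix f assume fa: "f \<in> Arr (sect (WW b U) X)"
  obtain y \<sigma> y' where f: "f = (y, \<sigma>, y')" by (cases f)
  have m: "mor X y \<sigma> y'" and y: "valid X y" "valid X y'" using fa val[OF X] by (auto simp: f)
  note i = mor_inv[OF y m]
  let ?t = "\<lambda>h \<in> into C X. \<lambda>z \<in> tval y' h. inv_into (tval y h) (\<sigma> h) z"
  have e: "mcomp C X y ?t \<sigma> = (\<lambda>h \<in> into C X. \<lambda>x \<in> tval y h. x)" "mcomp C X y' \<sigma> ?t = (\<lambda>h \<in> into C X. \<lambda>x \<in> tval y' h. x)"
   using morD(4)[OF m] morD(2)[OF m]
   by (auto intro!: mor_eqI[OF mor_comp[OF y(1,2,1) m i] mor_id[OF y(1)]] mor_eqI[OF mor_comp[OF y(2,1,2) i m] mor_id[OF y(2)]] simp: bij_betw_def f_inv_into_f)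
  show "\<exists>g\<in>Arr (sect (WW b U) X). Dom (sect (WW b U) X) g = Cod (sect (WW b U) X) f \<and> Cod (sect (WW b U) X) g = Dom (sect (WW b U) X) f \<and>
   Comp (sect (WW b U) X) g f = Idt (sect (WW b U) X) (Dom (sect (WW b U) X) f) \<and> Comp (sect (WW b U) X) f g = Idt (sect (WW b U) X) (Cod (sect (WW b U) X) f)"
   using fa i e pres_inv[OF y m] unfolding f by (intro bexI[of _ "(y', ?t, y)"]) (auto simp: pres_def)
 qed
 show ?thesis
 proof (rule gpshI, goal_cases)
  case (3 h a) then show ?case using sub by simp
 next
  case (4 h \<alpha>)
  then show ?case using sub mor_sub[OF val val] pres_sub[OF val val] by (cases \<alpha>) auto
 next
  case (5 h y)
  then show ?case using val[of "tgt h" y] by (auto simp: msub_def fun_eq_iff restrict_def)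
 next
  case (6 h \<alpha> \<beta>)
  obtain y \<sigma> y' where f: "\<alpha> = (y, \<sigma>, y')" by (cases \<alpha>)
  obtain \<tau> y'' where g: "\<beta> = (y', \<tau>, y'')" using 6 f by (cases \<beta>) auto
  have "msub C h (mcomp C (tgt h) y \<tau> \<sigma>) = mcomp C (src h) (tsub C h y) (msub C h \<tau>) (msub C h \<sigma>)"
   using 6(1) by (auto simp: msub_def mcomp_def fun_eq_iff restrict_def)
  then show ?case by (simp add: f g)
 next
  case (7 X y) then show ?case using tsub_Idt[OF val] by simp
 next
  case (8 X \<alpha>)
  obtain y \<sigma> y' where f: "\<alpha> = (y, \<sigma>, y')" by (cases \<alpha>)
  have "msub C (Idt C X) \<sigma> = \<sigma>" by (rule extensionalityI[of _ "into C X"]) (use 8 in \<open>auto simp: f msub_def mor_def\<close>)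
  then show ?case using 8 tsub_Idt[OF val[OF 8(1)]] by (simp add: f)
 next
  case (9 f g y) then show ?case using tsub_Comp[OF val, of "tgt g" y f g] by simp
 next
  case (10 f g \<alpha>)
  obtain y \<sigma> y' where a: "\<alpha> = (y, \<sigma>, y')" by (cases \<alpha>)
  have "msub C (cmp g f) \<sigma> = msub C f (msub C g \<sigma>)"
   using 10(1-3) by (auto simp: msub_def fun_eq_iff restrict_def comp_assoc)
  then show ?case using 10 tsub_Comp[OF val, of "tgt g" _ f g] by (simp add: a)
 qed (auto simp: G)
qed

text \<open>Gluing of morphisms is \<open>mor_glue\<close>. That the glued morphism preserves points
  is checked on the sieve, since the target is separated.\<close>

lemma WW_hom_sheaf:
 assumes U: "closedU U"
 shows "hom_sheaf C Cov (WW b U)"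
 unfolding hom_sheaf_def
proof (intro allI impI, elim conjE)
 fix X P y y' \<phi>
 assume P: "cs X P" and yy: "y \<in> Obj (sect (WW b U) X)" "y' \<in> Obj (sect (WW b U) X)"
  and p1: "\<forall>u \<in> P. \<phi> u \<in> Arr (sect (WW b U) (src u)) \<and> Dom (sect (WW b U) (src u)) (\<phi> u) = obm (rst (WW b U) u) y \<and>
   Cod (sect (WW b U) (src u)) (\<phi> u) = obm (rst (WW b U) u) y'"
  and p2: "\<forall>u \<in> P. \<forall>k \<in> pre u. \<phi> (cmp u k) = arm (rst (WW b U) k) (\<phi> u)"
 note P' = csvD[OF P]
 have y: "valid X y" "valid X y'" using yy U P' by (auto simp: closedU_def)
 note v = validD[OF y(1)] and v' = validD[OF y(2)]
 define \<sigma> where "\<sigma> u = fst (snd (\<phi> u))" for u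
 have fe: "\<phi> u = (tsub C u y, \<sigma> u, tsub C u y')" if "u \<in> P" for u
  using p1[rule_format, OF that] by (cases "\<phi> u") (auto simp: \<sigma>_def)
 have s: "mor (src u) (tsub C u y) (\<sigma> u) (tsub C u y')" and sp: "b --> pres (src u) (tsub C u y) (\<sigma> u) (tsub C u y')" if "u \<in> P" for u
  using p1[rule_format, OF that] by (auto simp: fe[OF that])
 have sn: "\<sigma> (cmp u k) = msub C k (\<sigma> u)" if "u \<in> P" "arr k" "tgt k = src u" for u k
  using p2[rule_format, OF that(1), of k] that fe[OF that(1)] fe[OF P'(4)[OF that]] by simp
 obtain \<Sigma> where S: "mor X y \<Sigma> y'" "!!u. u \<in> P ==> msub C u \<Sigma> = \<sigma> u" using mor_glue[OF y P s sn] by blast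
 have "pres X y \<Sigma> y'" if b: b
 proof -
  obtain x x' where x: "tpt y = Some x" "tpt y' = Some x'" using yy b by auto
  note xv = v(5)[OF x(1)] v'(5)[OF x(2)]
  have i: "Idt C X \<in> Arr C" "tgt (Idt C X) = X" using P'(1) by auto
  have "x' = \<Sigma> (Idt C X) x"
  proof (rule shf_sep[OF v'(1) _ _ xv(2) morD(4)[OF S(1) i xv(1)]])
   show "Idt C X \<in> into C X" "cs (src (Idt C X)) P" using P P'(1) by auto
   fix u assume u: "u \<in> P"
   have "tres y' (Idt C X) u x' = \<sigma> u (Idt C (src u)) (tres y (Idt C X) u x)"
    using sp[OF u] b x P' u by (simp add: pres_def)
   then show "tres y' (Idt C X) u x' = tres y' (Idt C X) u (\<Sigma> (Idt C X) x)"
    using morD(5)[OF S(1) i xv(1), of u] P' u S(2)[OF u, symmetric] by simp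
  qed
  then show ?thesis using x by (simp add: pres_def)
 qed
 then show "\<exists>!\<psi>. \<psi> \<in> Arr (sect (WW b U) X) \<and> Dom (sect (WW b U) X) \<psi> = y \<and> Cod (sect (WW b U) X) \<psi> = y' \<and> (\<forall>u \<in> P. arm (rst (WW b U) u) \<psi> = \<phi> u)"
 proof (intro ex1I[of _ "(y, \<Sigma>, y')"], goal_cases)
  case 1 then show ?case using S yy fe by auto
 next
  case (2 \<psi>)
  then obtain \<tau> where t: "\<psi> = (y, \<tau>, y')" "mor X y \<tau> y'" "!!u. u \<in> P ==> msub C u \<tau> = \<sigma> u"
   using fe by (cases \<psi>) auto
  have "\<tau> = \<Sigma>"
  proof (rule mor_sep[OF y P t(2) S(1)])
   fix u x assume u: "u \<in> P"
   have "msub C u \<tau> (Idt C (src u)) = msub C u \<Sigma> (Idt C (src u))" using t(3)[OF u] S(2)[OF u] by simp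
   then show "\<tau> u x = \<Sigma> u x" using P' u by simp
  qed
  then show ?case using t by simp
 qed
qed

text \<open>A descent datum assigns an object to every object of the nerve, so several objects to
  one arrow of the sieve. Choosing one of them over each arrow gives a sheaf on the sieve, whose
  restriction maps are corrected by the transition isomorphisms. Its extension to \<open>C/X\<close>
  receives charts from the objects of the datum; the last assumption then replaces the result by an
  isomorphic object in \<open>U X\<close>.\<close>

lemma WW_descent:
 assumes U: "closedU U"
  and ess: "!!X y. valid X y ==> \<exists>y' \<in> U X. \<exists>\<sigma>. mor X y \<sigma> y' \<and> pres X y \<sigma> y'"
 shows "descent C Cov (WW b U)"
 unfolding descent_def
proof (intro allI impI, elim conjE)
 fix X S \<omega> assume S: "Cov X S" and w: "grpd_map C (nerve_grpd C S) (WW b U) \<omega>"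
 let ?N = "nerve_grpd C S" and ?W = "WW b U"
 note SX = cov_arrows[OF S]
 note Wp = WW_gpsh[OF U]
 have X: "ob X" using SX by simp
 have val: "valid Z y" if "ob Z" "y \<in> U Z" for Z y using U that by (auto simp: closedU_def)
 \<comment> \<open>\<open>va\<close> is the arrow into \<open>X\<close> that an object of the nerve
   represents, \<open>rs\<close> its restriction, and \<open>NO\<close> the objects of the nerve in
   a form free of pattern matching.\<close>
 define va where "va a = cmp (fst a) (snd a)" for a :: "'a \<times> 'a"
 define rs where "rs l a = (fst a, cmp (snd a) l)" for l and a :: "'a \<times> 'a"
 define NO where "NO Z = {a. fst a \<in> S \<and> snd a \<in> Arr C \<and> src (snd a) = Z \<and> tgt (snd a) = src (fst a)}" for Z
 have NO: "a \<in> NO Z \<longleftrightarrow> a \<in> Obj (sect ?N Z)" for a Z by (cases a) (auto simp: NO_def Hom_iff)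
 have NA: "(a, a') \<in> Arr (sect ?N Z) \<longleftrightarrow> a \<in> NO Z \<and> a' \<in> NO Z \<and> va a = va a'" for a a' Z
  by (cases a; cases a') (auto simp: NO_def va_def Hom_iff)
 have rsN: "obm (rst ?N l) a = rs l a" for l a by (cases a) (simp add: rs_def)
 have rsA: "arm (rst ?N l) (a, a') = (rs l a, rs l a')" for l a a' by (cases a; cases a') (simp add: rs_def)
 have vaN: "va a \<in> Arr C" "src (va a) = Z" "tgt (va a) = X" "ob Z" if "a \<in> NO Z" for a Z
  using that SX by (auto simp: NO_def va_def)
 have rsI: "rs l a \<in> NO (src l)" "va (rs l a) = cmp (va a) l" if "a \<in> NO Z" "arr l" "tgt l = Z" for a l Z
  using that SX by (auto simp: NO_def rs_def va_def comp_assoc)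
 have rs_rs: "rs m (rs l a) = rs (cmp l m) a" if "a \<in> NO Z" "arr l" "tgt l = Z" "arr m" "tgt m = src l" for a l m Z
  using that by (auto simp: NO_def rs_def comp_assoc)
 have rs_id: "rs (Idt C Z) a = a" if "a \<in> NO Z" for a Z
  using that by (cases a) (auto simp: NO_def rs_def)
 \<comment> \<open>The datum: objects \<open>Y Z a\<close>, with transition isomorphisms
   \<open>\<gamma>\<close> between those of equal value.\<close>
 define Y where "Y Z a = obm (\<omega> Z) a" for Z a
 define \<gamma> where "\<gamma> Z a a' = fst (snd (arm (\<omega> Z) (a, a')))" for Z a a'
 have YU: "Y Z a \<in> U Z" "b ==> tpt (Y Z a) \<noteq> None" if "a \<in> NO Z" for Z a
  using gmapD(4)[OF w vaN(4)[OF that] that[unfolded NO]] by (auto simp: Y_def)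
 have Yv: "valid Z (Y Z a)" if "a \<in> NO Z" for Z a by (rule val[OF vaN(4)[OF that] YU(1)[OF that]])
 have wA: "arm (\<omega> Z) (a, a') = (Y Z a, \<gamma> Z a a', Y Z a')" and gm: "mor Z (Y Z a) (\<gamma> Z a a') (Y Z a')" and gp: "b ==> pres Z (Y Z a) (\<gamma> Z a a') (Y Z a')"
  if "a \<in> NO Z" "a' \<in> NO Z" "va a = va a'" for Z a a'
 proof -
  have A: "(a, a') \<in> Arr (sect ?N Z)" using that NA by blast
  have Z: "ob Z" by (rule vaN(4)[OF that(1)])
  have NS: "Dom (sect ?N Z) (a, a') = a" "Cod (sect ?N Z) (a, a') = a'" by simp_all
  show e: "arm (\<omega> Z) (a, a') = (Y Z a, \<gamma> Z a a', Y Z a')"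
   using gmapD(6,7)[OF w Z A] by (cases "arm (\<omega> Z) (a, a')") (simp add: Y_def \<gamma>_def)
  show "mor Z (Y Z a) (\<gamma> Z a a') (Y Z a')" "b ==> pres Z (Y Z a) (\<gamma> Z a a') (Y Z a')"
   using gmapD(5)[OF w Z A] by (simp_all add: e)
 qed
 have gc: "\<gamma> Z a' a'' h (\<gamma> Z a a' h x) = \<gamma> Z a a'' h x"
  if a: "a \<in> NO Z" "a' \<in> NO Z" "a'' \<in> NO Z" "va a = va a'" "va a' = va a''" and h: "arr h" "tgt h = Z" "x \<in> tval (Y Z a) h" for Z a a' a'' h x
 proof -
  have A: "(a, a') \<in> Arr (sect ?N Z)" "(a', a'') \<in> Arr (sect ?N Z)" using a NA by blast+
  have "arm (\<omega> Z) (a, a'') = Comp (sect ?W Z) (arm (\<omega> Z) (a', a'')) (arm (\<omega> Z) (a, a'))"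
   using gmapD(9)[OF w vaN(4)[OF a(1)] A] by simp
  then have "mcomp C Z (Y Z a) (\<gamma> Z a' a'') (\<gamma> Z a a') = \<gamma> Z a a''" using wA a by simp
  then show ?thesis using h mcomp_simp by metis
 qed
 have gid: "\<gamma> Z a a h x = x" if a: "a \<in> NO Z" and h: "arr h" "tgt h = Z" "x \<in> tval (Y Z a) h" for Z a h x
 proof -
  have "arm (\<omega> Z) (a, a) = Idt (sect ?W Z) (Y Z a)" using gmapD(8)[OF w vaN(4)[OF a] a[unfolded NO]] by (simp add: Y_def)
  then show ?thesis using wA[OF a a refl] h by simp
 qed
 have Yr: "Y (src l) (rs l a) = tsub C l (Y Z a)" if a: "a \<in> NO Z" and l: "arr l" "tgt l = Z" for Z a l
  using gmapD(10)[OF w l(1) refl, of a] a l by (simp add: rsN Y_def NO)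
 have gr: "\<gamma> (src l) (rs l a) (rs l a') h = \<gamma> Z a a' (cmp l h)"
  if a: "a \<in> NO Z" "a' \<in> NO Z" "va a = va a'" and l: "arr l" "tgt l = Z" and h: "arr h" "tgt h = src l" for Z a a' l h
 proof -
  have "(a, a') \<in> Arr (sect ?N (tgt l))" using a l NA by simp
  from gmapD(11)[OF w l(1) refl this]
  have "arm (\<omega> (src l)) (rs l a, rs l a') = arm (rst ?W l) (arm (\<omega> Z) (a, a'))" using l by (simp add: rsA)
  then have "\<gamma> (src l) (rs l a) (rs l a') = msub C l (\<gamma> Z a a')"
   using wA[OF a] wA[OF rsI(1)[OF a(1) l] rsI(1)[OF a(2) l]] rsI(2)[OF a(1) l] rsI(2)[OF a(2) l] a(3) by simp
  then show ?thesis using h by simp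
 qed
 define Q where "Q = {cmp u k | u k. u \<in> S \<and> k \<in> pre u}"
 have Q: "cs X Q" unfolding Q_def by (rule cs_gen[OF S])
 note Q' = csvD[OF Q]
 have "\<forall>r \<in> Q. \<exists>a. a \<in> NO (src r) \<and> va a = r"
 proof
  fix r assume "r \<in> Q"
  then obtain u k where "u \<in> S" "k \<in> pre u" "r = cmp u k" unfolding Q_def by blast
  then show "\<exists>a. a \<in> NO (src r) \<and> va a = r" using SX by (intro exI[of _ "(u, k)"]) (auto simp: NO_def va_def)
 qed
 \<comment> \<open>The choice of one object of the nerve over each arrow of the sieve. It does not
   commute with restriction, hence the corrections below.\<close>
 from bchoice[OF this] obtain q where q: "!!r. r \<in> Q ==> q r \<in> NO (src r)" "!!r. r \<in> Q ==> va (q r) = r" by blast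
 have vaQ: "va a \<in> Q" if "a \<in> NO Z" for a Z unfolding Q_def va_def using that by (auto simp: NO_def)
 have rQ: "cmp (va a) l \<in> Q" "q (cmp (va a) l) \<in> NO (src l)" "va (q (cmp (va a) l)) = cmp (va a) l"
  if "a \<in> NO Z" "arr l" "tgt l = Z" for a Z l
 proof -
  show 1: "cmp (va a) l \<in> Q" using Q'(4)[OF vaQ[OF that(1)] that(2)] vaN[OF that(1)] that by simp
  show "q (cmp (va a) l) \<in> NO (src l)" "va (q (cmp (va a) l)) = cmp (va a) l" using q[OF 1] vaN[OF that(1)] that by simp_all
 qed
 \<comment> \<open>The comparison of the sections of \<open>Y Z a\<close> over \<open>l\<close> with
   those of the chosen object over \<open>cmp (va a) l\<close>.\<close>
 define c where "c a l = \<gamma> (src l) (rs l a) (q (cmp (va a) l)) (Idt C (src l))" for a l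
 define v where "v r = tval (Y (src r) (q r)) (Idt C (src r))" for r
 \<comment> \<open>A section is restricted inside the chosen object over \<open>r\<close> and then
   carried to the chosen object over \<open>cmp r k\<close>.\<close>
 define res where "res r k z = c (q r) k (tres (Y (src r) (q r)) (Idt C (src r)) k z)" for r k z
 note pY = pshfD[OF shf_pshf[OF validD(1)[OF Yv]]]
 have cm: "mor (src l) (tsub C l (Y Z a)) (\<gamma> (src l) (rs l a) (q (cmp (va a) l))) (Y (src l) (q (cmp (va a) l)))"
  if a: "a \<in> NO Z" and l: "arr l" "tgt l = Z" for a l Z
  using gm[OF rsI(1)[OF that] rQ(2)[OF that]] rsI(2)[OF that] rQ(3)[OF that] Yr[OF that] by simp
 have cb: "bij_betw (c a l) (tval (Y Z a) l) (v (cmp (va a) l))" if a: "a \<in> NO Z" and l: "arr l" "tgt l = Z" for a l Z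
  using morD(2)[OF cm[OF that], of "Idt C (src l)"] l vaN[OF a] by (simp add: c_def v_def)
 have cin: "c a l x \<in> v (cmp (va a) l)" if "a \<in> NO Z" "arr l" "tgt l = Z" "x \<in> tval (Y Z a) l" for a l Z x
  using cb[OF that(1-3)] that(4) by (auto simp: bij_betw_def)
 \<comment> \<open>The comparison is natural: this is the cocycle condition for \<open>a\<close>,
   its chosen replacement, and the replacement chosen after restriction.\<close>
 have c1: "c a (cmp l m) (tres (Y Z a) l m x) = res (cmp (va a) l) m (c a l x)"
  if a: "a \<in> NO Z" and l: "arr l" "tgt l = Z" and m: "arr m" "tgt m = src l" and x: "x \<in> tval (Y Z a) l" for a l m Z x
 proof -
  let ?r = "cmp (va a) l" and ?i = "Idt C (src l)"
  note R = rQ[OF a l] and V = vaN[OF a]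
  have lm: "cmp l m \<in> Arr C" "tgt (cmp l m) = Z" "src (cmp l m) = src m" using l m by auto
  have as: "cmp ?r m = cmp (va a) (cmp l m)" using V l m by (simp add: comp_assoc)
  have d: "src ?r = src l" using V l by simp
  note R2 = rQ[OF a lm(1,2), unfolded lm(3)] and R3 = rQ[OF R(2) m, unfolded R(3)]
  have t0: "tres (Y Z a) l m x \<in> tval (Y Z a) (cmp l m)" using pY(2)[OF a _ x m] l by simp
  have n: "\<gamma> (src l) (rs l a) (q ?r) m (tres (Y Z a) l m x) = tres (Y (src l) (q ?r)) ?i m (c a l x)"
   using morD(5)[OF cm[OF a l], of ?i x m] l m x by (simp add: c_def)
  have "res ?r m (c a l x) = \<gamma> (src m) (rs m (q ?r)) (q (cmp ?r m)) (Idt C (src m)) (\<gamma> (src l) (rs l a) (q ?r) m (tres (Y Z a) l m x))"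
   unfolding res_def d n by (simp add: c_def R)
  also have "\<gamma> (src l) (rs l a) (q ?r) m = \<gamma> (src m) (rs m (rs l a)) (rs m (q ?r)) (Idt C (src m))"
   using gr[OF rsI(1)[OF a l] R(2) _ m, of "Idt C (src m)"] rsI(2)[OF a l] R(3) m by simp
  also have "\<gamma> (src m) (rs m (q ?r)) (q (cmp ?r m)) (Idt C (src m)) (\<gamma> (src m) (rs m (rs l a)) (rs m (q ?r)) (Idt C (src m)) (tres (Y Z a) l m x))
    = \<gamma> (src m) (rs m (rs l a)) (q (cmp ?r m)) (Idt C (src m)) (tres (Y Z a) l m x)"
  proof (rule gc[OF rsI(1)[OF rsI(1)[OF a l] m] rsI(1)[OF R(2) m] R3(2)])
   show "va (rs m (rs l a)) = va (rs m (q ?r))" using rsI(2)[OF rsI(1)[OF a l] m] rsI(2)[OF a l] rsI(2)[OF R(2) m] R(3) by simp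
   show "va (rs m (q ?r)) = va (q (cmp ?r m))" using rsI(2)[OF R(2) m] R(3) R3(3) by simp
   show "tres (Y Z a) l m x \<in> tval (Y (src m) (rs m (rs l a))) (Idt C (src m))"
    unfolding rs_rs[OF a l m] using Yr[OF a lm(1,2)] t0 lm m by simp
  qed (use m in auto)
  also have "\<dots> = c a (cmp l m) (tres (Y Z a) l m x)"
   unfolding c_def rs_rs[OF a l m] lm(3) as by simp
  finally show ?thesis by simp
 qed
 have c2: "c (q r) (Idt C (src r)) x = x" if r: "r \<in> Q" and x: "x \<in> v r" for r x
  using gid[OF q(1)[OF r], of "Idt C (src r)" x] rs_id[OF q(1)[OF r]] q[OF r] x Q'(2)[OF r] by (simp add: c_def v_def)
 \<comment> \<open>The comparison does not depend on the object of the nerve over a given arrow: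
   again the cocycle condition.\<close>
 have c3: "c a' l (\<gamma> Z a a' l x) = c a l x" if a: "a \<in> NO Z" "a' \<in> NO Z" "va a = va a'" and l: "arr l" "tgt l = Z" and x: "x \<in> tval (Y Z a) l" for a a' l Z x
 proof -
  have e: "\<gamma> Z a a' l = \<gamma> (src l) (rs l a) (rs l a') (Idt C (src l))"
   using gr[OF a l, of "Idt C (src l)"] l by simp
  show ?thesis unfolding c_def e a(3)
   by (rule gc[OF rsI(1)[OF a(1) l] rsI(1)[OF a(2) l]])
    (use rsI(2)[OF a(1) l] rsI(2)[OF a(2) l] a(3) rQ[OF a(2) l] Yr[OF a(1) l] l x in auto)
 qed
 have c4: "c (rs m a) l = c a (cmp m l)" if a: "a \<in> NO Z" and m: "arr m" "tgt m = Z" and l: "arr l" "tgt l = src m" for a m l Z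
  unfolding c_def using rs_rs[OF a m l] rsI(2)[OF a m] vaN[OF a] m l by (simp add: comp_assoc)
 have vres: "pshf C Q v res" unfolding pshf_def
 proof (intro ballI conjI)
  fix r x assume r: "r \<in> Q" and x: "x \<in> v r"
  have ra: "arr r" "tgt r = X" using Q' r by auto
  let ?i = "Idt C (src r)"
  have i: "?i \<in> Arr C" "tgt ?i = src r" "src ?i = src r" using ra by auto
  have x': "x \<in> tval (Y (src r) (q r)) ?i" using x by (simp add: v_def)
  note p = pY[OF q(1)[OF r] _ x', simplified i]
  show "res r ?i x = x" unfolding res_def using p(1) i c2[OF r x] by simp
  fix k assume "k \<in> pre r"
  then have k: "arr k" "tgt k = src r" by auto
  have tk: "tres (Y (src r) (q r)) ?i k x \<in> tval (Y (src r) (q r)) k" using p(2) i k by simp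
  show "res r k x \<in> v (cmp r k)" unfolding res_def using cin[OF q(1)[OF r] k tk] q(2)[OF r] by simp
  fix l assume "l \<in> pre k"
  then have l: "arr l" "tgt l = src k" by auto
  show "res (cmp r k) l (res r k x) = res r (cmp k l) x"
   using c1[OF q(1)[OF r] k l tk] q(2)[OF r] p(3)[of k l] i k l by (simp add: res_def[of r])
 qed
 have "shf C Cov Q v res" unfolding shf_def
 proof (intro conjI vres ballI allI impI, elim conjE)
  fix r P x assume r: "r \<in> Q" and P: "cs (src r) P" and x: "\<forall>u\<in>P. x u \<in> v (cmp r u)"
   and xn: "\<forall>u\<in>P. \<forall>k\<in>pre u. x (cmp u k) = res (cmp r u) k (x u)"
  note P' = csvD[OF P]
  have ra: "arr r" "tgt r = X" using Q' r by auto
  let ?i = "Idt C (src r)" and ?y = "Y (src r) (q r)"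
  have i: "?i \<in> Arr C" "tgt ?i = src r" "src ?i = src r" using ra by auto
  note b' = cb[OF q(1)[OF r], unfolded q(2)[OF r]]
  define z where "z w = inv_into (tval ?y w) (c (q r) w) (x w)" for w
  have z: "z w \<in> tval ?y w" "c (q r) w (z w) = x w" if w: "w \<in> P" for w
  proof -
   have "x w \<in> c (q r) w ` tval ?y w" using b'[OF P'(2,3)[OF w]] x w by (auto simp: bij_betw_def)
   then show "z w \<in> tval ?y w" "c (q r) w (z w) = x w" unfolding z_def by (rule inv_into_into, rule f_inv_into_f)
  qed
  have zn: "z (cmp w k) = tres ?y w k (z w)" if w: "w \<in> P" and k: "arr k" "tgt k = src w" for w k
  proof -
   note wk = P'(4)[OF w k]
   have "c (q r) (cmp w k) (tres ?y w k (z w)) = x (cmp w k)"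
    using c1[OF q(1)[OF r] P'(2,3)[OF w] k z(1)[OF w]] q(2)[OF r] z(2)[OF w] xn w k by simp
   moreover have "tres ?y w k (z w) \<in> tval ?y (cmp w k)" using pY(2)[OF q(1)[OF r] _ z(1)[OF w] k] P' w by simp
   ultimately show ?thesis using z[OF wk] b'[OF P'(2,3)[OF wk]] by (metis bij_betw_def inj_onD)
  qed
  have i': "?i \<in> pre r" "cs (src ?i) P" using i P by auto
  obtain t where t: "t \<in> tval ?y ?i" "\<forall>w \<in> P. tres ?y ?i w t = z w"
   using shf_ex[OF validD(1)[OF Yv[OF q(1)[OF r]]] i', of z] z(1) zn P' by auto
  show "\<exists>!y. y \<in> v r \<and> (\<forall>u\<in>P. res r u y = x u)"
  proof (rule ex1I[of _ t])
   show "t \<in> v r \<and> (\<forall>u\<in>P. res r u t = x u)" using t z by (simp add: v_def res_def)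
   fix t' assume t': "t' \<in> v r \<and> (\<forall>u\<in>P. res r u t' = x u)"
   show "t' = t"
   proof (rule shf_sep[OF validD(1)[OF Yv[OF q(1)[OF r]]] i'])
    show tv: "t' \<in> tval ?y ?i" using t' by (simp add: v_def)
    fix w assume w: "w \<in> P"
    have "c (q r) w (tres ?y ?i w t') = c (q r) w (z w)" using t' w z by (simp add: res_def)
    moreover have "tres ?y ?i w t' \<in> tval ?y w" using pY(2)[OF q(1)[OF r] _ tv, of w] i P' w by simp
    ultimately have "tres ?y ?i w t' = z w" using z(1)[OF w] b'[OF P'(2,3)[OF w]] by (metis bij_betw_def inj_onD)
    then show "tres ?y ?i w t' = tres ?y ?i w t" using t w by simp
   qed (rule t)
  qed
 qed
 \<comment> \<open>The sheaf so far lives on the sieve \<open>Q\<close>; \<open>\<iota>\<close>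
   compares it with its extension to all arrows into \<open>X\<close>.\<close>
 from ext_sheaf[OF Q this] obtain V R \<iota> where V: "shf C Cov (into C X) V R" and \<iota>n: "natm C Q v res V R \<iota>" and \<iota>b: "!!h. h \<in> Q ==> bij_betw (\<iota> h) (v h) (V h)"
  by blast
 define d where "d a l x = \<iota> (cmp (va a) l) (c a l x)" for a l x
 have db: "bij_betw (d a l) (tval (Y Z a) l) (V (cmp (va a) l))" if a: "a \<in> NO Z" and l: "arr l" "tgt l = Z" for a l Z
  using bij_betw_trans[OF cb[OF that] \<iota>b[OF rQ(1)[OF that]]] by (simp add: d_def[abs_def] comp_def)
 have d1: "d a (cmp l m) (tres (Y Z a) l m x) = R (cmp (va a) l) m (d a l x)"
  if a: "a \<in> NO Z" and l: "arr l" "tgt l = Z" and m: "arr m" "tgt m = src l" and x: "x \<in> tval (Y Z a) l" for a l m Z x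
  unfolding d_def c1[OF that] using natmD(2)[OF \<iota>n rQ(1)[OF a l] cin[OF a l x] m(1)] vaN[OF a] l m by (simp add: comp_assoc)
 have d3: "d a' l (\<gamma> Z a a' l x) = d a l x" if a: "a \<in> NO Z" "a' \<in> NO Z" "va a = va a'" and l: "arr l" "tgt l = Z" and x: "x \<in> tval (Y Z a) l" for a a' l Z x
  unfolding d_def c3[OF that] a(3) ..
 have d4: "d (rs m a) l = d a (cmp m l)" if a: "a \<in> NO Z" and m: "arr m" "tgt m = Z" and l: "arr l" "tgt l = src m" for a m l Z
  unfolding d_def using c4[OF that] rsI(2)[OF a m] vaN[OF a] m l by (simp add: comp_assoc)
 \<comment> \<open>Charts of the glued object are the charts of all objects of the datum, followed
   by the comparison \<open>d\<close>.\<close>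
 define ch where "ch = {(cmp (va a) h, m, \<lambda>k \<in> pre h. \<lambda>x. d a (cmp h k) (\<phi> k x)) | Z a h m \<phi>. a \<in> NO Z \<and> (h, m, \<phi>) \<in> tcht (Y Z a)}"
 have chI: "(cmp (va a) h, m, \<lambda>k \<in> pre h. \<lambda>x. d a (cmp h k) (\<phi> k x)) \<in> ch" if "a \<in> NO Z" "(h, m, \<phi>) \<in> tcht (Y Z a)" for Z a h m \<phi>
  unfolding ch_def using that by blast
 have chE: "\<exists>Z a h m' \<phi>'. a \<in> NO Z \<and> (h, m', \<phi>') \<in> tcht (Y Z a) \<and> s = cmp (va a) h \<and> m = m' \<and> \<phi> = (\<lambda>k \<in> pre h. \<lambda>x. d a (cmp h k) (\<phi>' k x))"
  if "(s, m, \<phi>) \<in> ch" for s m \<phi> using that unfolding ch_def by blast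
 have iX: "Idt C X \<in> into C X" "src (Idt C X) = X" "Idt C X \<in> Arr C" "tgt (Idt C X) = X" using X by auto
 have pV: "r \<in> Q ==> cmp (Idt C X) r = r" for r using Q' X by auto
 \<comment> \<open>In the pointed case the points of the datum correspond under the transitions, so
   their images match on \<open>Q\<close> and glue to a global section.\<close>
 have "\<exists>p. (b --> p \<in> V (Idt C X) \<and> (\<forall>Z a. a \<in> NO Z --> R (Idt C X) (va a) p = d a (Idt C Z) (the (tpt (Y Z a)))))"
 proof (cases b)
  case True
  define x where "x r = d (q r) (Idt C (src r)) (the (tpt (Y (src r) (q r))))" for r
  have pt: "the (tpt (Y Z a)) \<in> tval (Y Z a) (Idt C Z)" if "a \<in> NO Z" for Z a
   using YU(2)[OF that True] validD(5)[OF Yv[OF that]] by auto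
  have xa: "d a (Idt C Z) (the (tpt (Y Z a))) = x (va a)" if a: "a \<in> NO Z" for Z a
  proof -
   note V = vaN[OF a] and q' = q[OF vaQ[OF a]]
   have qa: "q (va a) \<in> NO Z" "va a = va (q (va a))" using q' V by auto
   have "the (tpt (Y Z (q (va a)))) = \<gamma> Z a (q (va a)) (Idt C Z) (the (tpt (Y Z a)))"
    using gp[OF a qa True] YU(2)[OF a True] by (auto simp: pres_def)
   then show ?thesis using d3[OF a qa, of "Idt C Z"] V pt[OF a] by (simp add: x_def)
  qed
  have "\<exists>p \<in> V (Idt C X). \<forall>u \<in> Q. R (Idt C X) u p = x u"
  proof (rule shf_ex[OF V iX(1)])
   show "cs (src (Idt C X)) Q" using Q iX by simp
   fix r assume r: "r \<in> Q"
   note qr = q[OF r]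
   have ra: "arr r" "tgt r = X" using Q' r by auto
   show "x r \<in> V (cmp (Idt C X) r)"
    using db[OF qr(1), of "Idt C (src r)"] pt[OF qr(1)] qr(2) ra pV[OF r] by (auto simp: x_def bij_betw_def)
   fix k assume k: "arr k" "tgt k = src r"
   have "R r k (x r) = d (q r) k (tres (Y (src r) (q r)) (Idt C (src r)) k (the (tpt (Y (src r) (q r)))))"
    using d1[OF qr(1), of "Idt C (src r)" k] k ra pt[OF qr(1)] qr(2) by (simp add: x_def)
   also have "\<dots> = d (rs k (q r)) (Idt C (src k)) (the (tpt (Y (src k) (rs k (q r)))))"
    using d4[OF qr(1) k, of "Idt C (src k)"] Yr[OF qr(1) k] YU(2)[OF qr(1) True] k by (auto simp del: not_None_eq)
   also have "\<dots> = x (cmp r k)" using xa[OF rsI(1)[OF qr(1) k]] rsI(2)[OF qr(1) k] qr(2) by simp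
   finally show "x (cmp r k) = R (cmp (Idt C X) r) k (x r)" using pV[OF r] by simp
  qed
  then show ?thesis using xa vaQ by metis
 qed simp
 then obtain p where p: "b ==> p \<in> V (Idt C X)" "!!Z a. b ==> a \<in> NO Z ==> R (Idt C X) (va a) p = d a (Idt C Z) (the (tpt (Y Z a)))" by blast
 define y where "y = \<lparr>tval = (\<lambda>h. if h \<in> into C X then V h else {}), tres = (\<lambda>h. if h \<in> into C X then R h else undefined),
  tcht = ch, tpt = (if b then Some p else None)\<rparr>"
 have yv: "tval y h = V h" "tres y h = R h" if "arr h" "tgt h = X" for h using that by (auto simp: y_def)
 have ych: "tcht y = ch" "tpt y = (if b then Some p else None)" by (simp_all add: y_def)
 have chin: "\<phi> k x \<in> tval (Y Z a) (cmp h k)" if "a \<in> NO Z" "(h, m, \<phi>) \<in> tcht (Y Z a)" "arr k" "tgt k = src h" "x \<in> gv m k" for Z a h m \<phi> k x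
  by (rule chart_in[OF Yv[OF that(1)] that(2-5)])
 have yval: "valid X y" unfolding valid_def
 proof (intro conjI allI impI, goal_cases)
  case (1 h) then show ?case by (auto simp: y_def)
 next
  case (2 h) then show ?case by (auto simp: y_def)
 next
  case 3
  have "pshf C (into C X) (tval y) (tres y)" using shf_pshf[OF V] unfolding pshf_def by (auto simp: yv)
  moreover have "\<exists>!z. z \<in> tval y h \<and> (\<forall>u\<in>P. tres y h u z = x u)"
   if "h \<in> into C X" "cs (src h) P" "\<forall>u\<in>P. x u \<in> tval y (cmp h u)" "\<forall>u\<in>P. \<forall>k\<in>pre u. x (cmp u k) = tres y (cmp h u) k (x u)" for h P x
  proof -
   have e: "tval y h = V h" "tres y h = R h" "!!u. u \<in> P ==> tval y (cmp h u) = V (cmp h u)" "!!u. u \<in> P ==> tres y (cmp h u) = R (cmp h u)"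
    using yv that(1) csvD[OF that(2)] by auto
   show ?thesis unfolding e(1,2)
    by (rule V[unfolded shf_def, THEN conjunct2, rule_format]) (use that e in auto)
  qed
  ultimately show ?case unfolding shf_def by blast
 next
  case (4 s m \<phi>)
  from chE[OF this[unfolded ych]] obtain Z a h \<phi>' where *: "a \<in> NO Z" "(h, m, \<phi>') \<in> tcht (Y Z a)" "s = cmp (va a) h" by blast
  then show ?case using chartD[OF Yv[OF *(1)] *(2)] vaN[OF *(1)] by simp
 next
  case (5 s m \<phi>)
  from chE[OF this[unfolded ych]] obtain Z a h \<phi>' where *: "a \<in> NO Z" "(h, m, \<phi>') \<in> tcht (Y Z a)" "s = cmp (va a) h" by blast
  then show ?case using chartD[OF Yv[OF *(1)] *(2)] vaN[OF *(1)] by simp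
 next
  case (6 s m \<phi>)
  from chE[OF this[unfolded ych]] obtain Z a h \<phi>' where *: "a \<in> NO Z" "(h, m, \<phi>') \<in> tcht (Y Z a)" "s = cmp (va a) h"
   "\<phi> = (\<lambda>k \<in> pre h. \<lambda>x. d a (cmp h k) (\<phi>' k x))" by blast
  note c = chartD[OF Yv[OF *(1)] *(2)] and V = vaN[OF *(1)]
  show ?case
  proof (intro ballI conjI)
   fix k assume "k \<in> pre s"
   then have k: "arr k" "tgt k = src h" using c V * by auto
   have hk: "cmp h k \<in> Arr C" "tgt (cmp h k) = Z" using c k by auto
   have sk: "cmp s k = cmp (va a) (cmp h k)" using * c k V by (simp add: comp_assoc)
   have sX: "cmp s k \<in> Arr C" "tgt (cmp s k) = X" using sk hk V by auto
   show "bij_betw (\<phi> k) (gv m k) (tval y (cmp s k))"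
    using bij_betw_trans[OF c(4)[OF k] db[OF *(1) hk]] k sX unfolding *(4) by (simp add: yv comp_def sk)
   fix x l assume x: "x \<in> gv m k" and "l \<in> pre k"
   then have l: "arr l" "tgt l = src k" by auto
   show "\<phi> (cmp k l) (rG l (rO k m) x) = tres y (cmp s k) l (\<phi> k x)"
    using c(5)[OF k x l] d1[OF *(1) hk, of l "\<phi>' k x"] chin[OF *(1,2) k x] k l c hk sX unfolding *(4) by (simp add: yv sk comp_assoc)
  qed
 next
  case (7 s m \<phi>)
  from chE[OF this[unfolded ych]] obtain Z a h \<phi>' where *: "a \<in> NO Z" "(h, m, \<phi>') \<in> tcht (Y Z a)" "s = cmp (va a) h"
   "\<phi> = (\<lambda>k \<in> pre h. \<lambda>x. d a (cmp h k) (\<phi>' k x))" by blast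
  note c = chartD[OF Yv[OF *(1)] *(2)] and V = vaN[OF *(1)]
  show ?case
  proof (intro ballI)
   fix k assume "k \<in> pre s"
   then have k: "arr k" "tgt k = src h" using c V * by auto
   have e: "(\<lambda>l\<in>pre (cmp h k). \<lambda>x. d a (cmp (cmp h k) l) ((\<lambda>l\<in>pre k. \<phi>' (cmp k l)) l x)) = (\<lambda>l\<in>pre k. \<phi> (cmp k l))"
    using k c unfolding *(4) by (auto simp: fun_eq_iff restrict_def comp_assoc)
   show "(cmp s k, rO k m, \<lambda>l\<in>pre k. \<phi> (cmp k l)) \<in> tcht y"
    using chI[OF *(1) c(6)[OF k]] e V c k * by (simp add: ych comp_assoc)
  qed
 next
  \<comment> \<open>Two charts over \<open>s\<close> may stem from different objects of the datum.
    After restriction these have equal value, and the transition between them is a morphism, hence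
    respects charts; \<open>d\<close> absorbs the transition by \<open>d3\<close>.\<close>
  case (8 s m1 \<phi>1 m2 \<phi>2)
  then have c8: "(s, m1, \<phi>1) \<in> ch" "(s, m2, \<phi>2) \<in> ch" by (simp_all add: ych)
  from chE[OF c8(1)] obtain Z1 a1 h1 f1 where A: "a1 \<in> NO Z1" "(h1, m1, f1) \<in> tcht (Y Z1 a1)" "s = cmp (va a1) h1"
   "\<phi>1 = (\<lambda>k \<in> pre h1. \<lambda>x. d a1 (cmp h1 k) (f1 k x))" by blast
  from chE[OF c8(2)] obtain Z2 a2 h2 f2 where B: "a2 \<in> NO Z2" "(h2, m2, f2) \<in> tcht (Y Z2 a2)" "s = cmp (va a2) h2"
   "\<phi>2 = (\<lambda>k \<in> pre h2. \<lambda>x. d a2 (cmp h2 k) (f2 k x))" by blast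
  note cA = chartD[OF Yv[OF A(1)] A(2)] and VA = vaN[OF A(1)] and cB = chartD[OF Yv[OF B(1)] B(2)] and VB = vaN[OF B(1)]
  have D: "src s = src h1" "src h2 = src h1" using A(3) B(3) VA VB cA cB by (simp, metis cat_simps(7) catC)
  note RA = rsI[OF A(1) cA(1,2)] and RB = rsI[OF B(1) cB(1,2), unfolded D(2)]
  have ve: "va (rs h1 a1) = va (rs h2 a2)" using RA RB A(3) B(3) by simp
  let ?Z = "src h1" and ?g = "\<gamma> (src h1) (rs h1 a1) (rs h2 a2)"
  have m: "mor ?Z (tsub C h1 (Y Z1 a1)) ?g (tsub C h2 (Y Z2 a2))"
   using gm[OF RA(1) RB(1) ve] Yr[OF A(1) cA(1,2)] Yr[OF B(1) cB(1,2)] D(2) by simp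
  have "rel (src (Idt C ?Z)) m1 f1 m2 f2 (\<lambda>k. ?g (cmp (Idt C ?Z) k))"
   by (rule morD(3)[OF m]) (use A(2) B(2) cA cB D in auto)
  then have r: "rel ?Z m1 f1 m2 f2 (\<lambda>k. ?g (cmp (Idt C ?Z) k))" using cA by simp
  have oM: "m1 \<in> OM ?Z" "m2 \<in> OM ?Z" using cA cB D by simp_all
  show ?case unfolding D(1)
  proof (rule rel_map[OF oM r])
   fix k x x' assume k: "arr k" "tgt k = ?Z" and x: "x \<in> gv m1 k" and x': "x' \<in> gv m2 k"
    and e: "f2 k x' = ?g (cmp (Idt C ?Z) k) (f1 k x)"
   have f1: "f1 k x \<in> tval (Y ?Z (rs h1 a1)) k" using chin[OF A(1,2) k x] Yr[OF A(1) cA(1,2)] k by simp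
   have "d a2 (cmp h2 k) (f2 k x') = d (rs h2 a2) k (?g k (f1 k x))"
    using d4[OF B(1) cB(1,2) k(1)] k D e cA by simp
   also have "\<dots> = d a1 (cmp h1 k) (f1 k x)"
    using d3[OF RA(1) RB(1) ve k f1] d4[OF A(1) cA(1,2) k] by simp
   finally show "\<phi>2 k x' = \<phi>1 k x" using k D by (simp add: A(4) B(4))
  qed
 next
  \<comment> \<open>Over \<open>r\<close> in \<open>Q\<close> the charts of the chosen object
    already form a covering sieve.\<close>
  case 9
  show ?case
  proof (rule cs_trans[OF Q])
   fix s k assume "s \<in> {h \<in> into C X. \<exists>m \<phi>. (h, m, \<phi>) \<in> tcht y}" and k: "arr k" "tgt k = src s"
   then obtain m \<phi> where s: "s \<in> into C X" "(s, m, \<phi>) \<in> ch" by (auto simp: ych)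
   from chE[OF s(2)] obtain Z a h \<phi>' where *: "a \<in> NO Z" "(h, m, \<phi>') \<in> tcht (Y Z a)" "s = cmp (va a) h" by blast
   note c = chartD[OF Yv[OF *(1)] *(2)] and V = vaN[OF *(1)]
   have k': "tgt k = src h" using k * c V by simp
   have "cmp (va a) (cmp h k) = cmp s k" using * c V k k' by (simp add: comp_assoc)
   then show "cmp s k \<in> {h \<in> into C X. \<exists>m \<phi>. (h, m, \<phi>) \<in> tcht y}"
    using chI[OF *(1) c(6)[OF k(1) k']] s(1) k by (auto simp: ych)
  next
   fix r assume r: "r \<in> Q"
   have ra: "arr r" "tgt r = X" using Q' r by auto
   show "cs (src r) {k \<in> pre r. cmp r k \<in> {h \<in> into C X. \<exists>m \<phi>. (h, m, \<phi>) \<in> tcht y}}"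
   proof (rule cs_mono[OF validD(4)[OF Yv[OF q(1)[OF r]]]])
    show "{h \<in> pre r. \<exists>m \<phi>. (h, m, \<phi>) \<in> tcht (Y (src r) (q r))} \<subseteq> {k \<in> pre r. cmp r k \<in> {h \<in> into C X. \<exists>m \<phi>. (h, m, \<phi>) \<in> tcht y}}"
     using chI[OF q(1)[OF r]] q(2)[OF r] ra by (fastforce simp: ych)
    fix k l assume "k \<in> {k \<in> pre r. cmp r k \<in> {h \<in> into C X. \<exists>m \<phi>. (h, m, \<phi>) \<in> tcht y}}" and l: "arr l" "tgt l = src k"
    then obtain m \<phi> where k: "arr k" "tgt k = src r" "(cmp r k, m, \<phi>) \<in> ch" by (auto simp: ych)
    from chE[OF k(3)] obtain Z a h \<phi>' where *: "a \<in> NO Z" "(h, m, \<phi>') \<in> tcht (Y Z a)" "cmp r k = cmp (va a) h" by blast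
    note c = chartD[OF Yv[OF *(1)] *(2)] and V = vaN[OF *(1)]
    have "src k = src h" using arg_cong[OF *(3), of "src"] k ra c V by simp
    then have l': "tgt l = src h" using l by simp
    have "cmp (va a) (cmp h l) = cmp (cmp r k) l" unfolding *(3) using c V l l' by (simp add: comp_assoc)
    then have "cmp (va a) (cmp h l) = cmp r (cmp k l)" using k l ra by (simp add: comp_assoc)
    then show "cmp k l \<in> {k \<in> pre r. cmp r k \<in> {h \<in> into C X. \<exists>m \<phi>. (h, m, \<phi>) \<in> tcht y}}"
     using chI[OF *(1) c(6)[OF l(1) l']] k l ra by (auto simp: ych)
   qed auto
  qed auto
 next
  case (10 x)
  then show ?case using p(1) iX by (auto simp: ych yv split: if_splits)
 qed
 \<comment> \<open>The comparison \<open>d\<close> as an isomorphism from each object of the datum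
   to the restriction of the glued object.\<close>
 define D where "D Z a = (\<lambda>l \<in> into C Z. \<lambda>x \<in> tval (Y Z a) l. d a l x)" for Z a
 have Dm: "mor Z (Y Z a) (D Z a) (tsub C (va a) y)" if a: "a \<in> NO Z" for Z a
  unfolding D_def
 proof (rule morI_restrict)
  note V = vaN[OF a]
  have dm: "tval (tsub C (va a) y) l = V (cmp (va a) l)" "tres (tsub C (va a) y) l = R (cmp (va a) l)" if "arr l" "tgt l = Z" for l
   using that V by (simp_all add: yv)
  show "natm C (into C Z) (tval (Y Z a)) (tres (Y Z a)) (tval (tsub C (va a) y)) (tres (tsub C (va a) y)) (d a)"
  proof -
   have din: "d a l x \<in> V (cmp (va a) l)" if "arr l" "tgt l = Z" "x \<in> tval (Y Z a) l" for l x
    using db[OF a that(1,2)] that(3) by (auto simp: bij_betw_def)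
   show ?thesis unfolding natm_def using din d1[OF a] by (auto simp: dm)
  qed
  show "valid Z (Y Z a)" by (rule Yv[OF a])
  show "valid Z (tsub C (va a) y)" using valid_tsub[OF yval V(1,3)] V(2) by simp
  show "bij_betw (d a l) (tval (Y Z a) l) (tval (tsub C (va a) y) l)" if "arr l" "tgt l = Z" for l
   using db[OF a that] by (simp add: dm that)
  fix h m \<phi> m' \<phi>' assume c: "(h, m, \<phi>) \<in> tcht (Y Z a)" "(h, m', \<phi>') \<in> tcht (tsub C (va a) y)"
  note cA = chartD[OF Yv[OF a] c(1)]
  have c2: "(cmp (va a) h, m', \<phi>') \<in> tcht y" using c(2) by simp
  have dh: "src (cmp (va a) h) = src h" using V cA by simp
  note r = validD(3)[OF yval chI[OF a c(1), folded ych(1)] c2, unfolded dh]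
  show "rel (src h) m \<phi> m' \<phi>' (\<lambda>k. d a (cmp h k))"
   by (rule rel_map[OF cA(3) chartD(3)[OF yval c2, unfolded dh] r]) simp
 qed
 obtain y' \<sigma> where y': "y' \<in> U X" "mor X y \<sigma> y'" "pres X y \<sigma> y'" using ess[OF yval] by blast
 note y'v = val[OF X y'(1)]
 have yo: "y' \<in> Obj (sect ?W X)" using y' by (auto simp: pres_def ych)
 note ym = yo_map[OF Wp X yo]
 note nm = cov_nerve_map[OF S]
 \<comment> \<open>The homotopy from the datum to the restrictions of \<open>y'\<close>;
   \<open>descent\<close> asks for the opposite direction, which its inverse provides.\<close>
 let ?E = "\<lambda>Z a. (Y Z a, mcomp C Z (Y Z a) (msub C (va a) \<sigma>) (D Z a), tsub C (va a) y')"
 have nmo: "obm (gmap_comp C ?N (yo C ?W X y') (nerve_map C S) Z) a = tsub C (va a) y'" if "ob Z" "a \<in> NO Z" for Z a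
  using that vaN[OF that(2)] by (cases a) (auto simp: NO Hom_iff va_def)
 have "hty C ?N ?W \<omega> (res2 C ?N ?E) (gmap_comp C ?N (yo C ?W X y') (nerve_map C S))"
 proof (rule hty_res2I[OF w gmap_comp_map[OF nm(1) ym]], goal_cases)
  case (1 Z a)
  then have a: "a \<in> NO Z" by (simp add: NO)
  note V = vaN[OF a]
  have s: "mor Z (tsub C (va a) y) (msub C (va a) \<sigma>) (tsub C (va a) y')" using mor_sub[OF yval y'v y'(2) V(1,3)] V(2) by simp
  have vv: "valid Z (tsub C (va a) y)" "valid Z (tsub C (va a) y')" using valid_tsub[OF yval V(1,3)] valid_tsub[OF y'v V(1,3)] V(2) by simp_all
  have "tsub C (va a) y' \<in> U Z" using U V y'(1) by (auto simp: closedU_def)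
  moreover have "pres Z (Y Z a) (mcomp C Z (Y Z a) (msub C (va a) \<sigma>) (D Z a)) (tsub C (va a) y')" if b: b
  proof (rule pres_comp[OF Yv[OF a]])
   show "pres Z (tsub C (va a) y) (msub C (va a) \<sigma>) (tsub C (va a) y')" using pres_sub[OF yval y'v y'(2,3) V(1,3)] V(2) by simp
   obtain t where t: "tpt (Y Z a) = Some t" using YU(2)[OF a b] by auto
   then show "pres Z (Y Z a) (D Z a) (tsub C (va a) y)"
    using b p(2)[OF b a] validD(5)[OF Yv[OF a] t] V iX by (simp add: pres_def ych D_def yv)
  qed
  ultimately show ?case
   using YU[OF a] mor_comp[OF Yv[OF a] vv Dm[OF a] s] nmo[OF V(4) a] by (auto simp: Y_def)
 next
  case (2 Z \<alpha>)
  obtain a a' where al: "\<alpha> = (a, a')" by (cases \<alpha>)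
  have a: "a \<in> NO Z" "a' \<in> NO Z" "va a = va a'" using 2(2) NA by (auto simp only: al)
  note V = vaN[OF a(1)]
  have "arm (gmap_comp C ?N (yo C ?W X y') (nerve_map C S) Z) \<alpha> = Idt (sect ?W Z) (tsub C (va a) y')"
   using 2 V by (cases a) (auto simp: al Hom_iff va_def)
  moreover have "mcomp C Z (Y Z a) (mcomp C Z (Y Z a') (msub C (va a') \<sigma>) (D Z a')) (\<gamma> Z a a')
   = mcomp C Z (Y Z a) (\<lambda>h\<in>into C Z. \<lambda>x\<in>tval (tsub C (va a) y') h. x) (mcomp C Z (Y Z a) (msub C (va a) \<sigma>) (D Z a))" (is "?l = ?r")
  proof (intro ext)
   fix h x
   show "?l h x = ?r h x"
   proof (cases "h \<in> into C Z \<and> x \<in> tval (Y Z a) h")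
    case True
    then have h: "arr h" "tgt h = Z" and x: "x \<in> tval (Y Z a) h" by auto
    note g = morD(4)[OF gm[OF a] h x]
    have "d a h x \<in> tval y (cmp (va a) h)" using morD(4)[OF Dm[OF a(1)] h x] h x V by (simp add: D_def)
    then have "\<sigma> (cmp (va a) h) (d a h x) \<in> tval y' (cmp (va a) h)" using morD(4)[OF y'(2)] h V by simp
    then show ?thesis using h x g d3[OF a h x] V vaN[OF a(2)] a(3) by (simp add: D_def)
   qed (auto simp: mcomp_def restrict_def)
  qed
  ultimately show ?case using wA[OF a] a by (simp add: al)
 next
  case (3 l a)
  then have a: "a \<in> NO (tgt l)" by (simp add: NO)
  note V = vaN[OF a]
  have l: "arr l" "tgt l = tgt l" using 3 by auto
  note RR = rsI[OF a l]
  have "mcomp C (src l) (Y (src l) (rs l a)) (msub C (cmp (va a) l) \<sigma>) (D (src l) (rs l a)) = msub C l (mcomp C (tgt l) (Y (tgt l) a) (msub C (va a) \<sigma>) (D (tgt l) a))" (is "?l = ?r")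
  proof (intro ext)
   fix h x
   show "?l h x = ?r h x"
   proof (cases "h \<in> pre l")
    case True
    then have h: "arr h" "tgt h = src l" by auto
    show ?thesis
    proof (cases "x \<in> tval (Y (tgt l) a) (cmp l h)")
     case True
     then show ?thesis using h l V Yr[OF a l] d4[OF a l h] by (simp add: D_def comp_assoc)
    qed (use h l Yr[OF a l] in \<open>auto simp: mcomp_def restrict_def\<close>)
   qed (auto simp: mcomp_def msub_def restrict_def)
  qed
  then show ?case using RR Yr[OF a l] tsub_Comp[OF y'v l(1) V(1)] V l by (simp add: rsN)
 qed
 from hty_inv[OF this] yo show "\<exists>x \<in> Obj (sect ?W X). \<exists>\<delta>. hty C ?N ?W (gmap_comp C ?N (yo C ?W X x) (nerve_map C S)) \<delta> \<omega>" by blast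
qed

section \<open>Induced objects and the size of the stack\<close>

text \<open>The sheaf \<open>m\<^sup>*G\<close> with its identity charts and a prescribed optional
  point.\<close>

definition std :: "'o => 'u => 'u option => ('a, 'u) tors" where
 "std X m t = \<lparr>tval = (\<lambda>h. if h \<in> into C X then gv m h else {}),
  tres = (\<lambda>h. if h \<in> into C X then grs m h else undefined),
  tcht = (\<lambda>h. (h, rO h m, \<lambda>k \<in> pre h. \<lambda>x. x)) ` into C X, tpt = t\<rparr>"

lemma std_simps [simp]:
 "[|arr h; tgt h = X|] ==> tval (std X m t) h = gv m h"
 "[|arr h; tgt h = X|] ==> tres (std X m t) h = grs m h"
 "(h, m', \<phi>) \<in> tcht (std X m t) \<longleftrightarrow> arr h \<and> tgt h = X \<and> m' = rO h m \<and> \<phi> = (\<lambda>k \<in> pre h. \<lambda>x. x)"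
 "tpt (std X m t) = t"
 by (auto simp: std_def)

lemma shf_cong:
 assumes S: "shf C Cov (into C X) v r" and e: "!!h. [|arr h; tgt h = X|] ==> v' h = v h \<and> r' h = r h"
 shows "shf C Cov (into C X) v' r'"
 unfolding shf_def
proof (intro conjI ballI allI impI)
 show "pshf C (into C X) v' r'" using shf_pshf[OF S] e unfolding pshf_def by simp
 fix h P x assume h: "h \<in> into C X" and a: "cs (src h) P \<and> (\<forall>u\<in>P. x u \<in> v' (cmp h u)) \<and>
  (\<forall>u\<in>P. \<forall>k\<in>pre u. x (cmp u k) = r' (cmp h u) k (x u))"
 have "v' (cmp h u) = v (cmp h u) \<and> r' (cmp h u) = r (cmp h u)" if "u \<in> P" for u
  using csvD(2,3)[of C Cov "src h" P u] a h that by (simp add: e)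
 then show "\<exists>!y. y \<in> v' h \<and> (\<forall>u\<in>P. r' h u y = x u)" using S h a e[of h] unfolding shf_def by simp
qed

lemma std_valid:
 assumes X: "ob X" and m: "m \<in> OM X" and t: "!!x. t = Some x ==> x \<in> at G (X, m)"
 shows "valid X (std X m t)"
 unfolding valid_def
proof (intro conjI allI impI)
 note [simp] = Ms
 show "shf C Cov (into C X) (tval (std X m t)) (tres (std X m t))"
  by (rule shf_cong[OF G_shf[OF X m]]) simp
 show "cs X {h \<in> into C X. \<exists>m' \<phi>. (h, m', \<phi>) \<in> tcht (std X m t)}" using cs_into[OF X] by (rule cs_mono) auto
 fix h m1 \<phi>1 m2 \<phi>2
 { assume c: "(h, m1, \<phi>1) \<in> tcht (std X m t) \<and> (h, m2, \<phi>2) \<in> tcht (std X m t)"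
  show "rel (src h) m1 \<phi>1 m2 \<phi>2 (\<lambda>_ z. z)"
   using c m by (auto intro!: rel_refl) }
 assume c: "(h, m1, \<phi>1) \<in> tcht (std X m t)"
 then have h: "arr h" "tgt h = X" "m1 = rO h m" "\<phi>1 = (\<lambda>k \<in> pre h. \<lambda>x. x)" by auto
 show "h \<in> into C X" "m1 \<in> Obj (MD h)" using h m by auto
 show "\<forall>k \<in> pre h. (cmp h k, rO k m1, \<lambda>l \<in> pre k. \<phi>1 (cmp k l)) \<in> tcht (std X m t)"
  using h m by (auto simp: fun_eq_iff restrict_def)
 show "\<forall>k \<in> pre h. bij_betw (\<phi>1 k) (gv m1 k) (tval (std X m t) (cmp h k)) \<and>
    (\<forall>x \<in> gv m1 k. \<forall>l \<in> pre k. \<phi>1 (cmp k l) (rG l (rO k m1) x) = tres (std X m t) (cmp h k) l (\<phi>1 k x))"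
  using h m by (auto simp: bij_betw_def)
qed (use X m t Ms in \<open>auto simp: std_def\<close>)

text \<open>An equality and not merely an isomorphism, so that sending \<open>m\<close> to the sheaf
  induced by it is a strict map of presheaves.\<close>

lemma tsub_std:
 assumes f: "arr f" and m: "m \<in> OM (tgt f)"
 shows "tsub C f (std (tgt f) m t) = std (src f) (rO f m) (map_option (rG f m) t)"
proof -
 note [simp] = Ms
 have "tcht (tsub C f (std (tgt f) m t)) = tcht (std (src f) (rO f m) (map_option (rG f m) t))"
 proof -
  have "(h, n, \<phi>) \<in> tcht (tsub C f (std (tgt f) m t)) \<longleftrightarrow> (h, n, \<phi>) \<in> tcht (std (src f) (rO f m) (map_option (rG f m) t))" for h n \<phi>
   using f m by auto
  then show ?thesis by (simp only: set_eq_iff split_paired_All simp_thms)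
 qed
 moreover have "tval (tsub C f (std (tgt f) m t)) = tval (std (src f) (rO f m) (map_option (rG f m) t))"
  "tres (tsub C f (std (tgt f) m t)) = tres (std (src f) (rO f m) (map_option (rG f m) t))"
  "tpt (tsub C f (std (tgt f) m t)) = tpt (std (src f) (rO f m) (map_option (rG f m) t))"
  using f m by (auto simp: tsub_def std_def fun_eq_iff)
 ultimately show ?thesis by simp
qed

text \<open>\<open>ch y r\<close> is a chosen chart of \<open>y\<close> over \<open>r\<close>; \<open>tc m \<phi> m' \<phi>' s u\<close> is a chosen transition isomorphism.
 The code of \<open>y\<close> records the objects of the chosen charts, the transitions between them and the
 coordinates of the point: these determine \<open>y\<close> up to isomorphism.\<close>

definition cdm :: "('a, 'u) tors => 'a set" where "cdm y = {r. \<exists>m \<phi>. (r, m, \<phi>) \<in> tcht y}"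

definition ch :: "('a, 'u) tors => 'a => 'u \<times> ('a => 'u => 'u)" where
 "ch y r = (SOME c. (r, fst c, snd c) \<in> tcht y)"

abbreviation "cm y r \<equiv> fst (ch y r)"
abbreviation "cf y r \<equiv> snd (ch y r)"

lemma ch: "r \<in> cdm y ==> (r, cm y r, cf y r) \<in> tcht y"
 unfolding ch_def cdm_def by (rule someI_ex) auto

definition tc :: "'u => ('a => 'u => 'u) => 'u => ('a => 'u => 'u) => ('a => 'u => 'u) => 'a => 'u option" where
 "tc m \<phi> m' \<phi>' s u = (if \<exists>\<alpha>. crel m \<phi> m' \<phi>' s u \<alpha> then Some (SOME \<alpha>. crel m \<phi> m' \<phi>' s u \<alpha>) else None)"

lemma tcD: "tc m \<phi> m' \<phi>' s u = Some \<alpha> ==> crel m \<phi> m' \<phi>' s u \<alpha>"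
 unfolding tc_def by (auto split: if_splits intro: someI)

lemma tc_crs: "u \<in> crs Y m \<phi> m' \<phi>' s ==> \<exists>\<alpha>. tc m \<phi> m' \<phi>' s u = Some \<alpha>"
 unfolding crs_def tc_def by auto

definition ocode :: "'o => ('a, 'u) tors => 'a => ('u option \<times> 'u option option) \<times> ('a => 'a => 'u option)" where
 "ocode X y = (\<lambda>r \<in> Arr C. ((if r \<in> cdm y then Some (cm y r) else None,
   map_option (\<lambda>t. if r \<in> cdm y then Some (inv_into (at G (src r, cm y r)) (cf y r (Idt C (src r))) (tres y (Idt C X) r t)) else None) (tpt y)),
  \<lambda>k \<in> Arr C. \<lambda>u \<in> Arr C. tc (rO k (cm y r)) (\<lambda>l. cf y r (cmp k l)) (cm y (cmp r k)) (cf y (cmp r k)) (\<lambda>_ z. z) u))"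

definition mcode :: "('a, 'u) tors => ('a => 'u => 'u) => ('a, 'u) tors => 'a => 'a => 'u option" where
 "mcode y \<sigma> y' = (\<lambda>r \<in> Arr C. \<lambda>u \<in> Arr C. tc (cm y r) (cf y r) (cm y' r) (cf y' r) (\<lambda>k. \<sigma> (cmp r k)) u)"

lemma cdm_cs: "valid X y ==> cs X (cdm y)"
proof -
 assume y: "valid X y"
 have "cdm y = {h \<in> into C X. \<exists>m \<phi>. (h, m, \<phi>) \<in> tcht y}" using chartD(1,2)[OF y] by (auto simp: cdm_def)
 then show ?thesis using validD(4)[OF y] by simp
qed

text \<open>Over a common chart domain, a transition isomorphism between the chosen charts
  determines the morphism wherever it exists. The same choices of transitions thus force two
  morphisms to agree on a covering sieve.\<close>

lemma mcode_inj:
 assumes y: "valid X y" "valid X y'" and s: "mor X y \<sigma> y'" "mor X y \<tau> y'" and e: "mcode y \<sigma> y' = mcode y \<tau> y'"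
 shows "\<sigma> = \<tau>"
proof -
 note [simp] = Ms
 define Q where "Q = {h \<in> into C X. \<forall>k \<in> pre h. \<forall>x \<in> tval y (cmp h k). \<sigma> (cmp h k) x = \<tau> (cmp h k) x}"
 note P = cs_Int[OF cdm_cs[OF y(1)] cdm_cs[OF y(2)]]
 have "cs X Q"
 proof (rule cs_trans[OF P])
  fix r assume r: "r \<in> cdm y \<inter> cdm y'"
  then have r1: "(r, cm y r, cf y r) \<in> tcht y" and r2: "(r, cm y' r, cf y' r) \<in> tcht y'" using ch by auto
  note c1 = chartD[OF y(1) r1] and c2 = chartD[OF y(2) r2]
  note rr = morD(3)[OF s(1) r1 r2]
  show "cs (src r) {k \<in> pre r. cmp r k \<in> Q}"
  proof (rule cs_mono[OF rr]; (intro subsetI)?)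
   fix u assume u: "u \<in> crs (src r) (cm y r) (cf y r) (cm y' r) (cf y' r) (\<lambda>k. \<sigma> (cmp r k))"
   then have u': "arr u" "tgt u = src r" by (auto simp: crs_def)
   obtain \<alpha> where \<alpha>: "tc (cm y r) (cf y r) (cm y' r) (cf y' r) (\<lambda>k. \<sigma> (cmp r k)) u = Some \<alpha>"
    using tc_crs[OF u] by blast
   then have "tc (cm y r) (cf y r) (cm y' r) (cf y' r) (\<lambda>k. \<tau> (cmp r k)) u = Some \<alpha>"
    using fun_cong[OF fun_cong[OF e, of r], of u] u' c1 by (simp add: mcode_def)
   note A = tcD[OF \<alpha>, unfolded crel_def] and B = tcD[OF this, unfolded crel_def]
   have "\<sigma> (cmp r (cmp u k)) x = \<tau> (cmp r (cmp u k)) x"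
    if k: "arr k" "tgt k = src u" and x: "x \<in> tval y (cmp r (cmp u k))" for k x
   proof -
    have "bij_betw (cf y r (cmp u k)) (at G (src k, rO k (rO u (cm y r)))) (tval y (cmp r (cmp u k)))"
     using c1(4)[of "cmp u k"] k u' c1 by simp
    then obtain z where z: "z \<in> at G (src k, rO k (rO u (cm y r)))" "x = cf y r (cmp u k) z"
     using x by (auto simp: bij_betw_def)
    have a: "rA k \<alpha> \<in> Arr (MD k)" "Dom (MD k) (rA k \<alpha>) = rO k (rO u (cm y r))"
     "Cod (MD k) (rA k \<alpha>) = rO k (rO u (cm y' r))" using A k by auto
    \<comment> \<open>The coordinate in the second chart that corresponds to \<open>z\<close>; the
      equations in \<open>A\<close> and \<open>B\<close> at \<open>w\<close> give both values at
      \<open>x\<close>.\<close>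
    define w where "w = aG (src k) (ginv (MD k) (rA k \<alpha>)) z"
    have "w \<in> at G (src k, rO k (rO u (cm y' r)))"
     using ga_in[of "src k" "ginv (MD k) (rA k \<alpha>)" z] a z k by (simp add: w_def)
    moreover have "aG (src k) (rA k \<alpha>) w = z" using ga_inv(2)[of "src k" "rA k \<alpha>" z] a z k by (simp add: w_def)
    ultimately show ?thesis using A B k z by (metis into_iff)
   qed
   then show "u \<in> {k \<in> pre r. cmp r k \<in> Q}" using u' c1 by (auto simp: Q_def comp_assoc)
  qed (use c1 in \<open>auto simp: Q_def comp_assoc\<close>)
 qed (auto simp: Q_def comp_assoc)
 then show ?thesis
 proof (rule mor_sep[OF y _ s])
  fix u x assume u: "u \<in> Q" and x: "x \<in> tval y u"
  then have "Idt C (src u) \<in> pre u" by (simp add: Q_def)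
  with u have "\<forall>x \<in> tval y (cmp u (Idt C (src u))). \<sigma> (cmp u (Idt C (src u))) x = \<tau> (cmp u (Idt C (src u))) x"
   unfolding Q_def by blast
  then show "\<sigma> u x = \<tau> u x" using u x by (simp add: Q_def)
 qed
qed

text \<open>Equal codes mean chosen charts over the same arrows with the same objects of
  \<open>M\<close>, so over each such arrow the coordinates give a bijection. Equal transitions make
  these bijections natural, and they glue to the isomorphism.\<close>

lemma ocode_iso:
 assumes y: "valid X y" "valid X y'" and e: "ocode X y = ocode X y'"
 shows "\<exists>\<sigma>. mor X y \<sigma> y' \<and> pres X y \<sigma> y'"
proof -
 note [simp] = Ms
 note v = validD[OF y(1)] and v' = validD[OF y(2)]
 note P = cdm_cs[OF y(1)]
 have er: "ocode X y r = ocode X y' r" for r using e by simp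
 have Pa: "arr r" "tgt r = X" if "r \<in> cdm y \<or> r \<in> cdm y'" for r
  using that csvD(2,3)[OF cdm_cs[OF y(1)]] csvD(2,3)[OF cdm_cs[OF y(2)]] by auto
 have ex: "r \<in> cdm y \<longleftrightarrow> r \<in> cdm y'" and em: "r \<in> cdm y ==> cm y' r = cm y r" for r
  using er[of r] Pa[of r] by (auto simp: ocode_def split: if_splits)
 have et: "tc (rO k (cm y r)) (\<lambda>l. cf y r (cmp k l)) (cm y (cmp r k)) (cf y (cmp r k)) (\<lambda>_ z. z) u
   = tc (rO k (cm y' r)) (\<lambda>l. cf y' r (cmp k l)) (cm y' (cmp r k)) (cf y' (cmp r k)) (\<lambda>_ z. z) u"
  if "r \<in> cdm y" "arr k" "arr u" for r k u
  using fun_cong[OF fun_cong[OF arg_cong[OF er[of r], of snd]], of k u] Pa that by (simp add: ocode_def)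
 let ?i = "\<lambda>r. Idt C (src r)"
 have c: "(r, cm y r, cf y r) \<in> tcht y" "(r, cm y r, cf y' r) \<in> tcht y'" if "r \<in> cdm y" for r
  using ch[OF that] ch[of r y'] that ex[of r] em[OF that] by auto
 note C1 = chartD[OF y(1) c(1)] and C2 = chartD[OF y(2) c(2)]
 have Pk: "cmp r k \<in> cdm y" if "r \<in> cdm y" "arr k" "tgt k = src r" for r k
  using csvD(4)[OF P] that by auto
 \<comment> \<open>The change of coordinates: from \<open>y\<close> to \<open>G\<close> by its
   chosen chart, and on to \<open>y'\<close> by the chart of \<open>y'\<close> over the same
   arrow.\<close>
 define \<sigma> where "\<sigma> r z = cf y' r (?i r) (inv_into (at G (src r, cm y r)) (cf y r (?i r)) z)" for r z
 have bi: "bij_betw (cf y r (?i r)) (at G (src r, cm y r)) (tval y r)" "bij_betw (cf y' r (?i r)) (at G (src r, cm y r)) (tval y' r)" if "r \<in> cdm y" for r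
  using C1(4)[OF that, of "?i r"] C2(4)[OF that, of "?i r"] C1(1,3)[OF that] by simp_all
 \<comment> \<open>The crucial compatibility: \<open>\<sigma>\<close> is defined by the chart chosen
   over \<open>cmp r k\<close>, but takes the restriction of the chart over \<open>r\<close> to its
   counterpart as well.\<close>
 have s1: "\<sigma> (cmp r k) (cf y r k x) = cf y' r k x"
  if r: "r \<in> cdm y" and k: "arr k" "tgt k = src r" and x: "x \<in> gv (cm y r) k" for r k x
 proof -
  note R = C1(1-3)[OF r] and rk = Pk[OF r k]
  note D1 = C1[OF rk] and D2 = C2[OF rk]
  have d: "src (cmp r k) = src k" using R k by simp
  have mk: "rO k (cm y r) \<in> Obj (MD k)" "cm y (cmp r k) \<in> Obj (MD k)" using R k D1 d by simp_all
  have q: "cf y r k x \<in> tval y (cmp r k)" "cf y' r k x \<in> tval y' (cmp r k)"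
   using chart_in[OF y(1) c(1)[OF r] k x] chart_in[OF y(2) c(2)[OF r] k x] by simp_all
  obtain w where w: "w \<in> at G (src k, cm y (cmp r k))" "cf y (cmp r k) (Idt C (src k)) w = cf y r k x"
   using q(1) bij_betw_imp_surj_on[OF bi(1)[OF rk], symmetric] unfolding d by auto
  have sw: "\<sigma> (cmp r k) (cf y r k x) = cf y' (cmp r k) (Idt C (src k)) w"
   using bi(1)[OF rk] w unfolding \<sigma>_def d by (simp flip: w(2) add: bij_betw_def)
  have ww: "w \<in> at G (src (Idt C (src k)), rO (Idt C (src k)) (cm y (cmp r k)))" using w mk k by simp
  have rl: "rel (src (cmp r k)) (rO k (cm y r)) (\<lambda>l\<in>pre k. cf y r (cmp k l)) (cm y (cmp r k)) (cf y (cmp r k)) (\<lambda>_ z. z)"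
   by (rule v(3)[OF C1(6)[OF r k] c(1)[OF rk]])
  have rl: "rel (src k) (rO k (cm y r)) (\<lambda>l. cf y r (cmp k l)) (cm y (cmp r k)) (cf y (cmp r k)) (\<lambda>_ z. z)"
   by (rule rel_map[OF mk rl[unfolded d]]) simp
  have "cf y' (cmp r k) (Idt C (src k)) w = cf y' r k x"
  proof (rule shf_sep[OF v'(1) _ _ _ q(2)])
   show "cs (src (cmp r k)) (crs (src k) (rO k (cm y r)) (\<lambda>l. cf y r (cmp k l)) (cm y (cmp r k)) (cf y (cmp r k)) (\<lambda>_ z. z))"
    using rl d by simp
   show "cmp r k \<in> into C X" using R k by simp
   show "cf y' (cmp r k) (Idt C (src k)) w \<in> tval y' (cmp r k)" using bi(2)[OF rk] w(1) d by (auto simp: bij_betw_def)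
   fix u assume u: "u \<in> crs (src k) (rO k (cm y r)) (\<lambda>l. cf y r (cmp k l)) (cm y (cmp r k)) (cf y (cmp r k)) (\<lambda>_ z. z)"
   then have u': "arr u" "tgt u = src k" by (auto simp: crs_def)
   obtain \<alpha> where \<alpha>: "tc (rO k (cm y r)) (\<lambda>l. cf y r (cmp k l)) (cm y (cmp r k)) (cf y (cmp r k)) (\<lambda>_ z. z) u = Some \<alpha>"
    using tc_crs[OF u] by blast
   note A = tcD[OF \<alpha>, unfolded crel_def]
   \<comment> \<open>The transition \<open>\<alpha>\<close> from the restricted chart to the chosen
     one is the same for \<open>y\<close> and \<open>y'\<close>; both coordinate changes are
     therefore the action of this one \<open>\<alpha>\<close>.\<close>
   note B = tcD[OF \<alpha>[unfolded et[OF r k(1) u'(1)]], unfolded crel_def em[OF r] em[OF rk]]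
   have a: "\<alpha> \<in> Arr (MD u)" "Dom (MD u) \<alpha> = rO u (rO k (cm y r))"
    "Cod (MD u) \<alpha> = rO u (cm y (cmp r k))" using A by auto
   define w' where "w' = rG u (cm y (cmp r k)) w"
   define x' where "x' = rG u (rO k (cm y r)) x"
   have w': "w' \<in> at G (src u, rO u (cm y (cmp r k)))"
    using gr_in[of u "cm y (cmp r k)" w] u' mk w by (simp add: w'_def)
   have x': "x' \<in> at G (src (cmp k u), rO (cmp k u) (cm y r))"
    using gr_in[of u "rO k (cm y r)" x] u' mk x k R by (simp add: x'_def)
   have aw: "aG (src u) \<alpha> w' \<in> at G (src (cmp k u), rO (cmp k u) (cm y r))"
    using ga_in[of "src u" \<alpha> w'] a w' u' k R by simp
   have I: "Idt C (src u) \<in> pre u" "src (Idt C (src u)) = src u" using u' by simp_all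
   have "w' \<in> at G (src (Idt C (src u)), rO (Idt C (src u)) (rO u (cm y (cmp r k))))" using w' u' mk by simp
   then have cr: "cf y (cmp r k) u w' = cf y r (cmp k u) (aG (src u) \<alpha> w')"
     "cf y' (cmp r k) u w' = cf y' r (cmp k u) (aG (src u) \<alpha> w')"
    using A B I u' a by (auto dest!: bspec[OF _ I(1)])
   have n1: "cf y (cmp r k) u w' = tres y (cmp r k) u (cf y r k x)" "cf y' (cmp r k) u w' = tres y' (cmp r k) u (cf y' (cmp r k) (Idt C (src k)) w)"
    using D1(5)[of "Idt C (src k)", OF _ _ ww, of u] D2(5)[of "Idt C (src k)", OF _ _ ww, of u] u' k mk w d R by (simp_all add: w'_def)
   have n2: "cf y r (cmp k u) x' = tres y (cmp r k) u (cf y r k x)" "cf y' r (cmp k u) x' = tres y' (cmp r k) u (cf y' r k x)"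
    using C1(5)[OF r k x, of u] C2(5)[OF r k x, of u] u' k by (simp_all add: x'_def)
   have "bij_betw (cf y r (cmp k u)) (at G (src (cmp k u), rO (cmp k u) (cm y r))) (tval y (cmp r (cmp k u)))"
    using C1(4)[OF r, of "cmp k u"] u' k by simp
   then have "aG (src u) \<alpha> w' = x'" using cr(1) n1(1) n2(1) aw x' by (metis bij_betw_imp_inj_on inj_onD)
   then show "tres y' (cmp r k) u (cf y' (cmp r k) (Idt C (src k)) w) = tres y' (cmp r k) u (cf y' r k x)"
    using cr(2) n1(2) n2(2) by simp
  qed
  then show ?thesis using sw by simp
 qed
 have sb: "bij_betw (\<sigma> r) (tval y r) (tval y' r)" if "r \<in> cdm y" for r
  using bij_betw_trans[OF bij_betw_inv_into[OF bi(1)[OF that]] bi(2)[OF that]] unfolding \<sigma>_def[abs_def] comp_def .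
 have "natm C (cdm y) (tval y) (tres y) (tval y') (tres y') \<sigma>"
  unfolding natm_def
 proof (intro ballI conjI)
  fix r z assume r: "r \<in> cdm y" and z: "z \<in> tval y r"
  show "\<sigma> r z \<in> tval y' r" using sb[OF r] z by (auto simp: bij_betw_def)
  obtain x where x: "x \<in> at G (src r, cm y r)" "z = cf y r (?i r) x" using z bi(1)[OF r] by (auto simp: bij_betw_def)
  note R = C1(1-3)[OF r]
  have xi: "x \<in> at G (src (?i r), rO (?i r) (cm y r))" using x R by simp
  fix k assume "k \<in> pre r"
  then have k: "arr k" "tgt k = src r" by auto
  have xk: "rG k (cm y r) x \<in> gv (cm y r) k" using gr_in[of k "cm y r" x] x k R by simp
  have n: "tres y r k z = cf y r k (rG k (cm y r) x)" "tres y' r k (cf y' r (?i r) x) = cf y' r k (rG k (cm y r) x)"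
   using C1(5)[OF r _ _ xi, of k] C2(5)[OF r _ _ xi, of k] k R x by simp_all
  have "\<sigma> r z = cf y' r (?i r) x" using s1[OF r _ _ xi] x R by simp
  then show "\<sigma> (cmp r k) (tres y r k z) = tres y' r k (\<sigma> r z)" using n s1[OF r k xk] by simp
 qed
 from hom_glue[OF v(2) shf_pshf[OF v(1)] v'(1) P this] obtain \<Sigma> where
  S: "natm C (into C X) (tval y) (tres y) (tval y') (tres y') \<Sigma>" "!!h x. h \<in> cdm y ==> x \<in> tval y h ==> \<Sigma> h x = \<sigma> h x" by blast
 have b: "bij_betw (\<Sigma> h) (tval y h) (tval y' h)" if "h \<in> into C X" for h
 proof (rule loc_bij[OF v(1) v'(1) P S(1) _ that])
  show "bij_betw (\<Sigma> h) (tval y h) (tval y' h)" if "h \<in> cdm y" for h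
   using sb[OF that] S(2)[OF that] by (simp cong: bij_betw_cong)
 qed
 have m: "mor X y (\<lambda>h\<in>into C X. \<lambda>x\<in>tval y h. \<Sigma> h x) y'"
 proof (rule morI_restrict[OF S(1) y])
  fix h m \<phi> m' \<phi>' assume h: "(h, m, \<phi>) \<in> tcht y" "(h, m', \<phi>') \<in> tcht y'"
  note H1 = chartD[OF y(1) h(1)] and H2 = chartD[OF y(2) h(2)]
  have hd: "h \<in> cdm y" using h by (auto simp: cdm_def)
  note R = C1(3)[OF hd]
  \<comment> \<open>An arbitrary pair of charts is compared by way of the chosen ones: inside
    \<open>y\<close>, across by \<open>\<Sigma>\<close>, inside \<open>y'\<close>.\<close>
  have 1: "rel (src h) m \<phi> (cm y h) (cf y h) (\<lambda>_ z. z)" by (rule v(3)[OF h(1) c(1)[OF hd]])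
  have 2: "rel (src h) (cm y h) (cf y' h) m' \<phi>' (\<lambda>_ z. z)" by (rule v'(3)[OF c(2)[OF hd] h(2)])
  have ss: "\<Sigma> (cmp h k) (cf y h k x) = cf y' h k x" if "arr k" "tgt k = src h" "x \<in> gv (cm y h) k" for k x
   using s1[OF hd that] S(2)[OF Pk[OF hd that(1,2)] chart_in[OF y(1) c(1)[OF hd] that]] by simp
  have 3: "rel (src h) (cm y h) (cf y h) (cm y h) (cf y' h) (\<lambda>k. \<Sigma> (cmp h k))"
   by (rule rel_refl[OF _ R]) (use H1 ss in simp_all)
  have 4: "rel (src h) m \<phi> (cm y h) (cf y' h) (\<lambda>k. \<Sigma> (cmp h k))"
   by (rule rel_trans[OF H1(3) R R 1 3]) simp
  show "rel (src h) m \<phi> m' \<phi>' (\<lambda>k. \<Sigma> (cmp h k))"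
   by (rule rel_trans[OF H1(3) R H2(3) 4 2]) simp
 qed (use b in simp)
 have "pres X y (\<lambda>h\<in>into C X. \<lambda>x\<in>tval y h. \<Sigma> h x) y'"
 proof (cases "tpt y")
  case None
  then have "tpt y' = None" using er[of "Idt C X"] v(2) by (simp add: ocode_def)
  then show ?thesis using None by (simp add: pres_def)
 next
  case (Some t)
  then obtain t' where t': "tpt y' = Some t'" using er[of "Idt C X"] v(2) by (cases "tpt y'") (auto simp: ocode_def)
  note T = v(5)[OF Some] and T' = v'(5)[OF t']
  note I = pshfD[OF shf_pshf[OF v(1)], of "Idt C X", OF _ T] and I' = pshfD[OF shf_pshf[OF v'(1)], of "Idt C X", OF _ T']
  have iX: "Idt C X \<in> into C X" using v(2) by simp
  have "\<Sigma> (Idt C X) t = t'"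
  proof (rule shf_sep[OF v'(1) iX _ _ T', of "cdm y"])
   show "cs (src (Idt C X)) (cdm y)" using P v(2) by simp
   show "\<Sigma> (Idt C X) t \<in> tval y' (Idt C X)" by (rule natmD(1)[OF S(1) iX T])
   fix r assume r: "r \<in> cdm y"
   note ra = C1(1,2)[OF r]
   have r2: "tres y (Idt C X) r t \<in> tval y r" "tres y' (Idt C X) r t' \<in> tval y' r" using I(2)[of r] I'(2)[of r] iX ra v(2) by simp_all
   have ep: "inv_into (at G (src r, cm y r)) (cf y r (?i r)) (tres y (Idt C X) r t) = inv_into (at G (src r, cm y r)) (cf y' r (?i r)) (tres y' (Idt C X) r t')"
    using er[of r] ra r ex[of r] em[OF r] Some t' by (simp add: ocode_def)
   have "tres y' (Idt C X) r (\<Sigma> (Idt C X) t) = \<Sigma> r (tres y (Idt C X) r t)"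
    using natmD(2)[OF S(1) iX T, of r] ra v(2) by simp
   also have "\<dots> = \<sigma> r (tres y (Idt C X) r t)" by (rule S(2)[OF r r2(1)])
   also have "\<dots> = tres y' (Idt C X) r t'" unfolding \<sigma>_def ep by (rule bij_betw_inv_into_right[OF bi(2)[OF r] r2(2)])
   finally show "tres y' (Idt C X) r (\<Sigma> (Idt C X) t) = tres y' (Idt C X) r t'" .
  qed
  then show ?thesis using Some t' iX T by (simp add: pres_def)
 qed
 with m show ?thesis by blast
qed

text \<open>The induced objects are included literally, since the maps out of presheaves over
  \<open>M\<close> take them as values; one representative per code makes every valid object
  isomorphic to a member. Restrictions along all arrows \<open>h\<close> are added to obtain closure
  under \<open>tsub\<close>.\<close>

definition UU :: "'o => ('a, 'u) tors set" where
 "UU X = (\<lambda>(h, m, t). tsub C h (std (tgt h) m t)) `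
   {(h, m, t). arr h \<and> src h = X \<and> m \<in> OM (tgt h) \<and> (\<forall>x. t = Some x --> x \<in> at G (tgt h, m))} \<union>
  (\<lambda>(h, c). tsub C h (SOME y. valid (tgt h) y \<and> ocode (tgt h) y = c)) `
   {(h, c). arr h \<and> src h = X \<and> (\<exists>y. valid (tgt h) y \<and> ocode (tgt h) y = c)}"

lemma UU_I1: "[|arr h; m \<in> OM (tgt h); !!x. t = Some x ==> x \<in> at G (tgt h, m)|]
 ==> tsub C h (std (tgt h) m t) \<in> UU (src h)"
 unfolding UU_def by (rule UnI1, rule image_eqI[of _ _ "(h, m, t)"]) auto

lemma UU_I2: "[|arr h; valid (tgt h) y|]
 ==> tsub C h (SOME z. valid (tgt h) z \<and> ocode (tgt h) z = ocode (tgt h) y) \<in> UU (src h)"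
 unfolding UU_def by (rule UnI2, rule image_eqI[of _ _ "(h, ocode (tgt h) y)"]) auto

lemma UU_cases:
 assumes "y \<in> UU X"
 obtains h z where "arr h" "src h = X" "valid (tgt h) z" "y = tsub C h z" "!!f. arr f ==> tgt f = tgt h ==> tsub C f z \<in> UU (src f)"
 using assms[unfolded UU_def]
proof (elim UnE imageE, goal_cases)
 case (1 w)
 then obtain h m t where w: "w = (h, m, t)" by (cases w)
 show ?case
 proof (rule 1(1)[of h "std (tgt h) m t"])
  fix f assume "arr f" "tgt f = tgt h"
  then show "tsub C f (std (tgt h) m t) \<in> UU (src f)" using 1(3) w UU_I1[of f m t] by auto
 qed (use 1(2,3) w std_valid in auto)
next
 case (2 w)
 then obtain h c where w: "w = (h, c)" by (cases w)
 let ?z = "SOME y. valid (tgt h) y \<and> ocode (tgt h) y = c"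
 have "\<exists>y. valid (tgt h) y \<and> ocode (tgt h) y = c" using 2 w by auto
 note z = someI_ex[OF this]
 show ?case
 proof (rule 2(1)[of h ?z])
  fix f assume "arr f" "tgt f = tgt h"
  then show "tsub C f ?z \<in> UU (src f)" using z UU_I2[of f ?z] by simp
 qed (use 2(2,3) w z in auto)
qed

lemma UU_closed: "closedU UU"
 unfolding closedU_def
proof (intro conjI ballI)
 fix X y assume "y \<in> UU X"
 then show "valid X y" by (cases rule: UU_cases) (use valid_tsub in auto)
next
 fix f y assume f: "arr f" and y: "y \<in> UU (tgt f)"
 from y show "tsub C f y \<in> UU (src f)"
 proof (cases rule: UU_cases)
  case (1 h z)
  then show ?thesis using f tsub_Comp[OF 1(3) f 1(1)] 1(5)[of "cmp h f"] by simp
 qed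
qed

lemma UU_std:
 assumes "ob X" "m \<in> OM X" "!!x. t = Some x ==> x \<in> at G (X, m)"
 shows "std X m t \<in> UU X"
proof -
 show ?thesis using UU_I1[of "Idt C X" m t] tsub_Idt[OF std_valid[OF assms]] assms by simp
qed

lemma UU_ess:
 assumes y: "valid X y"
 shows "\<exists>y' \<in> UU X. \<exists>\<sigma>. mor X y \<sigma> y' \<and> pres X y \<sigma> y'"
proof -
 let ?z = "SOME z. valid X z \<and> ocode X z = ocode X y"
 have z: "valid X ?z \<and> ocode X ?z = ocode X y" by (rule someI[of _ y]) (use y in simp)
 then have "?z \<in> UU X" using UU_I2[of "Idt C X" y] tsub_Idt[of X ?z] y validD(2)[OF y] by simp
 then show ?thesis using ocode_iso[OF y, of ?z] z by auto
qed

text \<open>Members are indexed by an arrow with an element of \<open>M\<close> and an optional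
  point, or by an arrow with a code; codes are families over \<open>Arr C\<close> with values in
  \<open>'u\<close> up to options.\<close>

lemma lepoll_UU: "UU X \<lesssim> (UNIV :: 'u set)"
proof -
 note o = lepoll_option[OF lepoll_refl, folded UNIV_option_conv]
 note o = o lepoll_option[OF o, folded UNIV_option_conv]
 let ?K = "Arr C \<rightarrow>\<^sub>E ((UNIV :: 'u option set) \<times> (UNIV :: 'u option option set)) \<times> (Arr C \<rightarrow>\<^sub>E Arr C \<rightarrow>\<^sub>E (UNIV :: 'u option set))"
 have "?K \<lesssim> (UNIV :: 'u set)"
  by (intro lepoll_fun lepoll_Times o)
 then have 1: "Arr C \<times> ?K \<lesssim> (UNIV :: 'u set)" by (intro lepoll_Times lepoll_Arr)
 have 2: "Arr C \<times> (UNIV :: 'u set) \<times> (UNIV :: 'u option set) \<lesssim> (UNIV :: 'u set)" by (intro lepoll_Times lepoll_Arr lepoll_refl o)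
 have "ocode Z y \<in> ?K" for Z y unfolding ocode_def by auto
 then show ?thesis unfolding UU_def
  by (intro lepoll_Un[OF lepoll_image[OF 2 image_mono] lepoll_image[OF 1 image_mono]]) (auto simp del: PiE_iff)
qed

text \<open>Smallness of objects and of arrows, the latter by \<open>mcode\<close>, yields a copy in
  \<open>'u\<close>. The stack conditions hold for \<open>WW\<close> itself, and the resulting
  equivalences are transferred to the copy.\<close>

lemma WW_coded:
 obtains W' :: "('o, 'a, 'u) ugpsh" and \<kappa> \<kappa>' where "giso C (WW b UU) W' \<kappa> \<kappa>'" "local_object C Cov W'"
proof -
 have p: "Obj (sect (WW b UU) X) \<lesssim> (UNIV :: 'u set)" for X
  using lepoll_UU[of X] by (rule lepoll_trans[rotated]) (auto intro!: subset_imp_lepoll)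
 have q: "Arr (sect (WW b UU) X) \<lesssim> (UNIV :: 'u set)" if X: "ob X" for X
 proof (rule lepoll_inj)
  have v: "valid X y" if "y \<in> UU X" for y using UU_closed X that by (auto simp: closedU_def)
  show "inj_on (\<lambda>(y, \<sigma>, y'). ((y, y'), mcode y \<sigma> y')) (Arr (sect (WW b UU) X))"
   by (auto intro!: inj_onI dest: mcode_inj[OF v v])
  show "(\<lambda>(y, \<sigma>, y'). ((y, y'), mcode y \<sigma> y')) ` Arr (sect (WW b UU) X) \<subseteq> (UU X \<times> UU X) \<times> (Arr C \<rightarrow>\<^sub>E Arr C \<rightarrow>\<^sub>E (UNIV :: 'u option set))"
   by (auto simp: mcode_def)
  show "(UU X \<times> UU X) \<times> (Arr C \<rightarrow>\<^sub>E Arr C \<rightarrow>\<^sub>E (UNIV :: 'u option set)) \<lesssim> (UNIV :: 'u set)"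
   by (intro lepoll_Times lepoll_fun lepoll_UU lepoll_option[OF lepoll_refl, folded UNIV_option_conv])
 qed
 note W = WW_gpsh[OF UU_closed, of b]
 obtain W' :: "('o, 'a, 'u) ugpsh" and \<kappa> \<kappa>' where g: "giso C (WW b UU) W' \<kappa> \<kappa>'" using coded_exists[OF W p q] by blast
 note W' = gmapD(2)[OF gisoD(1)[OF g]]
 have ff: "ff_es C (nerve_grpd C S) (rep C X) (nerve_map C S) W'" if "Cov X S" for X S
  by (rule ff_es_target[OF local_objectI[OF W WW_hom_sheaf[OF UU_closed] WW_descent[OF UU_closed] that] g]) (rule UU_ess)
 show thesis by (rule that[OF g]) (use local_object_iff local_objectD[OF W' ff] W' in blast)
qed

text \<open>The copy of \<open>WW\<close> is one of the local objects that a local equivalence is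
  tested on; the conclusion is then carried back to \<open>WW\<close>.\<close>

lemma WW_ff_es:
 assumes "grpd_map C A B f" "!!W :: ('o, 'a, 'u) ugpsh. local_object C Cov W ==> is_equivalence (Map_grpd C B W) (Map_grpd C A W) (Map_precomp C A f)"
 shows "ff_es C A B f (WW b UU)"
proof -
 obtain W' :: "('o, 'a, 'u) ugpsh" and \<kappa> \<kappa>' where g: "giso C (WW b UU) W' \<kappa> \<kappa>'" "local_object C Cov W'" by (rule WW_coded)
 have W': "grpd_presheaf C W'" using g(2) local_object_iff by blast
 have "ff_es C A B f W'" using assms(2)[OF g(2)] is_equivalence_precomp_iff[OF assms(1) W'] by simp
 then show ?thesis using giso_sym[OF g(1)] by (rule ff_es_target)
qed

section \<open>Extending sections along local equivalences\<close>

text \<open>The isomorphism of induced sheaves given by an arrow of \<open>M(X)\<close>; it is contravariant.\<close>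

definition sm :: "'o => 'u => 'a => 'u => 'u" where
 "sm X \<beta> = (\<lambda>h \<in> into C X. \<lambda>x \<in> at G (src h, rO h (Cod (sect M X) \<beta>)). aG (src h) (rA h \<beta>) x)"

lemma sm_simp [simp]: "[|arr h; tgt h = X; x \<in> at G (src h, rO h (Cod (sect M X) \<beta>))|]
 ==> sm X \<beta> h x = aG (src h) (rA h \<beta>) x"
 by (simp add: sm_def)

lemma sm_mor:
 assumes X: "ob X" and b: "\<beta> \<in> AM X" and m: "m = Cod (sect M X) \<beta>" "m' = Dom (sect M X) \<beta>"
  and t: "!!x. t = Some x ==> x \<in> at G (X, m)" "!!x. t' = Some x ==> x \<in> at G (X, m')"
 shows "mor X (std X m t) (sm X \<beta>) (std X m' t')" "t' = map_option (aG X \<beta>) t ==> pres X (std X m t) (sm X \<beta>) (std X m' t')"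
proof -
 note [simp] = Ms
 have o: "m \<in> OM X" "m' \<in> OM X" using b m X by simp_all
 have hb: "rA h \<beta> \<in> Arr (MD h)" "Dom (MD h) (rA h \<beta>) = rO h m'"
  "Cod (MD h) (rA h \<beta>) = rO h m" if "arr h" "tgt h = X" for h
  using b m that by simp_all
 have i: "aG (src h) (rA h \<beta>) x \<in> gv m' h"
  if "arr h" "tgt h = X" "x \<in> gv m h" for h x
  using ga_in[of "src h" "rA h \<beta>" x] hb[OF that(1,2)] that by simp
 have "mor X (std X m t) (\<lambda>h \<in> into C X. \<lambda>x \<in> tval (std X m t) h. aG (src h) (rA h \<beta>) x) (std X m' t')"
 proof (rule morI_restrict[OF _ std_valid[OF X o(1) t(1)] std_valid[OF X o(2) t(2)]])
  show "natm C (into C X) (tval (std X m t)) (tres (std X m t)) (tval (std X m' t')) (tres (std X m' t')) (\<lambda>h. aG (src h) (rA h \<beta>))"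
   unfolding natm_def
  proof (intro ballI conjI)
   fix h x assume h: "h \<in> into C X" and x: "x \<in> tval (std X m t) h"
   then show "aG (src h) (rA h \<beta>) x \<in> tval (std X m' t') h" using i by simp
   fix k assume k: "k \<in> pre h"
   show "aG (src (cmp h k)) (rA (cmp h k) \<beta>) (tres (std X m t) h k x) = tres (std X m' t') h k (aG (src h) (rA h \<beta>) x)"
    using gr_ga[of k "src h" "rA h \<beta>" x "rO h m'"] hb[of h] h x k b by simp
  qed
 next
  fix h assume h: "arr h" "tgt h = X"
  note hbs = hb[OF h]
  have "bij_betw (aG (src h) (rA h \<beta>)) (gv m h) (gv m' h)"
  proof (rule bij_betw_byWitness[where f' = "aG (src h) (ginv (MD h) (rA h \<beta>))"])
   show "aG (src h) (ginv (MD h) (rA h \<beta>)) ` gv m' h \<subseteq> gv m h"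
    using ga_in[of "src h" "ginv (MD h) (rA h \<beta>)"] hbs h by auto
  qed (use i[OF h] ga_inv[of "src h" "rA h \<beta>"] hbs h in auto)
  then show "bij_betw (aG (src h) (rA h \<beta>)) (tval (std X m t) h) (tval (std X m' t') h)" using h by simp
 next
  fix h n \<phi> n' \<phi>' assume c: "(h, n, \<phi>) \<in> tcht (std X m t)" "(h, n', \<phi>') \<in> tcht (std X m' t')"
  then have h: "arr h" "tgt h = X" by auto
  \<comment> \<open>The transition is the inverse of the restricted \<open>\<beta>\<close>:
    morphisms of induced sheaves and arrows of \<open>M\<close> point in opposite
    directions.\<close>
  have "crel n \<phi> n' \<phi>' (\<lambda>k. aG (src (cmp h k)) (rA (cmp h k) \<beta>)) u (ginv (MD u) (rA u (rA h \<beta>)))"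
   if u: "arr u" "tgt u = src h" for u
   unfolding crel_def
  proof (intro conjI ballI)
   have B: "rA u (rA h \<beta>) \<in> Arr (MD u)" "Dom (MD u) (rA u (rA h \<beta>)) = rO u n'"
     "Cod (MD u) (rA u (rA h \<beta>)) = rO u n" using c u hb[OF h] by auto
   then show "ginv (MD u) (rA u (rA h \<beta>)) \<in> Arr (MD u)"
    "Dom (MD u) (ginv (MD u) (rA u (rA h \<beta>))) = rO u n"
    "Cod (MD u) (ginv (MD u) (rA u (rA h \<beta>))) = rO u n'"
    using u by auto
   fix k x assume "k \<in> pre u" and x: "x \<in> gv (rO u n') k"
   then have k: "arr k" "tgt k = src u" by auto
   let ?b = "rA k (rA u (rA h \<beta>))"
   have kb: "?b \<in> Arr (MD k)" "Dom (MD k) ?b = rO k (rO u n')" "Cod (MD k) ?b = rO k (rO u n)"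
    using B k by simp_all
   have g: "rA k (ginv (MD u) (rA u (rA h \<beta>))) = ginv (MD k) ?b"
    using B k by simp
   have i: "aG (src k) (ginv (MD k) ?b) x \<in> gv (rO u n) k"
    using ga_in[of "src k" "ginv (MD k) ?b" x] kb x k by simp
   have "aG (src k) ?b (aG (src k) (ginv (MD k) ?b) x) = x" using ga_inv(2)[of "src k" ?b x] kb x k by simp
   then show "\<phi>' (cmp u k) x = aG (src (cmp h (cmp u k))) (rA (cmp h (cmp u k)) \<beta>) (\<phi> (cmp u k)
     (aG (src k) (rA k (ginv (MD u) (rA u (rA h \<beta>)))) x))"
    using c u k x b m i by (auto simp: g)
  qed
  then have "pre h \<subseteq> crs (src h) n \<phi> n' \<phi>' (\<lambda>k. aG (src (cmp h k)) (rA (cmp h k) \<beta>))"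
   unfolding crs_def by (intro subsetI CollectI conjI exI) auto
  then have "crs (src h) n \<phi> n' \<phi>' (\<lambda>k. aG (src (cmp h k)) (rA (cmp h k) \<beta>)) = pre h"
   using crs_into by (intro equalityI)
  then show "rel (src h) n \<phi> n' \<phi>' (\<lambda>k. aG (src (cmp h k)) (rA (cmp h k) \<beta>))" using h cs_into by simp
 qed
 moreover have "(\<lambda>h \<in> into C X. \<lambda>x \<in> tval (std X m t) h. aG (src h) (rA h \<beta>) x) = sm X \<beta>"
  by (auto simp: sm_def m fun_eq_iff restrict_def)
 ultimately show "mor X (std X m t) (sm X \<beta>) (std X m' t')" by simp
 show "pres X (std X m t) (sm X \<beta>) (std X m' t')" if "t' = map_option (aG X \<beta>) t"
  using that t X b m by (cases t) (auto simp: pres_def)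
qed

lemma mor_std_cong: "mor X y \<sigma> (std X m t) \<longleftrightarrow> mor X y \<sigma> (std X m t')"
 by (simp add: mor_def std_def)

text \<open>The composite of \<open>q\<close> with the map that sends an object of \<open>M\<close>
  to its induced sheaf, where \<open>s\<close> prescribes the points. The inverse compensates for
  the contravariance of \<open>sm\<close>.\<close>

definition stdm :: "('o, 'a, 'p, 'q) gpsh => ('o, 'p, 'q, 'u, 'u) gmap => ('o => 'p => 'u option)
  => ('o, 'p, 'q, ('a, 'u) tors, ('a, 'u) tors \<times> ('a => 'u => 'u) \<times> ('a, 'u) tors) gmap" where
 "stdm N q s = (\<lambda>X \<in> Obj C. \<lparr>obm = (\<lambda>n \<in> Obj (sect N X). std X (obm (q X) n) (s X n)),
   arm = (\<lambda>\<nu> \<in> Arr (sect N X). (std X (obm (q X) (Dom (sect N X) \<nu>)) (s X (Dom (sect N X) \<nu>)),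
    sm X (ginv (sect M X) (arm (q X) \<nu>)), std X (obm (q X) (Cod (sect N X) \<nu>)) (s X (Cod (sect N X) \<nu>))))\<rparr>)"

lemma stdm_simps [simp]:
 "[|ob X; n \<in> Obj (sect N X)|] ==> obm (stdm N q s X) n = std X (obm (q X) n) (s X n)"
 "[|ob X; \<nu> \<in> Arr (sect N X)|] ==> arm (stdm N q s X) \<nu> = (std X (obm (q X) (Dom (sect N X) \<nu>)) (s X (Dom (sect N X) \<nu>)),
    sm X (ginv (sect M X) (arm (q X) \<nu>)), std X (obm (q X) (Cod (sect N X) \<nu>)) (s X (Cod (sect N X) \<nu>)))"
 by (simp_all add: stdm_def)

lemma stdm_map:
 assumes q: "grpd_map C N M q"
  and s: "!!X n x. [|ob X; n \<in> Obj (sect N X); s X n = Some x|] ==> x \<in> at G (X, obm (q X) n)"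
   "!!X n. [|ob X; n \<in> Obj (sect N X); b|] ==> s X n \<noteq> None"
   "!!h n. [|arr h; n \<in> Obj (sect N (tgt h))|] ==> s (src h) (obm (rst N h) n) = map_option (rG h (obm (q (tgt h)) n)) (s (tgt h) n)"
   "!!X \<nu>. [|ob X; \<nu> \<in> Arr (sect N X); b|] ==>
     s X (Cod (sect N X) \<nu>) = map_option (aG X (ginv (sect M X) (arm (q X) \<nu>))) (s X (Dom (sect N X) \<nu>))"
 shows "grpd_map C N (WW b UU) (stdm N q s)"
proof (rule gmapI[OF gmapD(1)[OF q] WW_gpsh[OF UU_closed]], goal_cases)
 note [simp] = gpshD[OF gmapD(1)[OF q]] gmapD[OF q] Ms
 { case 1 show ?case by (simp add: stdm_def) }
 { case 2 then show ?case by (simp add: stdm_def) }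
 { case 3 then show ?case using UU_std s(1,2) by simp }
 { case (4 X \<nu>)
  let ?b = "ginv (sect M X) (arm (q X) \<nu>)"
  have b: "?b \<in> AM X" "obm (q X) (Dom (sect N X) \<nu>) = Cod (sect M X) ?b" "obm (q X) (Cod (sect N X) \<nu>) = Dom (sect M X) ?b"
   using 4 by simp_all
  have d: "Dom (sect N X) \<nu> \<in> Obj (sect N X)" "Cod (sect N X) \<nu> \<in> Obj (sect N X)" using 4 by simp_all
  note m = sm_mor[OF 4(1) b s(1)[OF 4(1) d(1)] s(1)[OF 4(1) d(2)]]
  show ?case using 4 d UU_std s(1,2) m s(4)[OF 4] by simp }
 { case (5 X n)
  let ?m = "obm (q X) n"
  have "sm X (Idt (sect M X) ?m) = (\<lambda>h\<in>into C X. \<lambda>x\<in>tval (std X ?m (s X n)) h. x)"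
   using 5 ga_Idt by (auto simp: sm_def fun_eq_iff restrict_def)
  then show ?case using 5 by simp }
 { case (6 X \<alpha> \<beta>)
  let ?a = "ginv (sect M X) (arm (q X) \<alpha>)" and ?b = "ginv (sect M X) (arm (q X) \<beta>)"
  let ?m = "obm (q X) (Dom (sect N X) \<alpha>)"
  have e: "ginv (sect M X) (Comp (sect M X) (arm (q X) \<beta>) (arm (q X) \<alpha>)) = Comp (sect M X) ?a ?b" using 6 by (simp add: ginv_Comp)
  have "sm X (Comp (sect M X) ?a ?b) = mcomp C X (std X ?m (s X (Dom (sect N X) \<alpha>))) (sm X ?b) (sm X ?a)" (is "?l = ?r")
  proof (intro ext)
   fix h x
   show "?l h x = ?r h x"
   proof (cases "h \<in> into C X \<and> x \<in> at G (src h, rO h ?m)")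
    case True
    then have h: "arr h" "tgt h = X" "x \<in> at G (src h, rO h ?m)" by auto
    have a: "rA h ?a \<in> Arr (MD h)" "Cod (MD h) (rA h ?a) = rO h ?m"
     "Dom (MD h) (rA h ?a) = rO h (obm (q X) (Cod (sect N X) \<alpha>))"
     "Cod (MD h) (rA h ?b) = rO h (obm (q X) (Cod (sect N X) \<alpha>))" "rA h ?b \<in> Arr (MD h)"
     using h 6 by simp_all
    note i = ga_in[of "src h" "rA h ?a" x, unfolded a(2,3)]
    have "rA h (Comp (sect M X) ?a ?b) = Comp (MD h) (rA h ?a) (rA h ?b)" using h 6 by simp
    then show ?thesis using ga_Comp[of "src h" "rA h ?b" "rA h ?a" x] i a h 6 by simp
   qed (use 6 in \<open>auto simp: mcomp_def sm_def restrict_def std_def\<close>)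
  qed
  then show ?case using 6 e by simp }
 { case (7 h n) then show ?case by (simp add: tsub_std s(3)) }
 { case (8 h \<nu>)
  have "msub C h (sm (tgt h) (ginv (sect M (tgt h)) (arm (q (tgt h)) \<nu>))) = sm (src h) (rA h (ginv (sect M (tgt h)) (arm (q (tgt h)) \<nu>)))"
   using 8 by (auto simp: msub_def sm_def fun_eq_iff restrict_def)
  then show ?case using 8 by (simp add: tsub_std s(3)) }
qed

text \<open>\<open>sec N q s\<close>: \<open>s\<close> is a global section of the pullback of \<open>G\<close> along \<open>q : N \<rightarrow> M\<close>.\<close>

definition sec :: "('o, 'a, 'p, 'q) gpsh => ('o, 'p, 'q, 'u, 'u) gmap => ('o => 'p => 'u) => bool" where
 "sec N q s \<longleftrightarrow> (\<forall>X \<in> Obj C. \<forall>n \<in> Obj (sect N X). s X n \<in> at G (X, obm (q X) n)) \<and>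
  (\<forall>h \<in> Arr C. \<forall>n \<in> Obj (sect N (tgt h)). s (src h) (obm (rst N h) n) = rG h (obm (q (tgt h)) n) (s (tgt h) n)) \<and>
  (\<forall>X \<in> Obj C. \<forall>\<nu> \<in> Arr (sect N X). s X (Dom (sect N X) \<nu>) = aG X (arm (q X) \<nu>) (s X (Cod (sect N X) \<nu>)))"

lemma secD:
 assumes "sec N q s"
 shows "[|ob X; n \<in> Obj (sect N X)|] ==> s X n \<in> at G (X, obm (q X) n)"
  "[|arr h; n \<in> Obj (sect N (tgt h))|] ==> s (src h) (obm (rst N h) n) = rG h (obm (q (tgt h)) n) (s (tgt h) n)"
  "[|ob X; \<nu> \<in> Arr (sect N X)|] ==> s X (Dom (sect N X) \<nu>) = aG X (arm (q X) \<nu>) (s X (Cod (sect N X) \<nu>))"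
 using assms by (simp_all add: sec_def)

lemma sec_pre:
 assumes s: "sec N q s" and f: "grpd_map C A N f"
 shows "sec A (gmap_comp C A q f) (\<lambda>X n. s X (obm (f X) n))"
 unfolding sec_def
proof (intro conjI ballI)
 fix X \<nu> assume "ob X" "\<nu> \<in> Arr (sect A X)"
 then show "s X (obm (f X) (Dom (sect A X) \<nu>)) = aG X (arm (gmap_comp C A q f X) \<nu>) (s X (obm (f X) (Cod (sect A X) \<nu>)))"
  using secD(3)[OF s, of X "arm (f X) \<nu>"] gmapD[OF f] by simp
qed (use secD(1,2)[OF s] gmapD[OF f] gpshD[OF gmapD(1)[OF f]] in simp_all)

text \<open>A section over \<open>A\<close> is the same as a map of the induced stack of pointed objects; it extends because
 that stack is local, and comparing with the unpointed stack turns the extension into a section.\<close>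

lemma sec_extend_local:
 assumes ff: "!!b. ff_es C A B f (WW b UU)" and g: "grpd_map C B M g" and s: "sec A (gmap_comp C A g f) s"
 shows "\<exists>t. sec B g t \<and> (\<forall>X \<in> Obj C. \<forall>n \<in> Obj (sect A X). t X (obm (f X) n) = s X n)"
proof -
 note f = ff_esD(1)[OF ff]
 note [simp] = Ms gpshD[OF gmapD(1)[OF f]] gpshD[OF gmapD(1)[OF g]] gmapD[OF f] gmapD[OF g]
 let ?q = "gmap_comp C A g f"
 note q = gmap_comp_map[OF f g]
 note [simp] = gmapD[OF q]
 \<comment> \<open>The section \<open>s\<close>, read as a map to the pointed stack.\<close>
 define \<phi> where "\<phi> = stdm A ?q (\<lambda>X n. Some (s X n))"
 have \<phi>: "grpd_map C A (WW True UU) \<phi>" unfolding \<phi>_def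
 proof (rule stdm_map[OF q])
  fix X \<nu> assume n: "ob X" "\<nu> \<in> Arr (sect A X)"
  have "aG X (ginv (sect M X) (arm (?q X) \<nu>)) (s X (Dom (sect A X) \<nu>)) = s X (Cod (sect A X) \<nu>)"
   unfolding secD(3)[OF s n] by (rule ga_inv(1)) (use n secD(1)[OF s n(1), of "Cod (sect A X) \<nu>"] in simp_all)
  then show "Some (s X (Cod (sect A X) \<nu>)) = map_option (aG X (ginv (sect M X) (arm (?q X) \<nu>))) (Some (s X (Dom (sect A X) \<nu>)))" by simp
 qed (use secD[OF s] in auto)
 have W: "grpd_presheaf C (WW b UU)" for b by (rule WW_gpsh[OF UU_closed])
 from ff_esD(2)[OF ff \<phi>] obtain \<psi> \<theta> where \<psi>: "grpd_map C B (WW True UU) \<psi>" and \<theta>: "hty C A (WW True UU) (gmap_comp C A \<psi> f) \<theta> \<phi>" by blast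
 \<comment> \<open>The passage from the pointed to the unpointed stack is the identity on data:
   objects keep their point, and only the condition on morphisms is dropped.\<close>
 define \<iota> where "\<iota> = (\<lambda>X \<in> Obj C. ftor_id (sect (WW True UU) X))"
 have \<iota>s: "ob X ==> y \<in> Obj (sect (WW True UU) X) ==> obm (\<iota> X) y = y" "ob X ==> w \<in> Arr (sect (WW True UU) X) ==> arm (\<iota> X) w = w" for X y w
  by (simp_all add: \<iota>_def ftor_id_def)
 have \<iota>: "grpd_map C (WW True UU) (WW False UU) \<iota>"
 proof -
  have "mor X y (\<lambda>h\<in>into C X. \<lambda>x\<in>tval y h. x) y \<and> pres X y (\<lambda>h\<in>into C X. \<lambda>x\<in>tval y h. x) y" if "ob X" "y \<in> UU X" for X y
  proof -
   have v: "valid X y" using UU_closed that by (auto simp: closedU_def)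
   show ?thesis using mor_id[OF v] validD(2,5)[OF v] by (cases "tpt y") (auto simp: pres_def)
  qed
  then show ?thesis
   using W by (intro gmapI) (auto simp: \<iota>_def ftor_id_def extensional_def gpshD[OF W] pres_def dest: gpshD(3,4)[OF W])
 qed
 let ?c = "gmap_comp C B \<iota> \<psi>"
 note c = gmap_comp_map[OF \<psi> \<iota>]
 define \<chi> where "\<chi> = stdm B g (\<lambda>X n. None)"
 have \<chi>: "grpd_map C B (WW False UU) \<chi>" unfolding \<chi>_def by (rule stdm_map[OF g]) auto
 note \<psi>s = gmapD[OF \<psi>]
 have po: "obm (\<psi> X) n \<in> UU X" "tpt (obm (\<psi> X) n) \<noteq> None" "valid X (obm (\<psi> X) n)" if "ob X" "n \<in> Obj (sect B X)" for X n
  using \<psi>s(4)[OF that] UU_closed that by (auto simp: closedU_def)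
 have pa: "\<exists>\<sigma>. arm (\<psi> X) \<nu> = (obm (\<psi> X) (Dom (sect B X) \<nu>), \<sigma>, obm (\<psi> X) (Cod (sect B X) \<nu>)) \<and>
   mor X (obm (\<psi> X) (Dom (sect B X) \<nu>)) \<sigma> (obm (\<psi> X) (Cod (sect B X) \<nu>)) \<and> pres X (obm (\<psi> X) (Dom (sect B X) \<nu>)) \<sigma> (obm (\<psi> X) (Cod (sect B X) \<nu>))"
  if "ob X" "\<nu> \<in> Arr (sect B X)" for X \<nu>
  using \<psi>s(5-7)[OF that] by (cases "arm (\<psi> X) \<nu>") auto
 define \<sigma> where "\<sigma> X n = fst (snd (\<theta> X n))" for X n
 have th: "\<theta> X n = (obm (\<psi> X) (obm (f X) n), \<sigma> X n, std X (obm (?q X) n) (Some (s X n)))"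
  "mor X (obm (\<psi> X) (obm (f X) n)) (\<sigma> X n) (std X (obm (?q X) n) None)"
  "tpt (obm (\<psi> X) (obm (f X) n)) = Some p ==> \<sigma> X n (Idt C X) p = s X n"
  if "ob X" "n \<in> Obj (sect A X)" for X n p
  using htyD(3-5)[OF \<theta> that] that mor_std_cong[of X _ _ _ "Some (s X n)" None] by (cases "\<theta> X n"; simp add: \<sigma>_def \<phi>_def pres_def)+
 \<comment> \<open>The homotopy \<open>\<theta>\<close> in the unpointed stack. Its target loses the
   point, which is allowed because \<open>mor\<close> does not involve points, and is now the
   restriction of a map \<open>\<chi>\<close> defined on all of \<open>B\<close>.\<close>
 let ?\<theta>' = "\<lambda>X n. (obm (\<psi> X) (obm (f X) n), \<sigma> X n, std X (obm (?q X) n) None)"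
 have "hty C A (WW False UU) (gmap_comp C A ?c f) (res2 C A ?\<theta>') (gmap_comp C A \<chi> f)"
 proof (rule hty_res2I[OF gmap_comp_map[OF f c] gmap_comp_map[OF f \<chi>]], goal_cases)
  case (1 X n)
  then show ?case using th(2)[OF 1] po[of X "obm (f X) n"] UU_std[of X "obm (?q X) n" None] \<iota>s by (simp add: \<chi>_def)
 next
  case (2 X \<nu>)
  obtain \<rho> where r: "arm (\<psi> X) (arm (f X) \<nu>) = (obm (\<psi> X) (obm (f X) (Dom (sect A X) \<nu>)), \<rho>, obm (\<psi> X) (obm (f X) (Cod (sect A X) \<nu>)))"
   using pa[of X "arm (f X) \<nu>"] 2 by auto
  show ?case using hty_nat[OF \<theta> 2] 2 \<psi>s(5)[of X "arm (f X) \<nu>"] \<iota>s(2) by (simp add: th(1) r \<phi>_def \<chi>_def \<iota>_def ftor_id_def)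
 next
  case (3 h n)
  show ?case using htyD(6)[OF \<theta> 3(1) refl 3(2)] 3 by (simp add: th(1) tsub_std)
 qed
 \<comment> \<open>The extension \<open>\<Theta>\<close> restricts to \<open>?\<theta>'\<close>
   strictly, which is why the section obtained from it extends \<open>s\<close> strictly.\<close>
 from ff_esD(3)[OF ff c \<chi> this] obtain \<Theta> where \<Theta>: "hty C B (WW False UU) ?c \<Theta> \<chi>"
  "!!X n. ob X ==> n \<in> Obj (sect A X) ==> \<Theta> X (obm (f X) n) = ?\<theta>' X n" by (auto simp: Ex1_def)
 define \<Sigma> where "\<Sigma> X n = fst (snd (\<Theta> X n))" for X n
 have Th: "\<Theta> X n = (obm (\<psi> X) n, \<Sigma> X n, std X (obm (g X) n) None)" "mor X (obm (\<psi> X) n) (\<Sigma> X n) (std X (obm (g X) n) None)"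
  if "ob X" "n \<in> Obj (sect B X)" for X n
  using htyD(3-5)[OF \<Theta>(1) that] that \<psi>s(4)[OF that] by (cases "\<Theta> X n"; simp add: \<Sigma>_def \<chi>_def \<iota>_def ftor_id_def)+
 define p where "p X n = the (tpt (obm (\<psi> X) n))" for X n
 have p: "tpt (obm (\<psi> X) n) = Some (p X n)" "p X n \<in> tval (obm (\<psi> X) n) (Idt C X)" if "ob X" "n \<in> Obj (sect B X)" for X n
  using po[OF that] validD(5) by (auto simp: p_def)
 \<comment> \<open>The point of the extended map \<open>\<psi>\<close>, transported along
   \<open>\<Theta>\<close> to the sheaf induced by \<open>g\<close>.\<close>
 define t where "t X n = \<Sigma> X n (Idt C X) (p X n)" for X n
 have ti: "t X n \<in> at G (X, obm (g X) n)" if n: "ob X" "n \<in> Obj (sect B X)" for X n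
  using morD(4)[OF Th(2)[OF n] _ _ p(2)[OF n]] n by (simp add: t_def)
 have "sec B g t" unfolding sec_def
 proof (intro conjI ballI)
  fix h n assume n: "arr h" "n \<in> Obj (sect B (tgt h))"
  let ?X = "tgt h"
  have X: "?X \<in> Obj C" using n by simp
  have "\<Theta> (src h) (obm (rst B h) n) = arm (rst (WW False UU) h) (\<Theta> ?X n)" by (rule htyD(6)[OF \<Theta>(1) n(1) refl n(2)])
  then have e: "\<Sigma> (src h) (obm (rst B h) n) = msub C h (\<Sigma> ?X n)" using n by (simp add: Th(1))
  have "obm (\<psi> (src h)) (obm (rst B h) n) = tsub C h (obm (\<psi> ?X) n)" using \<psi>s(10)[OF n(1) refl n(2)] by simp
  then have "p (src h) (obm (rst B h) n) = tres (obm (\<psi> ?X) n) (Idt C ?X) h (p ?X n)" using p(1)[OF X n(2)] by (cases "tpt (obm (\<psi> ?X) n)") (auto simp: p_def)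
  then show "t (src h) (obm (rst B h) n) = rG h (obm (g ?X) n) (t ?X n)"
   using morD(5)[OF Th(2)[OF X n(2)] _ _ p(2)[OF X n(2)], of h] n by (simp add: t_def e)
 next
  fix X \<nu> assume n: "ob X" "\<nu> \<in> Arr (sect B X)"
  let ?a = "Dom (sect B X) \<nu>" and ?b = "Cod (sect B X) \<nu>"
  have d: "?a \<in> Obj (sect B X)" "?b \<in> Obj (sect B X)" using n by simp_all
  obtain \<rho> where r: "arm (\<psi> X) \<nu> = (obm (\<psi> X) ?a, \<rho>, obm (\<psi> X) ?b)" "pres X (obm (\<psi> X) ?a) \<rho> (obm (\<psi> X) ?b)" using pa[OF n] by blast
  have pe: "p X ?b = \<rho> (Idt C X) (p X ?a)" using r(2) p(1)[OF n(1)] d by (simp add: pres_def)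
  have "mcomp C X (obm (\<psi> X) ?a) (\<Sigma> X ?b) \<rho> = mcomp C X (obm (\<psi> X) ?a) (sm X (ginv (sect M X) (arm (g X) \<nu>))) (\<Sigma> X ?a)"
   using hty_nat[OF \<Theta>(1) n] n d \<psi>s(5)[OF n] by (simp add: Th(1) r(1) \<chi>_def \<iota>_def ftor_id_def)
  from fun_cong[OF fun_cong[OF this, of "Idt C X"], of "p X ?a"]
  have "t X ?b = sm X (ginv (sect M X) (arm (g X) \<nu>)) (Idt C X) (t X ?a)" using n d p(2)[OF n(1) d(1)] by (simp add: t_def pe)
  also have "\<dots> = aG X (ginv (sect M X) (arm (g X) \<nu>)) (t X ?a)" using n ti[OF n(1) d(1)] by simp
  finally show "t X ?a = aG X (arm (g X) \<nu>) (t X ?b)" using ga_inv(2)[of X "arm (g X) \<nu>" "t X ?a"] n ti[OF n(1) d(1)] by simp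
 qed (rule ti)
 moreover have "t X (obm (f X) n) = s X n" if n: "ob X" "n \<in> Obj (sect A X)" for X n
  using \<Theta>(2)[OF n] Th(1)[of X "obm (f X) n"] th(3)[OF n p(1)] n by (simp add: t_def)
 ultimately show ?thesis by blast
qed

text \<open>A local equivalence is described only on a cofibrant approximation. The section is
  pulled back to \<open>A'\<close>, extended to \<open>B'\<close>, and then descended along the
  levelwise equivalence \<open>b\<close>: a section is determined on isomorphism classes by the
  action of \<open>M\<close>.\<close>

lemma sec_extend:
 fixes A B :: "('o, 'a, 'u) ugpsh"
 assumes f: "local_equivalence C Cov A B f" and g: "grpd_map C B M g" and s: "sec A (gmap_comp C A g f) s"
 shows "\<exists>t. sec B g t \<and> (\<forall>X \<in> Obj C. \<forall>n \<in> Obj (sect A X). t X (obm (f X) n) = s X n)"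
proof -
 from f obtain A' B' :: "('o, 'a, 'u) ugpsh" and f' a b where fm: "grpd_map C A B f" and f': "grpd_map C A' B' f'"
  and a: "levelwise_equivalence C A' A a" and b: "levelwise_equivalence C B' B b" and e: "gmap_comp C A' f a = gmap_comp C A' b f'"
  and loc: "!!W :: ('o, 'a, 'u) ugpsh. local_object C Cov W ==> is_equivalence (Map_grpd C B' W) (Map_grpd C A' W) (Map_precomp C A' f')"
  unfolding local_equivalence_def by blast
 have am: "grpd_map C A' A a" and bm: "grpd_map C B' B b"
  and ae: "!!X. ob X ==> is_equivalence (sect A' X) (sect A X) (a X)" and be: "!!X. ob X ==> is_equivalence (sect B' X) (sect B X) (b X)"
  using a b by (auto simp: levelwise_equivalence_def)
 note [simp] = Ms gpshD[OF gmapD(1)[OF fm]] gpshD[OF gmapD(2)[OF fm]] gpshD[OF gmapD(1)[OF f']] gpshD[OF gmapD(2)[OF f']]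
  gmapD[OF fm] gmapD[OF g] gmapD[OF am] gmapD[OF bm] gmapD[OF f']
 let ?gb = "gmap_comp C B' g b"
 have ee: "obm (f X) (obm (a X) n) = obm (b X) (obm (f' X) n)" if "ob X" "n \<in> Obj (sect A' X)" for X n
  using gmap_comp_simps(1)[OF that, of f a] gmap_comp_simps(1)[OF that, of b f'] unfolding e by simp
 have "gmap_comp C A' (gmap_comp C A g f) a = gmap_comp C A' ?gb f'"
  using gmap_comp_assoc[OF am fm g] gmap_comp_assoc[OF f' bm g] e by simp
 with sec_pre[OF s am] have "sec A' (gmap_comp C A' ?gb f') (\<lambda>X n. s X (obm (a X) n))" by simp
 from sec_extend_local[OF WW_ff_es[OF f' loc] gmap_comp_map[OF bm g] this] obtain \<tau> where \<tau>: "sec B' ?gb \<tau>"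
  and \<tau>f: "!!X n. [|ob X; n \<in> Obj (sect A' X)|] ==> \<tau> X (obm (f' X) n) = s X (obm (a X) n)" by blast
 have ess: "\<exists>c \<in> Obj S. \<exists>j \<in> Arr T. Dom T j = y \<and> Cod T j = obm F c"
  if eq: "is_equivalence S T F" "groupoid T" "y \<in> Obj T" for S T :: "('u, 'u) cat" and F y
 proof -
  obtain c i where c: "c \<in> Obj S" "i \<in> Arr T" "Dom T i = obm F c" "Cod T i = y"
   using equivalence_full_faithful(4)[OF eq(1,3)] by blast
  show ?thesis by (rule bexI[OF _ c(1)], rule bexI[of _ "ginv T i"]) (use eq(2) c in simp_all)
 qed
 have ex: "\<exists>w. fst w \<in> Obj (sect B' X) \<and> snd w \<in> Arr (sect B X) \<and> Dom (sect B X) (snd w) = y \<and> Cod (sect B X) (snd w) = obm (b X) (fst w)"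
  if "ob X" "y \<in> Obj (sect B X)" for X y
  using ess[OF be[OF that(1)] _ that(2)] that(1) by (auto intro: exI[of _ "(_, _)"])
 \<comment> \<open>For each object of \<open>B\<close> a chosen isomorphism to the image of an
   object of \<open>B'\<close>; \<open>t\<close> is the value there, acted on by this
   isomorphism.\<close>
 define w where "w X y = (SOME w. fst w \<in> Obj (sect B' X) \<and> snd w \<in> Arr (sect B X) \<and> Dom (sect B X) (snd w) = y \<and> Cod (sect B X) (snd w) = obm (b X) (fst w))" for X y
 note W = someI_ex[OF ex, folded w_def]
 define t where "t X y = aG X (arm (g X) (snd (w X y))) (\<tau> X (fst (w X y)))" for X y
 \<comment> \<open>Independence of the choice: two such isomorphisms differ by the image of an arrow
   of \<open>B'\<close>, as \<open>b\<close> is full, and \<open>\<tau>\<close> is invariant under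
   arrows of \<open>B'\<close>.\<close>
 have tt: "t X y = aG X (arm (g X) j) (\<tau> X c)" if X: "ob X" and c: "c \<in> Obj (sect B' X)"
  and j: "j \<in> Arr (sect B X)" "Dom (sect B X) j = y" "Cod (sect B X) j = obm (b X) c" for X y c j
 proof -
  have y: "y \<in> Obj (sect B X)" using X j by auto
  note w = W[OF X y]
  let ?j = "snd (w X y)" and ?c = "fst (w X y)"
  let ?k = "Comp (sect B X) j (ginv (sect B X) ?j)"
  have k: "?k \<in> Arr (sect B X)" "Dom (sect B X) ?k = obm (b X) ?c" "Cod (sect B X) ?k = obm (b X) c" using w j X by simp_all
  obtain \<nu> where n: "\<nu> \<in> Arr (sect B' X)" "Dom (sect B' X) \<nu> = ?c" "Cod (sect B' X) \<nu> = c" "arm (b X) \<nu> = ?k"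
   using equivalence_full_faithful(3)[OF be[OF X] _ c k] w by blast
  have "\<tau> X ?c = aG X (arm (g X) ?k) (\<tau> X c)" using secD(3)[OF \<tau> X n(1)] n X by simp
  then have "t X y = aG X (Comp (sect M X) (arm (g X) ?k) (arm (g X) ?j)) (\<tau> X c)"
   using ga_Comp[of X "arm (g X) ?j" "arm (g X) ?k" "\<tau> X c"] secD(1)[OF \<tau> X c] w k X c by (simp add: t_def)
  also have "Comp (sect M X) (arm (g X) ?k) (arm (g X) ?j) = arm (g X) (Comp (sect B X) ?k ?j)" using w k X by simp
  also have "Comp (sect B X) ?k ?j = j" using w j X by (simp add: comp_assoc)
  finally show ?thesis .
 qed
 have ti: "aG X (arm (g X) j) (\<tau> X c) \<in> at G (X, obm (g X) y)" if "ob X" "c \<in> Obj (sect B' X)"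
  "j \<in> Arr (sect B X)" "Dom (sect B X) j = y" "Cod (sect B X) j = obm (b X) c" for X y c j
  using ga_in[of X "arm (g X) j" "\<tau> X c"] secD(1)[OF \<tau> that(1,2)] that by auto
 have "sec B g t" unfolding sec_def
 proof (intro conjI ballI)
  fix X y assume X: "ob X" and y: "y \<in> Obj (sect B X)"
  show "t X y \<in> at G (X, obm (g X) y)" unfolding t_def by (rule ti[OF X]) (use W[OF X y] in auto)
 next
  fix h y assume h: "arr h" and y: "y \<in> Obj (sect B (tgt h))"
  obtain c j where c: "c \<in> Obj (sect B' (tgt h))" "j \<in> Arr (sect B (tgt h))" "Dom (sect B (tgt h)) j = y" "Cod (sect B (tgt h)) j = obm (b (tgt h)) c"
   using ess[OF be _ y] h by fastforce
  have "t (src h) (obm (rst B h) y) = aG (src h) (arm (g (src h)) (arm (rst B h) j)) (\<tau> (src h) (obm (rst B' h) c))"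
   by (rule tt) (use c h in auto)
  also have "\<dots> = aG (src h) (rA h (arm (g (tgt h)) j)) (rG h (obm (g (tgt h)) (obm (b (tgt h)) c)) (\<tau> (tgt h) c))"
   using secD(2)[OF \<tau> h c(1)] c h by simp
  also have "\<dots> = rG h (obm (g (tgt h)) y) (t (tgt h) y)"
   using gr_ga[of h "tgt h" "arm (g (tgt h)) j" "\<tau> (tgt h) c" "obm (g (tgt h)) y"] tt[OF _ c] secD(1)[OF \<tau> _ c(1)] c h by simp
  finally show "t (src h) (obm (rst B h) y) = rG h (obm (g (tgt h)) y) (t (tgt h) y)" .
 next
  fix X \<nu> assume X: "ob X" and n: "\<nu> \<in> Arr (sect B X)"
  obtain c j where c: "c \<in> Obj (sect B' X)" "j \<in> Arr (sect B X)" "Dom (sect B X) j = Cod (sect B X) \<nu>" "Cod (sect B X) j = obm (b X) c"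
   using ess[OF be[OF X], of "Cod (sect B X) \<nu>"] X n by auto
  have "t X (Dom (sect B X) \<nu>) = aG X (arm (g X) (Comp (sect B X) j \<nu>)) (\<tau> X c)" by (rule tt[OF X c(1)]) (use c n X in auto)
  also have "\<dots> = aG X (arm (g X) \<nu>) (aG X (arm (g X) j) (\<tau> X c))"
   using ga_Comp[of X "arm (g X) \<nu>" "arm (g X) j" "\<tau> X c"] secD(1)[OF \<tau> X c(1)] c n X by simp
  finally show "t X (Dom (sect B X) \<nu>) = aG X (arm (g X) \<nu>) (t X (Cod (sect B X) \<nu>))" using tt[OF X c] by simp
 qed
 moreover have "t X (obm (f X) n) = s X n" if X: "ob X" and n: "n \<in> Obj (sect A X)" for X n
 proof -
  obtain c j where c: "c \<in> Obj (sect A' X)" "j \<in> Arr (sect A X)" "Dom (sect A X) j = n" "Cod (sect A X) j = obm (a X) c"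
   using ess[OF ae[OF X], of n] X n by auto
  have "t X (obm (f X) n) = aG X (arm (g X) (arm (f X) j)) (\<tau> X (obm (f' X) c))"
   by (rule tt[OF X]) (use c X ee[OF X c(1)] in auto)
  also have "\<dots> = s X n" using secD(3)[OF s X c(2)] \<tau>f[OF X c(1)] c X by simp
  finally show ?thesis .
 qed
 ultimately show ?thesis by blast
qed

end

section \<open>The equivalence\<close>

locale bst = set_universe C enc + slice_psh C M G
 for C :: "('o, 'a) cat" and enc :: "'u \<times> 'u => 'u" and M :: "('o, 'a, 'u) ugpsh"
  and G :: "('o \<times> 'u, ('o, 'a, 'u) slice_arr, 'u) set_psh"
begin

abbreviation "BG \<equiv> B_gpsh enc C M G"
abbreviation "Bp \<equiv> B_proj enc C M G"

lemma enc_simps [simp]: "inv enc (enc p) = p" "enc p = enc p' \<longleftrightarrow> p = p'"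
 using enc_inj by (auto simp: inj_eq)

lemma B_simps [simp]:
 "enc (a, s) \<in> Obj (sect BG X) \<longleftrightarrow> a \<in> OM X \<and> s \<in> at G (X, a)"
 "enc (a, s) \<in> Arr (sect BG X) \<longleftrightarrow> a \<in> AM X \<and> s \<in> at G (X, Cod (sect M X) a)"
 "Dom (sect BG X) (enc (a, s)) = enc (Dom (sect M X) a, aG X a s)"
 "Cod (sect BG X) (enc (a, s)) = enc (Cod (sect M X) a, s)"
 "Idt (sect BG X) (enc (a, s)) = enc (Idt (sect M X) a, s)"
 "Comp (sect BG X) (enc (b, t)) (enc (a, s)) = enc (Comp (sect M X) b a, t)"
 "obm (rst BG h) (enc (a, s)) = enc (rO h a, rG h a s)"
 "arm (rst BG h) (enc (a, s)) = enc (rA h a, rG h (Cod (sect M (Cod C h)) a) s)"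
 by (auto simp: B_gpsh_def Let_def gr_def)

lemma B_cases:
 "w \<in> Obj (sect BG X) ==> \<exists>a s. w = enc (a, s) \<and> a \<in> OM X \<and> s \<in> at G (X, a)"
 "w \<in> Arr (sect BG X) ==> \<exists>a s. w = enc (a, s) \<and> a \<in> AM X \<and> s \<in> at G (X, Cod (sect M X) a)"
 by (auto simp: B_gpsh_def Let_def)

lemma B_grpd:
 assumes X: "X \<in> Obj C"
 shows "groupoid (sect BG X)"
proof (rule groupoidI[OF categoryI])
 note [simp] = Ms X ga_in ga_Idt ga_Comp
 show "Dom (sect BG X) f \<in> Obj (sect BG X) \<and> Cod (sect BG X) f \<in> Obj (sect BG X)" if "f \<in> Arr (sect BG X)" for f
  using B_cases(2)[OF that] by auto
 show "Idt (sect BG X) x \<in> Arr (sect BG X) \<and> Dom (sect BG X) (Idt (sect BG X) x) = x \<and> Cod (sect BG X) (Idt (sect BG X) x) = x" if "x \<in> Obj (sect BG X)" for x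
  using B_cases(1)[OF that] by auto
 show "Comp (sect BG X) g f \<in> Arr (sect BG X) \<and> Dom (sect BG X) (Comp (sect BG X) g f) = Dom (sect BG X) f \<and> Cod (sect BG X) (Comp (sect BG X) g f) = Cod (sect BG X) g"
  if "f \<in> Arr (sect BG X)" "g \<in> Arr (sect BG X)" "Cod (sect BG X) f = Dom (sect BG X) g" for f g
  using B_cases(2)[OF that(1)] B_cases(2)[OF that(2)] that(3) by auto
 show "Comp (sect BG X) f (Idt (sect BG X) (Dom (sect BG X) f)) = f \<and> Comp (sect BG X) (Idt (sect BG X) (Cod (sect BG X) f)) f = f" if "f \<in> Arr (sect BG X)" for f
  using B_cases(2)[OF that] by auto
 show "Comp (sect BG X) (Comp (sect BG X) h g) f = Comp (sect BG X) h (Comp (sect BG X) g f)"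
  if "f \<in> Arr (sect BG X)" "g \<in> Arr (sect BG X)" "h \<in> Arr (sect BG X)" "Cod (sect BG X) f = Dom (sect BG X) g" "Cod (sect BG X) g = Dom (sect BG X) h" for f g h
  using B_cases(2)[OF that(1)] B_cases(2)[OF that(2)] B_cases(2)[OF that(3)] that(4,5) by (auto simp: comp_assoc)
 fix f assume "f \<in> Arr (sect BG X)"
 then obtain a s where f: "f = enc (a, s)" "a \<in> AM X" "s \<in> at G (X, Cod (sect M X) a)" using B_cases(2) by blast
 show "\<exists>g \<in> Arr (sect BG X). Dom (sect BG X) g = Cod (sect BG X) f \<and> Cod (sect BG X) g = Dom (sect BG X) f \<and>
  Comp (sect BG X) g f = Idt (sect BG X) (Dom (sect BG X) f) \<and> Comp (sect BG X) f g = Idt (sect BG X) (Cod (sect BG X) f)"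
  by (rule bexI[of _ "enc (ginv (sect M X) a, aG X a s)"]) (use f ga_inv in auto)
qed

lemma B_gpsh: "grpd_presheaf C BG"
proof (rule gpshI[OF _ B_grpd], goal_cases)
 note [simp] = Ms ga_in gr_in gr_Idt gr_Comp gr_ga
 { case 1 show ?case by simp }
 { case 2 then show ?case . }
 { case (3 h a) then show ?case using B_cases(1)[of a "Cod C h"] by auto }
 { case (4 h a) then show ?case using B_cases(2)[of a "Cod C h"] by auto }
 { case (5 h a) then show ?case using B_cases(1)[of a "Cod C h"] by auto }
 { case (6 h a b) then show ?case using B_cases(2)[of a "Cod C h"] B_cases(2)[of b "Cod C h"] by auto }
 { case (7 X a) then show ?case using B_cases(1)[of a X] by auto }
 { case (8 X a) then show ?case using B_cases(2)[of a X] by auto }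
 { case (9 f g a) then show ?case using B_cases(1)[of a "Cod C g"] by auto }
 { case (10 f g a) then show ?case using B_cases(2)[of a "Cod C g"] by auto }
qed

lemma Bp_simps [simp]:
 "[|X \<in> Obj C; a \<in> OM X; s \<in> at G (X, a)|] ==> obm (Bp X) (enc (a, s)) = a"
 "[|X \<in> Obj C; a \<in> AM X; s \<in> at G (X, Cod (sect M X) a)|] ==> arm (Bp X) (enc (a, s)) = a"
 by (simp_all add: B_proj_def)

lemma Bp_fib: "levelwise_fibration C BG M Bp"
proof -
 note [simp] = Ms ga_in gr_in
 have "grpd_map C BG M Bp"
 proof (rule gmapI[OF B_gpsh M], goal_cases)
  { case 1 show ?case by (simp add: B_proj_def) }
  { case 2 then show ?case by (simp add: B_proj_def) }
  { case (3 X a) then show ?case using B_cases(1)[of a X] by auto }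
  { case (4 X a) then show ?case using B_cases(2)[of a X] by auto }
  { case (5 X a) then show ?case using B_cases(1)[of a X] by auto }
  { case (6 X a b) then show ?case using B_cases(2)[of a X] B_cases(2)[of b X] by auto }
  { case (7 h a) then show ?case using B_cases(1)[of a "Cod C h"] by auto }
  { case (8 h a) then show ?case using B_cases(2)[of a "Cod C h"] by auto }
 qed
 moreover have "grpd_fibration (sect BG X) (sect M X) (Bp X)" if X: "X \<in> Obj C" for X
  unfolding grpd_fibration_def
 proof (intro ballI impI)
  fix a \<alpha> assume a: "a \<in> Obj (sect BG X)" and al: "\<alpha> \<in> AM X" "Cod (sect M X) \<alpha> = obm (Bp X) a"
  obtain b s where b: "a = enc (b, s)" "b \<in> OM X" "s \<in> at G (X, b)" using B_cases(1)[OF a] by blast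
  show "\<exists>\<beta> \<in> Arr (sect BG X). Cod (sect BG X) \<beta> = a \<and> arm (Bp X) \<beta> = \<alpha>"
   by (rule bexI[of _ "enc (\<alpha>, s)"]) (use X al b in auto)
 qed
 ultimately show ?thesis by (simp add: levelwise_fibration_def)
qed

lemma Bp_df: "discrete_fibers C BG M Bp"
 unfolding discrete_fibers_def
proof (intro ballI impI)
 fix X a \<beta> assume X: "X \<in> Obj C" and a: "a \<in> OM X" and b: "\<beta> \<in> Arr (sect BG X)" "arm (Bp X) \<beta> = Idt (sect M X) a"
 obtain \<alpha> s where "\<beta> = enc (\<alpha>, s)" "\<alpha> \<in> AM X" "s \<in> at G (X, Cod (sect M X) \<alpha>)" using B_cases(2)[OF b(1)] by blast
 then show "\<beta> = Idt (sect BG X) (Dom (sect BG X) \<beta>)" using b X a by (auto simp: Ms ga_Idt)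
qed

end

sublocale stk \<subseteq> bst C enc M G ..

text \<open>Over a fixed map to \<open>M\<close>, a map into \<open>BG\<close> is the same as a
  section of the pullback of \<open>G\<close>, with no freedom on arrows. Hence lifting is extension
  of sections.\<close>

lemma (in stk) Bp_local_fibration: "local_fibration C Cov BG M Bp"
 unfolding local_fibration_def
proof (intro conjI allI impI)
 show pm: "grpd_map C BG M Bp" using Bp_fib by (simp add: levelwise_fibration_def)
 fix A B :: "('o, 'a, 'u) ugpsh" and j assume "cofibration C A B j \<and> local_equivalence C Cov A B j"
 then have j: "local_equivalence C Cov A B j" and jm: "grpd_map C A B j" by (auto simp: local_equivalence_def)
 show "lifts_against C A B j BG M Bp" unfolding lifts_against_def
 proof (intro allI impI)
  fix u v assume "grpd_map C A BG u \<and> grpd_map C B M v \<and> gmap_comp C A Bp u = gmap_comp C A v j"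
  then have u: "grpd_map C A BG u" and v: "grpd_map C B M v" and e: "gmap_comp C A Bp u = gmap_comp C A v j" by auto
  note [simp] = Ms gmapD[OF u] gmapD[OF v] gmapD[OF jm] gpshD[OF gmapD(1)[OF jm]] gpshD[OF gmapD(2)[OF jm]] ga_in gr_in
  \<comment> \<open>The second components of the codes; the first ones are prescribed by
    \<open>v\<close>.\<close>
  define s where "s X n = snd (inv enc (obm (u X) n))" for X n
  have uo: "obm (u X) n = enc (obm (v X) (obm (j X) n), s X n) \<and> s X n \<in> at G (X, obm (v X) (obm (j X) n))"
   if n: "ob X" "n \<in> Obj (sect A X)" for X n
  proof -
   have "obm (Bp X) (obm (u X) n) = obm (v X) (obm (j X) n)"
    using gmap_comp_simps(1)[OF n, of Bp u] gmap_comp_simps(1)[OF n, of v j] unfolding e by simp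
   then show ?thesis using B_cases(1)[OF gmapD(4)[OF u n]] n by (auto simp: s_def)
  qed
  have ua: "arm (u X) \<nu> = enc (arm (v X) (arm (j X) \<nu>), s X (Cod (sect A X) \<nu>))" if n: "ob X" "\<nu> \<in> Arr (sect A X)" for X \<nu>
  proof -
   have a: "arm (Bp X) (arm (u X) \<nu>) = arm (v X) (arm (j X) \<nu>)"
    using gmap_comp_simps(2)[OF n, of Bp u] gmap_comp_simps(2)[OF n, of v j] unfolding e by simp
   obtain \<alpha> t where t: "arm (u X) \<nu> = enc (\<alpha>, t)" "\<alpha> \<in> AM X" "t \<in> at G (X, Cod (sect M X) \<alpha>)" using B_cases(2)[OF gmapD(5)[OF u n]] by blast
   have "enc (Cod (sect M X) \<alpha>, t) = obm (u X) (Cod (sect A X) \<nu>)" using gmapD(7)[OF u n] t by simp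
   then show ?thesis using a t n uo[OF n(1), of "Cod (sect A X) \<nu>"] by simp
  qed
  have "sec A (gmap_comp C A v j) s" unfolding sec_def
  proof (intro conjI ballI)
   show "s X n \<in> at G (X, obm (gmap_comp C A v j X) n)" if "ob X" "n \<in> Obj (sect A X)" for X n using uo[OF that] that by simp
   show "s (src h) (obm (rst A h) n) = rG h (obm (gmap_comp C A v j (tgt h)) n) (s (tgt h) n)"
    if n: "arr h" "n \<in> Obj (sect A (tgt h))" for h n
    using gmapD(10)[OF u n(1) refl n(2)] uo[OF _ n(2)] uo[of "src h" "obm (rst A h) n"] n by simp
   show "s X (Dom (sect A X) \<nu>) = aG X (arm (gmap_comp C A v j X) \<nu>) (s X (Cod (sect A X) \<nu>))" if n: "ob X" "\<nu> \<in> Arr (sect A X)" for X \<nu>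
    using gmapD(6)[OF u n] uo[OF n(1), of "Dom (sect A X) \<nu>"] n by (simp add: ua)
  qed
  from sec_extend[OF j v this] obtain t where t: "sec B v t" "!!X n. ob X ==> n \<in> Obj (sect A X) ==> t X (obm (j X) n) = s X n" by blast
  note tD = secD[OF t(1)]
  \<comment> \<open>An arrow of \<open>BG\<close> is coded by its image in \<open>M\<close> and the
    section at its target, hence the codomain in the second component.\<close>
  define l where "l = (\<lambda>X \<in> Obj C. \<lparr>obm = (\<lambda>n \<in> Obj (sect B X). enc (obm (v X) n, t X n)),
   arm = (\<lambda>\<nu> \<in> Arr (sect B X). enc (arm (v X) \<nu>, t X (Cod (sect B X) \<nu>)))\<rparr>)"
  have ls: "ob X ==> n \<in> Obj (sect B X) ==> obm (l X) n = enc (obm (v X) n, t X n)"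
   "ob X ==> \<nu> \<in> Arr (sect B X) ==> arm (l X) \<nu> = enc (arm (v X) \<nu>, t X (Cod (sect B X) \<nu>))" for X n \<nu> by (simp_all add: l_def)
  have lm: "grpd_map C B BG l"
   by (rule gmapI[OF gmapD(2)[OF jm] B_gpsh]) (simp add: l_def, simp add: l_def, auto simp: ls tD(1,2) tD(3)[symmetric])
  have "gmap_comp C A l j = u"
   by (rule gmap_eqI[OF gmap_comp_map[OF jm lm] u]) (simp_all add: ls uo ua t(2))
  moreover have "gmap_comp C B Bp l = v"
   by (rule gmap_eqI[OF gmap_comp_map[OF lm pm] v]) (simp_all add: ls tD(1))
  ultimately show "\<exists>l. grpd_map C B BG l \<and> gmap_comp C A l j = u \<and> gmap_comp C B Bp l = v" using lm by blast
 qed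
qed

section \<open>The category of sheaves and tools for isomorphisms\<close>

text \<open>As \<open>hty\<close> does for homotopies, this keeps source and target of a presheaf
  morphism outside of a triple.\<close>

definition pn :: "('o, 'a) cat => ('o, 'a, 'u) set_psh => ('o => 'u => 'u) => ('o, 'a, 'u) set_psh => bool" where
 "pn D G \<theta> G' \<longleftrightarrow> (G, \<theta>, G') \<in> Arr (PSh D)"

lemma pnD:
 assumes "pn D G \<theta> G'"
 shows "presheaf D G" "presheaf D G'" "\<theta> \<in> extensional (Obj D)" "x \<in> Obj D ==> \<theta> x \<in> extensional (at G x)"
  "[|x \<in> Obj D; s \<in> at G x|] ==> \<theta> x s \<in> at G' x"
  "[|h \<in> Arr D; s \<in> at G (Cod D h)|] ==> \<theta> (Dom D h) (rs G h s) = rs G' h (\<theta> (Cod D h) s)"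
 using assms unfolding pn_def PSh_def by (auto simp: PiE_def Pi_def)

lemma pnI:
 assumes "presheaf D G" "presheaf D G'"
  "!!x s. [|x \<in> Obj D; s \<in> at G x|] ==> \<theta> x s \<in> at G' x"
  "!!h s. [|h \<in> Arr D; s \<in> at G (Cod D h)|] ==> \<theta> (Dom D h) (rs G h s) = rs G' h (\<theta> (Cod D h) s)"
 shows "pn D G (\<lambda>x \<in> Obj D. \<lambda>s \<in> at G x. \<theta> x s) G'"
proof -
 have "category D" "!!h s. [|h \<in> Arr D; s \<in> at G (Cod D h)|] ==> rs G h s \<in> at G (Dom D h)" using assms(1) by (auto simp: presheaf_def)
 then show ?thesis using assms unfolding pn_def PSh_def by auto
qed

lemma pn_ext:
 assumes "pn D G \<theta> G'" "pn D G \<theta>' H" "!!x s. [|x \<in> Obj D; s \<in> at G x|] ==> \<theta> x s = \<theta>' x s"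
 shows "\<theta> = \<theta>'"
 by (rule extensionalityI[OF pnD(3)[OF assms(1)] pnD(3)[OF assms(2)]], rule extensionalityI[OF pnD(4)[OF assms(1)] pnD(4)[OF assms(2)]])
  (use assms(3) in auto)

lemma sheaf_presheaf: "sheaf D J G ==> presheaf D G" by (simp add: sheaf_def)

lemma Sh_simps [simp]:
 "G \<in> Obj (Sh D J) \<longleftrightarrow> sheaf D J G" "(G, \<theta>, G') \<in> Arr (Sh D J) \<longleftrightarrow> pn D G \<theta> G' \<and> sheaf D J G \<and> sheaf D J G'"
 "Dom (Sh D J) (G, \<theta>, G') = G" "Cod (Sh D J) (G, \<theta>, G') = G'"
 "Idt (Sh D J) G = (G, (\<lambda>x \<in> Obj D. \<lambda>s \<in> at G x. s), G)"
 "Comp (Sh D J) (H, \<theta>', G'') (G, \<theta>, G') = (G, (\<lambda>x \<in> Obj D. \<lambda>s \<in> at G x. \<theta>' x (\<theta> x s)), G'')"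
 by (auto simp: Sh_def full_subcat_def pn_def PSh_def dest: sheaf_presheaf)

lemma pn_id: "presheaf D G ==> pn D G (\<lambda>x \<in> Obj D. \<lambda>s \<in> at G x. s) G" by (rule pnI) auto

lemma pn_comp:
 assumes "pn D G \<theta> G'" "pn D G' \<theta>' G''"
 shows "pn D G (\<lambda>x \<in> Obj D. \<lambda>s \<in> at G x. \<theta>' x (\<theta> x s)) G''"
 by (rule pnI) (use pnD[OF assms(1)] pnD[OF assms(2)] in \<open>auto simp: presheaf_def\<close>)

lemma Sh_category: "category (Sh D J)"
proof (rule categoryI, goal_cases)
 case (1 f) then show ?case by (cases f) auto
next
 case (2 G) then show ?case by (auto simp: pn_id sheaf_presheaf)
next
 case (3 f g) then show ?case by (cases f; cases g) (auto intro: pn_comp)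
next
 case (4 f)
 then obtain G \<theta> G' where f: "f = (G, \<theta>, G')" "pn D G \<theta> G'" by (cases f) auto
 note i = pn_id[OF pnD(1)[OF f(2)]] pn_id[OF pnD(2)[OF f(2)]]
 have "(\<lambda>x \<in> Obj D. \<lambda>s \<in> at G x. \<theta> x ((\<lambda>x \<in> Obj D. \<lambda>s \<in> at G x. s) x s)) = \<theta>"
  by (rule pn_ext[OF pn_comp[OF i(1) f(2)] f(2)]) simp
 moreover have "(\<lambda>x \<in> Obj D. \<lambda>s \<in> at G x. (\<lambda>x \<in> Obj D. \<lambda>s \<in> at G' x. s) x (\<theta> x s)) = \<theta>"
  by (rule pn_ext[OF pn_comp[OF f(2) i(2)] f(2)]) (use pnD(5)[OF f(2)] in simp)
 ultimately show ?case using f(1) by simp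
next
 case (5 f g h)
 then obtain G \<theta> G' where f: "f = (G, \<theta>, G')" "pn D G \<theta> G'" by (cases f) auto
 have "(\<lambda>x \<in> Obj D. \<lambda>s \<in> at G x. (\<lambda>x \<in> Obj D. \<lambda>s \<in> at G' x. b x (a x s)) x (\<theta> x s)) =
  (\<lambda>x \<in> Obj D. \<lambda>s \<in> at G x. b x ((\<lambda>x \<in> Obj D. \<lambda>s \<in> at G x. a x (\<theta> x s)) x s))" for a b
  using pnD(5)[OF f(2)] by (intro ext) (simp add: restrict_def)
 then show ?case using 5 f(1) by (cases g; cases h) simp
qed

lemma isoI: "[|f \<in> Arr K; g \<in> Arr K; Dom K g = Cod K f; Cod K g = Dom K f; Comp K g f = Idt K (Dom K f); Comp K f g = Idt K (Cod K f)|] ==> iso_arr K f"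
 unfolding iso_arr_def Hom_def by auto

lemma Sh_iso:
 assumes p: "pn D G \<theta> G'" and s: "sheaf D J G" "sheaf D J G'" and b: "!!x. x \<in> Obj D ==> bij_betw (\<theta> x) (at G x) (at G' x)"
 shows "iso_arr (Sh D J) (G, \<theta>, G')"
proof (rule isoI)
 let ?g = "\<lambda>x \<in> Obj D. \<lambda>s \<in> at G' x. inv_into (at G x) (\<theta> x) s"
 have gi: "inv_into (at G x) (\<theta> x) s \<in> at G x" if "x \<in> Obj D" "s \<in> at G' x" for x s
  using that b[OF that(1)] by (metis bij_betw_def inv_into_into)
 have g1: "\<theta> x (inv_into (at G x) (\<theta> x) s) = s" if "x \<in> Obj D" "s \<in> at G' x" for x s
  using bij_betw_inv_into_right[OF b[OF that(1)] that(2)] .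
 have g2: "inv_into (at G x) (\<theta> x) (\<theta> x s) = s" if "x \<in> Obj D" "s \<in> at G x" for x s
  using bij_betw_inv_into_left[OF b[OF that(1)] that(2)] .
 have D: "category D" "!!h s. h \<in> Arr D ==> s \<in> at G (Cod D h) ==> rs G h s \<in> at G (Dom D h)" using pnD(1)[OF p] by (auto simp: presheaf_def)
 have "pn D G' ?g G"
 proof (rule pnI[OF pnD(2,1)[OF p] gi])
  fix h s assume h: "h \<in> Arr D" "s \<in> at G' (Cod D h)"
  let ?t = "inv_into (at G (Cod D h)) (\<theta> (Cod D h)) s"
  have t: "?t \<in> at G (Cod D h)" "\<theta> (Cod D h) ?t = s" using gi g1 h D(1) by simp_all
  have "rs G' h s = \<theta> (Dom D h) (rs G h ?t)" using pnD(6)[OF p h(1) t(1)] t(2) by simp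
  then show "inv_into (at G (Dom D h)) (\<theta> (Dom D h)) (rs G' h s) = rs G h ?t" using g2[of "Dom D h" "rs G h ?t"] D h t by simp
 qed
 then show "(G', ?g, G) \<in> Arr (Sh D J)" using s by simp
 show "Comp (Sh D J) (G', ?g, G) (G, \<theta>, G') = Idt (Sh D J) (Dom (Sh D J) (G, \<theta>, G'))"
  using g2 pnD(5)[OF p] by (simp add: restrict_def fun_eq_iff)
 show "Comp (Sh D J) (G, \<theta>, G') (G', ?g, G) = Idt (Sh D J) (Cod (Sh D J) (G, \<theta>, G'))"
  using g1 by (simp add: restrict_def fun_eq_iff)
qed (use p s in simp_all)

lemma gmap_bij_giso:
 assumes k: "grpd_map C A B \<kappa>" and b: "!!X. X \<in> Obj C ==> bij_betw (obm (\<kappa> X)) (Obj (sect A X)) (Obj (sect B X))"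
  "!!X. X \<in> Obj C ==> bij_betw (arm (\<kappa> X)) (Arr (sect A X)) (Arr (sect B X))"
 shows "\<exists>\<kappa>'. giso C A B \<kappa> \<kappa>'"
proof -
 note [simp] = gmapD[OF k] gpshD[OF gmapD(1)[OF k]] gpshD[OF gmapD(2)[OF k]]
 define \<kappa>' where "\<kappa>' = (\<lambda>X \<in> Obj C. \<lparr>obm = (\<lambda>y \<in> Obj (sect B X). inv_into (Obj (sect A X)) (obm (\<kappa> X)) y),
  arm = (\<lambda>y \<in> Arr (sect B X). inv_into (Arr (sect A X)) (arm (\<kappa> X)) y)\<rparr>)"
 have l: "obm (\<kappa>' X) (obm (\<kappa> X) x) = x" if "X \<in> Obj C" "x \<in> Obj (sect A X)" for X x
  using bij_betw_inv_into_left[OF b(1)[OF that(1)] that(2)] that by (simp add: \<kappa>'_def)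
 have l': "arm (\<kappa>' X) (arm (\<kappa> X) x) = x" if "X \<in> Obj C" "x \<in> Arr (sect A X)" for X x
  using bij_betw_inv_into_left[OF b(2)[OF that(1)] that(2)] that by (simp add: \<kappa>'_def)
 have so: "\<exists>x \<in> Obj (sect A X). y = obm (\<kappa> X) x" if "X \<in> Obj C" "y \<in> Obj (sect B X)" for X y
  using b(1)[OF that(1)] that(2) by (auto simp: bij_betw_def)
 have sa: "\<exists>x \<in> Arr (sect A X). y = arm (\<kappa> X) x" if "X \<in> Obj C" "y \<in> Arr (sect B X)" for X y
  using b(2)[OF that(1)] that(2) by (auto simp: bij_betw_def)
 have "grpd_map C B A \<kappa>'"
 proof (rule gmapI[OF gmapD(2,1)[OF k]], goal_cases)
  { case 1 show ?case by (simp add: \<kappa>'_def) }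
  { case 2 then show ?case by (simp add: \<kappa>'_def) }
  { case (3 X a) then show ?case using so[OF 3] l by auto }
  { case (4 X a) then obtain x where x: "x \<in> Arr (sect A X)" "a = arm (\<kappa> X) x" using sa[OF 4] by blast
   then show ?case using l l' 4 by simp }
  { case (5 X a) then obtain x where "x \<in> Obj (sect A X)" "a = obm (\<kappa> X) x" using so[OF 5] by blast
   then show ?case using l l'[of X "Idt (sect A X) x"] 5 by simp }
  { case (6 X a a')
   obtain x where x: "x \<in> Arr (sect A X)" "a = arm (\<kappa> X) x" using sa[OF 6(1,2)] by blast
   obtain x' where x': "x' \<in> Arr (sect A X)" "a' = arm (\<kappa> X) x'" using sa[OF 6(1,3)] by blast
   have "obm (\<kappa> X) (Cod (sect A X) x) = obm (\<kappa> X) (Dom (sect A X) x')" using 6 x x' by simp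
   then have "Cod (sect A X) x = Dom (sect A X) x'" using b(1)[OF 6(1)] 6(1) x x' by (auto simp: bij_betw_def inj_on_eq_iff)
   then show ?case using l'[of X "Comp (sect A X) x' x"] l'[OF 6(1)] 6(1) x x' by simp }
  { case (7 h a)
   then obtain x where "x \<in> Obj (sect A (Cod C h))" "a = obm (\<kappa> (Cod C h)) x" using so[of "Cod C h" a] by auto
   then show ?case using l[of "Dom C h" "obm (rst A h) x"] l 7 by simp }
  { case (8 h a)
   then obtain x where "x \<in> Arr (sect A (Cod C h))" "a = arm (\<kappa> (Cod C h)) x" using sa[of "Cod C h" a] by auto
   then show ?case using l'[of "Dom C h" "arm (rst A h) x"] l' 8 by simp }
 qed
 then have "giso C A B \<kappa> \<kappa>'" by (rule gisoI[OF k]) (use l l' so sa in force)+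
 then show ?thesis by blast
qed

text \<open>Needed for the counit: the natural comparison runs from a fibration to the one built
  from its fibers, while \<open>equivalence_pair\<close> asks for the opposite direction.\<close>

lemma naturally_isomorphic_sym:
 assumes F: "is_functor K L F" and G: "is_functor K L G" and n: "naturally_isomorphic K L F G"
 shows "naturally_isomorphic K L G F"
proof -
 from n obtain \<eta> where e: "!!x. x \<in> Obj K ==> \<eta> x \<in> Hom L (obm F x) (obm G x) \<and> iso_arr L (\<eta> x)"
  and nt: "!!f. f \<in> Arr K ==> Comp L (\<eta> (Cod K f)) (arm F f) = Comp L (arm G f) (\<eta> (Dom K f))" unfolding naturally_isomorphic_def by blast
 note [simp] = ftorD[OF F] ftorD[OF G]
 have E: "\<eta> x \<in> Arr L" "Dom L (\<eta> x) = obm F x" "Cod L (\<eta> x) = obm G x" "ginv L (\<eta> x) \<in> Arr L" "Dom L (ginv L (\<eta> x)) = obm G x" "Cod L (ginv L (\<eta> x)) = obm F x"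
  "Comp L (ginv L (\<eta> x)) (\<eta> x) = Idt L (obm F x)" "Comp L (\<eta> x) (ginv L (\<eta> x)) = Idt L (obm G x)" if "x \<in> Obj K" for x
  using e[OF that] iso_arr_ginv[of L "\<eta> x"] by (auto simp: Hom_iff)
 have "ginv L (\<eta> x) \<in> Hom L (obm G x) (obm F x) \<and> iso_arr L (ginv L (\<eta> x))" if "x \<in> Obj K" for x
  using E[OF that] by (auto simp: Hom_iff intro!: isoI[of _ _ "\<eta> x"])
 moreover have "Comp L (ginv L (\<eta> (Cod K f))) (arm G f) = Comp L (arm F f) (ginv L (\<eta> (Dom K f)))" if f: "f \<in> Arr K" for f
 proof -
  let ?a = "Dom K f" and ?b = "Cod K f"
  have o: "?a \<in> Obj K" "?b \<in> Obj K" using f by simp_all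
  have "Comp L (ginv L (\<eta> ?b)) (arm G f) = Comp L (ginv L (\<eta> ?b)) (Comp L (arm G f) (Comp L (\<eta> ?a) (ginv L (\<eta> ?a))))"
   using f E[OF o(1)] by simp
  also have "\<dots> = Comp L (ginv L (\<eta> ?b)) (Comp L (Comp L (\<eta> ?b) (arm F f)) (ginv L (\<eta> ?a)))"
   using f E[OF o(1)] by (simp add: nt comp_assoc)
  also have "\<dots> = Comp L (Comp L (ginv L (\<eta> ?b)) (\<eta> ?b)) (Comp L (arm F f) (ginv L (\<eta> ?a)))"
   using f E[OF o(1)] E(1-6)[OF o(2)] by (simp add: comp_assoc)
  also have "\<dots> = Comp L (arm F f) (ginv L (\<eta> ?a))" using f E[OF o(1)] E(7)[OF o(2)] by simp
  finally show ?thesis .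
 qed
 ultimately show ?thesis unfolding naturally_isomorphic_def by (intro exI[of _ "\<lambda>x. ginv L (\<eta> x)"]) blast
qed

lemma ftor_comp_functor:
 assumes "is_functor K L F" "is_functor L N G"
 shows "is_functor K N (ftor_comp K G F)"
 by (rule ftorI) (use ftorD[OF assms(1)] ftorD[OF assms(2)] in \<open>auto simp: ftor_comp_def\<close>)

section \<open>The two functors, unit and counit\<close>

locale over_site = uni_site C Cov enc
 for C :: "('o, 'a) cat" and Cov and enc :: "'u \<times> 'u => 'u" +
 fixes M :: "('o, 'a, 'u) ugpsh"
 assumes M: "grpd_presheaf C M"
begin

abbreviation "S \<equiv> slice C M"
abbreviation "J \<equiv> slice_cov C Cov M"
abbreviation "OL \<equiv> Over_L_df C Cov M"
abbreviation "Gm \<equiv> Gamma_psh C"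
abbreviation "B G \<equiv> (B_gpsh enc C M G, B_proj enc C M G)"

text \<open>Membership in \<open>Over_L_df\<close>, with its two nested full subcategories
  unfolded.\<close>

definition lfd :: "('o, 'a, 'u) over_obj => bool" where
 "lfd x \<longleftrightarrow> levelwise_fibration C (fst x) M (snd x) \<and> discrete_fibers C (fst x) M (snd x) \<and> local_fibration C Cov (fst x) M (snd x)"

lemma O_simps [simp]:
 "x \<in> Obj OL \<longleftrightarrow> lfd x"
 "(x, \<phi>, y) \<in> Arr OL \<longleftrightarrow> lfd x \<and> lfd y \<and> grpd_map C (fst x) (fst y) \<phi> \<and> gmap_comp C (fst x) (snd y) \<phi> = snd x"
 "Dom OL (x, \<phi>, y) = x" "Cod OL (x, \<phi>, y) = y" "Idt OL x = (x, gmap_id C (fst x), x)"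
 "Comp OL (y', \<psi>, z) (x, \<phi>, y) = (x, gmap_comp C (fst x) \<psi> \<phi>, z)"
 by (cases x; cases y; auto simp: Over_L_df_def Over_df_def full_subcat_def Over_def lfd_def levelwise_fibration_def)+

lemma lfdD:
 assumes "lfd x"
 shows "dfib C (fst x) M (snd x)" "sheaf S J (Gm x)" "presheaf S (Gm x)" "grpd_map C (fst x) M (snd x)" "grpd_presheaf C (fst x)"
proof -
 show d: "dfib C (fst x) M (snd x)" using assms by unfold_locales (auto simp: lfd_def)
 show "sheaf S J (Gm x)" using Gamma_sheaf[of "fst x" M "snd x"] assms by (simp add: lfd_def)
 then show "presheaf S (Gm x)" by (rule sheaf_presheaf)
 show "grpd_map C (fst x) M (snd x)" by (rule dfib.pim[OF d])
 then show "grpd_presheaf C (fst x)" by (rule gmapD(1))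
qed

lemma O_category: "category OL"
proof (rule categoryI, goal_cases)
 case (1 f) then show ?case by (cases f) auto
next
 case (2 x) then show ?case using lfdD(4,5)[of x] by (auto simp: gmap_comp_id)
next
 case (3 f g)
 obtain x \<phi> y where f: "f = (x, \<phi>, y)" by (cases f)
 obtain \<psi> z where g: "g = (y, \<psi>, z)" using 3(3) f by (cases g) auto
 show ?case using 3 f g gmap_comp_assoc[of C "fst x" "fst y" \<phi> "fst z" \<psi> M "snd z"] lfdD(4)[of z] by auto
next
 case (4 f) then show ?case by (cases f) (auto simp: gmap_comp_id)
next
 case (5 f g h) then show ?case by (cases f; cases g; cases h) (auto simp: gmap_comp_assoc)
qed

lemma O_iso:
 assumes a: "(x, \<kappa>, y) \<in> Arr OL" and b: "!!X. ob X ==> bij_betw (obm (\<kappa> X)) (Obj (sect (fst x) X)) (Obj (sect (fst y) X))"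
  "!!X. ob X ==> bij_betw (arm (\<kappa> X)) (Arr (sect (fst x) X)) (Arr (sect (fst y) X))"
 shows "iso_arr OL (x, \<kappa>, y)"
proof -
 from a have k: "grpd_map C (fst x) (fst y) \<kappa>" and x: "lfd x" "lfd y" and e: "gmap_comp C (fst x) (snd y) \<kappa> = snd x" by auto
 obtain \<kappa>' where g: "giso C (fst x) (fst y) \<kappa> \<kappa>'" using gmap_bij_giso[OF k b] by blast
 note g' = gisoD(2-4)[OF g]
 have "gmap_comp C (fst y) (snd x) \<kappa>' = snd y"
  using gmap_comp_assoc[OF g'(1) k lfdD(4)[OF x(2)]] gmap_comp_id(1)[OF lfdD(4)[OF x(2)]] by (simp add: e g')
 then show ?thesis by (intro isoI[of _ _ "(y, \<kappa>', x)"]) (use k x e g' in auto)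
qed

text \<open>A map over \<open>M\<close> sends the lift of \<open>\<alpha>\<close> to a lift of
  \<open>\<alpha>\<close>, which by uniqueness is the lift in the target. This is naturality on
  fibers.\<close>

lemma Gamma_mor:
 assumes f: "(x, \<phi>, y) \<in> Arr OL"
 shows "pn S (Gm x) (\<lambda>z \<in> Obj S. \<lambda>s \<in> at (Gm x) z. obm (\<phi> (fst z)) s) (Gm y)"
  "(\<lambda>(X, a) \<in> Obj S. \<lambda>s \<in> at (Gm x) (X, a). obm (\<phi> X) s) = (\<lambda>z \<in> Obj S. \<lambda>s \<in> at (Gm x) z. obm (\<phi> (fst z)) s)"
proof -
 obtain F \<pi> where x: "x = (F, \<pi>)" by (cases x)
 obtain F' \<pi>' where y: "y = (F', \<pi>')" by (cases y)
 from f x y have l: "lfd (F, \<pi>)" "lfd (F', \<pi>')" and p: "grpd_map C F F' \<phi>" and e: "gmap_comp C F \<pi>' \<phi> = \<pi>" by auto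
 interpret dfib C F M \<pi> using lfdD(1)[OF l(1)] by simp
 interpret F': dfib C F' M \<pi>' using lfdD(1)[OF l(2)] by simp
 note [simp] = gpshD[OF M] gpshD[OF gmapD(1)[OF p]] gpshD[OF gmapD(2)[OF p]] gmapD[OF p] gmapD[OF pim]
 have eo: "obm (\<pi>' X) (obm (\<phi> X) c) = obm (\<pi> X) c" if "ob X" "c \<in> Obj (sect F X)" for X c
  using gmap_comp_simps(1)[OF that, of \<pi>' \<phi>] e by simp
 have ea: "arm (\<pi>' X) (arm (\<phi> X) c) = arm (\<pi> X) c" if "ob X" "c \<in> Arr (sect F X)" for X c
  using gmap_comp_simps(2)[OF that, of \<pi>' \<phi>] e by simp
 show "pn S (Gm x) (\<lambda>z \<in> Obj S. \<lambda>s \<in> at (Gm x) z. obm (\<phi> (fst z)) s) (Gm y)" unfolding x y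
 proof (rule pnI[OF lfdD(3)[OF l(1)] lfdD(3)[OF l(2)]])
  show "obm (\<phi> (fst z)) s \<in> at (Gm (F', \<pi>')) z" if "z \<in> Obj S" "s \<in> at (Gm (F, \<pi>)) z" for z s
   using that eo by (cases z) (auto simp: Gamma_at F'.Gamma_at)
  fix r s assume r: "r \<in> Arr S" and s: "s \<in> at (Gm (F, \<pi>)) (Cod S r)"
  obtain X m h \<alpha> X' m' where rr: "r = ((X, m), (h, \<alpha>), (X', m'))" by (rule slice_arr_cases)
  have h: "arr h" "src h = X" "tgt h = X'" "\<alpha> \<in> Arr (sect M X)" "Cod (sect M X) \<alpha> = obm (rst M h) m'" "ob X" "m' \<in> Obj (sect M X')"
   and s': "s \<in> Obj (sect F X')" "obm (\<pi> X') s = m'" using r s by (auto simp: rr Hom_iff Gamma_at)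
  let ?c = "obm (rst F h) s"
  have c: "?c \<in> Obj (sect F X)" "Cod (sect M X) \<alpha> = obm (\<pi> X) ?c" using h s' gmapD(10)[OF pim h(1), of X s] by auto
  note L = lft[OF h(6,4) c]
  have "F'.lft X (arm (\<pi>' X) (arm (\<phi> X) (lft X \<alpha> ?c))) (Cod (sect F' X) (arm (\<phi> X) (lft X \<alpha> ?c))) = arm (\<phi> X) (lft X \<alpha> ?c)"
   by (rule F'.lft_eq) (use L h in auto)
  moreover have "obm (rst F' h) (obm (\<phi> X') s) = obm (\<phi> X) ?c" using gmapD(10)[OF p h(1), of X s] h s' by auto
  ultimately have "F'.lft X \<alpha> (obm (rst F' h) (obm (\<phi> X') s)) = arm (\<phi> X) (lft X \<alpha> ?c)" using L h by (simp add: ea)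
  then show "obm (\<phi> (fst (Dom S r))) (rs (Gm (F, \<pi>)) r s) = rs (Gm (F', \<pi>')) r (obm (\<phi> (fst (Cod S r))) s)"
   using L h by (simp add: rr Gamma_rs F'.Gamma_rs)
 qed
qed (auto simp: restrict_def fun_eq_iff)

lemma Gamma_arm:
 assumes "(x, \<phi>, y) \<in> Arr OL"
 shows "arm (Gamma_functor C M) (x, \<phi>, y) = (Gm x, (\<lambda>z \<in> Obj S. \<lambda>s \<in> at (Gm x) z. obm (\<phi> (fst z)) s), Gm y)"
 using Gamma_mor(2)[OF assms] by (simp add: Gamma_functor_def)

lemma Gamma_obm [simp]: "obm (Gamma_functor C M) x = Gm x"
 by (simp add: Gamma_functor_def)

lemma Gamma_in: "z \<in> Obj S ==> s \<in> at (Gm x) z ==> fst z \<in> Obj C \<and> s \<in> Obj (sect (fst x) (fst z)) \<and> obm (snd x (fst z)) s = snd z"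
 by (cases x; cases z) (auto simp: Gamma_psh_def)

lemma Gamma_functor: "is_functor OL (Sh S J) (Gamma_functor C M)"
proof (rule ftorI[OF O_category Sh_category], goal_cases)
 case (1 x) then show ?case by (simp add: lfdD)
next
 case (2 f)
 obtain x \<phi> y where f: "f = (x, \<phi>, y)" by (cases f)
 have "lfd x" "lfd y" using 2 f by auto
 then show ?case using Gamma_mor(1)[of x \<phi> y] 2 f by (simp add: Gamma_arm lfdD del: O_simps(2))
next
 case (3 x)
 then have "(x, gmap_id C (fst x), x) \<in> Arr OL" using cat_simps(3)[OF O_category 3] by simp
 moreover have "(\<lambda>z \<in> Obj S. \<lambda>s \<in> at (Gm x) z. obm (gmap_id C (fst x) (fst z)) s) = (\<lambda>z \<in> Obj S. \<lambda>s \<in> at (Gm x) z. s)"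
  using Gamma_in by (intro ext) (simp add: restrict_def)
 ultimately show ?case by (simp add: Gamma_arm del: O_simps(2))
next
 case (4 f g)
 obtain x \<phi> y where f: "f = (x, \<phi>, y)" by (cases f)
 obtain \<psi> z where g: "g = (y, \<psi>, z)" using 4(3) f by (cases g) auto
 have c: "(x, gmap_comp C (fst x) \<psi> \<phi>, z) \<in> Arr OL" using cat_simps(6)[OF O_category 4] f g by simp
 have i: "obm (\<phi> (fst w)) s \<in> at (Gm y) w" if "w \<in> Obj S" "s \<in> at (Gm x) w" for w s
  using pnD(5)[OF Gamma_mor(1)[OF 4(1)[unfolded f]] that] that by simp
 have "(\<lambda>w \<in> Obj S. \<lambda>s \<in> at (Gm x) w. obm (gmap_comp C (fst x) \<psi> \<phi> (fst w)) s) =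
  (\<lambda>w \<in> Obj S. \<lambda>s \<in> at (Gm x) w. (\<lambda>w \<in> Obj S. \<lambda>s \<in> at (Gm y) w. obm (\<psi> (fst w)) s) w ((\<lambda>w \<in> Obj S. \<lambda>s \<in> at (Gm x) w. obm (\<phi> (fst w)) s) w s))"
  using Gamma_in i by (intro ext) (simp add: restrict_def)
 then show ?case using 4(1,2) c unfolding f g by (simp add: Gamma_arm del: O_simps(2))
qed

lemma bstI: "presheaf S G ==> bst C enc M G"
 by unfold_locales (auto simp: M)

lemma B_lfd:
 assumes "sheaf S J G"
 shows "lfd (B G)"
proof -
 interpret stk C Cov enc M G by unfold_locales (use assms sheaf_presheaf M in auto)
 show ?thesis using Bp_fib Bp_df Bp_local_fibration by (simp add: lfd_def)
qed

lemma B_map_simps: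
 assumes "presheaf S G" "ob X"
 shows "[|a \<in> Obj (sect M X); s \<in> at G (X, a)|] ==> obm (B_map enc C M G \<theta> X) (enc (a, s)) = enc (a, \<theta> (X, a) s)"
  "[|a \<in> Arr (sect M X); s \<in> at G (X, Cod (sect M X) a)|] ==> arm (B_map enc C M G \<theta> X) (enc (a, s)) = enc (a, \<theta> (X, Cod (sect M X) a) s)"
 using assms bst.B_simps[OF bstI[OF assms(1)]] bst.enc_simps[OF bstI[OF assms(1)]] by (simp_all add: B_map_def)

lemma B_mor:
 assumes p: "pn S G \<theta> G'" and s: "sheaf S J G" "sheaf S J G'"
 shows "(B G, B_map enc C M G \<theta>, B G') \<in> Arr OL"
proof -
 interpret bst C enc M G by (rule bstI[OF pnD(1)[OF p]])
 interpret G': bst C enc M G' by (rule bstI[OF pnD(2)[OF p]])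
 note [simp] = gpshD[OF M] B_map_simps[OF pnD(1)[OF p]] ga_in gr_in G'.ga_in G'.gr_in
 have ti[simp]: "\<theta> (X, a) s \<in> at G' (X, a)" if "ob X" "a \<in> Obj (sect M X)" "s \<in> at G (X, a)" for X a s
  using pnD(5)[OF p] that by simp
 have ta: "\<theta> (X, Dom (sect M X) \<alpha>) (aG X \<alpha> s) = G'.aG X \<alpha> (\<theta> (X, Cod (sect M X) \<alpha>) s)"
  if "ob X" "\<alpha> \<in> Arr (sect M X)" "s \<in> at G (X, Cod (sect M X) \<alpha>)" for X \<alpha> s
  using pnD(6)[OF p, of "((X, Dom (sect M X) \<alpha>), (Idt C X, \<alpha>), (X, Cod (sect M X) \<alpha>))" s] that by (simp add: iso_act_def Hom_iff)
 have tg: "\<theta> (src h, obm (rst M h) a) (rG h a s) = G'.rG h a (\<theta> (tgt h, a) s)"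
  if "arr h" "a \<in> Obj (sect M (tgt h))" "s \<in> at G (tgt h, a)" for h a s
  using pnD(6)[OF p, of "((src h, obm (rst M h) a), (h, Idt (sect M (src h)) (obm (rst M h) a)), (tgt h, a))" s] that by (simp add: gr_def Hom_iff)
 let ?b = "B_map enc C M G \<theta>"
 have m: "grpd_map C BG G'.BG ?b"
 proof (rule gmapI[OF B_gpsh G'.B_gpsh], goal_cases)
  { case 1 show ?case by (simp add: B_map_def) }
  { case 2 then show ?case by (simp add: B_map_def) }
  { case (3 X a) then show ?case using B_cases(1)[of a X] by auto }
  { case (4 X a) then show ?case using B_cases(2)[of a X] by (auto simp: ta) }
  { case (5 X a) then show ?case using B_cases(1)[of a X] by auto }
  { case (6 X a b) then show ?case using B_cases(2)[of a X] B_cases(2)[of b X] by auto }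
  { case (7 h a) then show ?case using B_cases(1)[of a "tgt h"] by (auto simp: tg) }
  { case (8 h a) then show ?case using B_cases(2)[of a "tgt h"] by (auto simp: tg) }
 qed
 have "gmap_comp C BG G'.Bp ?b = Bp"
  by (rule gmap_eqI[OF gmap_comp_map[OF m] ]) (use Bp_fib G'.Bp_fib in \<open>auto simp: levelwise_fibration_def dest!: B_cases\<close>)
 then show ?thesis using m B_lfd s by simp
qed

lemma B_functor: "is_functor (Sh S J) OL (B_functor enc C M)"
proof (rule ftorI[OF Sh_category O_category], goal_cases)
 case (1 G) then show ?case by (simp add: B_functor_def B_lfd)
next
 case (2 f) then show ?case using B_mor by (cases f) (auto simp: B_functor_def simp del: O_simps(2))
next
 case (3 G)
 then have s: "sheaf S J G" by simp
 note p = sheaf_presheaf[OF s]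
 interpret bst C enc M G by (rule bstI[OF p])
 have m: "grpd_map C BG BG (B_map enc C M G (\<lambda>x \<in> Obj S. \<lambda>s \<in> at G x. s))" using B_mor[OF pn_id[OF p] s s] by simp
 have "B_map enc C M G (\<lambda>x \<in> Obj S. \<lambda>s \<in> at G x. s) = gmap_id C BG"
  by (rule gmap_eqI[OF m gmap_id_map[OF B_gpsh]]) (auto simp: B_map_simps[OF p] gpshD[OF M] dest!: B_cases)
 then show ?case by (simp add: B_functor_def)
next
 case (4 f g)
 obtain G \<theta> G' where f: "f = (G, \<theta>, G')" by (cases f)
 obtain \<theta>' G'' where g: "g = (G', \<theta>', G'')" using 4(3) f by (cases g) auto
 have p: "pn S G \<theta> G'" "pn S G' \<theta>' G''" and s: "sheaf S J G" "sheaf S J G'" "sheaf S J G''" using 4 f g by auto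
 interpret bst C enc M G by (rule bstI[OF pnD(1)[OF p(1)]])
 let ?t = "\<lambda>x \<in> Obj S. \<lambda>s \<in> at G x. \<theta>' x (\<theta> x s)"
 note m = B_mor[OF p(1) s(1,2)] B_mor[OF p(2) s(2,3)] B_mor[OF pn_comp[OF p] s(1,3)]
 have "B_map enc C M G ?t = gmap_comp C BG (B_map enc C M G' \<theta>') (B_map enc C M G \<theta>)"
  by (rule gmap_eqI) (use m pnD(5)[OF p(1)] in \<open>auto simp: B_map_simps[OF pnD(1)[OF p(1)]] B_map_simps[OF pnD(1)[OF p(2)]] gpshD[OF M] dest!: B_cases\<close>)
 then show ?case by (simp add: B_functor_def f g)
qed

text \<open>The fiber of \<open>BG\<close> over \<open>a\<close> consists of the codes
  \<open>enc (a, s)\<close> with \<open>s\<close> in \<open>G\<close>. The only point to check is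
  that path lifting in \<open>BG\<close> reproduces the restriction maps of
  \<open>G\<close>.\<close>

lemma unit_iso: "naturally_isomorphic (Sh S J) (Sh S J) (ftor_id (Sh S J)) (ftor_comp (Sh S J) (Gamma_functor C M) (B_functor enc C M))"
proof -
 define \<eta> where "\<eta> G = (\<lambda>x \<in> Obj S. \<lambda>s \<in> at G x. enc (snd x, s))" for G :: "('o \<times> 'u, ('o, 'a, 'u) slice_arr, 'u) set_psh"
 have e: "pn S G (\<eta> G) (Gm (B G)) \<and> (\<forall>x \<in> Obj S. bij_betw (\<eta> G x) (at G x) (at (Gm (B G)) x))" if s: "sheaf S J G" for G
 proof -
  interpret bst C enc M G by (rule bstI[OF sheaf_presheaf[OF s]])
  interpret D: dfib C BG M Bp by unfold_locales (rule Bp_fib, rule Bp_df)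
  have at: "at (Gm (B G)) (X, a) = (\<lambda>s. enc (a, s)) ` at G (X, a)" if "ob X" "a \<in> Obj (sect M X)" for X a
   using that by (auto simp: D.Gamma_at dest!: B_cases(1))
  have "pn S G (\<lambda>x \<in> Obj S. \<lambda>s \<in> at G x. enc (snd x, s)) (Gm (B G))"
  proof (rule pnI[OF sheaf_presheaf[OF s] lfdD(3)[OF B_lfd[OF s]]])
   show "enc (snd x, t) \<in> at (Gm (B G)) x" if "x \<in> Obj S" "t \<in> at G x" for x t using that at by (cases x) auto
   fix r t assume r: "r \<in> Arr S" "t \<in> at G (Cod S r)"
   obtain X m h \<alpha> X' m' where rr: "r = ((X, m), (h, \<alpha>), (X', m'))" by (rule slice_arr_cases)
   have h: "arr h" "src h = X" "tgt h = X'" "\<alpha> \<in> Arr (sect M X)" "Cod (sect M X) \<alpha> = obm (rst M h) m'" "ob X" "m' \<in> Obj (sect M X')" "Dom (sect M X) \<alpha> = m"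
    "t \<in> at G (X', m')" using r by (auto simp: rr Hom_iff)
   have g: "rG h m' t \<in> at G (X, Cod (sect M X) \<alpha>)" using gr_in[of h m' t X] h by simp
   \<comment> \<open>The lift of \<open>\<alpha>\<close> with target coded by a section
     \<open>s\<close> is the arrow coded by \<open>\<alpha>\<close> and \<open>s\<close>, and its
     source is by definition \<open>s\<close> acted on by \<open>\<alpha>\<close>.\<close>
   have "D.lft X \<alpha> (enc (Cod (sect M X) \<alpha>, rG h m' t)) = enc (\<alpha>, rG h m' t)"
    using D.lft_eq[OF h(6), of "enc (\<alpha>, rG h m' t)"] h g by simp
   then show "enc (snd (Dom S r), rs G r t) = rs (Gm (B G)) r (enc (snd (Cod S r), t))"
    using h rs_dec[of X m h \<alpha> X' m' t] r by (simp add: rr D.Gamma_rs)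
  qed
  then show ?thesis using at by (auto simp: \<eta>_def bij_betw_def inj_on_def)
 qed
 show ?thesis unfolding naturally_isomorphic_def
 proof (intro exI[of _ "\<lambda>G. (G, \<eta> G, Gm (B G))"] conjI ballI)
  fix G :: "('o \<times> 'u, ('o, 'a, 'u) slice_arr, 'u) set_psh" assume "G \<in> Obj (Sh S J)"
  then have G: "sheaf S J G" by simp
  have o: "obm (ftor_comp (Sh S J) (Gamma_functor C M) (B_functor enc C M)) G = Gm (B G)" using G by (simp add: ftor_comp_def B_functor_def)
  show "(G, \<eta> G, Gm (B G)) \<in> Hom (Sh S J) (obm (ftor_id (Sh S J)) G) (obm (ftor_comp (Sh S J) (Gamma_functor C M) (B_functor enc C M)) G)"
   unfolding o using e[OF G] G lfdD(2)[OF B_lfd[OF G]] by (simp add: Hom_iff ftor_id_def)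
  show "iso_arr (Sh S J) (G, \<eta> G, Gm (B G))" by (rule Sh_iso) (use e[OF G] G lfdD(2)[OF B_lfd[OF G]] in auto)
 next
  fix f :: "('o \<times> 'u, ('o, 'a, 'u) slice_arr, 'u) set_psh_arr" assume f': "f \<in> Arr (Sh S J)"
  obtain G \<theta> G' where f: "f = (G, \<theta>, G')" by (cases f)
  from f f' have p: "pn S G \<theta> G'" and s: "sheaf S J G" "sheaf S J G'" by auto
  note b = B_mor[OF p s]
  have "(\<lambda>x \<in> Obj S. \<lambda>s \<in> at G x. \<eta> G' x (\<theta> x s)) = (\<lambda>x \<in> Obj S. \<lambda>s \<in> at G x. (\<lambda>z \<in> Obj S. \<lambda>s \<in> at (Gm (B G)) z. obm (B_map enc C M G \<theta> (fst z)) s) x (\<eta> G x s))"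
   using pnD(5)[OF p] pnD(5)[OF conjunct1[OF e[OF s(1)]]] by (intro ext) (auto simp: restrict_def \<eta>_def B_map_simps[OF pnD(1)[OF p]])
  then show "Comp (Sh S J) (Cod (Sh S J) f, \<eta> (Cod (Sh S J) f), Gm (B (Cod (Sh S J) f))) (arm (ftor_id (Sh S J)) f) =
   Comp (Sh S J) (arm (ftor_comp (Sh S J) (Gamma_functor C M) (B_functor enc C M)) f) (Dom (Sh S J) f, \<eta> (Dom (Sh S J) f), Gm (B (Dom (Sh S J) f)))"
   using f' Gamma_arm[OF b] by (simp add: f ftor_id_def ftor_comp_def B_functor_def)
 qed
qed

text \<open>An object \<open>c\<close> of the fibration is recorded together with its image in
  \<open>M\<close>, an arrow by its image and its target. Unique path lifting makes the second
  assignment bijective, so the comparison is an isomorphism and not only an equivalence.\<close>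

lemma counit_iso: "naturally_isomorphic OL OL (ftor_id OL) (ftor_comp OL (B_functor enc C M) (Gamma_functor C M))"
proof -
 define \<kappa> where "\<kappa> x = (\<lambda>X \<in> Obj C. \<lparr>obm = (\<lambda>c \<in> Obj (sect (fst x) X). enc (obm (snd x X) c, c)),
  arm = (\<lambda>\<beta> \<in> Arr (sect (fst x) X). enc (arm (snd x X) \<beta>, Cod (sect (fst x) X) \<beta>))\<rparr>)" for x :: "('o, 'a, 'u) over_obj"
 have ks: "ob X ==> c \<in> Obj (sect (fst x) X) ==> obm (\<kappa> x X) c = enc (obm (snd x X) c, c)"
  "ob X ==> \<beta> \<in> Arr (sect (fst x) X) ==> arm (\<kappa> x X) \<beta> = enc (arm (snd x X) \<beta>, Cod (sect (fst x) X) \<beta>)" for x X c \<beta>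
  by (simp_all add: \<kappa>_def)
 have e: "(x, \<kappa> x, B (Gm x)) \<in> Arr OL \<and> iso_arr OL (x, \<kappa> x, B (Gm x))" if l: "lfd x" for x
 proof -
  obtain F \<pi> where x: "x = (F, \<pi>)" by (cases x)
  interpret D: dfib C F M \<pi> using lfdD(1)[OF l] x by simp
  interpret bst C enc M "Gm (F, \<pi>)" using bstI[OF lfdD(3)[OF l]] x by simp
  note [simp] = gpshD[OF M] gmapD[OF D.pim] gpshD[OF gmapD(1)[OF D.pim]] ks[of _ _ "(F, \<pi>)", simplified] D.Gamma_at
  have a: "aG X (arm (\<pi> X) \<beta>) (Cod (sect F X) \<beta>) = Dom (sect F X) \<beta>" if "ob X" "\<beta> \<in> Arr (sect F X)" for X \<beta>
   using that D.lft_eq[OF that] by (simp add: iso_act_def D.Gamma_rs)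
  have g: "rG h (obm (\<pi> (tgt h)) c) c = obm (rst F h) c" if "arr h" "c \<in> Obj (sect F (tgt h))" for h c
   using that D.tr_Idt[of "src h" "obm (rst F h) c"] by (simp add: gr_def D.Gamma_rs)
  have k: "grpd_map C F BG (\<kappa> x)"
   by (rule gmapI[OF gmapD(1)[OF D.pim] B_gpsh]) (simp add: \<kappa>_def, simp add: \<kappa>_def x, auto simp: x a g)
  have "gmap_comp C F Bp (\<kappa> x) = \<pi>"
   by (rule gmap_eqI[OF gmap_comp_map[OF k] D.pim]) (use Bp_fib in \<open>auto simp: x levelwise_fibration_def\<close>)
  then have A: "(x, \<kappa> x, B (Gm x)) \<in> Arr OL" using k l B_lfd[OF lfdD(2)[OF l]] x by simp
  moreover have "iso_arr OL (x, \<kappa> x, B (Gm x))"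
  proof (rule O_iso[OF A])
   fix X assume X: "ob X"
   have "enc w \<in> obm (\<kappa> x X) ` Obj (sect F X)" if "enc w \<in> Obj (sect BG X)" for w
    using that X by (cases w) (auto simp: x image_iff)
   then show "bij_betw (obm (\<kappa> x X)) (Obj (sect (fst x) X)) (Obj (sect (fst (B (Gm x))) X))"
    using X by (auto simp: x bij_betw_def inj_on_def dest!: B_cases(1))
   \<comment> \<open>The preimage is the unique lift of \<open>\<alpha>\<close> with target
     \<open>c\<close>.\<close>
   have "enc (\<alpha>, c) \<in> arm (\<kappa> x X) ` Arr (sect F X)" if "enc (\<alpha>, c) \<in> Arr (sect BG X)" for \<alpha> c
    by (rule image_eqI[of _ _ "D.lft X \<alpha> c"]) (use that X D.lft[of X \<alpha> c] in \<open>auto simp: x\<close>)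
   then show "bij_betw (arm (\<kappa> x X)) (Arr (sect (fst x) X)) (Arr (sect (fst (B (Gm x))) X))"
    using X D.lift_unique[OF X] by (auto simp: x bij_betw_def inj_on_def dest!: B_cases(2))
  qed
  ultimately show ?thesis by blast
 qed
 show ?thesis unfolding naturally_isomorphic_def
 proof (intro exI[of _ "\<lambda>x. (x, \<kappa> x, B (Gm x))"] conjI ballI)
  fix x assume x: "x \<in> Obj OL"
  then show "(x, \<kappa> x, B (Gm x)) \<in> Hom OL (obm (ftor_id OL) x) (obm (ftor_comp OL (B_functor enc C M) (Gamma_functor C M)) x)"
   using e[of x] by (simp add: Hom_iff ftor_id_def ftor_comp_def B_functor_def)
  show "iso_arr OL (x, \<kappa> x, B (Gm x))" using e[of x] x by simp
 next
  fix f assume f': "f \<in> Arr OL"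
  obtain x \<phi> y where f: "f = (x, \<phi>, y)" by (cases f)
  from f f' have l: "lfd x" "lfd y" and p: "grpd_map C (fst x) (fst y) \<phi>" and c: "gmap_comp C (fst x) (snd y) \<phi> = snd x" by auto
  let ?\<theta> = "\<lambda>z \<in> Obj S. \<lambda>s \<in> at (Gm x) z. obm (\<phi> (fst z)) s"
  note g = Gamma_mor(1)[OF f'[unfolded f]]
  note b = B_mor[OF g lfdD(2)[OF l(1)] lfdD(2)[OF l(2)]]
  note [simp] = gmapD[OF p] gpshD[OF M] gpshD[OF gmapD(1)[OF p]] gmapD[OF lfdD(4)[OF l(1)]] gmapD[OF lfdD(4)[OF l(2)]] ks
  have at: "c \<in> at (Gm x) (X, obm (snd x X) c)" if "c \<in> Obj (sect (fst x) X)" for c X using that by (cases x) (simp add: Gamma_psh_def)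
  have eo: "obm (snd y X) (obm (\<phi> X) c) = obm (snd x X) c" if "ob X" "c \<in> Obj (sect (fst x) X)" for X c
   unfolding c[symmetric] using that by simp
  have ea: "arm (snd y X) (arm (\<phi> X) c) = arm (snd x X) c" if "ob X" "c \<in> Arr (sect (fst x) X)" for X c
   unfolding c[symmetric] using that by simp
  have "gmap_comp C (fst x) (\<kappa> y) \<phi> = gmap_comp C (fst x) (B_map enc C M (Gm x) ?\<theta>) (\<kappa> x)"
   by (rule gmap_eqI) (use e[OF l(1)] e[OF l(2)] p b at in \<open>auto simp: B_map_simps[OF lfdD(3)[OF l(1)]] eo ea\<close>)
  then show "Comp OL (Cod OL f, \<kappa> (Cod OL f), B (Gm (Cod OL f))) (arm (ftor_id OL) f) =
   Comp OL (arm (ftor_comp OL (B_functor enc C M) (Gamma_functor C M)) f) (Dom OL f, \<kappa> (Dom OL f), B (Gm (Dom OL f)))"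
   using f' Gamma_arm[OF f'[unfolded f]] by (simp add: f ftor_id_def ftor_comp_def B_functor_def del: O_simps(2))
 qed
qed

lemma ftor_id_functor: "category K ==> is_functor K K (ftor_id K)"
 by (rule equivalence_full_faithful(1)[OF ftor_id_equivalence])

lemma B_Gamma_equivalence: "equivalence_pair (Sh S J) OL (B_functor enc C M) (Gamma_functor C M)"
 unfolding equivalence_pair_def
 using B_functor Gamma_functor unit_iso
  naturally_isomorphic_sym[OF ftor_id_functor[OF O_category] ftor_comp_functor[OF Gamma_functor B_functor] counit_iso] by blast

end

theorem proposition4p1:
  fixes C :: "('o, 'a) cat" and Cov :: "'o \<Rightarrow> 'a set \<Rightarrow> bool"
    and M :: "('o, 'a, 'u, 'u) gpsh" and enc :: "'u \<times> 'u \<Rightarrow> 'u"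
  assumes "site C Cov" and "has_finite_products C" and "has_pullbacks C"
    and "set_universe C enc"
    and "grpd_presheaf C M"
  shows "equivalence_pair (Sh (slice C M) (slice_cov C Cov M)) (Over_L_df C Cov M)
    (B_functor enc C M) (Gamma_functor C M)"
proof -
  interpret site C Cov by fact
  interpret set_universe C enc by fact
  interpret over_site C Cov enc M by unfold_locales (use assms in auto)
  show ?thesis by (rule B_Gamma_equivalence)
qed

end
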